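(* Let $\pi:\Gamma\to\Lambda$ be a surjective morphism of countable groups and let $\Lambda\curvearrowright(Y,\nu)$ be an ergodic measure preserving action on a standard infinite measure space. Suppose that the free, ergodic, probability measure preserving action $\Gamma\curvearrowright(X,\mu)$ on a standard probability space satisfies the following conditions. (1) The restricted action $\ker\pi\curvearrowright X$ is $\mathcal U_{\mathrm{fin}}$-cocycle superrigid and weakly mixing. (2) There are no non-trivial group morphisms $\theta:\ker\pi\to\Lambda$. (3) Every conjugation $\Delta$ of the action $\ker\pi\curvearrowright X$ with itself is given by $\Delta(x)=gx$ almost everywhere, for some fixed element $g\in\Gamma$. Consider the action $\Gamma\curvearrowright X\times Y$ given by $g(x,y)=(gx,\pi(g)y)$. Then the outer automorphism group of the type II$_\infty$ equivalence relation $\mathcal R=\mathcal R(\Gamma\curvearrowright X\times Y)$ is given by $$\mathrm{Out}(\mathcal R)=\mathrm{Centr}_{\mathrm{Aut}_{\mathrm{ns}}(Y,\nu)}(\Lambda),$$ where $\Delta_0\in \mathrm{Centr}_{\mathrm{Aut}_{\mathrm{ns}}(Y,\nu)}(\Lambda)$ is identified with the class of $\mathrm{id}_X\times\Delta_0$. In particular, for every subset $U\subset X\times Y$ with finite non-zero measure, $$\mathcal F(\mathcal R|_U)=\mathrm{mod}\big(\mathrm{Centr}_{\mathrm{Aut}_{\mathrm{ns}}(Y,\nu)}(\Lambda)\big)\quad\text{and}\quad \mathrm{Out}(\mathcal R|_U)=\mathrm{Centr}_{\mathrm{Aut}_{\mathrm{mp}}(Y,\nu)}(\Lambda).$$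
   Context: $\mathrm{Aut}_{\mathrm{ns}}(Y,\nu)$ (resp. $\mathrm{Aut}_{\mathrm{mp}}(Y,\nu)$) is the group of non-singular (resp. measure preserving) automorphisms of $(Y,\nu)$, modulo equality a.e. $\mathrm{Centr}_{G}(\Lambda)$ is the group of elements of $G$ that commute with the action of $\Lambda$. When $\Lambda$ acts ergodically and preserves $\nu$, every $\Delta\in\mathrm{Centr}_{\mathrm{Aut}_{\mathrm{ns}}(Y,\nu)}(\Lambda)$ scales $\nu$ by a positive constant, denoted $\mathrm{mod}(\Delta)$. The orbit equivalence relation $\mathcal R(\Gamma\curvearrowright Z)$ is given by $x\sim y$ iff $x\in\Gamma y$. For a countable equivalence relation $\mathcal R$ on $(Z,\eta)$: $\mathrm{Aut}(\mathcal R)$ is the group of non-singular automorphisms $\Delta$ of $Z$ with $x\sim y\iff\Delta(x)\sim\Delta(y)$ (a.e.); the full group $[\mathcal R]$ is the normal subgroup of those with $\Delta(x)\sim x$ a.e.; $\mathrm{Out}(\mathcal R)=\mathrm{Aut}(\mathcal R)/[\mathcal R]$. $\mathcal R|_U$ is the restriction to $U$. A type II$_1$ equivalence relation is an ergodic countable p.m.p. equivalence relation on a standard non-atomic probability space (when restricting, the measure is normalized); its fundamental group is $\mathcal F(\mathcal R)=\{\mu(U)/\mu(V): \mathcal R|_U\cong\mathcal R|_V\}\subset\mathbb R_+^*$, with $U,V$ of positive measure. A type II$_\infty$ equivalence relation is ergodic, countable and preserves an infinite non-atomic measure. A p.m.p. action $G\curvearrowright(X,\mu)$ is weakly mixing if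 the diagonal action on $X\times X$ is ergodic. A Polish group is a $\mathcal U_{\mathrm{fin}}$ group if it is isomorphic to a closed subgroup of the unitary group of a finite von Neumann algebra. A 1-cocycle $\omega:G\times X\to\mathcal G$ is a measurable map with $\omega(gh,x)=\omega(g,hx)\omega(h,x)$ a.e.; the action is $\mathcal U_{\mathrm{fin}}$-cocycle superrigid if every 1-cocycle $\omega$ with values in a $\mathcal U_{\mathrm{fin}}$ group $\mathcal G$ is cohomologous to a group morphism, i.e. there are a measurable $\varphi:X\to\mathcal G$ and a morphism $\delta:G\to\mathcal G$ with $\delta(g)=\varphi(gx)\omega(g,x)\varphi(x)^{-1}$ a.e. A conjugation of $G\curvearrowright(X,\mu)$ with itself is a measure preserving automorphism $\Delta$ of $X$ such that for some $\delta\in\mathrm{Aut}(G)$, $\Delta(gx)=\delta(g)\Delta(x)$ a.e. for all $g\in G$. *)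

theory Defs
  imports "HOL-Probability.Probability_Measure" "HOL-Algebra.Group_Action"
begin

section \<open>Unitary groups of finite von Neumann algebras\<close>

text \<open>
  Von Neumann algebras are represented on the complex Hilbert spaces \<open>\<ell>\<^sup>2(I)\<close>. Operators are
  extensional functions on \<open>\<ell>\<^sup>2(I)\<close>, so that equality of operators is equality in HOL.
\<close>

definition ell2 :: "'i set \<Rightarrow> ('i \<Rightarrow> complex) set" where
  "ell2 I = {x. (\<forall>i. i \<notin> I \<longrightarrow> x i = 0) \<and> (\<lambda>i. (cmod (x i))\<^sup>2) summable_on I}"

definition ell2_inner :: "'i set \<Rightarrow> ('i \<Rightarrow> complex) \<Rightarrow> ('i \<Rightarrow> complex) \<Rightarrow> complex" where
  "ell2_inner I x y = (\<Sum>\<^sub>\<infinity>i\<in>I. cnj (x i) * y i)"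

definition ell2_norm :: "'i set \<Rightarrow> ('i \<Rightarrow> complex) \<Rightarrow> real" where
  "ell2_norm I x = sqrt (\<Sum>\<^sub>\<infinity>i\<in>I. (cmod (x i))\<^sup>2)"

definition ell2_topology :: "'i set \<Rightarrow> ('i \<Rightarrow> complex) topology" where
  "ell2_topology I = Metric_space.mtopology (ell2 I) (\<lambda>x y. ell2_norm I (\<lambda>i. x i - y i))"

type_synonym 'i oper = "('i \<Rightarrow> complex) \<Rightarrow> ('i \<Rightarrow> complex)"

definition bounded_operators :: "'i set \<Rightarrow> 'i oper set" where
  "bounded_operators I = {T \<in> ell2 I \<rightarrow>\<^sub>E ell2 I.
     (\<forall>x\<in>ell2 I. \<forall>y\<in>ell2 I. T (\<lambda>i. x i + y i) = (\<lambda>i. T x i + T y i)) \<and>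
     (\<forall>c. \<forall>x\<in>ell2 I. T (\<lambda>i. c * x i) = (\<lambda>i. c * T x i)) \<and>
     (\<exists>C. \<forall>x\<in>ell2 I. ell2_norm I (T x) \<le> C * ell2_norm I x)}"

definition oper_id :: "'i set \<Rightarrow> 'i oper" where
  "oper_id I = (\<lambda>x\<in>ell2 I. x)"

definition adjoint_oper :: "'i set \<Rightarrow> 'i oper \<Rightarrow> 'i oper" where
  "adjoint_oper I T = (THE S. S \<in> bounded_operators I \<and>
     (\<forall>x\<in>ell2 I. \<forall>y\<in>ell2 I. ell2_inner I (T x) y = ell2_inner I x (S y)))"

definition commutant :: "'i set \<Rightarrow> 'i oper set \<Rightarrow> 'i oper set" where
  "commutant I S = {T \<in> bounded_operators I.
     \<forall>A\<in>S. compose (ell2 I) T A = compose (ell2 I) A T}"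

definition von_neumann_algebra :: "'i set \<Rightarrow> 'i oper set \<Rightarrow> bool" where
  "von_neumann_algebra I M \<longleftrightarrow>
     M \<subseteq> bounded_operators I \<and>
     (\<forall>T\<in>M. adjoint_oper I T \<in> M) \<and>
     commutant I (commutant I M) = M"

text \<open>Finiteness in the sense of Murray and von Neumann: every isometry in \<open>M\<close> is a unitary.\<close>

definition finite_von_neumann_algebra :: "'i set \<Rightarrow> 'i oper set \<Rightarrow> bool" where
  "finite_von_neumann_algebra I M \<longleftrightarrow>
     von_neumann_algebra I M \<and>
     (\<forall>V\<in>M. compose (ell2 I) (adjoint_oper I V) V = oper_id I \<longrightarrow>
             compose (ell2 I) V (adjoint_oper I V) = oper_id I)"

definition unitary_group :: "'i set \<Rightarrow> 'i oper set \<Rightarrow> 'i oper monoid" where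
  "unitary_group I M = \<lparr>
     carrier = {V \<in> M. compose (ell2 I) (adjoint_oper I V) V = oper_id I \<and>
                       compose (ell2 I) V (adjoint_oper I V) = oper_id I},
     mult = compose (ell2 I),
     one = oper_id I\<rparr>"

text \<open>The strong operator topology, i.e. the topology of pointwise norm convergence on \<open>\<ell>\<^sup>2(I)\<close>.\<close>

definition strong_topology :: "'i set \<Rightarrow> 'i oper topology" where
  "strong_topology I = product_topology (\<lambda>_. ell2_topology I) (ell2 I)"


section \<open>Polish groups and cocycle superrigidity\<close>

definition polish_group :: "('g, 'b) monoid_scheme \<Rightarrow> 'g topology \<Rightarrow> bool" where
  "polish_group G T \<longleftrightarrow>
     group G \<and> topspace T = carrier G \<and>
     continuous_map (prod_topology T T) T (\<lambda>(x, y). x \<otimes>\<^bsub>G\<^esub> y) \<and>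
     continuous_map T T (\<lambda>x. inv\<^bsub>G\<^esub> x) \<and>
     completely_metrizable_space T \<and> second_countable T"

text \<open>
  Up to isomorphism the spaces \<open>\<ell>\<^sup>2(I)\<close> with \<open>I \<subseteq> \<nat>\<close> are all separable Hilbert spaces.
  Restricting to them does not change the class of groups defined below: for every finite von
  Neumann algebra \<open>M\<close>, a Polish closed subgroup of the unitary group of \<open>M\<close> is also a closed
  subgroup of the unitary group of a finite von Neumann algebra that acts on a separable
  Hilbert space.
\<close>

definition U_fin_group :: "('g, 'b) monoid_scheme \<Rightarrow> 'g topology \<Rightarrow> bool" where
  "U_fin_group G T \<longleftrightarrow>
     polish_group G T \<and>
     (\<exists>(I :: nat set) M H h.
        finite_von_neumann_algebra I M \<and>
        subgroup H (unitary_group I M) \<and>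
        closedin (subtopology (strong_topology I) (carrier (unitary_group I M))) H \<and>
        h \<in> iso G ((unitary_group I M)\<lparr>carrier := H\<rparr>) \<and>
        homeomorphic_map T (subtopology (strong_topology I) H) h)"

definition borel_of :: "'a topology \<Rightarrow> 'a measure" where
  "borel_of T = sigma (topspace T) {U. openin T U}"

definition is_cocycle ::
  "('a, 'b) monoid_scheme \<Rightarrow> 'x measure \<Rightarrow> ('a \<Rightarrow> 'x \<Rightarrow> 'x) \<Rightarrow>
   ('g, 'c) monoid_scheme \<Rightarrow> 'g topology \<Rightarrow> ('a \<Rightarrow> 'x \<Rightarrow> 'g) \<Rightarrow> bool" where
  "is_cocycle G M \<alpha> P T \<omega> \<longleftrightarrow>
     (\<lambda>(g, x). \<omega> g x) \<in> count_space (carrier G) \<Otimes>\<^sub>M M \<rightarrow>\<^sub>M borel_of T \<and>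
     (\<forall>g\<in>carrier G. \<forall>h\<in>carrier G.
        AE x in M. \<omega> (g \<otimes>\<^bsub>G\<^esub> h) x = \<omega> g (\<alpha> h x) \<otimes>\<^bsub>P\<^esub> \<omega> h x)"

text \<open>
  The acting group is countable and discrete. A Polish group has at most the cardinality of the
  continuum, so every Polish group is isomorphic to one whose carrier is a set of reals.
\<close>

definition U_fin_cocycle_superrigid ::
  "('a, 'b) monoid_scheme \<Rightarrow> 'x measure \<Rightarrow> ('a \<Rightarrow> 'x \<Rightarrow> 'x) \<Rightarrow> bool" where
  "U_fin_cocycle_superrigid G M \<alpha> \<longleftrightarrow>
     (\<forall>(P :: real monoid) T \<omega>. U_fin_group P T \<longrightarrow> is_cocycle G M \<alpha> P T \<omega> \<longrightarrow>
        (\<exists>\<phi> \<delta>. \<phi> \<in> M \<rightarrow>\<^sub>M borel_of T \<and> \<delta> \<in> hom G P \<and>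
           (\<forall>g\<in>carrier G. AE x in M.
              \<delta> g = \<phi> (\<alpha> g x) \<otimes>\<^bsub>P\<^esub> \<omega> g x \<otimes>\<^bsub>P\<^esub> inv\<^bsub>P\<^esub> (\<phi> x))))"


section \<open>Measure spaces and actions\<close>

definition standard_measure :: "'x measure \<Rightarrow> bool" where
  "standard_measure M \<longleftrightarrow>
     sigma_finite_measure M \<and>
     (\<exists>T. topspace T = space M \<and> completely_metrizable_space T \<and> second_countable T \<and>
          sets M = sets (borel_of T))"

definition nonatomic :: "'x measure \<Rightarrow> bool" where
  "nonatomic M \<longleftrightarrow>
     (\<forall>A\<in>sets M. 0 < emeasure M A \<longrightarrow>
        (\<exists>B\<in>sets M. B \<subseteq> A \<and> 0 < emeasure M B \<and> 0 < emeasure M (A - B)))"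

definition mp_action :: "('a, 'b) monoid_scheme \<Rightarrow> 'x measure \<Rightarrow> ('a \<Rightarrow> 'x \<Rightarrow> 'x) \<Rightarrow> bool" where
  "mp_action G M \<alpha> \<longleftrightarrow>
     group_action G (space M) \<alpha> \<and>
     (\<forall>g\<in>carrier G. \<alpha> g \<in> M \<rightarrow>\<^sub>M M \<and> distr M M (\<alpha> g) = M)"

definition ergodic_action ::
  "('a, 'b) monoid_scheme \<Rightarrow> 'x measure \<Rightarrow> ('a \<Rightarrow> 'x \<Rightarrow> 'x) \<Rightarrow> bool" where
  "ergodic_action G M \<alpha> \<longleftrightarrow>
     (\<forall>A\<in>sets M. (\<forall>g\<in>carrier G. \<alpha> g -` A \<inter> space M = A) \<longrightarrow>
        A \<in> null_sets M \<or> space M - A \<in> null_sets M)"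

definition free_action ::
  "('a, 'b) monoid_scheme \<Rightarrow> 'x measure \<Rightarrow> ('a \<Rightarrow> 'x \<Rightarrow> 'x) \<Rightarrow> bool" where
  "free_action G M \<alpha> \<longleftrightarrow> (\<forall>g\<in>carrier G - {\<one>\<^bsub>G\<^esub>}. AE x in M. \<alpha> g x \<noteq> x)"

definition product_action ::
  "'x measure \<Rightarrow> 'y measure \<Rightarrow> ('a \<Rightarrow> 'x \<Rightarrow> 'x) \<Rightarrow> ('a \<Rightarrow> 'y \<Rightarrow> 'y) \<Rightarrow> 'a \<Rightarrow> 'x \<times> 'y \<Rightarrow> 'x \<times> 'y"
  where
  "product_action M N \<alpha> \<beta> g = (\<lambda>z \<in> space M \<times> space N. (\<alpha> g (fst z), \<beta> g (snd z)))"

definition weakly_mixing_action ::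
  "('a, 'b) monoid_scheme \<Rightarrow> 'x measure \<Rightarrow> ('a \<Rightarrow> 'x \<Rightarrow> 'x) \<Rightarrow> bool" where
  "weakly_mixing_action G M \<alpha> \<longleftrightarrow> ergodic_action G (M \<Otimes>\<^sub>M M) (product_action M M \<alpha> \<alpha>)"

definition kernel_group ::
  "'a monoid \<Rightarrow> 'l monoid \<Rightarrow> ('a \<Rightarrow> 'l) \<Rightarrow> 'a monoid" where
  "kernel_group G L \<pi> = G\<lparr>carrier := kernel G L \<pi>\<rparr>"


section \<open>Groups of automorphisms modulo equality almost everywhere\<close>

text \<open>
  An isomorphism between measure spaces need only be defined up to null sets: it is a measurable
  map that has a measurable inverse almost everywhere.
\<close>

definition ns_isos :: "'x measure \<Rightarrow> 'y measure \<Rightarrow> ('x \<Rightarrow> 'y) set" where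
  "ns_isos M N = {f \<in> M \<rightarrow>\<^sub>M N.
     (\<exists>g \<in> N \<rightarrow>\<^sub>M M. (AE x in M. g (f x) = x) \<and> (AE y in N. f (g y) = y)) \<and>
     (\<forall>A\<in>sets N. emeasure M (f -` A \<inter> space M) = 0 \<longleftrightarrow> emeasure N A = 0)}"

definition ae_class :: "'x measure \<Rightarrow> ('x \<Rightarrow> 'x) \<Rightarrow> ('x \<Rightarrow> 'x) set" where
  "ae_class M f = {g \<in> ns_isos M M. AE x in M. g x = f x}"

definition Aut_ns :: "'x measure \<Rightarrow> ('x \<Rightarrow> 'x) set monoid" where
  "Aut_ns M = \<lparr>
     carrier = ae_class M ` ns_isos M M,
     mult = (\<lambda>C D. {h \<in> ns_isos M M. \<exists>f\<in>C. \<exists>g\<in>D. AE x in M. h x = f (g x)}),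
     one = ae_class M (\<lambda>x. x)\<rparr>"

definition Aut_mp :: "'x measure \<Rightarrow> ('x \<Rightarrow> 'x) set monoid" where
  "Aut_mp M = (Aut_ns M)\<lparr>carrier := {C \<in> carrier (Aut_ns M). \<forall>f\<in>C. distr M M f = M}\<rparr>"

definition Centr ::
  "('x \<Rightarrow> 'x) set monoid \<Rightarrow> 'x measure \<Rightarrow> ('l, 'b) monoid_scheme \<Rightarrow> ('l \<Rightarrow> 'x \<Rightarrow> 'x) \<Rightarrow>
   ('x \<Rightarrow> 'x) set monoid" where
  "Centr A M L \<beta> = A\<lparr>carrier := {C \<in> carrier A. \<forall>l\<in>carrier L.
     C \<otimes>\<^bsub>A\<^esub> ae_class M (\<beta> l) = ae_class M (\<beta> l) \<otimes>\<^bsub>A\<^esub> C}\<rparr>"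

text \<open>
  The scaling constant \<open>c\<close> of the class \<open>C\<close> of \<open>\<Delta>\<close> satisfies \<open>\<nu> (\<Delta> B) = c * \<nu> B\<close>; here this is
  written with \<open>A = \<Delta> B\<close>.
\<close>

definition mod_ns :: "'y measure \<Rightarrow> ('y \<Rightarrow> 'y) set \<Rightarrow> real" where
  "mod_ns N C = (THE c. c > 0 \<and>
     (\<forall>f\<in>C. \<forall>A\<in>sets N. emeasure N A = ennreal c * emeasure N (f -` A \<inter> space N)))"

definition is_conjugation ::
  "('a, 'b) monoid_scheme \<Rightarrow> 'x measure \<Rightarrow> ('a \<Rightarrow> 'x \<Rightarrow> 'x) \<Rightarrow> ('x \<Rightarrow> 'x) \<Rightarrow> bool" where
  "is_conjugation G M \<alpha> \<Delta> \<longleftrightarrow>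
     \<Delta> \<in> ns_isos M M \<and> distr M M \<Delta> = M \<and>
     (\<exists>\<delta>\<in>iso G G. \<forall>g\<in>carrier G. AE x in M. \<Delta> (\<alpha> g x) = \<alpha> (\<delta> g) (\<Delta> x))"


section \<open>Equivalence relations\<close>

definition orbit_rel ::
  "('a, 'b) monoid_scheme \<Rightarrow> 'z measure \<Rightarrow> ('a \<Rightarrow> 'z \<Rightarrow> 'z) \<Rightarrow> ('z \<times> 'z) set" where
  "orbit_rel G M \<alpha> = {(x, y). y \<in> space M \<and> x \<in> orbit G \<alpha> y}"

definition respects_rel ::
  "'x measure \<Rightarrow> ('x \<times> 'x) set \<Rightarrow> ('y \<times> 'y) set \<Rightarrow> ('x \<Rightarrow> 'y) \<Rightarrow> bool" where
  "respects_rel M R S f \<longleftrightarrow>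
     (\<exists>N\<in>null_sets M. \<forall>x\<in>space M - N. \<forall>y\<in>space M - N. (x, y) \<in> R \<longleftrightarrow> (f x, f y) \<in> S)"

text \<open>
  As for automorphisms, isomorphisms are only required to be non-singular. Between ergodic
  probability measure preserving relations they automatically preserve the measure.
\<close>

definition rel_isomorphic ::
  "'x measure \<Rightarrow> ('x \<times> 'x) set \<Rightarrow> 'y measure \<Rightarrow> ('y \<times> 'y) set \<Rightarrow> bool" where
  "rel_isomorphic M R N S \<longleftrightarrow> (\<exists>f\<in>ns_isos M N. respects_rel M R S f)"

definition Aut_rel :: "'z measure \<Rightarrow> ('z \<times> 'z) set \<Rightarrow> ('z \<Rightarrow> 'z) set monoid" where
  "Aut_rel M R = (Aut_ns M)\<lparr>carrier := {C \<in> carrier (Aut_ns M). \<forall>f\<in>C. respects_rel M R R f}\<rparr>"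

definition full_group :: "'z measure \<Rightarrow> ('z \<times> 'z) set \<Rightarrow> ('z \<Rightarrow> 'z) set set" where
  "full_group M R = {C \<in> carrier (Aut_rel M R). \<forall>f\<in>C. AE x in M. (f x, x) \<in> R}"

definition Out_rel :: "'z measure \<Rightarrow> ('z \<times> 'z) set \<Rightarrow> ('z \<Rightarrow> 'z) set set monoid" where
  "Out_rel M R = Aut_rel M R Mod full_group M R"

definition normalized_restrict :: "'z measure \<Rightarrow> 'z set \<Rightarrow> 'z measure" where
  "normalized_restrict M U = scale_measure (inverse (emeasure M U)) (restrict_space M U)"

definition restrict_rel :: "('z \<times> 'z) set \<Rightarrow> 'z set \<Rightarrow> ('z \<times> 'z) set" where
  "restrict_rel R U = R \<inter> U \<times> U"

definition fundamental_group_rel :: "'z measure \<Rightarrow> ('z \<times> 'z) set \<Rightarrow> real set" where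
  "fundamental_group_rel M R = {measure M U / measure M V | U V.
     U \<in> sets M \<and> V \<in> sets M \<and> 0 < measure M U \<and> 0 < measure M V \<and>
     rel_isomorphic (normalized_restrict M U) (restrict_rel R U)
                    (normalized_restrict M V) (restrict_rel R V)}"

text \<open>
  Invariance of the measure is expressed by all partial Borel isomorphisms whose graph lies in
  the relation.
\<close>

definition mp_rel :: "'z measure \<Rightarrow> ('z \<times> 'z) set \<Rightarrow> bool" where
  "mp_rel M R \<longleftrightarrow>
     (\<forall>A\<in>sets M. \<forall>B\<in>sets M. \<forall>f.
        bij_betw f A B \<longrightarrow>
        f \<in> restrict_space M A \<rightarrow>\<^sub>M restrict_space M B \<longrightarrow>
        the_inv_into A f \<in> restrict_space M B \<rightarrow>\<^sub>M restrict_space M A \<longrightarrow>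
        (\<forall>x\<in>A. (f x, x) \<in> R) \<longrightarrow> emeasure M A = emeasure M B)"

definition type_II_inf_rel :: "'z measure \<Rightarrow> ('z \<times> 'z) set \<Rightarrow> bool" where
  "type_II_inf_rel M R \<longleftrightarrow>
     standard_measure M \<and> nonatomic M \<and> emeasure M (space M) = \<infinity> \<and>
     equiv (space M) R \<and> R \<in> sets (M \<Otimes>\<^sub>M M) \<and> (\<forall>x\<in>space M. countable (R `` {x})) \<and>
     mp_rel M R \<and>
     (\<forall>A\<in>sets M. (\<forall>(x, y)\<in>R. x \<in> A \<longleftrightarrow> y \<in> A) \<longrightarrow>
        A \<in> null_sets M \<or> space M - A \<in> null_sets M)"


section \<open>The identification maps\<close>

text \<open>For the class \<open>C\<close> of \<open>\<Delta>\<^sub>0\<close>, this is the class of \<open>id \<times> \<Delta>\<^sub>0\<close>.\<close>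

definition id_times :: "'x measure \<Rightarrow> 'y measure \<Rightarrow> ('y \<Rightarrow> 'y) set \<Rightarrow> ('x \<times> 'y \<Rightarrow> 'x \<times> 'y) set" where
  "id_times M N C = {h \<in> ns_isos (M \<Otimes>\<^sub>M N) (M \<Otimes>\<^sub>M N).
     \<exists>f\<in>C. AE z in M \<Otimes>\<^sub>M N. h z = (fst z, f (snd z))}"

definition out_class ::
  "'x measure \<Rightarrow> 'y measure \<Rightarrow> (('x \<times> 'y) \<times> ('x \<times> 'y)) set \<Rightarrow> ('y \<Rightarrow> 'y) set \<Rightarrow>
   ('x \<times> 'y \<Rightarrow> 'x \<times> 'y) set set" where
  "out_class M N R C =
     full_group (M \<Otimes>\<^sub>M N) R #>\<^bsub>Aut_rel (M \<Otimes>\<^sub>M N) R\<^esub> id_times M N C"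

text \<open>
  The map \<open>id \<times> \<Delta>\<^sub>0\<close> need not leave \<open>U\<close> invariant, but when it preserves the measure it can be
  composed with an element of the full group of \<open>R\<close> so that it does. The resulting element of
  the outer automorphism group of the restriction of \<open>R\<close> to \<open>U\<close> consists of the automorphisms
  \<open>h\<close> with \<open>h z\<close> equivalent to \<open>(id \<times> \<Delta>\<^sub>0) z\<close> for almost every \<open>z\<close> in \<open>U\<close>.
\<close>

definition out_class_restrict ::
  "'x measure \<Rightarrow> 'y measure \<Rightarrow> (('x \<times> 'y) \<times> ('x \<times> 'y)) set \<Rightarrow> ('x \<times> 'y) set \<Rightarrow>
   ('y \<Rightarrow> 'y) set \<Rightarrow> ('x \<times> 'y \<Rightarrow> 'x \<times> 'y) set set" where
  "out_class_restrict M N R U C =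
     {D \<in> carrier (Aut_rel (normalized_restrict (M \<Otimes>\<^sub>M N) U) (restrict_rel R U)).
        \<forall>h\<in>D. \<forall>f\<in>C. AE z in normalized_restrict (M \<Otimes>\<^sub>M N) U. (h z, (fst z, f (snd z))) \<in> R}"

end

theory Submission imports Defs begin

text \<open>
  Let \<open>N\<close> be the kernel of \<open>\<pi>\<close> and let \<open>F\<close> be an automorphism of the orbit relation, possibly between
  restrictions; return maps make it a map on all of \<open>X \<times> Y\<close>. Since \<open>\<Gamma>\<close> acts freely, \<open>F\<close> has a
  \<open>\<Gamma>\<close>-valued Zimmer cocycle. For fixed \<open>y\<close> its restriction to \<open>N \<times> X\<close> can be untwisted to a morphism
  \<open>D\<^sub>y: N \<rightarrow> \<Gamma>\<close>, because a countable group is a closed subgroup of the unitary group of its von Neumann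
  algebra, and the untwisting can be chosen measurably in \<open>y\<close> by a selection theorem for Souslin sets.
  As \<open>\<pi> \<circ> D\<^sub>y\<close> is trivial, \<open>D\<^sub>y\<close> takes values in \<open>N\<close> and by weak mixing the untwisted map has the form
  \<open>(x, y) \<mapsto> (F\<^sub>y(x), F\<^sub>0(y))\<close> with \<open>F\<^sub>y(n x) = D\<^sub>y(n) F\<^sub>y(x)\<close>. The inverse of \<open>F\<close> shows that \<open>F\<^sub>y\<close> is a
  conjugation, so \<open>F\<^sub>y(x) = g\<^sub>y x\<close> with \<open>g\<^sub>y\<close> in \<open>\<Gamma>\<close>, and multiplying by the inverse of \<open>g\<^sub>y\<close> leaves
  \<open>id \<times> \<Delta>\<^sub>0\<close> with \<open>\<Delta>\<^sub>0\<close> in the centralizer of \<open>\<Lambda>\<close>. Conversely, if \<open>\<Delta>\<^sub>0\<close> preserves the measure, then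
  ergodicity allows \<open>id \<times> \<Delta>\<^sub>0\<close> to be moved within orbits to an automorphism of a set of finite measure.
\<close>

section \<open>Bounded operators on square-summable families\<close>

text \<open>The kernel acts trivially on \<open>Y\<close>, so over almost every \<open>y\<close> the
  Zimmer cocycle restricts to an honest cocycle of \<open>N\<close> on the probability space
  \<open>X\<close>. This is how superrigidity can enter although \<open>Y\<close> has infinite
  measure. It yields an untwisting for each \<open>y\<close> separately; nothing ties these choices
  together, and this is the obstacle that shapes the middle of the development. Isomorphisms are
  only non-singular, so the argument runs on maps that pull null sets back to null sets. Exact
  statements about measures are recovered from equivariance and ergodicity: the maps
  \<open>F_y\<close> preserve the measure of \<open>X\<close>, and an element of the centralizer
  multiplies the measure of \<open>Y\<close> by a constant. That constant is what the fundamental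
  group records. An isomorphism from the restriction to \<open>V\<close> onto the restriction to
  \<open>W\<close> agrees up to orbits with some \<open>id_map j\<close>; group elements preserve
  the measure, so the measure of \<open>W\<close> is the constant of \<open>j\<close> times that of
  \<open>V\<close>. Freeness is used on the first coordinate throughout: an element relating
  \<open>id_map f z\<close> to \<open>id_map g z\<close> fixes \<open>fst z\<close>, hence is
  trivial. So the second coordinate is determined and not merely its orbit.\<close>

lemma ell2_sum_bound:
  assumes "x \<in> ell2 I" "finite F" "F \<subseteq> I"
  shows "L2_set (\<lambda>i. cmod (x i)) F \<le> ell2_norm I x"
  using assms unfolding L2_set_def ell2_norm_def ell2_def
  by (auto intro!: real_sqrt_le_mono finite_sum_le_infsum)

text \<open>All estimates are made on finite sections, where \<open>L2_set\<close> is the Euclidean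
  norm with its triangle and Cauchy-Schwarz inequalities; this lemma passes to the whole index
  set.\<close>

lemma ell2I_bound:
  assumes "\<And>i. i \<notin> I \<Longrightarrow> x i = 0" "0 \<le> C"
    and "\<And>F. finite F \<Longrightarrow> F \<subseteq> I \<Longrightarrow> L2_set (\<lambda>i. cmod (x i)) F \<le> C"
  shows "x \<in> ell2 I" "ell2_norm I x \<le> C"
proof -
  have *: "(\<Sum>i\<in>F. (cmod (x i))\<^sup>2) \<le> C\<^sup>2" if "finite F" "F \<subseteq> I" for F
    using assms(3)[OF that] unfolding L2_set_def by (simp add: real_le_lsqrt sqrt_le_D)
  have s: "(\<lambda>i. (cmod (x i))\<^sup>2) summable_on I"
    by (rule nonneg_bdd_above_summable_on) (auto intro!: bdd_aboveI2 * simp: )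
  show "x \<in> ell2 I" using s assms(1) by (auto simp: ell2_def)
  have "(\<Sum>\<^sub>\<infinity>i\<in>I. (cmod (x i))\<^sup>2) \<le> C\<^sup>2"
    by (rule infsum_le_finite_sums[OF s]) (use * in auto)
  then show "ell2_norm I x \<le> C"
    unfolding ell2_norm_def using assms(2) by (simp add: real_le_lsqrt)
qed

lemma ell2_norm_nonneg [simp]: "0 \<le> ell2_norm I x"
  unfolding ell2_norm_def by (simp add: infsum_nonneg)

lemma ell2_zero [simp]: "(\<lambda>i. 0) \<in> ell2 I"
  by (rule ell2I_bound(1)[where C=0]) (auto simp: L2_set_def)

lemma ell2_norm_zero [simp]: "ell2_norm I (\<lambda>i. 0) = 0"
  by (simp add: ell2_norm_def)

lemma ell2_add:
  assumes "x \<in> ell2 I" "y \<in> ell2 I"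
  shows "(\<lambda>i. x i + y i) \<in> ell2 I" "ell2_norm I (\<lambda>i. x i + y i) \<le> ell2_norm I x + ell2_norm I y"
proof -
  have b: "L2_set (\<lambda>i. cmod (x i + y i)) F \<le> ell2_norm I x + ell2_norm I y" if F: "finite F" "F \<subseteq> I" for F
  proof -
    have "L2_set (\<lambda>i. cmod (x i + y i)) F \<le> L2_set (\<lambda>i. cmod (x i) + cmod (y i)) F"
      by (intro L2_set_mono) (auto intro: norm_triangle_ineq)
    also have "\<dots> \<le> L2_set (\<lambda>i. cmod (x i)) F + L2_set (\<lambda>i. cmod (y i)) F"
      by (rule L2_set_triangle_ineq)
    finally show ?thesis using ell2_sum_bound[OF assms(1) F] ell2_sum_bound[OF assms(2) F] by linarith
  qed
  have z: "i \<notin> I \<Longrightarrow> x i + y i = 0" for i using assms by (auto simp: ell2_def)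
  show "(\<lambda>i. x i + y i) \<in> ell2 I" "ell2_norm I (\<lambda>i. x i + y i) \<le> ell2_norm I x + ell2_norm I y"
    using ell2I_bound[of I "\<lambda>i. x i + y i", OF z _ b] by auto
qed

lemma ell2_scale:
  assumes "x \<in> ell2 I"
  shows "(\<lambda>i. c * x i) \<in> ell2 I" "ell2_norm I (\<lambda>i. c * x i) = cmod c * ell2_norm I x"
proof -
  have s: "(\<lambda>i. (cmod (x i))\<^sup>2) summable_on I" and z: "\<And>i. i \<notin> I \<Longrightarrow> x i = 0"
    using assms by (auto simp: ell2_def)
  have e: "(\<lambda>i. (cmod (c * x i))\<^sup>2) = (\<lambda>i. (cmod c)\<^sup>2 * (cmod (x i))\<^sup>2)"
    by (simp add: norm_mult power_mult_distrib)
  have "(\<lambda>i. (cmod (c * x i))\<^sup>2) summable_on I"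
    unfolding e by (rule summable_on_cmult_right[OF s])
  then show "(\<lambda>i. c * x i) \<in> ell2 I" using z by (simp add: ell2_def)
  show "ell2_norm I (\<lambda>i. c * x i) = cmod c * ell2_norm I x"
    unfolding ell2_norm_def e by (simp add: infsum_cmult_right' real_sqrt_mult)
qed

lemma ell2_diff:
  assumes "x \<in> ell2 I" "y \<in> ell2 I"
  shows "(\<lambda>i. x i - y i) \<in> ell2 I"
  using ell2_add(1)[OF assms(1) ell2_scale(1)[OF assms(2), of "-1"]] by simp

lemma ell2_norm_minus_commute: "ell2_norm I (\<lambda>i. x i - y i) = ell2_norm I (\<lambda>i. y i - x i)"
  unfolding ell2_norm_def by (simp add: norm_minus_commute)

lemma ell2_component_le:
  assumes "x \<in> ell2 I" shows "cmod (x i) \<le> ell2_norm I x"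
proof (cases "i \<in> I")
  case True then show ?thesis using ell2_sum_bound[OF assms, of "{i}"] by simp
next
  case False then show ?thesis using assms by (auto simp: ell2_def)
qed

lemma ell2_norm_eq_0:
  assumes "x \<in> ell2 I" "ell2_norm I x = 0" shows "x = (\<lambda>i. 0)"
  using ell2_component_le[OF assms(1)] assms(2) by (auto simp: fun_eq_iff)

lemma Metric_space_ell2: "Metric_space (ell2 I) (\<lambda>x y. ell2_norm I (\<lambda>i. x i - y i))"
proof
  fix x y z assume xyz: "x \<in> ell2 I" "y \<in> ell2 I"
  show "(ell2_norm I (\<lambda>i. x i - y i) = 0) = (x = y)"
    using ell2_norm_eq_0[OF ell2_diff[OF xyz]] by (auto simp: fun_eq_iff)
  assume z: "z \<in> ell2 I"
  have "(\<lambda>i. x i - z i) = (\<lambda>i. (x i - y i) + (y i - z i))" by auto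
  then show "ell2_norm I (\<lambda>i. x i - z i) \<le> ell2_norm I (\<lambda>i. x i - y i) + ell2_norm I (\<lambda>i. y i - z i)"
    using ell2_add(2)[OF ell2_diff[OF xyz] ell2_diff[OF xyz(2) z]] by simp
qed (auto intro: ell2_norm_minus_commute)

text \<open>Cauchy-Schwarz on finite sections gives absolute summability and the norm estimate at
  once.\<close>

lemma ell2_inner_summable:
  assumes "x \<in> ell2 I" "y \<in> ell2 I"
  shows "(\<lambda>i. cmod (cnj (x i) * y i)) summable_on I"
    and "cmod (ell2_inner I x y) \<le> ell2_norm I x * ell2_norm I y"
proof -
  have b: "(\<Sum>i\<in>F. cmod (cnj (x i) * y i)) \<le> ell2_norm I x * ell2_norm I y" if F: "finite F" "F \<subseteq> I" for F
  proof -
    have "(\<Sum>i\<in>F. cmod (cnj (x i) * y i)) \<le> L2_set (\<lambda>i. cmod (x i)) F * L2_set (\<lambda>i. cmod (y i)) F"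
      using L2_set_mult_ineq[of "\<lambda>i. cmod (x i)" "\<lambda>i. cmod (y i)" F] by (simp add: norm_mult)
    also have "\<dots> \<le> ell2_norm I x * ell2_norm I y"
      by (intro mult_mono ell2_sum_bound assms F) auto
    finally show ?thesis .
  qed
  show s: "(\<lambda>i. cmod (cnj (x i) * y i)) summable_on I"
    by (rule nonneg_bdd_above_summable_on) (auto intro!: bdd_aboveI2 b)
  have "cmod (ell2_inner I x y) \<le> (\<Sum>\<^sub>\<infinity>i\<in>I. cmod (cnj (x i) * y i))"
    unfolding ell2_inner_def by (rule norm_infsum_bound[OF s])
  also have "\<dots> \<le> ell2_norm I x * ell2_norm I y"
    by (rule infsum_le_finite_sums[OF s]) (use b in auto)
  finally show "cmod (ell2_inner I x y) \<le> ell2_norm I x * ell2_norm I y" .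
qed

lemma ell2_inner_add:
  assumes "x \<in> ell2 I" "y \<in> ell2 I" "z \<in> ell2 I"
  shows "ell2_inner I x (\<lambda>i. y i + z i) = ell2_inner I x y + ell2_inner I x z"
    and "ell2_inner I (\<lambda>i. y i + z i) x = ell2_inner I y x + ell2_inner I z x"
  unfolding ell2_inner_def
  using ell2_inner_summable(1)[THEN abs_summable_summable] assms
  by (auto simp: distrib_left distrib_right intro!: infsum_add)

lemma ell2_inner_scale:
  assumes "x \<in> ell2 I" "y \<in> ell2 I"
  shows "ell2_inner I x (\<lambda>i. c * y i) = c * ell2_inner I x y"
    and "ell2_inner I (\<lambda>i. c * y i) x = cnj c * ell2_inner I y x"
  unfolding ell2_inner_def
  by (auto simp: mult.left_commute[of _ c] mult.assoc infsum_cmult_right')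

lemma ell2_inner_diff:
  assumes "x \<in> ell2 I" "y \<in> ell2 I" "z \<in> ell2 I"
  shows "ell2_inner I x (\<lambda>i. y i - z i) = ell2_inner I x y - ell2_inner I x z"
    and "ell2_inner I (\<lambda>i. y i - z i) x = ell2_inner I y x - ell2_inner I z x"
  using ell2_inner_add[OF assms(1,2) ell2_scale(1)[OF assms(3), of "-1"]] ell2_inner_scale[OF assms(1,3), of "-1"]
  by auto

lemma ell2_inner_cnj: "ell2_inner I y x = cnj (ell2_inner I x y)"
  unfolding ell2_inner_def by (simp add: mult.commute flip: infsum_cnj)

lemma ell2_inner_self: "x \<in> ell2 I \<Longrightarrow> ell2_inner I x x = complex_of_real ((ell2_norm I x)\<^sup>2)"
proof -
  assume x: "x \<in> ell2 I"
  have "ell2_inner I x x = (\<Sum>\<^sub>\<infinity>i\<in>I. complex_of_real ((cmod (x i))\<^sup>2))"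
    unfolding ell2_inner_def by (intro infsum_cong) (metis complex_norm_square mult.commute)
  also have "\<dots> = complex_of_real (\<Sum>\<^sub>\<infinity>i\<in>I. (cmod (x i))\<^sup>2)" using x by (intro infsumI has_sum_of_real) (auto simp: ell2_def)
  also have "(\<Sum>\<^sub>\<infinity>i\<in>I. (cmod (x i))\<^sup>2) = (ell2_norm I x)\<^sup>2"
    unfolding ell2_norm_def by (simp add: infsum_nonneg)
  finally show ?thesis .
qed

definition ell2_unit :: "'i \<Rightarrow> 'i \<Rightarrow> complex" where "ell2_unit k = (\<lambda>i. if i = k then 1 else 0)"

lemma ell2_unit_eq: "ell2_unit k i = (if i = k then 1 else 0)"
  by (simp add: ell2_unit_def)

lemma ell2_unit_in [simp]: "k \<in> I \<Longrightarrow> ell2_unit k \<in> ell2 I"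
  unfolding ell2_def ell2_unit_def
  using summable_on_cong_neutral[of "{k}" I "\<lambda>i. (cmod (if i = k then 1 else 0))\<^sup>2" "\<lambda>i. (cmod (if i = k then 1 else 0))\<^sup>2"]
  by auto

lemma ell2_inner_unit [simp]: "k \<in> I \<Longrightarrow> ell2_inner I (ell2_unit k) x = x k"
  unfolding ell2_inner_def
  by (subst infsum_cong_neutral[where T="{k}" and g="x"]) (auto simp: ell2_unit_def)

lemma ell2_inner_unit_right [simp]: "k \<in> I \<Longrightarrow> ell2_inner I x (ell2_unit k) = cnj (x k)"
  by (subst ell2_inner_cnj) simp

lemma ell2_norm_unit [simp]: "k \<in> I \<Longrightarrow> ell2_norm I (ell2_unit k) = 1"
proof -
  assume "k \<in> I"
  then have "complex_of_real ((ell2_norm I (ell2_unit k))\<^sup>2) = 1"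
    using ell2_inner_self[of "ell2_unit k" I] ell2_inner_unit[of k I "ell2_unit k"]
    by (simp add: ell2_unit_eq)
  then have "(ell2_norm I (ell2_unit k))\<^sup>2 = 1" using of_real_eq_1_iff by blast
  then show ?thesis by (smt (verit) power2_eq_1_iff ell2_norm_nonneg)
qed

lemma ell2_truncate:
  assumes "x \<in> ell2 I"
  shows "(\<lambda>i. if i \<in> F then x i else 0) \<in> ell2 I"
    "ell2_norm I (\<lambda>i. if i \<in> F then x i else 0) \<le> ell2_norm I x"
proof -
  have b: "L2_set (\<lambda>i. cmod (if i \<in> F then x i else 0)) G \<le> ell2_norm I x" if G: "finite G" "G \<subseteq> I" for G
    by (rule order_trans[OF _ ell2_sum_bound[OF assms G]]) (auto intro!: L2_set_mono)
  show "(\<lambda>i. if i \<in> F then x i else 0) \<in> ell2 I"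
    "ell2_norm I (\<lambda>i. if i \<in> F then x i else 0) \<le> ell2_norm I x"
    using ell2I_bound[of I "\<lambda>i. if i \<in> F then x i else 0", OF _ _ b] assms
    by (auto simp: ell2_def)
qed

lemma ell2_finite_approx:
  assumes x: "x \<in> ell2 I" and "0 < e"
  obtains F where "finite F" "F \<subseteq> I" "ell2_norm I (\<lambda>i. x i - (if i \<in> F then x i else 0)) < e"
proof -
  have s: "(\<lambda>i. (cmod (x i))\<^sup>2) summable_on I" using x by (auto simp: ell2_def)
  define S where "S = (\<Sum>\<^sub>\<infinity>i\<in>I. (cmod (x i))\<^sup>2)"
  have hs: "((\<lambda>i. (cmod (x i))\<^sup>2) has_sum S) I" using s by (simp add: S_def)
  have "0 < e\<^sup>2" using assms by simp
  then obtain F where F: "finite F" "F \<subseteq> I" "S - (\<Sum>i\<in>F. (cmod (x i))\<^sup>2) < e\<^sup>2"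
  proof -
    assume *: "\<And>F. finite F \<Longrightarrow> F \<subseteq> I \<Longrightarrow> S - (\<Sum>i\<in>F. (cmod (x i))\<^sup>2) < e\<^sup>2 \<Longrightarrow> thesis"
    have "eventually (\<lambda>F. dist (\<Sum>i\<in>F. (cmod (x i))\<^sup>2) S < e\<^sup>2) (finite_subsets_at_top I)"
      using hs \<open>0 < e\<^sup>2\<close> unfolding has_sum_def tendsto_iff by blast
    then obtain F where "finite F" "F \<subseteq> I" "dist (\<Sum>i\<in>F. (cmod (x i))\<^sup>2) S < e\<^sup>2"
      unfolding eventually_finite_subsets_at_top by blast
    then show thesis using * by (auto simp: dist_real_def)
  qed
  have *: "(\<Sum>\<^sub>\<infinity>i\<in>I. (cmod (x i - (if i \<in> F then x i else 0)))\<^sup>2) = S - (\<Sum>i\<in>F. (cmod (x i))\<^sup>2)"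
  proof -
    have "(\<Sum>\<^sub>\<infinity>i\<in>I. (cmod (x i - (if i \<in> F then x i else 0)))\<^sup>2) = (\<Sum>\<^sub>\<infinity>i\<in>I-F. (cmod (x i))\<^sup>2)"
      by (rule infsum_cong_neutral) auto
    also have "\<dots> = S - (\<Sum>\<^sub>\<infinity>i\<in>F. (cmod (x i))\<^sup>2)"
      unfolding S_def by (rule infsum_Diff) (use s F in auto)
    finally show ?thesis using F by simp
  qed
  have "ell2_norm I (\<lambda>i. x i - (if i \<in> F then x i else 0)) < e"
    unfolding ell2_norm_def * using F(3) \<open>0 < e\<close> by (simp add: real_less_lsqrt)
  then show ?thesis using F that by blast
qed

lemma ell2_finite_support:
  assumes "finite F" "F \<subseteq> I"
  shows "(\<lambda>i. if i \<in> F then x i else 0) \<in> ell2 I"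
    and "ell2_norm I (\<lambda>i. if i \<in> F then x i else 0) = L2_set (\<lambda>i. cmod (x i)) F"
proof -
  have "(\<lambda>i. (cmod (if i \<in> F then x i else 0))\<^sup>2) summable_on I"
    using summable_on_cong_neutral[of F I "\<lambda>i. (cmod (if i \<in> F then x i else 0))\<^sup>2" "\<lambda>i. (cmod (if i \<in> F then x i else 0))\<^sup>2"]
      assms by auto
  then show "(\<lambda>i. if i \<in> F then x i else 0) \<in> ell2 I"
    using assms by (auto simp: ell2_def)
  show "ell2_norm I (\<lambda>i. if i \<in> F then x i else 0) = L2_set (\<lambda>i. cmod (x i)) F"
    unfolding ell2_norm_def L2_set_def
    by (subst infsum_cong_neutral[where T=F and g="\<lambda>i. (cmod (x i))\<^sup>2"]) (use assms in auto)
qed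

lemma ell2_functional_truncate:
  fixes f :: "('i \<Rightarrow> complex) \<Rightarrow> complex"
  assumes add: "\<And>x y. x \<in> ell2 I \<Longrightarrow> y \<in> ell2 I \<Longrightarrow> f (\<lambda>i. x i + y i) = f x + f y"
    and scale: "\<And>c x. x \<in> ell2 I \<Longrightarrow> f (\<lambda>i. c * x i) = c * f x"
    and F: "finite F" "F \<subseteq> I"
  shows "f (\<lambda>i. if i \<in> F then x i else 0) = (\<Sum>i\<in>F. x i * f (ell2_unit i))"
  using F
proof (induction F)
  case empty
  then show ?case using scale[of "\<lambda>i. 0" 0] by simp
next
  case (insert k F)
  have e: "(\<lambda>i. if i \<in> insert k F then x i else 0) =
      (\<lambda>i. (if i \<in> F then x i else 0) + x k * ell2_unit k i)"
    using insert.hyps by (auto simp: ell2_unit_def)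
  have "f (\<lambda>i. if i \<in> insert k F then x i else 0) =
      f (\<lambda>i. if i \<in> F then x i else 0) + f (\<lambda>i. x k * ell2_unit k i)"
    unfolding e by (rule add) (use insert.prems insert.hyps in \<open>auto intro!: ell2_finite_support ell2_scale\<close>)
  also have "f (\<lambda>i. x k * ell2_unit k i) = x k * f (ell2_unit k)"
    using insert.prems by (intro scale) auto
  finally show ?case using insert by simp
qed

text \<open>Finitely supported vectors are dense, and boundedness carries the vanishing over from
  them. Operators and sesquilinear forms are compared below by their values on unit vectors through
  this lemma.\<close>

lemma ell2_functional_zero:
  fixes f :: "('i \<Rightarrow> complex) \<Rightarrow> complex"
  assumes add: "\<And>x y. x \<in> ell2 I \<Longrightarrow> y \<in> ell2 I \<Longrightarrow> f (\<lambda>i. x i + y i) = f x + f y"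
    and scale: "\<And>c x. x \<in> ell2 I \<Longrightarrow> f (\<lambda>i. c * x i) = c * f x"
    and bound: "\<And>x. x \<in> ell2 I \<Longrightarrow> cmod (f x) \<le> C * ell2_norm I x"
    and unit: "\<And>k. k \<in> I \<Longrightarrow> f (ell2_unit k) = 0"
    and x: "x \<in> ell2 I"
  shows "f x = 0"
proof -
  have "cmod (f x) \<le> e" if e: "0 < e" for e
  proof -
    \<comment> \<open>No sign is known for \<open>C\<close>; this is a positive bound by which one
      can divide.\<close>
    have pos: "0 < \<bar>C\<bar> + 1" by simp
    obtain F where F: "finite F" "F \<subseteq> I"
        "ell2_norm I (\<lambda>i. x i - (if i \<in> F then x i else 0)) < e / (\<bar>C\<bar> + 1)"
      by (rule ell2_finite_approx[OF x, of "e / (\<bar>C\<bar> + 1)"]) (use e pos in auto)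
    let ?t = "\<lambda>i. if i \<in> F then x i else 0"
    let ?d = "\<lambda>i. x i - ?t i"
    have t: "?t \<in> ell2 I" "?d \<in> ell2 I" using ell2_truncate[OF x] ell2_diff[OF x] by auto
    have "f ?t = (\<Sum>i\<in>F. x i * f (ell2_unit i))"
      by (rule ell2_functional_truncate[of I f F x, OF add scale F(1,2)])
    also have "\<dots> = 0" using unit F(2) by (intro sum.neutral) (simp add: subset_iff)
    finally have "f ?t = 0" .
    moreover have "f x = f ?d + f ?t" using add[OF t(2,1)] by simp
    ultimately have "cmod (f x) \<le> C * ell2_norm I ?d" using bound[OF t(2)] by simp
    also have "\<dots> \<le> (\<bar>C\<bar> + 1) * ell2_norm I ?d" by (intro mult_right_mono) auto
    also have "\<dots> \<le> e" using F(3) pos by (simp add: field_simps)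
    finally show ?thesis .
  qed
  then show ?thesis using field_le_epsilon[of "cmod (f x)" 0] by auto
qed

section \<open>Bounded operators, adjoints and commutants\<close>

lemma bounded_operatorsD:
  assumes "T \<in> bounded_operators I"
  shows "x \<in> ell2 I \<Longrightarrow> T x \<in> ell2 I"
    "x \<in> ell2 I \<Longrightarrow> y \<in> ell2 I \<Longrightarrow> T (\<lambda>i. x i + y i) = (\<lambda>i. T x i + T y i)"
    "x \<in> ell2 I \<Longrightarrow> T (\<lambda>i. c * x i) = (\<lambda>i. c * T x i)"
    "x \<notin> ell2 I \<Longrightarrow> T x = undefined"
    "\<exists>C\<ge>0. \<forall>x\<in>ell2 I. ell2_norm I (T x) \<le> C * ell2_norm I x"
proof -
  show "\<exists>C\<ge>0. \<forall>x\<in>ell2 I. ell2_norm I (T x) \<le> C * ell2_norm I x"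
  proof -
    obtain C where C: "\<forall>x\<in>ell2 I. ell2_norm I (T x) \<le> C * ell2_norm I x"
      using assms by (auto simp: bounded_operators_def)
    have "C * ell2_norm I x \<le> max C 0 * ell2_norm I x" for x by (intro mult_right_mono) auto
    then show ?thesis using C by (intro exI[of _ "max C 0"]) (auto intro: order_trans)
  qed
  have P: "T \<in> ell2 I \<rightarrow>\<^sub>E ell2 I"
    and A: "\<forall>x\<in>ell2 I. \<forall>y\<in>ell2 I. T (\<lambda>i. x i + y i) = (\<lambda>i. T x i + T y i)"
    and S: "\<forall>c. \<forall>x\<in>ell2 I. T (\<lambda>i. c * x i) = (\<lambda>i. c * T x i)"
    using assms unfolding bounded_operators_def mem_Collect_eq by - (elim conjE, assumption)+
  show "x \<in> ell2 I \<Longrightarrow> T x \<in> ell2 I" by (rule PiE_mem[OF P])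
  show "x \<notin> ell2 I \<Longrightarrow> T x = undefined" by (rule PiE_arb[OF P])
  show "x \<in> ell2 I \<Longrightarrow> y \<in> ell2 I \<Longrightarrow> T (\<lambda>i. x i + y i) = (\<lambda>i. T x i + T y i)"
    using A by blast
  show "x \<in> ell2 I \<Longrightarrow> T (\<lambda>i. c * x i) = (\<lambda>i. c * T x i)"
    using S by blast
qed

text \<open>Each coordinate of the difference is a bounded linear functional that vanishes on the
  unit vectors. Outside \<open>ell2 I\<close> both operators are \<open>undefined\<close>.\<close>

lemma bounded_operators_eqI:
  assumes T: "T \<in> bounded_operators I" and S: "S \<in> bounded_operators I"
    and unit: "\<And>k. k \<in> I \<Longrightarrow> T (ell2_unit k) = S (ell2_unit k)"
  shows "T = S"
proof
  fix x
  show "T x = S x"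
  proof (cases "x \<in> ell2 I")
    case True
    obtain C where C: "\<forall>x\<in>ell2 I. ell2_norm I (T x) \<le> C * ell2_norm I x" using bounded_operatorsD(5)[OF T] by blast
    obtain D where D: "\<forall>x\<in>ell2 I. ell2_norm I (S x) \<le> D * ell2_norm I x" using bounded_operatorsD(5)[OF S] by blast
    have "T x j - S x j = 0" for j
    proof (rule ell2_functional_zero[where f="\<lambda>x. T x j - S x j" and C="C + D", OF _ _ _ _ True])
      fix x assume x: "x \<in> ell2 I"
      have "cmod (T x j - S x j) \<le> cmod (T x j) + cmod (S x j)" by (rule norm_triangle_ineq4)
      also have "\<dots> \<le> C * ell2_norm I x + D * ell2_norm I x"
        using ell2_component_le[OF bounded_operatorsD(1)[OF T x], of j] ell2_component_le[OF bounded_operatorsD(1)[OF S x], of j] C D x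
        by (meson add_mono order_trans)
      finally show "cmod (T x j - S x j) \<le> (C + D) * ell2_norm I x" by (simp add: distrib_right)
    qed (simp_all add: bounded_operatorsD[OF T] bounded_operatorsD[OF S] unit algebra_simps)
    then show ?thesis by (auto simp: fun_eq_iff)
  qed (simp add: bounded_operatorsD(4)[OF T] bounded_operatorsD(4)[OF S])
qed

text \<open>The matrix entries \<open>\<langle>T e\<^sub>i, y\<rangle>\<close> define the adjoint; testing \<open>T\<close> on a finite truncation of
  \<open>T* y\<close> bounds its norm.\<close>

lemma adjoint_exists:
  assumes T: "T \<in> bounded_operators I"
  shows "\<exists>S\<in>bounded_operators I. \<forall>x\<in>ell2 I. \<forall>y\<in>ell2 I. ell2_inner I (T x) y = ell2_inner I x (S y)"
proof -
  obtain C where C0: "0 \<le> C" and C: "\<And>x. x \<in> ell2 I \<Longrightarrow> ell2_norm I (T x) \<le> C * ell2_norm I x"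
    using bounded_operatorsD(5)[OF T] by blast
  define S0 where "S0 y i = (if i \<in> I then ell2_inner I (T (ell2_unit i)) y else 0)" for y i
  define S where "S = (\<lambda>y\<in>ell2 I. S0 y)"
  note TD = bounded_operatorsD[OF T]
  have fadd: "ell2_inner I y (T (\<lambda>i. x i + x' i)) = ell2_inner I y (T x) + ell2_inner I y (T x')"
    if "y \<in> ell2 I" "x \<in> ell2 I" "x' \<in> ell2 I" for x x' y
    using that by (simp add: TD ell2_inner_add)
  have fscale: "ell2_inner I y (T (\<lambda>i. c * x i)) = c * ell2_inner I y (T x)"
    if "y \<in> ell2 I" "x \<in> ell2 I" for c x y
    using that by (simp add: TD ell2_inner_scale)
  have fbound: "cmod (ell2_inner I y (T x)) \<le> ell2_norm I y * C * ell2_norm I x"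
    if "y \<in> ell2 I" "x \<in> ell2 I" for x y
  proof -
    have "cmod (ell2_inner I y (T x)) \<le> ell2_norm I y * ell2_norm I (T x)"
      using that TD by (intro ell2_inner_summable) auto
    also have "\<dots> \<le> ell2_norm I y * (C * ell2_norm I x)" using that C by (intro mult_left_mono) auto
    finally show ?thesis by (simp add: mult.assoc)
  qed
  have S0: "S0 y \<in> ell2 I" "ell2_norm I (S0 y) \<le> C * ell2_norm I y" if y: "y \<in> ell2 I" for y
  proof -
    have b: "L2_set (\<lambda>i. cmod (S0 y i)) F \<le> C * ell2_norm I y" if F: "finite F" "F \<subseteq> I" for F
    proof -
      let ?t = "\<lambda>i. if i \<in> F then S0 y i else 0"
      let ?L = "L2_set (\<lambda>i. cmod (S0 y i)) F"
      have t: "?t \<in> ell2 I" "ell2_norm I ?t = ?L" using ell2_finite_support[OF F] by auto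
      have "ell2_inner I y (T ?t) = (\<Sum>i\<in>F. S0 y i * ell2_inner I y (T (ell2_unit i)))"
        by (rule ell2_functional_truncate[where f="\<lambda>x. ell2_inner I y (T x)" and I=I]) (use y F fadd fscale in auto)
      also have "\<dots> = (\<Sum>i\<in>F. complex_of_real ((cmod (S0 y i))\<^sup>2))"
      proof (rule sum.cong)
        fix i assume "i \<in> F"
        then have "ell2_inner I y (T (ell2_unit i)) = cnj (S0 y i)"
          using F ell2_inner_cnj[of I y] by (auto simp: S0_def)
        then show "S0 y i * ell2_inner I y (T (ell2_unit i)) = complex_of_real ((cmod (S0 y i))\<^sup>2)"
          using complex_norm_square[of "S0 y i"] by simp
      qed simp
      also have "\<dots> = complex_of_real (?L\<^sup>2)" by (simp add: L2_set_def sum_nonneg)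
      finally have "?L\<^sup>2 = cmod (ell2_inner I y (T ?t))" by (simp add: norm_power)
      also have "\<dots> \<le> ell2_norm I y * C * ?L" using fbound[OF y t(1)] t(2) by simp
      finally have "?L * ?L \<le> (C * ell2_norm I y) * ?L" by (simp add: power2_eq_square algebra_simps)
      moreover have "0 \<le> ?L" by simp
      ultimately show ?thesis using C0 by (cases "?L = 0") (auto simp: mult_le_cancel_right)
    qed
    show "S0 y \<in> ell2 I" "ell2_norm I (S0 y) \<le> C * ell2_norm I y"
      using ell2I_bound[of I "S0 y", OF _ _ b] C0 by (auto simp: S0_def)
  qed
  have "S \<in> bounded_operators I"
    unfolding bounded_operators_def
  proof (intro CollectI conjI ballI allI)
    show "S \<in> ell2 I \<rightarrow>\<^sub>E ell2 I" using S0 by (auto simp: S_def)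
    show "\<exists>C. \<forall>x\<in>ell2 I. ell2_norm I (S x) \<le> C * ell2_norm I x" using S0 by (auto simp: S_def)
  qed (auto simp: S_def S0_def ell2_add ell2_scale ell2_inner_add ell2_inner_scale TD fun_eq_iff)
  moreover have "ell2_inner I (T x) y = ell2_inner I x (S y)" if x: "x \<in> ell2 I" and y: "y \<in> ell2 I" for x y
  proof -
    have "ell2_inner I y (T x) - ell2_inner I (S0 y) x = 0"
    proof (rule ell2_functional_zero[where f="\<lambda>x. ell2_inner I y (T x) - ell2_inner I (S0 y) x"
          and C="ell2_norm I y * C + ell2_norm I (S0 y)", OF _ _ _ _ x])
      fix x assume x: "x \<in> ell2 I"
      have "cmod (ell2_inner I y (T x) - ell2_inner I (S0 y) x) \<le>
          cmod (ell2_inner I y (T x)) + cmod (ell2_inner I (S0 y) x)" by (rule norm_triangle_ineq4)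
      also have "\<dots> \<le> ell2_norm I y * C * ell2_norm I x + ell2_norm I (S0 y) * ell2_norm I x"
        by (intro add_mono fbound ell2_inner_summable x y S0)
      finally show "cmod (ell2_inner I y (T x) - ell2_inner I (S0 y) x) \<le>
          (ell2_norm I y * C + ell2_norm I (S0 y)) * ell2_norm I x" by (simp add: distrib_right)
    next
      fix k assume k: "k \<in> I"
      show "ell2_inner I y (T (ell2_unit k)) - ell2_inner I (S0 y) (ell2_unit k) = 0"
        using k ell2_inner_cnj[of I y] by (simp add: S0_def)
    qed (use y S0 in \<open>simp_all add: fadd fscale ell2_inner_add ell2_inner_scale algebra_simps\<close>)
    then have "cnj (ell2_inner I y (T x)) = cnj (ell2_inner I (S0 y) x)" by simp
    then show ?thesis using y by (simp add: S_def flip: ell2_inner_cnj)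
  qed
  ultimately show ?thesis by blast
qed

lemma adjoint_unique:
  assumes S: "S \<in> bounded_operators I" "S' \<in> bounded_operators I"
    and "\<forall>x\<in>ell2 I. \<forall>y\<in>ell2 I. ell2_inner I (T x) y = ell2_inner I x (S y)"
    and "\<forall>x\<in>ell2 I. \<forall>y\<in>ell2 I. ell2_inner I (T x) y = ell2_inner I x (S' y)"
  shows "S = S'"
proof (rule bounded_operators_eqI[OF S])
  fix k assume k: "k \<in> I"
  have "S (ell2_unit k) i = S' (ell2_unit k) i" for i
  proof (cases "i \<in> I")
    case True
    then show ?thesis using assms(3,4) k by (metis ell2_inner_unit ell2_unit_in)
  next
    case False
    then show ?thesis using bounded_operatorsD(1)[OF S(1)] bounded_operatorsD(1)[OF S(2)] k
      by (metis (mono_tags, lifting) ell2_def ell2_unit_in mem_Collect_eq)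
  qed
  then show "S (ell2_unit k) = S' (ell2_unit k)" by auto
qed

lemma adjoint_oper:
  assumes T: "T \<in> bounded_operators I"
  shows "adjoint_oper I T \<in> bounded_operators I"
    "x \<in> ell2 I \<Longrightarrow> y \<in> ell2 I \<Longrightarrow> ell2_inner I (T x) y = ell2_inner I x (adjoint_oper I T y)"
proof -
  let ?P = "\<lambda>S. S \<in> bounded_operators I \<and> (\<forall>x\<in>ell2 I. \<forall>y\<in>ell2 I. ell2_inner I (T x) y = ell2_inner I x (S y))"
  have "\<exists>!S. ?P S" using adjoint_exists[OF T] adjoint_unique by blast
  then have "?P (adjoint_oper I T)" unfolding adjoint_oper_def by (rule theI')
  then show "adjoint_oper I T \<in> bounded_operators I"
    "x \<in> ell2 I \<Longrightarrow> y \<in> ell2 I \<Longrightarrow> ell2_inner I (T x) y = ell2_inner I x (adjoint_oper I T y)" by auto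
qed

lemma adjoint_operI:
  assumes "T \<in> bounded_operators I" "S \<in> bounded_operators I"
    and "\<And>x y. x \<in> ell2 I \<Longrightarrow> y \<in> ell2 I \<Longrightarrow> ell2_inner I (T x) y = ell2_inner I x (S y)"
  shows "adjoint_oper I T = S"
  using adjoint_unique[of "adjoint_oper I T" I S T] adjoint_oper[OF assms(1)] assms by blast

text \<open>Every set lies in its bicommutant and commutants reverse inclusions; applying the first
  fact to \<open>S\<close> and to its commutant gives the two inclusions. Thus a commutant satisfies
  the bicommutant condition formally.\<close>

lemma commutant_commutant_commutant:
  assumes "S \<subseteq> bounded_operators I"
  shows "commutant I (commutant I (commutant I S)) = commutant I S"
proof -
  have "S \<subseteq> commutant I (commutant I S)" using assms by (auto simp: commutant_def)
  moreover have "commutant I S \<subseteq> commutant I (commutant I (commutant I S))" by (auto simp: commutant_def)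
  ultimately show ?thesis by (auto simp: commutant_def)
qed

section \<open>Permutation operators\<close>

definition perm_oper :: "'i set \<Rightarrow> ('i \<Rightarrow> 'i) \<Rightarrow> 'i oper" where
  "perm_oper I p = (\<lambda>x\<in>ell2 I. \<lambda>i. if i \<in> I then x (p i) else 0)"

lemma perm_oper_ell2:
  assumes p: "bij_betw p I I" and x: "x \<in> ell2 I"
  shows "perm_oper I p x \<in> ell2 I" "ell2_norm I (perm_oper I p x) = ell2_norm I x"
proof -
  have s: "(\<lambda>i. (cmod (x i))\<^sup>2) summable_on I" using x by (auto simp: ell2_def)
  have s2: "(\<lambda>i. (cmod (x (p i)))\<^sup>2) summable_on I"
    using summable_on_reindex_bij_betw[OF p, of "\<lambda>i. (cmod (x i))\<^sup>2"] s by simp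
  have "(\<lambda>i. (cmod (perm_oper I p x i))\<^sup>2) summable_on I"
    using s2 x by (subst summable_on_cong[where g="\<lambda>i. (cmod (x (p i)))\<^sup>2"]) (auto simp: perm_oper_def)
  then show "perm_oper I p x \<in> ell2 I" using x by (auto simp: ell2_def perm_oper_def)
  have "(\<Sum>\<^sub>\<infinity>i\<in>I. (cmod (perm_oper I p x i))\<^sup>2) = (\<Sum>\<^sub>\<infinity>i\<in>I. (cmod (x (p i)))\<^sup>2)"
    using x by (intro infsum_cong) (auto simp: perm_oper_def)
  also have "\<dots> = (\<Sum>\<^sub>\<infinity>i\<in>I. (cmod (x i))\<^sup>2)"
    using infsum_reindex_bij_betw[OF p, of "\<lambda>i. (cmod (x i))\<^sup>2"] by simp
  finally show "ell2_norm I (perm_oper I p x) = ell2_norm I x" by (simp add: ell2_norm_def)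
qed

lemma perm_oper_bounded:
  assumes p: "bij_betw p I I"
  shows "perm_oper I p \<in> bounded_operators I"
  unfolding bounded_operators_def
proof (intro CollectI conjI ballI allI)
  show "perm_oper I p \<in> ell2 I \<rightarrow>\<^sub>E ell2 I"
    using perm_oper_ell2[OF p] by (auto simp: perm_oper_def)
  show "\<exists>C. \<forall>x\<in>ell2 I. ell2_norm I (perm_oper I p x) \<le> C * ell2_norm I x"
    using perm_oper_ell2[OF p] by (intro exI[of _ 1]) auto
qed (auto simp: perm_oper_def ell2_add ell2_scale)

text \<open>\<open>perm_oper I p\<close> is the pullback along \<open>p\<close>, hence
  contravariant: the two permutations appear in reversed order.\<close>

lemma perm_oper_compose:
  assumes "bij_betw p I I" "bij_betw q I I"
  shows "compose (ell2 I) (perm_oper I p) (perm_oper I q) = perm_oper I (q \<circ> p)"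
  using perm_oper_ell2[OF assms(2)] bij_betwE[OF assms(1)] by (auto simp: compose_def perm_oper_def fun_eq_iff)

lemma perm_oper_inner:
  assumes p: "bij_betw p I I" and q: "\<And>i. i \<in> I \<Longrightarrow> q i \<in> I" "\<And>i. i \<in> I \<Longrightarrow> q (p i) = i"
    and x: "x \<in> ell2 I" "y \<in> ell2 I"
  shows "ell2_inner I (perm_oper I p x) y = ell2_inner I x (perm_oper I q y)"
proof -
  have "ell2_inner I (perm_oper I p x) y = (\<Sum>\<^sub>\<infinity>i\<in>I. cnj (x (p i)) * y (q (p i)))"
    unfolding ell2_inner_def using x q by (intro infsum_cong) (auto simp: perm_oper_def)
  also have "\<dots> = (\<Sum>\<^sub>\<infinity>i\<in>I. cnj (x i) * y (q i))"
    using infsum_reindex_bij_betw[OF p, of "\<lambda>i. cnj (x i) * y (q i)"] by simp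
  also have "\<dots> = ell2_inner I x (perm_oper I q y)"
    unfolding ell2_inner_def using x by (intro infsum_cong) (auto simp: perm_oper_def)
  finally show ?thesis .
qed

lemma perm_oper_cong: "(\<And>i. i \<in> I \<Longrightarrow> p i = q i) \<Longrightarrow> perm_oper I p = perm_oper I q"
  by (auto simp: perm_oper_def fun_eq_iff)

lemma perm_oper_id: "perm_oper I (\<lambda>i. i) = oper_id I"
  by (auto simp: perm_oper_def oper_id_def ell2_def fun_eq_iff restrict_def)

lemma perm_oper_unit:
  assumes "bij_betw p I I" "k \<in> I"
  shows "perm_oper I p (ell2_unit (p k)) = ell2_unit k"
  using assms bij_betwE[OF assms(1)] by (auto simp: perm_oper_def ell2_unit_eq fun_eq_iff bij_betw_def inj_on_eq_iff)

section \<open>The von Neumann algebra of a countable group\<close>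

locale discrete_group = group G for G :: "nat monoid" (structure)
begin

abbreviation (input) I where "I \<equiv> carrier G"

text \<open>With the pullback convention, \<open>rt h\<close> sends the unit vector at
  \<open>k\<close> to the one at \<open>k \<otimes> inv h\<close>; the inverse in \<open>lt\<close>
  makes \<open>lt g\<close> send the unit vector at \<open>k\<close> to the one at
  \<open>g \<otimes> k\<close>.\<close>

definition rt where "rt h = perm_oper I (\<lambda>i. i \<otimes> h)"
definition lt where "lt g = perm_oper I (\<lambda>i. inv g \<otimes> i)"
text \<open>The group von Neumann algebra, classically the bicommutant of the left translations.
  Taken as the commutant of the right translations, it satisfies the bicommutant condition by a
  formal argument.\<close>

definition VN where "VN = commutant I (rt ` I)"

lemma bij_rt: "h \<in> I \<Longrightarrow> bij_betw (\<lambda>i. i \<otimes> h) I I"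
  by (rule bij_betwI[where g="\<lambda>i. i \<otimes> inv h"]) (auto simp: m_assoc)

lemma bij_lt: "g \<in> I \<Longrightarrow> bij_betw (\<lambda>i. inv g \<otimes> i) I I"
  by (rule bij_betwI[where g="\<lambda>i. g \<otimes> i"]) (auto simp flip: m_assoc)

lemma rt_bounded: "h \<in> I \<Longrightarrow> rt h \<in> bounded_operators I"
  unfolding rt_def by (rule perm_oper_bounded[OF bij_rt])

lemma lt_bounded: "h \<in> I \<Longrightarrow> lt h \<in> bounded_operators I"
  unfolding lt_def by (rule perm_oper_bounded[OF bij_lt])

lemma rt_inner:
  assumes "h \<in> I" "x \<in> ell2 I" "y \<in> ell2 I"
  shows "ell2_inner I (rt h x) y = ell2_inner I x (rt (inv h) y)"
  unfolding rt_def by (rule perm_oper_inner[OF bij_rt]) (use assms in \<open>auto simp: m_assoc\<close>)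

lemma lt_inner:
  assumes "h \<in> I" "x \<in> ell2 I" "y \<in> ell2 I"
  shows "ell2_inner I (lt h x) y = ell2_inner I x (lt (inv h) y)"
  unfolding lt_def by (rule perm_oper_inner[OF bij_lt]) (use assms in \<open>auto simp flip: m_assoc\<close>)

lemma lt_rt: "g \<in> I \<Longrightarrow> h \<in> I \<Longrightarrow> compose (ell2 I) (lt g) (rt h) = compose (ell2 I) (rt h) (lt g)"
  unfolding lt_def rt_def
  by (simp add: perm_oper_compose bij_lt bij_rt) (intro perm_oper_cong, simp add: m_assoc)

lemma lt_VN: "g \<in> I \<Longrightarrow> lt g \<in> VN"
  using lt_rt lt_bounded by (auto simp: VN_def commutant_def)

lemma lt_mult: "g \<in> I \<Longrightarrow> h \<in> I \<Longrightarrow> compose (ell2 I) (lt g) (lt h) = lt (g \<otimes> h)"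
  unfolding lt_def by (simp add: perm_oper_compose bij_lt) (intro perm_oper_cong, simp add: m_assoc inv_mult_group)

lemma lt_one: "lt \<one> = oper_id I"
  unfolding lt_def perm_oper_id[symmetric] by (intro perm_oper_cong) simp

lemma lt_adjoint: "g \<in> I \<Longrightarrow> adjoint_oper I (lt g) = lt (inv g)"
  by (rule adjoint_operI) (auto simp: lt_bounded lt_inner)

lemma lt_unit: "g \<in> I \<Longrightarrow> k \<in> I \<Longrightarrow> lt g (ell2_unit k) = ell2_unit (g \<otimes> k)"
  unfolding lt_def using perm_oper_unit[OF bij_lt, of g "g \<otimes> k"] by (simp flip: m_assoc)

lemma rt_unit: "h \<in> I \<Longrightarrow> k \<in> I \<Longrightarrow> rt h (ell2_unit k) = ell2_unit (k \<otimes> inv h)"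
  unfolding rt_def using perm_oper_unit[OF bij_rt, of h "k \<otimes> inv h"] by (simp add: m_assoc)

lemma VN_bounded: "T \<in> VN \<Longrightarrow> T \<in> bounded_operators I"
  by (auto simp: VN_def commutant_def)

lemma VN_rt: "T \<in> VN \<Longrightarrow> h \<in> I \<Longrightarrow> x \<in> ell2 I \<Longrightarrow> T (rt h x) = rt h (T x)"
  unfolding VN_def commutant_def by (auto simp: compose_def dest!: fun_cong[of _ _ x])

lemma VN_I:
  assumes "T \<in> bounded_operators I" "\<And>h x. h \<in> I \<Longrightarrow> x \<in> ell2 I \<Longrightarrow> T (rt h x) = rt h (T x)"
  shows "T \<in> VN"
  using assms unfolding VN_def commutant_def by (auto simp: compose_def)

text \<open>The unit vector at \<open>\<one>\<close> is separating: right translations carry it to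
  every unit vector, and the elements of \<open>VN\<close> commute with them.\<close>

lemma VN_determined:
  assumes "T \<in> VN" "S \<in> VN" "T (ell2_unit \<one>) = S (ell2_unit \<one>)"
  shows "T = S"
proof (rule bounded_operators_eqI)
  fix k assume k: "k \<in> I"
  have "ell2_unit k = rt (inv k) (ell2_unit \<one>)" using k by (simp add: rt_unit)
  then show "T (ell2_unit k) = S (ell2_unit k)"
    using assms k by (simp add: VN_rt)
qed (use assms VN_bounded in auto)

text \<open>The adjoint of \<open>rt h\<close> is \<open>rt (inv h)\<close>, again a right
  translation, so commutation can be moved across the inner product and checked coordinate by
  coordinate.\<close>

lemma VN_adjoint:
  assumes T: "T \<in> VN" shows "adjoint_oper I T \<in> VN"
proof (rule VN_I)
  note b = VN_bounded[OF T] and a = adjoint_oper[OF VN_bounded[OF T]]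
  note aD = bounded_operatorsD(1)[OF a(1)] and bD = bounded_operatorsD(1)[OF b]
  show "adjoint_oper I T \<in> bounded_operators I" by (rule a)
  fix h x assume h: "h \<in> I" and x: "x \<in> ell2 I"
  note rtD = bounded_operatorsD(1)[OF rt_bounded]
  show "adjoint_oper I T (rt h x) = rt h (adjoint_oper I T x)"
  proof
    fix i
    show "adjoint_oper I T (rt h x) i = rt h (adjoint_oper I T x) i"
    proof (cases "i \<in> I")
      case True
      let ?e = "ell2_unit i"
      have e: "?e \<in> ell2 I" using True by simp
      have "adjoint_oper I T (rt h x) i = ell2_inner I ?e (adjoint_oper I T (rt h x))" using True by simp
      also have "\<dots> = ell2_inner I (T ?e) (rt h x)" using a(2) e rtD h x by simp
      also have "\<dots> = ell2_inner I (rt (inv h) (T ?e)) x"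
        using rt_inner[of "inv h" "T ?e" x] h x bD e by simp
      also have "\<dots> = ell2_inner I (T (rt (inv h) ?e)) x" using VN_rt[OF T, of "inv h" ?e] h e by simp
      also have "\<dots> = ell2_inner I (rt (inv h) ?e) (adjoint_oper I T x)" using a(2) e rtD h x by simp
      also have "\<dots> = ell2_inner I ?e (rt h (adjoint_oper I T x))"
        using rt_inner[of "inv h" ?e "adjoint_oper I T x"] h x e aD by simp
      also have "\<dots> = rt h (adjoint_oper I T x) i" using True by simp
      finally show ?thesis .
    next
      case False
      have "adjoint_oper I T (rt h x) \<in> ell2 I" "rt h (adjoint_oper I T x) \<in> ell2 I"
        using aD rtD h x by auto
      then show ?thesis using False by (auto simp: ell2_def)
    qed
  qed
qed

lemma VN_von_neumann: "von_neumann_algebra I VN"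
  unfolding von_neumann_algebra_def
proof (intro conjI ballI)
  show "commutant I (commutant I VN) = VN"
    unfolding VN_def using rt_bounded by (intro commutant_commutant_commutant) auto
qed (use VN_bounded VN_adjoint in auto)

text \<open>The vector state at the unit vector of \<open>\<one>\<close> is a trace. In coordinates,
  the adjoint has at \<open>g\<close> the conjugate of the entry of \<open>T\<close> at
  \<open>inv g\<close>, and inversion only permutes the index set.\<close>

lemma VN_tracial:
  assumes T: "T \<in> VN"
  shows "ell2_norm I (adjoint_oper I T (ell2_unit \<one>)) = ell2_norm I (T (ell2_unit \<one>))"
proof -
  let ?e = "ell2_unit \<one>"
  note b = VN_bounded[OF T] and a = adjoint_oper[OF VN_bounded[OF T]]
  have "adjoint_oper I T ?e g = cnj (T ?e (inv g))" if g: "g \<in> I" for g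
  proof -
    have "adjoint_oper I T ?e g = ell2_inner I (ell2_unit g) (adjoint_oper I T ?e)" using g by simp
    also have "\<dots> = ell2_inner I (T (ell2_unit g)) ?e" using a(2)[of "ell2_unit g" ?e] g
      by (simp del: ell2_inner_unit ell2_inner_unit_right)
    also have "T (ell2_unit g) = rt (inv g) (T ?e)"
      using VN_rt[OF T, of "inv g" ?e] g by (simp add: rt_unit)
    also have "ell2_inner I (rt (inv g) (T ?e)) ?e = ell2_inner I (T ?e) (rt g ?e)"
      using rt_inner[of "inv g" "T ?e" ?e] g bounded_operatorsD(1)[OF b] by simp
    also have "\<dots> = cnj (T ?e (inv g))" using g by (simp add: rt_unit)
    finally show ?thesis .
  qed
  then have "(\<Sum>\<^sub>\<infinity>i\<in>I. (cmod (adjoint_oper I T ?e i))\<^sup>2) = (\<Sum>\<^sub>\<infinity>i\<in>I. (cmod (T ?e (inv i)))\<^sup>2)"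
    by (intro infsum_cong) simp
  also have "\<dots> = (\<Sum>\<^sub>\<infinity>i\<in>I. (cmod (T ?e i))\<^sup>2)"
  proof -
    have "bij_betw (\<lambda>i. inv i) I I" by (rule bij_betwI[where g="\<lambda>i. inv i"]) auto
    from infsum_reindex_bij_betw[OF this, of "\<lambda>i. (cmod (T ?e i))\<^sup>2"] show ?thesis by simp
  qed
  finally show ?thesis by (simp add: ell2_norm_def)
qed

text \<open>Let \<open>A\<close> be the adjoint of an isometry \<open>V\<close> and \<open>e\<close>
  the unit vector at \<open>\<one>\<close>. By traciality \<open>A e\<close> has the norm of
  \<open>V e\<close>, which is 1. So \<open>w = V (A e)\<close> has norm 1 and inner product 1 with
  \<open>e\<close>, which forces \<open>w = e\<close>; as \<open>e\<close> is separating,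
  \<open>V\<close> composed with \<open>A\<close> is the identity.\<close>

lemma VN_finite: "finite_von_neumann_algebra I VN"
  unfolding finite_von_neumann_algebra_def
proof (intro conjI ballI impI VN_von_neumann)
  fix V assume V: "V \<in> VN" and iso: "compose (ell2 I) (adjoint_oper I V) V = oper_id I"
  let ?e = "ell2_unit \<one>" and ?A = "adjoint_oper I V"
  have e: "?e \<in> ell2 I" by simp
  note A = VN_adjoint[OF V]
  note VD = bounded_operatorsD[OF VN_bounded[OF V]] and AD = bounded_operatorsD[OF VN_bounded[OF A]]
  note adj = adjoint_oper(2)[OF VN_bounded[OF V]]
  have AV: "?A (V x) = x" if "x \<in> ell2 I" for x
    using fun_cong[OF iso, of x] that by (simp add: compose_def oper_id_def)
  have nV: "ell2_norm I (V x) = ell2_norm I x" if x: "x \<in> ell2 I" for x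
  proof -
    have "ell2_inner I (V x) (V x) = ell2_inner I x x" using adj[of x "V x"] x VD AV by simp
    then have "complex_of_real ((ell2_norm I (V x))\<^sup>2) = complex_of_real ((ell2_norm I x)\<^sup>2)"
      using ell2_inner_self[of x I] ell2_inner_self[of "V x" I] x VD(1) by simp
    then have "(ell2_norm I (V x))\<^sup>2 = (ell2_norm I x)\<^sup>2" by (simp only: of_real_eq_iff)
    then show ?thesis by simp
  qed
  define w where "w = V (?A ?e)"
  have w: "w \<in> ell2 I" using e AD(1) VD(1) by (simp add: w_def)
  have nw: "ell2_norm I w = 1" "ell2_norm I (?A ?e) = 1"
    using nV[of "?A ?e"] nV[of ?e] AD(1) e VN_tracial[OF V] by (auto simp: w_def)
  have "ell2_inner I w ?e = ell2_inner I (?A ?e) (?A ?e)"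
    unfolding w_def using adj[of "?A ?e" ?e] AD(1) e by simp
  also have "\<dots> = 1" using ell2_inner_self[of "?A ?e" I] AD(1) e nw by simp
  finally have i1: "ell2_inner I w ?e = 1" .
  have i2: "ell2_inner I ?e w = 1" using ell2_inner_cnj[of I ?e w] i1 by simp
  have d: "(\<lambda>i. w i - ?e i) \<in> ell2 I" using w e ell2_diff by blast
  have "ell2_inner I (\<lambda>i. w i - ?e i) (\<lambda>i. w i - ?e i) =
      ell2_inner I w w - ell2_inner I w ?e - (ell2_inner I ?e w - ell2_inner I ?e ?e)"
    using w e d by (simp add: ell2_inner_diff del: ell2_inner_unit ell2_inner_unit_right)
  also have "\<dots> = 0" using i1 i2 ell2_inner_self[OF w] ell2_inner_self[OF e] nw
    by (simp del: ell2_inner_unit ell2_inner_unit_right)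
  finally have "(\<lambda>i. w i - ?e i) = (\<lambda>i. 0)"
    using ell2_inner_self[OF d] ell2_norm_eq_0[OF d] by simp
  then have we: "w = ?e" by (auto simp: fun_eq_iff)
  have VA: "compose (ell2 I) V ?A \<in> VN"
  proof (rule VN_I)
    obtain C where C: "C \<ge> 0" "\<forall>x\<in>ell2 I. ell2_norm I (?A x) \<le> C * ell2_norm I x" using AD(5) by blast
    show "compose (ell2 I) V ?A \<in> bounded_operators I"
      unfolding bounded_operators_def
      using VD(1-3) AD(1-3) nV C by (auto simp: compose_def ell2_add ell2_scale)
    fix h x assume "h \<in> I" "x \<in> ell2 I"
    then show "compose (ell2 I) V ?A (rt h x) = rt h (compose (ell2 I) V ?A x)"
      using VN_rt[OF V] VN_rt[OF A] AD(1) bounded_operatorsD(1)[OF rt_bounded, of h x]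
      by (simp add: compose_def)
  qed
  have "oper_id I \<in> VN" using lt_VN[of \<one>] lt_one by simp
  from VN_determined[OF VA this] show "compose (ell2 I) V ?A = oper_id I"
    using we e by (simp add: compose_def oper_id_def w_def)
qed

end

section \<open>The group inside its unitary group, with the strong topology\<close>

lemma topspace_ell2 [simp]: "topspace (ell2_topology I) = ell2 I"
  unfolding ell2_topology_def by (rule Metric_space.topspace_mtopology[OF Metric_space_ell2])

text \<open>The coordinate at \<open>g\<close> alone contributes 1. This separation makes the left
  translations both discrete and closed.\<close>

lemma ell2_unit_dist:
  assumes "g \<in> I" "h \<in> I" "g \<noteq> h" shows "1 \<le> ell2_norm I (\<lambda>i. ell2_unit g i - ell2_unit h i)"
  using ell2_component_le[OF ell2_diff[OF ell2_unit_in[OF assms(1)] ell2_unit_in[OF assms(2)]], of g] assms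
  by (simp add: ell2_unit_eq)

text \<open>A point is within 1/2 of at most one unit vector. If there is one, it is the nearest,
  and its distance is the radius of a ball that contains no unit vector; otherwise 1/2 is such a
  radius.\<close>

lemma closedin_ell2_units: "closedin (ell2_topology I) (ell2_unit ` I)"
proof -
  interpret Metric_space "ell2 I" "\<lambda>x y. ell2_norm I (\<lambda>i. x i - y i)" by (rule Metric_space_ell2)
  let ?d = "\<lambda>x y. ell2_norm I (\<lambda>i. x i - y i)"
  have "\<exists>r>0. disjnt (ell2_unit ` I) (mball v r)" if v: "v \<in> ell2 I" "v \<notin> ell2_unit ` I" for v
  proof (cases "\<exists>g\<in>I. ?d v (ell2_unit g) < 1/2")
    case True
    then obtain g where g: "g \<in> I" "?d v (ell2_unit g) < 1/2" by blast
    have pos: "0 < ?d v (ell2_unit g)" using v g mdist_pos_eq[of v "ell2_unit g"] by auto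
    have "?d v (ell2_unit g) \<le> ?d v (ell2_unit h)" if h: "h \<in> I" for h
    proof (cases "h = g")
      case False
      have "1 \<le> ?d (ell2_unit g) (ell2_unit h)" using ell2_unit_dist g h False by metis
      also have "\<dots> \<le> ?d (ell2_unit g) v + ?d v (ell2_unit h)" using g h v by (intro triangle) auto
      finally show ?thesis using g(2) commute[of v "ell2_unit g"] by linarith
    qed simp
    then have "disjnt (ell2_unit ` I) (mball v (?d v (ell2_unit g)))"
      unfolding disjnt_def by (fastforce simp: not_less)
    then show ?thesis using pos by blast
  next
    case False
    then have "disjnt (ell2_unit ` I) (mball v (1/2))" unfolding disjnt_def by auto
    then show ?thesis by (intro exI[of _ "1/2"]) auto
  qed
  then show ?thesis unfolding ell2_topology_def closedin_metric by auto
qed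

lemma homeomorphic_map_discrete:
  assumes "bij_betw f A B"
  shows "homeomorphic_map (discrete_topology A) (discrete_topology B) f"
  using assms by (intro bijective_open_imp_homeomorphic_map)
    (auto simp: bij_betw_def open_map_def)

definition transport_group :: "('a \<Rightarrow> 'b) \<Rightarrow> 'a monoid \<Rightarrow> 'b monoid" where
  "transport_group f G = \<lparr>carrier = f ` carrier G,
     mult = (\<lambda>x y. f (inv_into (carrier G) f x \<otimes>\<^bsub>G\<^esub> inv_into (carrier G) f y)), one = f \<one>\<^bsub>G\<^esub>\<rparr>"

lemma transport_group:
  assumes G: "group G" and f: "inj_on f (carrier G)"
  shows "group (transport_group f G)" "f \<in> iso G (transport_group f G)"
    "carrier (transport_group f G) = f ` carrier G"
proof -
  interpret group G by fact
  show "group (transport_group f G)"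
  proof (rule groupI)
    fix x assume "x \<in> carrier (transport_group f G)"
    then obtain g where "g \<in> carrier G" "x = f g" by (auto simp: transport_group_def)
    then show "\<exists>y\<in>carrier (transport_group f G). y \<otimes>\<^bsub>transport_group f G\<^esub> x = \<one>\<^bsub>transport_group f G\<^esub>"
      using f by (intro bexI[of _ "f (inv\<^bsub>G\<^esub> g)"]) (auto simp: transport_group_def)
  qed (use f in \<open>auto simp: transport_group_def m_assoc\<close>)
  show "f \<in> iso G (transport_group f G)"
    using f by (auto simp: iso_def hom_def bij_betw_def transport_group_def)
qed (simp add: transport_group_def)

context discrete_group
begin

abbreviation (input) U where "U \<equiv> unitary_group I VN"

lemma lt_U: "g \<in> I \<Longrightarrow> lt g \<in> carrier U"
  using lt_VN lt_adjoint lt_mult lt_one by (auto simp: unitary_group_def)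

lemma lt_inj: "inj_on lt I"
proof (rule inj_onI)
  fix g h assume gh: "g \<in> I" "h \<in> I" "lt g = lt h"
  then have "ell2_unit g = ell2_unit h" using lt_unit[of g \<one>] lt_unit[of h \<one>] by simp
  then have "ell2_unit g g = ell2_unit h g" by simp
  then show "g = h" by (simp add: ell2_unit_eq split: if_splits)
qed

lemma U_ext: "V \<in> carrier U \<Longrightarrow> V \<in> ell2 I \<rightarrow>\<^sub>E ell2 I"
  using VN_bounded by (auto simp: unitary_group_def bounded_operators_def)

text \<open>A competing inverse \<open>y\<close> is determined by evaluating the identity for
  \<open>y\<close> composed with \<open>lt g\<close> at \<open>lt (inv g) x\<close>; off
  \<open>ell2 I\<close> both operators are \<open>undefined\<close>.\<close>

lemma lt_inv: "g \<in> I \<Longrightarrow> inv\<^bsub>U\<^esub> (lt g) = lt (inv g)"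
  unfolding m_inv_def[of U]
proof (rule the_equality)
  assume g: "g \<in> I"
  have c: "compose (ell2 I) (lt g) (lt (inv g)) = oper_id I" "compose (ell2 I) (lt (inv g)) (lt g) = oper_id I"
    using g by (auto simp: lt_mult lt_one)
  show "lt (inv g) \<in> carrier U \<and> lt g \<otimes>\<^bsub>U\<^esub> lt (inv g) = \<one>\<^bsub>U\<^esub> \<and> lt (inv g) \<otimes>\<^bsub>U\<^esub> lt g = \<one>\<^bsub>U\<^esub>"
    using c lt_U g by (auto simp: unitary_group_def)
  fix y assume y: "y \<in> carrier U \<and> lt g \<otimes>\<^bsub>U\<^esub> y = \<one>\<^bsub>U\<^esub> \<and> y \<otimes>\<^bsub>U\<^esub> lt g = \<one>\<^bsub>U\<^esub>"
  then have yc: "compose (ell2 I) y (lt g) = oper_id I" by (simp add: unitary_group_def)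
  show "y = lt (inv g)"
  proof
    fix x show "y x = lt (inv g) x"
    proof (cases "x \<in> ell2 I")
      case True
      then have l: "lt (inv g) x \<in> ell2 I" using U_ext[OF lt_U[of "inv g"]] g by auto
      have "lt g (lt (inv g) x) = x" using fun_cong[OF c(1), of x] True by (simp add: compose_def oper_id_def)
      then show ?thesis using fun_cong[OF yc, of "lt (inv g) x"] l by (simp add: compose_def oper_id_def)
    next
      case False
      then show ?thesis using U_ext[of y] y U_ext[OF lt_U[of "inv g"]] g PiE_arb by (metis inv_closed)
    qed
  qed
qed

lemma lt_iso: "lt \<in> iso G (U\<lparr>carrier := lt ` I\<rparr>)"
  using lt_inj lt_mult by (auto simp: iso_def hom_def bij_betw_def unitary_group_def)

lemma lt_subgroup: "subgroup (lt ` I) U"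
proof
  show "lt ` I \<subseteq> carrier U" using lt_U by auto
  show "\<one>\<^bsub>U\<^esub> \<in> lt ` I" using lt_one[symmetric] by (auto simp: unitary_group_def)
qed (auto simp: lt_inv, auto simp: unitary_group_def lt_mult)

lemma continuous_map_eval:
  "x \<in> ell2 I \<Longrightarrow> continuous_map (strong_topology I) (ell2_topology I) (\<lambda>T. T x)"
  unfolding strong_topology_def by (rule continuous_map_product_projection)

lemma topspace_strong: "topspace (strong_topology I) = ell2 I \<rightarrow>\<^sub>E ell2 I"
  by (simp add: strong_topology_def)

text \<open>Since the unit vector at \<open>\<one>\<close> is separating, the left translations are
  exactly the unitaries of \<open>VN\<close> that send it to a unit vector, and evaluation at a
  vector is continuous.\<close>

lemma lt_closed: "closedin (subtopology (strong_topology I) (carrier U)) (lt ` I)"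
proof -
  have "continuous_map (subtopology (strong_topology I) (carrier U)) (ell2_topology I) (\<lambda>T. T (ell2_unit \<one>))"
    by (rule continuous_map_from_subtopology[OF continuous_map_eval]) simp
  from closedin_continuous_map_preimage[OF this closedin_ell2_units]
  have "closedin (subtopology (strong_topology I) (carrier U))
    {T \<in> topspace (subtopology (strong_topology I) (carrier U)). T (ell2_unit \<one>) \<in> ell2_unit ` I}" .
  also have "{T \<in> topspace (subtopology (strong_topology I) (carrier U)). T (ell2_unit \<one>) \<in> ell2_unit ` I} = lt ` I"
    (is "?L = ?R")
  proof
    show "?R \<subseteq> ?L" using lt_U U_ext by (auto simp: topspace_strong lt_unit)
    show "?L \<subseteq> ?R"
    proof
      fix T assume "T \<in> ?L"
      then obtain g where g: "g \<in> I" "T (ell2_unit \<one>) = ell2_unit g" and T: "T \<in> VN"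
        by (auto simp: unitary_group_def)
      have "T = lt g" by (rule VN_determined[OF T lt_VN[OF g(1)]]) (use g in \<open>simp add: lt_unit\<close>)
      then show "T \<in> ?R" using g by auto
    qed
  qed
  finally show ?thesis .
qed

text \<open>Evaluation at the unit vector of \<open>\<one>\<close> is continuous, and the open ball
  of radius 1 about a unit vector contains no other one.\<close>

lemma lt_discrete: "subtopology (strong_topology I) (lt ` I) = discrete_topology (lt ` I)"
proof -
  interpret MS: Metric_space "ell2 I" "\<lambda>x y. ell2_norm I (\<lambda>i. x i - y i)" by (rule Metric_space_ell2)
  have sub: "lt ` I \<subseteq> ell2 I \<rightarrow>\<^sub>E ell2 I" using lt_U U_ext by auto
  have "openin (subtopology (strong_topology I) (lt ` I)) {lt g}" if g: "g \<in> I" for g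
  proof -
    have "continuous_map (subtopology (strong_topology I) (lt ` I)) (ell2_topology I) (\<lambda>T. T (ell2_unit \<one>))"
      by (rule continuous_map_from_subtopology[OF continuous_map_eval]) simp
    moreover have "openin (ell2_topology I) (MS.mball (ell2_unit g) 1)"
      unfolding ell2_topology_def by (rule MS.openin_mball)
    ultimately have "openin (subtopology (strong_topology I) (lt ` I))
      {T \<in> topspace (subtopology (strong_topology I) (lt ` I)). T (ell2_unit \<one>) \<in> MS.mball (ell2_unit g) 1}"
      by (rule openin_continuous_map_preimage)
    also have "{T \<in> topspace (subtopology (strong_topology I) (lt ` I)). T (ell2_unit \<one>) \<in> MS.mball (ell2_unit g) 1} = {lt g}"
    proof -
      have "h = g" if "h \<in> I" "ell2_norm I (\<lambda>i. ell2_unit g i - ell2_unit h i) < 1" for h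
        using ell2_unit_dist[OF g that(1)] that(2) by fastforce
      note close = this
      show ?thesis
      proof (intro equalityI subsetI)
        fix T assume "T \<in> {T \<in> topspace (subtopology (strong_topology I) (lt ` I)). T (ell2_unit \<one>) \<in> MS.mball (ell2_unit g) 1}"
        then obtain h where "h \<in> I" "T = lt h" "lt h (ell2_unit \<one>) \<in> MS.mball (ell2_unit g) 1" by auto
        then show "T \<in> {lt g}" using close[of h] by (simp add: lt_unit)
      next
        fix T assume "T \<in> {lt g}"
        then show "T \<in> {T \<in> topspace (subtopology (strong_topology I) (lt ` I)). T (ell2_unit \<one>) \<in> MS.mball (ell2_unit g) 1}"
          using g sub by (simp add: topspace_strong lt_unit image_subset_iff)
      qed
    qed
    finally show ?thesis .
  qed
  then show ?thesis using sub by (subst eq_commute, subst discrete_topology_unique) (auto simp: topspace_strong)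
qed

end

lemma U_fin_group_discrete:
  fixes P :: "'p monoid"
  assumes P: "group P" and c: "countable (carrier P)"
  shows "U_fin_group P (discrete_topology (carrier P))"
proof -
  interpret P: group P by fact
  define f where "f = to_nat_on (carrier P)"
  have f: "inj_on f (carrier P)" unfolding f_def by (rule inj_on_to_nat_on[OF c])
  define G where "G = transport_group f P"
  interpret G: discrete_group G
    unfolding discrete_group_def G_def by (rule transport_group(1)[OF P f])
  have fiso: "f \<in> iso P G" and cG: "carrier G = f ` carrier P"
    unfolding G_def by (rule transport_group[OF P f])+
  let ?V = "(unitary_group (carrier G) G.VN)\<lparr>carrier := G.lt ` carrier G\<rparr>"
  have iso: "G.lt \<circ> f \<in> iso P ?V"
    by (rule Group.iso_set_trans[OF fiso G.lt_iso])
  have "bij_betw (G.lt \<circ> f) (carrier P) (G.lt ` carrier G)" using iso by (simp add: iso_def)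
  from homeomorphic_map_discrete[OF this]
  have hom: "homeomorphic_map (discrete_topology (carrier P)) (subtopology (strong_topology (carrier G)) (G.lt ` carrier G)) (G.lt \<circ> f)"
    by (simp only: G.lt_discrete)
  have prod: "prod_topology (discrete_topology (carrier P)) (discrete_topology (carrier P)) =
      discrete_topology (carrier P \<times> carrier P)"
    by (simp add: prod_topology_discrete_topology)
  have "polish_group P (discrete_topology (carrier P))"
    unfolding polish_group_def prod using P c
    by (auto simp: completely_metrizable_space_discrete_topology second_countable_discrete_topology)
  then show ?thesis
    unfolding U_fin_group_def using G.VN_finite G.lt_subgroup G.lt_closed iso hom by blast
qed

section \<open>Superrigidity for cocycles with values in a countable group\<close>

lemma sets_borel_of_discrete: "sets (borel_of (discrete_topology S)) = Pow S"
proof -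
  have "Collect (openin (discrete_topology S)) = Pow S" by auto
  then have "sets (borel_of (discrete_topology S)) = sigma_sets S (Pow S)"
    unfolding borel_of_def by (simp add: sets_measure_of)
  also have "\<dots> = Pow S" using sigma_sets_into_sp[of "Pow S" S] by auto
  finally show ?thesis .
qed

text \<open>Superrigidity is defined with targets carried by sets of reals. The target is copied
  into \<open>real\<close> with the discrete topology, for which every subset is Borel, and the
  untwisting is carried back along the isomorphism.\<close>

lemma superrigid_countable:
  fixes P :: "'p monoid"
  assumes sr: "U_fin_cocycle_superrigid K M \<alpha>" and P: "group P" "countable (carrier P)"
    and K: "countable (carrier K)" "\<And>k. k \<in> carrier K \<Longrightarrow> \<alpha> k \<in> M \<rightarrow>\<^sub>M M"
      "\<And>k h. k \<in> carrier K \<Longrightarrow> h \<in> carrier K \<Longrightarrow> k \<otimes>\<^bsub>K\<^esub> h \<in> carrier K"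
    and \<omega>: "\<And>k. k \<in> carrier K \<Longrightarrow> \<omega> k \<in> M \<rightarrow>\<^sub>M count_space (carrier P)"
    and coc: "\<And>g h. g \<in> carrier K \<Longrightarrow> h \<in> carrier K \<Longrightarrow> AE x in M. \<omega> (g \<otimes>\<^bsub>K\<^esub> h) x = \<omega> g (\<alpha> h x) \<otimes>\<^bsub>P\<^esub> \<omega> h x"
  obtains \<phi> \<delta> where "\<phi> \<in> M \<rightarrow>\<^sub>M count_space (carrier P)" "\<delta> \<in> hom K P"
    "\<And>k. k \<in> carrier K \<Longrightarrow> AE x in M. \<delta> k = \<phi> (\<alpha> k x) \<otimes>\<^bsub>P\<^esub> \<omega> k x \<otimes>\<^bsub>P\<^esub> inv\<^bsub>P\<^esub> (\<phi> x)"
proof -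
  interpret P: group P by fact
  define f :: "'p \<Rightarrow> real" where "f g = real (to_nat_on (carrier P) g)" for g
  have f: "inj_on f (carrier P)"
    using inj_on_to_nat_on[OF P(2)] by (auto simp: f_def inj_on_def)
  define Q where "Q = transport_group f P"
  have Q: "group Q" and fiso: "f \<in> iso P Q" and cQ: "carrier Q = f ` carrier P"
    unfolding Q_def by (rule transport_group[OF P(1) f])+
  interpret Q: group Q by (rule Q)
  interpret f: group_hom P Q f using fiso by unfold_locales (auto simp: iso_def)
  let ?T = "discrete_topology (carrier Q)"
  have cs: "sets (borel_of ?T) = sets (count_space (carrier Q))" by (simp add: sets_borel_of_discrete)
  have fin: "U_fin_group Q ?T" by (rule U_fin_group_discrete[OF Q]) (use P cQ in auto)
  have "is_cocycle K M \<alpha> Q ?T (\<lambda>k x. f (\<omega> k x))"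
    unfolding is_cocycle_def
  proof (intro conjI ballI)
    show "(\<lambda>(k, x). f (\<omega> k x)) \<in> count_space (carrier K) \<Otimes>\<^sub>M M \<rightarrow>\<^sub>M borel_of ?T"
      unfolding measurable_cong_sets[OF refl cs]
    proof (rule measurable_pair_measure_countable1[OF K(1)])
      fix k assume "k \<in> carrier K"
      from \<omega>[OF this] have "f \<circ> \<omega> k \<in> M \<rightarrow>\<^sub>M count_space (carrier Q)"
        by (rule measurable_comp) (simp add: cQ)
      then show "(\<lambda>y. case (k, y) of (k, x) \<Rightarrow> f (\<omega> k x)) \<in> M \<rightarrow>\<^sub>M count_space (carrier Q)" by (simp add: comp_def)
    qed
    fix g h assume gh: "g \<in> carrier K" "h \<in> carrier K"
    show "AE x in M. f (\<omega> (g \<otimes>\<^bsub>K\<^esub> h) x) = f (\<omega> g (\<alpha> h x)) \<otimes>\<^bsub>Q\<^esub> f (\<omega> h x)"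
      using coc[OF gh] AE_space
    proof eventually_elim
      case (elim x)
      have "\<omega> g (\<alpha> h x) \<in> carrier P" "\<omega> h x \<in> carrier P"
        using elim(2) measurable_space[OF \<omega>] measurable_space[OF K(2)] gh by auto
      then show ?case using elim(1) by simp
    qed
  qed
  then obtain \<phi> \<delta> where \<phi>: "\<phi> \<in> M \<rightarrow>\<^sub>M borel_of ?T" and \<delta>: "\<delta> \<in> hom K Q"
    and eq: "\<And>k. k \<in> carrier K \<Longrightarrow> AE x in M. \<delta> k = \<phi> (\<alpha> k x) \<otimes>\<^bsub>Q\<^esub> f (\<omega> k x) \<otimes>\<^bsub>Q\<^esub> inv\<^bsub>Q\<^esub> (\<phi> x)"
    using sr fin unfolding U_fin_cocycle_superrigid_def by blast
  define j where "j = inv_into (carrier P) f"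
  have jiso: "j \<in> iso Q P" unfolding j_def by (rule P.iso_set_sym[OF fiso])
  interpret j: group_hom Q P j using jiso by unfold_locales (auto simp: iso_def)
  have jf: "g \<in> carrier P \<Longrightarrow> j (f g) = g" for g using f by (simp add: j_def)
  have \<phi>': "\<phi> \<in> M \<rightarrow>\<^sub>M count_space (carrier Q)" using \<phi> unfolding measurable_cong_sets[OF refl cs] .
  show ?thesis
  proof
    have "j \<circ> \<phi> \<in> M \<rightarrow>\<^sub>M count_space (carrier P)" by (rule measurable_comp[OF \<phi>']) auto
    then show "(\<lambda>x. j (\<phi> x)) \<in> M \<rightarrow>\<^sub>M count_space (carrier P)" by (simp add: comp_def)
    show "(\<lambda>k. j (\<delta> k)) \<in> hom K P" using \<delta> by (auto simp: hom_def Pi_iff)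
    fix k assume k: "k \<in> carrier K"
    show "AE x in M. j (\<delta> k) = j (\<phi> (\<alpha> k x)) \<otimes>\<^bsub>P\<^esub> \<omega> k x \<otimes>\<^bsub>P\<^esub> inv\<^bsub>P\<^esub> (j (\<phi> x))"
      using eq[OF k] AE_space
    proof eventually_elim
      case (elim x)
      have m: "\<phi> (\<alpha> k x) \<in> carrier Q" "\<phi> x \<in> carrier Q" "\<omega> k x \<in> carrier P"
        using elim(2) measurable_space[OF \<phi>'] measurable_space[OF \<omega>] measurable_space[OF K(2)] k by auto
      show ?case unfolding elim(1) using m by (simp add: jf)
    qed
  qed
qed

section \<open>Borel structures of Polish spaces\<close>

lemma space_borel_of [simp]: "space (borel_of T) = topspace T"
  unfolding borel_of_def by (rule space_measure_of) (auto dest: openin_subset)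

lemma sets_borel_of: "sets (borel_of T) = sigma_sets (topspace T) {U. openin T U}"
  unfolding borel_of_def by (rule sets_measure_of) (auto dest: openin_subset)

lemma second_countable_base:
  assumes "second_countable T"
  obtains B where "countable B" "\<And>V. V \<in> B \<Longrightarrow> openin T V"
    "\<And>U x. openin T U \<Longrightarrow> x \<in> U \<Longrightarrow> \<exists>V\<in>B. x \<in> V \<and> V \<subseteq> U"
  using assms unfolding second_countable_def by metis

lemma sets_borel_of_base:
  assumes B: "countable B" "\<And>V. V \<in> B \<Longrightarrow> openin T V"
    "\<And>U x. openin T U \<Longrightarrow> x \<in> U \<Longrightarrow> \<exists>V\<in>B. x \<in> V \<and> V \<subseteq> U"
  shows "sets (borel_of T) = sigma_sets (topspace T) B"
  unfolding sets_borel_of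
proof (rule sigma_sets_eqI)
  fix U assume "U \<in> {U. openin T U}"
  then have U: "openin T U" by simp
  have "U = \<Union>{V \<in> B. V \<subseteq> U}" using B(3)[OF U] by blast
  moreover have "\<Union>{V \<in> B. V \<subseteq> U} \<in> sigma_sets (topspace T) B"
  proof (rule sigma_sets_UNION)
    show "countable {V \<in> B. V \<subseteq> U}" using B(1) by (rule countable_subset[rotated]) auto
  qed auto
  ultimately show "U \<in> sigma_sets (topspace T) B" by simp
next
  fix V assume "V \<in> B" then show "V \<in> sigma_sets (topspace T) {U. openin T U}" using B(2) by auto
qed

lemma prod_topology_base:
  assumes B: "\<And>U x. openin S U \<Longrightarrow> x \<in> U \<Longrightarrow> \<exists>V\<in>B. x \<in> V \<and> V \<subseteq> U"
    and C: "\<And>U x. openin T U \<Longrightarrow> x \<in> U \<Longrightarrow> \<exists>V\<in>C. x \<in> V \<and> V \<subseteq> U"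
    and U: "openin (prod_topology S T) U" "z \<in> U"
  shows "\<exists>V\<in>(\<lambda>(V, W). V \<times> W) ` (B \<times> C). z \<in> V \<and> V \<subseteq> U"
proof -
  obtain x y where xy: "z = (x, y)" by (cases z)
  obtain V W where VW: "openin S V" "openin T W" "x \<in> V" "y \<in> W" "V \<times> W \<subseteq> U"
    using U(1)[unfolded openin_prod_topology_alt, rule_format, of x y] U(2) xy by auto
  obtain V' where V': "V' \<in> B" "x \<in> V'" "V' \<subseteq> V" using B[OF VW(1,3)] by auto
  obtain W' where W': "W' \<in> C" "y \<in> W'" "W' \<subseteq> W" using C[OF VW(2,4)] by auto
  have "V' \<times> W' \<in> (\<lambda>(V, W). V \<times> W) ` (B \<times> C)" using V' W' by auto
  moreover have "z \<in> V' \<times> W'" "V' \<times> W' \<subseteq> U" using V' W' VW(5) xy by auto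
  ultimately show ?thesis by blast
qed

lemma second_countable_prod_topology:
  assumes S: "second_countable S" and T: "second_countable T"
  shows "second_countable (prod_topology S T)"
proof -
  obtain B where B: "countable B" "\<And>V. V \<in> B \<Longrightarrow> openin S V"
    "\<And>U x. openin S U \<Longrightarrow> x \<in> U \<Longrightarrow> \<exists>V\<in>B. x \<in> V \<and> V \<subseteq> U" using second_countable_base[OF S] by metis
  obtain C where C: "countable C" "\<And>V. V \<in> C \<Longrightarrow> openin T V"
    "\<And>U x. openin T U \<Longrightarrow> x \<in> U \<Longrightarrow> \<exists>V\<in>C. x \<in> V \<and> V \<subseteq> U" using second_countable_base[OF T] by metis
  let ?D = "(\<lambda>(V, W). V \<times> W) ` (B \<times> C)"
  have "\<exists>V\<in>?D. z \<in> V \<and> V \<subseteq> U" if U: "openin (prod_topology S T) U" and z: "z \<in> U" for U z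
    by (rule prod_topology_base[OF B(3) C(3) U z])
  moreover have "\<forall>V\<in>?D. openin (prod_topology S T) V" using B(2) C(2) by (auto simp: openin_prod_Times_iff)
  ultimately show ?thesis unfolding second_countable_def using B(1) C(1)
    by (intro exI[of _ ?D]) auto
qed

lemma continuous_map_measurable:
  assumes "continuous_map S T f" shows "f \<in> borel_of S \<rightarrow>\<^sub>M borel_of T"
  unfolding borel_of_def[of T]
proof (rule measurable_measure_of)
  show "{U. openin T U} \<subseteq> Pow (topspace T)" by (auto dest: openin_subset)
  show "f \<in> space (borel_of S) \<rightarrow> topspace T" using continuous_map_funspace[OF assms] by simp
  fix U assume "U \<in> {U. openin T U}"
  then have "openin S {x \<in> topspace S. f x \<in> U}" using assms openin_continuous_map_preimage by auto
  moreover have "f -` U \<inter> space (borel_of S) = {x \<in> topspace S. f x \<in> U}" by auto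
  ultimately show "f -` U \<inter> space (borel_of S) \<in> sets (borel_of S)"
    unfolding sets_borel_of by auto
qed

text \<open>Products of members of two countable bases form a base of the product topology; this
  keeps its Borel sets within the product sigma-algebra.\<close>

lemma standard_measure_pair:
  assumes M: "standard_measure M" and N: "standard_measure N"
  shows "standard_measure (M \<Otimes>\<^sub>M N)"
proof -
  obtain S where S: "topspace S = space M" "completely_metrizable_space S" "second_countable S" "sets M = sets (borel_of S)"
    using M by (auto simp: standard_measure_def)
  obtain T where T: "topspace T = space N" "completely_metrizable_space T" "second_countable T" "sets N = sets (borel_of T)"
    using N by (auto simp: standard_measure_def)
  interpret M: sigma_finite_measure M using M by (auto simp: standard_measure_def)
  interpret N: sigma_finite_measure N using N by (auto simp: standard_measure_def)
  interpret P: pair_sigma_finite M N ..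
  let ?P = "prod_topology S T"
  have "sets (M \<Otimes>\<^sub>M N) \<subseteq> sets (borel_of ?P)"
  proof (rule sets_pair_in_sets)
    fix a b assume a: "a \<in> sets M" and b: "b \<in> sets N"
    have "fst -` a \<inter> space (borel_of ?P) \<in> sets (borel_of ?P)"
      using continuous_map_measurable[OF continuous_map_fst] a S(4) by (intro measurable_sets) auto
    moreover have "snd -` b \<inter> space (borel_of ?P) \<in> sets (borel_of ?P)"
      using continuous_map_measurable[OF continuous_map_snd] b T(4) by (intro measurable_sets) auto
    moreover have "a \<times> b = (fst -` a \<inter> space (borel_of ?P)) \<inter> (snd -` b \<inter> space (borel_of ?P))"
      using sets.sets_into_space[OF a] sets.sets_into_space[OF b] S(1) T(1) by auto
    ultimately show "a \<times> b \<in> sets (borel_of ?P)" by simp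
  qed
  moreover have "sets (borel_of ?P) \<subseteq> sets (M \<Otimes>\<^sub>M N)"
  proof -
    obtain B where B: "countable B" "\<And>V. V \<in> B \<Longrightarrow> openin S V"
      "\<And>U x. openin S U \<Longrightarrow> x \<in> U \<Longrightarrow> \<exists>V\<in>B. x \<in> V \<and> V \<subseteq> U" using second_countable_base[OF S(3)] by metis
    obtain C where C: "countable C" "\<And>V. V \<in> C \<Longrightarrow> openin T V"
      "\<And>U x. openin T U \<Longrightarrow> x \<in> U \<Longrightarrow> \<exists>V\<in>C. x \<in> V \<and> V \<subseteq> U" using second_countable_base[OF T(3)] by metis
    let ?D = "(\<lambda>(V, W). V \<times> W) ` (B \<times> C)"
    have "sets (borel_of ?P) = sigma_sets (topspace ?P) ?D"
    proof (rule sets_borel_of_base)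
      fix U z assume U: "openin ?P U" and z: "z \<in> U"
      show "\<exists>V\<in>?D. z \<in> V \<and> V \<subseteq> U" by (rule prod_topology_base[OF B(3) C(3) U z])
    qed (use B C in \<open>auto simp: openin_prod_Times_iff\<close>)
    also have "\<dots> \<subseteq> sets (M \<Otimes>\<^sub>M N)"
    proof -
      have "V \<in> sets M" if "V \<in> B" for V using B(2)[OF that] S(4) by (auto simp: sets_borel_of)
      moreover have "V \<in> sets N" if "V \<in> C" for V using C(2)[OF that] T(4) by (auto simp: sets_borel_of)
      ultimately have "?D \<subseteq> sets (M \<Otimes>\<^sub>M N)" by auto
      then have "sigma_sets (space (M \<Otimes>\<^sub>M N)) ?D \<subseteq> sets (M \<Otimes>\<^sub>M N)" by (rule sets.sigma_sets_subset)
      then show ?thesis using S(1) T(1) by (simp add: space_pair_measure)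
    qed
    finally show ?thesis .
  qed
  ultimately have "sets (M \<Otimes>\<^sub>M N) = sets (borel_of ?P)" by auto
  moreover have "completely_metrizable_space ?P" using S T by (simp add: completely_metrizable_space_prod_topology)
  moreover have "topspace ?P = space (M \<Otimes>\<^sub>M N)" using S T by (simp add: space_pair_measure)
  ultimately show ?thesis
    unfolding standard_measure_def using second_countable_prod_topology[OF S(3) T(3)] P.sigma_finite_measure_axioms by blast
qed

text \<open>A countable base generates the Borel sets and, by the Hausdorff property, separates
  points. Equality of points and constancy of functions thereby become countably many membership
  tests.\<close>

lemma standard_measure_separating:
  fixes M :: "'x measure"
  assumes M: "standard_measure M"
  obtains E :: "nat \<Rightarrow> 'x set" where "\<And>n. E n \<in> sets M" "sets M = sigma_sets (space M) (range E)"
    "\<And>x y. x \<in> space M \<Longrightarrow> y \<in> space M \<Longrightarrow> (\<And>n. x \<in> E n \<longleftrightarrow> y \<in> E n) \<Longrightarrow> x = y"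
proof -
  obtain S where S: "topspace S = space M" "completely_metrizable_space S" "second_countable S" "sets M = sets (borel_of S)"
    using M by (auto simp: standard_measure_def)
  obtain B where B: "countable B" "\<And>V. V \<in> B \<Longrightarrow> openin S V"
    "\<And>U x. openin S U \<Longrightarrow> x \<in> U \<Longrightarrow> \<exists>V\<in>B. x \<in> V \<and> V \<subseteq> U" using second_countable_base[OF S(3)] by metis
  \<comment> \<open>Inserting the empty set makes the enumerated set nonempty and harms neither
    generation nor separation.\<close>
  define E where "E = from_nat_into (insert {} B)"
  have rE: "range E = insert {} B" unfolding E_def using B(1) by (intro range_from_nat_into) auto
  have En: "openin S (E n)" for n using rE B(2) by (metis insert_iff openin_empty rangeI)
  show ?thesis
  proof
    show "E n \<in> sets M" for n using En S(4) by (auto simp: sets_borel_of)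
    have "sets (borel_of S) = sigma_sets (topspace S) (insert {} B)"
      by (rule sets_borel_of_base) (use B in auto)
    then show "sets M = sigma_sets (space M) (range E)" using S rE by simp
    fix x y assume xy: "x \<in> space M" "y \<in> space M" "\<And>n. x \<in> E n \<longleftrightarrow> y \<in> E n"
    show "x = y"
    proof (rule ccontr)
      assume "x \<noteq> y"
      have "Hausdorff_space S"
        by (rule metrizable_imp_Hausdorff_space[OF completely_metrizable_imp_metrizable_space[OF S(2)]])
      then obtain U V where UV: "openin S U" "x \<in> U" "y \<in> V" "disjnt U V"
        using xy(1,2) S(1) \<open>x \<noteq> y\<close> unfolding Hausdorff_space_def by metis
      then have U: "openin S U" "x \<in> U" "y \<notin> U" by (auto simp: disjnt_iff)
      obtain V where V: "V \<in> B" "x \<in> V" "V \<subseteq> U" using B(3)[OF U(1,2)] by auto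
      obtain n where "E n = V" using rE V(1) by (metis insertCI imageE)
      then show False using xy(3)[of n] U V by auto
    qed
  qed
qed

text \<open>Finite intersections of a generating sequence form a countable family. Countability
  matters where measures depend on a parameter: identities that hold almost everywhere for each set
  of \<open>G\<close> then hold almost everywhere for all of them together.\<close>

lemma standard_measure_generator:
  fixes M :: "'x measure"
  assumes M: "standard_measure M"
  obtains G where "countable G" "Int_stable G" "G \<subseteq> sets M" "space M \<in> G" "sets M = sigma_sets (space M) G"
proof -
  obtain E :: "nat \<Rightarrow> 'x set" where E: "\<And>n. E n \<in> sets M" "sets M = sigma_sets (space M) (range E)"
    using standard_measure_separating[OF M] by metis
  define G where "G = (\<lambda>J. space M \<inter> \<Inter>(E ` J)) ` {J. finite J}"
  have GM: "G \<subseteq> sets M"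
  proof
    fix A assume "A \<in> G"
    then obtain J where J: "finite J" "A = space M \<inter> \<Inter>(E ` J)" by (auto simp: G_def)
    from J(1) have "space M \<inter> \<Inter>(E ` J) \<in> sets M"
    proof induction
      case (insert n J)
      have "space M \<inter> \<Inter>(E ` insert n J) = E n \<inter> (space M \<inter> \<Inter>(E ` J))" by auto
      then show ?case using insert E(1) by auto
    qed simp
    then show "A \<in> sets M" using J by simp
  qed
  show ?thesis
  proof (rule that)
    show "countable G" unfolding G_def by (intro countable_image countable_Collect_finite)
    show "Int_stable G"
    proof (rule Int_stableI)
      fix a b assume "a \<in> G" "b \<in> G"
      then obtain J K where "finite J" "a = space M \<inter> \<Inter>(E ` J)" "finite K" "b = space M \<inter> \<Inter>(E ` K)" by (auto simp: G_def)
      then have "a \<inter> b = space M \<inter> \<Inter>(E ` (J \<union> K))" "finite (J \<union> K)" by auto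
      then show "a \<inter> b \<in> G" unfolding G_def by blast
    qed
    show "G \<subseteq> sets M" by (rule GM)
    show "space M \<in> G" unfolding G_def by (rule image_eqI[of _ _ "{}"]) auto
    show "sets M = sigma_sets (space M) G"
    proof
      have "range E \<subseteq> sigma_sets (space M) G"
      proof safe
        fix n
        have "E n = space M \<inter> \<Inter>(E ` {n})" using sets.sets_into_space[OF E(1)[of n]] by auto
        then have "E n \<in> G" unfolding G_def by blast
        then show "E n \<in> sigma_sets (space M) G" by auto
      qed
      then show "sets M \<subseteq> sigma_sets (space M) G" unfolding E(2) by (rule sigma_sets_mono)
      show "sigma_sets (space M) G \<subseteq> sets M" using GM by (rule sets.sigma_sets_subset)
    qed
  qed
qed

lemma standard_measure_eq_sets:
  fixes S :: "'b measure"
  assumes S: "standard_measure S" and f: "f \<in> M \<rightarrow>\<^sub>M S" and g: "g \<in> M \<rightarrow>\<^sub>M S"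
  shows "{x \<in> space M. f x = g x} \<in> sets M"
proof -
  obtain E :: "nat \<Rightarrow> 'b set" where E: "\<And>n. E n \<in> sets S"
    "\<And>x y. x \<in> space S \<Longrightarrow> y \<in> space S \<Longrightarrow> (\<And>n. x \<in> E n \<longleftrightarrow> y \<in> E n) \<Longrightarrow> x = y"
    using standard_measure_separating[OF S] by metis
  have "{x \<in> space M. f x = g x} = {x \<in> space M. \<forall>n. f x \<in> E n \<longleftrightarrow> g x \<in> E n}"
    using E(2)[OF measurable_space[OF f] measurable_space[OF g]] by (intro Collect_cong conj_cong refl) metis
  also have "\<dots> \<in> sets M"
  proof -
    note [measurable] = E(1) f g
    show ?thesis by measurable
  qed
  finally show ?thesis .
qed

lemma standard_sigma_finite: "standard_measure M \<Longrightarrow> sigma_finite_measure M"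
  by (simp add: standard_measure_def)

section \<open>Countable choices and null sets\<close>

lemma AE_iff_cong:
  assumes "AE x in M. P x \<longleftrightarrow> Q x" shows "(AE x in M. P x) \<longleftrightarrow> (AE x in M. Q x)"
proof
  assume "AE x in M. P x" with assms show "AE x in M. Q x" by eventually_elim simp
next
  assume "AE x in M. Q x" with assms show "AE x in M. P x" by eventually_elim simp
qed

text \<open>The first admissible element in an enumeration is a measurable choice, because the least
  index that satisfies measurable predicates is measurable.\<close>

lemma measurable_countable_choice:
  assumes C: "countable C" "C \<noteq> {}"
    and P: "\<And>c. c \<in> C \<Longrightarrow> {x \<in> space M. P c x} \<in> sets M"
    and ex: "AE x in M. \<exists>c\<in>C. P c x"
  obtains f where "f \<in> M \<rightarrow>\<^sub>M count_space C" "AE x in M. P (f x) x"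
proof -
  define e where "e = from_nat_into C"
  have e: "range e = C" unfolding e_def by (rule range_from_nat_into[OF C(2,1)])
  define n where "n x = (LEAST n. P (e n) x)" for x
  have n: "n \<in> M \<rightarrow>\<^sub>M count_space UNIV"
    unfolding n_def
  proof (rule measurable_Least)
    fix i
    have "e i \<in> C" using e by auto
    then show "(\<lambda>x. P (e i) x) \<in> M \<rightarrow>\<^sub>M count_space UNIV" using P[of "e i"] by (simp add: pred_def)
  qed
  have "e \<circ> n \<in> M \<rightarrow>\<^sub>M count_space C" by (rule measurable_comp[OF n]) (use e in auto)
  moreover have "AE x in M. P ((e \<circ> n) x) x"
    using ex
  proof eventually_elim
    case (elim x)
    then obtain k where "P (e k) x" using e by auto
    then show ?case unfolding n_def comp_def by (rule LeastI)
  qed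
  ultimately show ?thesis by (rule that)
qed

text \<open>Half of non-singularity: what holds almost everywhere can be pulled back. It asks for no
  inverse, so it applies to return maps and to other maps that are far from injective.\<close>

definition null_preserving :: "'x measure \<Rightarrow> 'y measure \<Rightarrow> ('x \<Rightarrow> 'y) \<Rightarrow> bool" where
  "null_preserving M N f \<longleftrightarrow> f \<in> M \<rightarrow>\<^sub>M N \<and> (\<forall>A\<in>null_sets N. f -` A \<inter> space M \<in> null_sets M)"

lemma null_preserving_AE:
  assumes f: "null_preserving M N f" and P: "AE y in N. P y"
  shows "AE x in M. P (f x)"
proof -
  obtain A where A: "A \<in> null_sets N" "{y \<in> space N. \<not> P y} \<subseteq> A" using P by (auto simp: eventually_ae_filter)
  have "f -` A \<inter> space M \<in> null_sets M" using f A by (auto simp: null_preserving_def)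
  moreover have "{x \<in> space M. \<not> P (f x)} \<subseteq> f -` A \<inter> space M"
    using A(2) f measurable_space[of f M N] by (auto simp: null_preserving_def)
  ultimately show ?thesis unfolding eventually_ae_filter by blast
qed

lemma null_preservingI:
  assumes f: "f \<in> M \<rightarrow>\<^sub>M N" and "\<And>A. A \<in> null_sets N \<Longrightarrow> AE x in M. f x \<notin> A"
  shows "null_preserving M N f"
  unfolding null_preserving_def
proof (intro conjI ballI f)
  fix A assume A: "A \<in> null_sets N"
  have "f -` A \<inter> space M = {x \<in> space M. f x \<in> A}" by auto
  moreover have "f -` A \<inter> space M \<in> sets M" using f A by auto
  ultimately show "f -` A \<inter> space M \<in> null_sets M"
    using assms(2)[OF A] by (simp add: AE_iff_null_sets)
qed

lemma null_preserving_comp: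
  assumes "null_preserving M N f" "null_preserving N K g"
  shows "null_preserving M K (\<lambda>x. g (f x))"
proof (rule null_preservingI)
  show "(\<lambda>x. g (f x)) \<in> M \<rightarrow>\<^sub>M K" using assms by (auto simp: null_preserving_def)
  fix A assume "A \<in> null_sets K"
  then show "AE x in M. g (f x) \<notin> A"
    by (intro null_preserving_AE[OF assms(1)] null_preserving_AE[OF assms(2)] AE_not_in)
qed

lemma null_preserving_piecewise:
  assumes k: "k \<in> M \<rightarrow>\<^sub>M count_space C" "countable C"
    and f: "\<And>c. c \<in> C \<Longrightarrow> null_preserving M N (f c)"
  shows "null_preserving M N (\<lambda>x. f (k x) x)"
proof (rule null_preservingI)
  show "(\<lambda>x. f (k x) x) \<in> M \<rightarrow>\<^sub>M N"
    by (rule measurable_compose_countable'[OF _ k]) (use f in \<open>auto simp: null_preserving_def\<close>)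
  fix A assume "A \<in> null_sets N"
  then have "AE x in M. \<forall>c\<in>C. f c x \<notin> A"
    using f null_preserving_AE AE_not_in by (subst AE_ball_countable[OF k(2)]) blast
  then show "AE x in M. f (k x) x \<notin> A" using AE_space
    by eventually_elim (use measurable_space[OF k(1)] in auto)
qed

lemma null_preserving_cong:
  assumes "null_preserving M N f" "g \<in> M \<rightarrow>\<^sub>M N" "AE x in M. g x = f x"
  shows "null_preserving M N g"
proof (rule null_preservingI[OF assms(2)])
  fix A assume "A \<in> null_sets N"
  then have "AE x in M. f x \<notin> A" by (intro null_preserving_AE[OF assms(1)] AE_not_in)
  then show "AE x in M. g x \<notin> A" using assms(3) by eventually_elim auto
qed

section \<open>Almost everywhere statements on products\<close>

lemma (in pair_sigma_finite) AE_pair_swap: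
  assumes "AE z in M1 \<Otimes>\<^sub>M M2. Q z"
  shows "AE y in M2. AE x in M1. Q (x, y)"
proof -
  interpret Q: pair_sigma_finite M2 M1 ..
  have "(\<lambda>(x, y). (y, x)) \<in> M2 \<Otimes>\<^sub>M M1 \<rightarrow>\<^sub>M M1 \<Otimes>\<^sub>M M2" by simp
  moreover have "AE z in distr (M2 \<Otimes>\<^sub>M M1) (M1 \<Otimes>\<^sub>M M2) (\<lambda>(x, y). (y, x)). Q z"
    by (subst distr_pair_swap[symmetric]) (rule assms)
  ultimately have "AE z in M2 \<Otimes>\<^sub>M M1. Q ((\<lambda>(x, y). (y, x)) z)" by (rule AE_distrD)
  from Q.AE_pair[OF this] show ?thesis by simp
qed

lemma (in pair_sigma_finite) AE_pair_measure_swap: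
  assumes "{z \<in> space (M1 \<Otimes>\<^sub>M M2). Q z} \<in> sets (M1 \<Otimes>\<^sub>M M2)"
    and "AE y in M2. AE x in M1. Q (x, y)"
  shows "AE z in M1 \<Otimes>\<^sub>M M2. Q z"
proof -
  have "AE x in M1. AE y in M2. Q (x, y)"
    by (subst AE_commute) (use assms in simp_all)
  then show ?thesis by (rule AE_pair_measure[OF assms(1)])
qed

text \<open>The property holds exactly at those \<open>x\<close> where the section of the complement
  has measure zero, and the measure of a section is measurable in \<open>x\<close>.\<close>

lemma (in sigma_finite_measure) sets_Collect_AE:
  assumes "{z \<in> space (N \<Otimes>\<^sub>M M). P z} \<in> sets (N \<Otimes>\<^sub>M M)"
  shows "{x \<in> space N. AE y in M. P (x, y)} \<in> sets N"
proof -
  let ?A = "{z \<in> space (N \<Otimes>\<^sub>M M). \<not> P z}"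
  have A: "?A \<in> sets (N \<Otimes>\<^sub>M M)" using assms by (rule sets.sets_Collect_neg)
  have "{x \<in> space N. AE y in M. P (x, y)} = {x \<in> space N. emeasure M (Pair x -` ?A) = 0}"
  proof (intro Collect_cong conj_cong refl)
    fix x assume x: "x \<in> space N"
    have e: "Pair x -` ?A = {y \<in> space M. \<not> P (x, y)}" using x by (auto simp: space_pair_measure)
    have "Pair x -` ?A \<in> sets M" using A by (rule sets_Pair1)
    then show "(AE y in M. P (x, y)) = (emeasure M (Pair x -` ?A) = 0)"
      unfolding e by (subst AE_iff_measurable[OF _ refl]) auto
  qed
  also have "\<dots> \<in> sets N" using measurable_emeasure_Pair[OF A] by measurable
  finally show ?thesis .
qed

text \<open>A function of \<open>(x, y)\<close> that does not depend on \<open>x\<close> almost everywhere is a measurable function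
  of \<open>y\<close>: evaluate it at a generic point \<open>x\<^sub>0\<close>.\<close>

lemma generic_section:
  assumes X: "prob_space X" and Y: "sigma_finite_measure Y"
    and eq: "{z \<in> space (X \<Otimes>\<^sub>M (X \<Otimes>\<^sub>M Y)). f (snd z) = f (fst z, snd (snd z))} \<in> sets (X \<Otimes>\<^sub>M (X \<Otimes>\<^sub>M Y))"
    and const: "AE y in Y. AE x in X. AE x' in X. f (x, y) = f (x', y)"
  obtains x0 where "x0 \<in> space X" "AE z in X \<Otimes>\<^sub>M Y. f z = f (x0, snd z)"
proof -
  interpret X: prob_space X by fact
  interpret Y: sigma_finite_measure Y by fact
  interpret XY: pair_sigma_finite X Y ..
  interpret XXY: pair_sigma_finite X "X \<Otimes>\<^sub>M Y" ..
  have m: "{z \<in> space ((X \<Otimes>\<^sub>M Y) \<Otimes>\<^sub>M X). f (fst z) = f (snd z, snd (fst z))} \<in> sets ((X \<Otimes>\<^sub>M Y) \<Otimes>\<^sub>M X)"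
  proof -
    have "(\<lambda>z. (snd z, fst z)) \<in> (X \<Otimes>\<^sub>M Y) \<Otimes>\<^sub>M X \<rightarrow>\<^sub>M X \<Otimes>\<^sub>M (X \<Otimes>\<^sub>M Y)" by measurable
    from measurable_sets[OF this eq] show ?thesis
      by (rule rev_iffD1[OF _ arg_cong[where f="\<lambda>A. A \<in> sets _"]]) (auto simp: space_pair_measure)
  qed
  have "AE z in X \<Otimes>\<^sub>M Y. AE x' in X. f z = f (x', snd z)"
  proof (rule XY.AE_pair_measure_swap)
    show "{z \<in> space (X \<Otimes>\<^sub>M Y). AE x' in X. f z = f (x', snd z)} \<in> sets (X \<Otimes>\<^sub>M Y)"
      using X.sets_Collect_AE[OF m] by simp
  qed (use const in simp)
  \<comment> \<open>After the exchange almost every \<open>x'\<close> is generic; \<open>X\<close>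
    is a probability space, so at least one such point exists.\<close>
  then have "AE x' in X. AE z in X \<Otimes>\<^sub>M Y. f z = f (x', snd z)"
    by (subst XXY.AE_commute) (use eq in simp_all)
  then have "AE x' in X. x' \<in> space X \<and> (AE z in X \<Otimes>\<^sub>M Y. f z = f (x', snd z))" by auto
  then obtain x0 where "x0 \<in> space X \<and> (AE z in X \<Otimes>\<^sub>M Y. f z = f (x0, snd z))"
    using eventually_happens'[OF X.ae_filter_bot] by blast
  then show ?thesis using that by blast
qed

section \<open>Group actions\<close>

lemma group_actionI:
  assumes G: "group G" and ext: "\<And>g. g \<in> carrier G \<Longrightarrow> \<alpha> g \<in> extensional E"
    and cl: "\<And>g x. g \<in> carrier G \<Longrightarrow> x \<in> E \<Longrightarrow> \<alpha> g x \<in> E"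
    and one: "\<And>x. x \<in> E \<Longrightarrow> \<alpha> \<one>\<^bsub>G\<^esub> x = x"
    and mult: "\<And>g h x. g \<in> carrier G \<Longrightarrow> h \<in> carrier G \<Longrightarrow> x \<in> E \<Longrightarrow> \<alpha> (g \<otimes>\<^bsub>G\<^esub> h) x = \<alpha> g (\<alpha> h x)"
  shows "group_action G E \<alpha>"
proof -
  interpret group G by fact
  have bij: "\<alpha> g \<in> Bij E" if g: "g \<in> carrier G" for g
  proof -
    have "bij_betw (\<alpha> g) E E"
    proof (rule bij_betwI[where g="\<alpha> (inv\<^bsub>G\<^esub> g)"])
      fix x assume x: "x \<in> E"
      show "\<alpha> (inv\<^bsub>G\<^esub> g) (\<alpha> g x) = x" using mult[of "inv\<^bsub>G\<^esub> g" g x] g x one by simp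
      show "\<alpha> g (\<alpha> (inv\<^bsub>G\<^esub> g) x) = x" using mult[of g "inv\<^bsub>G\<^esub> g" x] g x one by simp
    qed (use cl g in auto)
    then show ?thesis using ext[OF g] by (simp add: Bij_def)
  qed
  have "\<alpha> (g \<otimes>\<^bsub>G\<^esub> h) = compose E (\<alpha> g) (\<alpha> h)" if "g \<in> carrier G" "h \<in> carrier G" for g h
    using ext[of "g \<otimes>\<^bsub>G\<^esub> h"] mult that by (auto simp: fun_eq_iff compose_def extensional_def)
  then show ?thesis
    unfolding group_action_def group_hom_def group_hom_axioms_def
    using G group_BijGroup[of E] bij by (auto simp: hom_def BijGroup_def)
qed

locale countable_action = group G for G :: "'a monoid" (structure) +
  fixes M :: "'x measure" and \<alpha> :: "'a \<Rightarrow> 'x \<Rightarrow> 'x"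
  assumes cnt: "countable (carrier G)" and act: "mp_action G M \<alpha>"
begin

sublocale group_action G "space M" \<alpha>
  using act by (simp add: mp_action_def)

lemma act_measurable [measurable]: "g \<in> carrier G \<Longrightarrow> \<alpha> g \<in> M \<rightarrow>\<^sub>M M"
  using act by (simp add: mp_action_def)

lemma act_distr: "g \<in> carrier G \<Longrightarrow> distr M M (\<alpha> g) = M"
  using act by (simp add: mp_action_def)

lemma act_space [simp]: "g \<in> carrier G \<Longrightarrow> x \<in> space M \<Longrightarrow> \<alpha> g x \<in> space M"
  by (rule measurable_space[OF act_measurable])

lemma act_mult: "g \<in> carrier G \<Longrightarrow> h \<in> carrier G \<Longrightarrow> x \<in> space M \<Longrightarrow> \<alpha> (g \<otimes> h) x = \<alpha> g (\<alpha> h x)"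
  by (rule composition_rule)

lemma act_one [simp]: "x \<in> space M \<Longrightarrow> \<alpha> \<one> x = x"
  using id_eq_one by (metis restrict_apply')

lemma act_inv [simp]:
  assumes "g \<in> carrier G" "x \<in> space M"
  shows "\<alpha> (inv g) (\<alpha> g x) = x" "\<alpha> g (\<alpha> (inv g) x) = x"
  using act_mult[of "inv g" g x] act_mult[of g "inv g" x] assms by auto

lemma act_emeasure:
  "g \<in> carrier G \<Longrightarrow> A \<in> sets M \<Longrightarrow> emeasure M (\<alpha> g -` A \<inter> space M) = emeasure M A"
  by (metis act_distr act_measurable emeasure_distr)

lemma act_null_preserving: "g \<in> carrier G \<Longrightarrow> null_preserving M M (\<alpha> g)"
  unfolding null_preserving_def null_sets_def by (auto simp: act_emeasure)

lemma act_AE: "AE x in M. P x \<Longrightarrow> g \<in> carrier G \<Longrightarrow> AE x in M. P (\<alpha> g x)"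
  by (rule null_preserving_AE[OF act_null_preserving])

lemma act_AE_all: "AE x in M. P x \<Longrightarrow> AE x in M. \<forall>g\<in>carrier G. P (\<alpha> g x)"
  using act_AE by (subst AE_ball_countable[OF cnt]) auto

text \<open>\<open>ergodic_action\<close> speaks of strictly invariant sets. The set
  \<open>A\<close> of points whose whole orbit satisfies \<open>P\<close> is strictly invariant, and
  countability of the group makes it agree with \<open>P\<close> almost everywhere.\<close>

lemma ergodic_AE:
  assumes erg: "ergodic_action G M \<alpha>" and P: "{x \<in> space M. P x} \<in> sets M"
    and inv: "\<And>g. g \<in> carrier G \<Longrightarrow> AE x in M. P (\<alpha> g x) \<longleftrightarrow> P x"
  shows "(AE x in M. P x) \<or> (AE x in M. \<not> P x)"
proof -
  define A where "A = {x \<in> space M. \<forall>g\<in>carrier G. P (\<alpha> g x)}"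
  have A: "A \<in> sets M"
  proof -
    have "{x \<in> space M. P (\<alpha> g x)} \<in> sets M" if g: "g \<in> carrier G" for g
    proof -
      have "{x \<in> space M. P (\<alpha> g x)} = \<alpha> g -` {x \<in> space M. P x} \<inter> space M" using g by auto
      then show ?thesis using measurable_sets[OF act_measurable[OF g] P] by simp
    qed
    then have "(\<Inter>g\<in>carrier G. {x \<in> space M. P (\<alpha> g x)}) \<in> sets M"
      by (intro sets.countable_INT' cnt) auto
    also have "(\<Inter>g\<in>carrier G. {x \<in> space M. P (\<alpha> g x)}) = A" unfolding A_def using one_closed by blast
    finally show ?thesis .
  qed
  have strict: "\<alpha> g -` A \<inter> space M = A" if g: "g \<in> carrier G" for g
  proof (intro equalityI subsetI)
    fix x assume x: "x \<in> \<alpha> g -` A \<inter> space M"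
    have "P (\<alpha> h x)" if h: "h \<in> carrier G" for h
    proof -
      have "P (\<alpha> (h \<otimes> inv g) (\<alpha> g x))" using x g h by (auto simp: A_def)
      then show ?thesis using act_mult[of "h \<otimes> inv g" g x] g h x by (simp add: m_assoc)
    qed
    then show "x \<in> A" using x by (auto simp: A_def)
  next
    fix x assume x: "x \<in> A"
    then show "x \<in> \<alpha> g -` A \<inter> space M" using g by (auto simp: A_def simp flip: act_mult)
  qed
  have "AE x in M. \<forall>g\<in>carrier G. P (\<alpha> g x) \<longleftrightarrow> P x"
    using inv by (subst AE_ball_countable[OF cnt]) auto
  then have eq: "AE x in M. x \<in> A \<longleftrightarrow> P x"
    using AE_space by eventually_elim (use one_closed in \<open>auto simp: A_def\<close>)
  have "A \<in> null_sets M \<or> space M - A \<in> null_sets M"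
    using erg A strict by (auto simp: ergodic_action_def)
  then show ?thesis
  proof
    assume "A \<in> null_sets M"
    from AE_not_in[OF this] have "AE x in M. \<not> P x" using eq by eventually_elim auto
    then show ?thesis ..
  next
    assume "space M - A \<in> null_sets M"
    from AE_not_in[OF this] have "AE x in M. P x" using eq AE_space by eventually_elim auto
    then show ?thesis ..
  qed
qed

text \<open>Ergodicity decides each membership test, and countably many decisions determine the
  value. Constancy is expressed by two quantifiers, so that no point realizing the decisions has to
  be named.\<close>

lemma ergodic_constant:
  assumes erg: "ergodic_action G M \<alpha>" and f: "f \<in> M \<rightarrow>\<^sub>M S" and E: "\<And>n::nat. E n \<in> sets S"
    and sep: "\<And>x y. x \<in> space S \<Longrightarrow> y \<in> space S \<Longrightarrow> (\<And>n. x \<in> E n \<longleftrightarrow> y \<in> E n) \<Longrightarrow> x = y"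
    and inv: "\<And>g. g \<in> carrier G \<Longrightarrow> AE x in M. f (\<alpha> g x) = f x"
  shows "AE x in M. AE x' in M. f x = f x'"
proof -
  have "\<exists>b. AE x in M. f x \<in> E n \<longleftrightarrow> b" for n
  proof -
    have "(AE x in M. f x \<in> E n) \<or> (AE x in M. \<not> f x \<in> E n)"
    proof (rule ergodic_AE[OF erg])
      show "{x \<in> space M. f x \<in> E n} \<in> sets M" using f E[of n] by measurable
      fix g assume "g \<in> carrier G"
      from inv[OF this] show "AE x in M. (f (\<alpha> g x) \<in> E n) = (f x \<in> E n)" by eventually_elim simp
    qed
    then show ?thesis
    proof
      assume "AE x in M. f x \<in> E n" then show ?thesis by (intro exI[of _ True]) simp
    next
      assume "AE x in M. \<not> f x \<in> E n" then show ?thesis by (intro exI[of _ False]) simp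
    qed
  qed
  then obtain b where "\<And>n. AE x in M. f x \<in> E n \<longleftrightarrow> b n" by metis
  then have b: "AE x in M. \<forall>n. f x \<in> E n \<longleftrightarrow> b n" by (simp add: AE_all_countable)
  then show ?thesis using AE_space
  proof eventually_elim
    case (elim x)
    note x = this
    show ?case using b AE_space
    proof eventually_elim
      case (elim x')
      show ?case by (rule sep) (use x elim measurable_space[OF f] in auto)
    qed
  qed
qed

lemma ergodic_constant_standard:
  fixes S :: "'b measure"
  assumes "ergodic_action G M \<alpha>" "f \<in> M \<rightarrow>\<^sub>M S" "standard_measure S"
    and "\<And>g. g \<in> carrier G \<Longrightarrow> AE x in M. f (\<alpha> g x) = f x"
  shows "AE x in M. AE x' in M. f x = f x'"
proof (rule standard_measure_separating[OF assms(3)])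
  fix E :: "nat \<Rightarrow> 'b set"
  assume E: "\<And>n. E n \<in> sets S"
    "\<And>x y. x \<in> space S \<Longrightarrow> y \<in> space S \<Longrightarrow> (\<And>n. x \<in> E n \<longleftrightarrow> y \<in> E n) \<Longrightarrow> x = y"
  show ?thesis by (rule ergodic_constant[where E=E, OF assms(1,2) E assms(4)])
qed

text \<open>The Radon-Nikodym density is invariant, hence constant. Sigma-finiteness is assumed of
  \<open>M\<close> only, so the factor \<open>c\<close> is an extended real that may be
  infinite.\<close>

lemma ergodic_measure_unique:
  assumes erg: "ergodic_action G M \<alpha>" and sf: "sigma_finite_measure M" and nz: "emeasure M (space M) \<noteq> 0"
    and m: "sets m = sets M" "absolutely_continuous M m"
    and inv: "\<And>g A. g \<in> carrier G \<Longrightarrow> A \<in> sets M \<Longrightarrow> emeasure m (\<alpha> g -` A \<inter> space M) = emeasure m A"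
  obtains c where "\<And>A. A \<in> sets M \<Longrightarrow> emeasure m A = c * emeasure M A"
proof -
  interpret sigma_finite_measure M by fact
  obtain f where f[measurable]: "f \<in> borel_measurable M" and mf: "density M f = m"
    using Radon_Nikodym[OF m(2,1)] by metis
  have fi: "AE x in M. f (\<alpha> g x) = f x" if g: "g \<in> carrier G" for g
  proof -
    have fg[measurable]: "(\<lambda>x. f (\<alpha> g x)) \<in> borel_measurable M" using g by measurable
    have "density M (\<lambda>x. f (\<alpha> g x)) = density M f"
    proof (rule measure_eqI)
      fix A assume "A \<in> sets (density M (\<lambda>x. f (\<alpha> g x)))"
      then have A[measurable]: "A \<in> sets M" by simp
      \<comment> \<open>The translate of \<open>A\<close> by \<open>g\<close>: the indicator of
        \<open>A\<close> at \<open>x\<close> is that of \<open>B\<close> at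
        \<open>\<alpha> g x\<close>, which prepares the change of variables.\<close>
      define B where "B = \<alpha> (inv g) -` A \<inter> space M"
      have B[measurable]: "B \<in> sets M" unfolding B_def using g A by (intro measurable_sets[OF act_measurable]) auto
      have "emeasure (density M (\<lambda>x. f (\<alpha> g x))) A = (\<integral>\<^sup>+x. f (\<alpha> g x) * indicator A x \<partial>M)"
        by (rule emeasure_density) (use fg A in auto)
      also have "\<dots> = (\<integral>\<^sup>+x. f (\<alpha> g x) * indicator B (\<alpha> g x) \<partial>M)"
        by (intro nn_integral_cong) (use g in \<open>auto simp: B_def indicator_def\<close>)
      also have "\<dots> = (\<integral>\<^sup>+x. f x * indicator B x \<partial>distr M M (\<alpha> g))"
        using g by (subst nn_integral_distr) auto
      also have "\<dots> = emeasure m B" unfolding mf[symmetric] act_distr[OF g] by (rule emeasure_density[symmetric]) auto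
      also have "\<dots> = emeasure m A" unfolding B_def by (rule inv) (use g in auto)
      finally show "emeasure (density M (\<lambda>x. f (\<alpha> g x))) A = emeasure (density M f) A" by (simp add: mf)
    qed simp
    then show ?thesis using density_unique_iff[OF fg f] by simp
  qed
  \<comment> \<open>Half-lines below rationals separate the points of \<open>ennreal\<close>,
    infinity included.\<close>
  have "AE x in M. AE x' in M. f x = f x'"
  proof (rule ergodic_constant[OF erg f _ _ fi, where E="\<lambda>n. {..<ennreal (real_of_rat (from_nat n))}"])
    fix x y :: ennreal
    assume *: "\<And>n. (x \<in> {..<ennreal (real_of_rat (from_nat n))}) = (y \<in> {..<ennreal (real_of_rat (from_nat n))})"
    then have **: "x < ennreal (real_of_rat r) \<longleftrightarrow> y < ennreal (real_of_rat r)" for r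
      using *[of "to_nat r"] by simp
    show "x = y"
    proof (rule ccontr)
      assume "x \<noteq> y"
      then show False using ennreal_rat_dense[of x y] ennreal_rat_dense[of y x] **
        by (metis linorder_neqE order.asym)
    qed
  qed auto
  moreover have "ae_filter M \<noteq> bot"
    using nz by (auto simp: trivial_limit_def AE_iff_null)
  ultimately obtain x where x: "AE x' in M. f x = f x'" by (metis (mono_tags, lifting) eventually_happens')
  have "emeasure m A = f x * emeasure M A" if A: "A \<in> sets M" for A
  proof -
    have "emeasure m A = (\<integral>\<^sup>+x. f x * indicator A x \<partial>M)"
      unfolding mf[symmetric] by (rule emeasure_density) (use A in auto)
    also have "\<dots> = (\<integral>\<^sup>+y. f x * indicator A y \<partial>M)"
      by (rule nn_integral_cong_AE) (use x in eventually_elim, simp)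
    also have "\<dots> = f x * emeasure M A" by (rule nn_integral_cmult_indicator[OF A])
    finally show ?thesis .
  qed
  then show ?thesis by (rule that)
qed

end

lemma mp_action_product:
  assumes G: "group G" and M: "mp_action G M \<alpha>" "sigma_finite_measure M" and N: "mp_action G N \<beta>" "sigma_finite_measure N"
  shows "mp_action G (M \<Otimes>\<^sub>M N) (product_action M N \<alpha> \<beta>)"
proof -
  interpret M: sigma_finite_measure M by fact
  interpret N: sigma_finite_measure N by fact
  interpret A: group_action G "space M" \<alpha> using M by (simp add: mp_action_def)
  interpret B: group_action G "space N" \<beta> using N by (simp add: mp_action_def)
  interpret group G by fact
  have one: "x \<in> space M \<Longrightarrow> \<alpha> \<one>\<^bsub>G\<^esub> x = x" "y \<in> space N \<Longrightarrow> \<beta> \<one>\<^bsub>G\<^esub> y = y" for x y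
    using A.id_eq_one B.id_eq_one by (metis restrict_apply')+
  have cl: "g \<in> carrier G \<Longrightarrow> x \<in> space M \<Longrightarrow> \<alpha> g x \<in> space M" "g \<in> carrier G \<Longrightarrow> y \<in> space N \<Longrightarrow> \<beta> g y \<in> space N" for g x y
    using A.element_image B.element_image by auto
  show ?thesis
    unfolding mp_action_def
  proof (intro conjI ballI)
    show "group_action G (space (M \<Otimes>\<^sub>M N)) (product_action M N \<alpha> \<beta>)"
      by (rule group_actionI[OF G])
        (auto simp: product_action_def space_pair_measure one cl A.composition_rule B.composition_rule)
    fix g assume g: "g \<in> carrier G"
    have [measurable]: "\<alpha> g \<in> M \<rightarrow>\<^sub>M M" "\<beta> g \<in> N \<rightarrow>\<^sub>M N" and d: "distr M M (\<alpha> g) = M" "distr N N (\<beta> g) = N"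
      using M N g by (auto simp: mp_action_def)
    have m: "(\<lambda>(x, y). (\<alpha> g x, \<beta> g y)) \<in> M \<Otimes>\<^sub>M N \<rightarrow>\<^sub>M M \<Otimes>\<^sub>M N" by measurable
    have c: "z \<in> space (M \<Otimes>\<^sub>M N) \<Longrightarrow> product_action M N \<alpha> \<beta> g z = (\<lambda>(x, y). (\<alpha> g x, \<beta> g y)) z" for z
      by (auto simp: product_action_def space_pair_measure)
    show "product_action M N \<alpha> \<beta> g \<in> M \<Otimes>\<^sub>M N \<rightarrow>\<^sub>M M \<Otimes>\<^sub>M N"
      using m by (subst measurable_cong[OF c])
    have "distr (M \<Otimes>\<^sub>M N) (M \<Otimes>\<^sub>M N) (product_action M N \<alpha> \<beta> g) =
        distr (M \<Otimes>\<^sub>M N) (M \<Otimes>\<^sub>M N) (\<lambda>(x, y). (\<alpha> g x, \<beta> g y))"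
      by (intro distr_cong refl c)
    also have "\<dots> = distr M M (\<alpha> g) \<Otimes>\<^sub>M distr N N (\<beta> g)"
      by (rule pair_measure_distr[symmetric]) (use d N in auto)
    finally show "distr (M \<Otimes>\<^sub>M N) (M \<Otimes>\<^sub>M N) (product_action M N \<alpha> \<beta> g) = M \<Otimes>\<^sub>M N" by (simp add: d)
  qed
qed

section \<open>Weakly mixing actions\<close>

locale weakly_mixing_countable = countable_action + prob_space M +
  assumes wm: "weakly_mixing_action G M \<alpha>"
begin

lemma square_action: "countable_action G (M \<Otimes>\<^sub>M M) (product_action M M \<alpha> \<alpha>)"
  by unfold_locales (use cnt mp_action_product[OF is_group act _ act] sigma_finite_measure_axioms in auto)

text \<open>An invariant set \<open>A\<close> gives the set \<open>A \<times> space M\<close>,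
  invariant under the diagonal action and of the same measure as \<open>A\<close>.\<close>

lemma ergodic: "ergodic_action G M \<alpha>"
  unfolding ergodic_action_def
proof (intro ballI impI)
  interpret MM: pair_sigma_finite M M ..
  fix A assume A: "A \<in> sets M" and inv: "\<forall>g\<in>carrier G. \<alpha> g -` A \<inter> space M = A"
  have sub: "A \<subseteq> space M" by (rule sets.sets_into_space[OF A])
  have "product_action M M \<alpha> \<alpha> g -` (A \<times> space M) \<inter> space (M \<Otimes>\<^sub>M M) = A \<times> space M" if g: "g \<in> carrier G" for g
  proof -
    have "\<alpha> g x \<in> A \<longleftrightarrow> x \<in> A" if "x \<in> space M" for x using inv g that by blast
    then show ?thesis using g sub by (auto simp: product_action_def space_pair_measure)
  qed
  then have "A \<times> space M \<in> null_sets (M \<Otimes>\<^sub>M M) \<or> space (M \<Otimes>\<^sub>M M) - A \<times> space M \<in> null_sets (M \<Otimes>\<^sub>M M)"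
    using wm A unfolding weakly_mixing_action_def ergodic_action_def by auto
  moreover have "space (M \<Otimes>\<^sub>M M) - A \<times> space M = (space M - A) \<times> space M" by (auto simp: space_pair_measure)
  moreover have "B \<in> null_sets M" if "B \<times> space M \<in> null_sets (M \<Otimes>\<^sub>M M)" "B \<in> sets M" for B
    using that by (auto simp: null_sets_def emeasure_pair_measure_Times emeasure_space_1)
  ultimately show "A \<in> null_sets M \<or> space M - A \<in> null_sets M" using A by auto
qed

text \<open>Weak mixing makes a countably valued function constant as soon as the group acts on its values
  by injections: \<open>{(x, x'). k x = k x'}\<close> is invariant and not a null set.\<close>

lemma weakly_mixing_constant:
  assumes k: "k \<in> M \<rightarrow>\<^sub>M count_space C" "countable C"
    and eq: "\<And>g. g \<in> carrier G \<Longrightarrow> \<exists>\<tau>. inj_on \<tau> C \<and> (AE x in M. k (\<alpha> g x) = \<tau> (k x))"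
  shows "\<exists>c\<in>C. AE x in M. k x = c"
proof -
  interpret MM: pair_sigma_finite M M ..
  interpret S: countable_action G "M \<Otimes>\<^sub>M M" "product_action M M \<alpha> \<alpha>" by (rule square_action)
  note [measurable] = k(1)
  have kC: "k x \<in> C" if "x \<in> space M" for x using measurable_space[OF k(1) that] by simp
  have lev: "{x \<in> space M. k x = c} \<in> sets M" if "c \<in> C" for c
    using measurable_sets[OF k(1), of "{c}"] that
    by (rule_tac rev_iffD1[OF _ arg_cong[where f="\<lambda>A. A \<in> sets M"]]) auto
  have D: "{z \<in> space (M \<Otimes>\<^sub>M M). k (fst z) = k (snd z)} \<in> sets (M \<Otimes>\<^sub>M M)"
  proof -
    have "{z \<in> space (M \<Otimes>\<^sub>M M). k (fst z) = k (snd z)} =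
        (\<Union>c\<in>C. {x \<in> space M. k x = c} \<times> {x \<in> space M. k x = c})"
      using kC by (auto simp: space_pair_measure)
    also have "\<dots> \<in> sets (M \<Otimes>\<^sub>M M)" using lev k(2) by (intro sets.countable_UN') auto
    finally show ?thesis .
  qed
  have "(AE z in M \<Otimes>\<^sub>M M. k (fst z) = k (snd z)) \<or> (AE z in M \<Otimes>\<^sub>M M. \<not> k (fst z) = k (snd z))"
  proof (rule S.ergodic_AE[OF _ D])
    show "ergodic_action G (M \<Otimes>\<^sub>M M) (product_action M M \<alpha> \<alpha>)" using wm by (simp add: weakly_mixing_action_def)
    fix g assume g: "g \<in> carrier G"
    obtain \<tau> where \<tau>: "inj_on \<tau> C" "AE x in M. k (\<alpha> g x) = \<tau> (k x)" using eq[OF g] by blast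
    have np: "null_preserving (M \<Otimes>\<^sub>M M) M fst" "null_preserving (M \<Otimes>\<^sub>M M) M snd"
    proof -
      have "fst -` A \<inter> space (M \<Otimes>\<^sub>M M) = A \<times> space M" "snd -` A \<inter> space (M \<Otimes>\<^sub>M M) = space M \<times> A"
        if "A \<in> sets M" for A
        using sets.sets_into_space[OF that] by (auto simp: space_pair_measure)
      then show "null_preserving (M \<Otimes>\<^sub>M M) M fst" "null_preserving (M \<Otimes>\<^sub>M M) M snd"
        by (auto simp: null_preserving_def null_sets_def emeasure_pair_measure_Times)
    qed
    show "AE z in M \<Otimes>\<^sub>M M. (k (fst (product_action M M \<alpha> \<alpha> g z)) = k (snd (product_action M M \<alpha> \<alpha> g z))) = (k (fst z) = k (snd z))"
      using null_preserving_AE[OF np(1) \<tau>(2)] null_preserving_AE[OF np(2) \<tau>(2)] AE_space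
    proof eventually_elim
      case (elim z)
      then have "k (fst z) \<in> C" "k (snd z) \<in> C" using kC by (auto simp: space_pair_measure)
      then show ?case using elim \<tau>(1) by (auto simp: product_action_def space_pair_measure dest: inj_onD)
    qed
  qed
  \<comment> \<open>Otherwise every level set of \<open>k\<close> would be null, as one sees from a
    generic point in it; but countably many level sets cover the space.\<close>
  moreover have "\<not> (AE z in M \<Otimes>\<^sub>M M. \<not> k (fst z) = k (snd z))"
  proof
    assume "AE z in M \<Otimes>\<^sub>M M. \<not> k (fst z) = k (snd z)"
    from MM.AE_pair[OF this] have a: "AE x in M. AE y in M. k x \<noteq> k y" by simp
    have "AE x in M. k x \<noteq> c" if c: "c \<in> C" for c
    proof (rule ccontr)
      assume n: "\<not> (AE x in M. k x \<noteq> c)"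
      have "\<exists>x. k x = c \<and> (AE y in M. k x \<noteq> k y)"
      proof (rule ccontr)
        assume *: "\<not> ?thesis"
        have "AE x in M. k x \<noteq> c" using a by eventually_elim (use * in blast)
        then show False using n by simp
      qed
      then obtain x where x: "k x = c" "AE y in M. k x \<noteq> k y" by blast
      from x(2) have "AE y in M. k y \<noteq> c" by eventually_elim (use x(1) in auto)
      then show False using n by simp
    qed
    then have "AE x in M. \<forall>c\<in>C. k x \<noteq> c" by (subst AE_ball_countable[OF k(2)]) blast
    then have "AE x in M. False" using AE_space by eventually_elim (use kC in auto)
    then show False using AE_False by simp
  qed
  ultimately have "AE z in M \<Otimes>\<^sub>M M. k (fst z) = k (snd z)" by blast
  from MM.AE_pair[OF this] have "AE x in M. x \<in> space M \<and> (AE y in M. k x = k y)" by simp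
  then obtain x where x: "x \<in> space M" "AE y in M. k x = k y" using eventually_happens'[OF ae_filter_bot] by blast
  from x(2) have "AE y in M. k y = k x" by eventually_elim simp
  then show ?thesis using kC[OF x(1)] by blast
qed

end

section \<open>Measurable selection\<close>

definition initial :: "(nat \<Rightarrow> nat) \<Rightarrow> nat \<Rightarrow> nat list" where
  "initial z k = map z [0..<k]"

lemma initial_Suc: "initial z (Suc k) = initial z k @ [z k]"
  by (simp add: initial_def)

lemma length_initial [simp]: "length (initial z k) = k"
  by (simp add: initial_def)

lemma nth_initial [simp]: "i < k \<Longrightarrow> initial z k ! i = z i"
  by (simp add: initial_def)

lemma take_initial: "j \<le> k \<Longrightarrow> take j (initial z k) = initial z j"
  by (simp add: initial_def take_map)

text \<open>\<open>extendible A b s y\<close>: below the bound \<open>b\<close>, the list \<open>s\<close> has extensions of every length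
  all of whose initial segments \<open>t\<close> satisfy \<open>y \<in> A t\<close>. By Koenig's lemma some infinite branch
  below \<open>b\<close> then extends \<open>s\<close>, and the leftmost one depends measurably on \<open>y\<close>.\<close>

definition good_lists :: "(nat list \<Rightarrow> 'y set) \<Rightarrow> (nat \<Rightarrow> nat) \<Rightarrow> nat list \<Rightarrow> nat \<Rightarrow> 'y \<Rightarrow> nat list set" where
  "good_lists A b s k y = {t. length t = length s + k \<and> take (length s) t = s \<and>
     (\<forall>i<length t. t ! i \<le> b i) \<and> (\<forall>j\<le>length t. y \<in> A (take j t))}"

definition extendible :: "(nat list \<Rightarrow> 'y set) \<Rightarrow> (nat \<Rightarrow> nat) \<Rightarrow> nat list \<Rightarrow> 'y \<Rightarrow> bool" where
  "extendible A b s y \<longleftrightarrow> (\<forall>k. good_lists A b s k y \<noteq> {})"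

lemma good_lists_shorten:
  assumes "t \<in> good_lists A b s k y" "l \<le> k"
  shows "take (length s + l) t \<in> good_lists A b s l y"
  using assms by (auto simp: good_lists_def min_def)

text \<open>The inductive step of Koenig's lemma. Below \<open>b\<close> there are finitely many
  one-step extensions; if each of them failed at some length, a list longer than all these lengths
  could not exist.\<close>

lemma extendible_step:
  assumes ext: "extendible A b s y"
  shows "\<exists>n. extendible A b (s @ [n]) y"
proof (rule ccontr)
  assume "\<nexists>n. extendible A b (s @ [n]) y"
  then obtain k where k: "\<And>n. good_lists A b (s @ [n]) (k n) y = {}"
    unfolding extendible_def by metis
  \<comment> \<open>A length at which all of the finitely many admissible extensions have already
    failed.\<close>
  define K where "K = Max (k ` {..b (length s)})"
  obtain t where t: "t \<in> good_lists A b s (Suc K) y" using ext unfolding extendible_def by blast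
  define n where "n = t ! length s"
  have lt: "length s < length t" using t by (simp add: good_lists_def)
  then have n: "n \<le> b (length s)" using t by (auto simp: good_lists_def n_def)
  have "take (Suc (length s)) t = s @ [n]" using t lt by (simp add: good_lists_def take_Suc_conv_app_nth n_def)
  then have "t \<in> good_lists A b (s @ [n]) K y" using t by (simp add: good_lists_def)
  moreover have "k n \<le> K" unfolding K_def by (rule Max_ge) (use n in auto)
  ultimately have "take (length (s @ [n]) + k n) t \<in> good_lists A b (s @ [n]) (k n) y" by (rule good_lists_shorten)
  then show False using k by blast
qed

lemma extendible_in: "extendible A b s y \<Longrightarrow> y \<in> A s"
  unfolding extendible_def good_lists_def by (drule spec[of _ 0]) (fastforce)

text \<open>Each entry is the smallest one that keeps the list extendible. This is meaningful only
  at points where the empty list is extendible; elsewhere the values are arbitrary but still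
  measurable in \<open>y\<close>.\<close>

primrec leftmost :: "(nat list \<Rightarrow> 'y set) \<Rightarrow> (nat \<Rightarrow> nat) \<Rightarrow> nat \<Rightarrow> 'y \<Rightarrow> nat list" where
  "leftmost A b 0 y = []"
| "leftmost A b (Suc k) y = leftmost A b k y @ [LEAST n. extendible A b (leftmost A b k y @ [n]) y]"

lemma extendible_leftmost:
  assumes "extendible A b [] y"
  shows "extendible A b (leftmost A b k y) y"
proof (induction k)
  case (Suc k)
  from extendible_step[OF Suc] show ?case by (auto intro: LeastI_ex)
qed (use assms in simp)

lemma leftmost_initial: "leftmost A b k y = initial (\<lambda>i. leftmost A b (Suc i) y ! i) k"
proof -
  have l: "length (leftmost A b k y) = k" for k by (induction k) auto
  show ?thesis
  proof (induction k)
    case (Suc k)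
    have "leftmost A b (Suc k) y ! k = (LEAST n. extendible A b (leftmost A b k y @ [n]) y)"
      by (simp add: nth_append l)
    then show ?case unfolding initial_Suc using Suc by simp
  qed (simp add: initial_def)
qed

text \<open>The bound \<open>b\<close> leaves finitely many lists of each length, so only finite
  unions and countable intersections of the sets \<open>A s\<close> occur.\<close>

lemma measurable_extendible:
  assumes A: "\<And>s. A s \<in> sets M"
  shows "{y \<in> space M. extendible A b s y} \<in> sets M"
proof -
  have fin: "finite {t. length t = n \<and> (\<forall>i<n. t ! i \<le> b i)}" for n
  proof (rule finite_subset)
    show "{t. length t = n \<and> (\<forall>i<n. t ! i \<le> b i)} \<subseteq> {t. set t \<subseteq> {..Max (b ` {..<n})} \<and> length t = n}"
    proof safe
      fix t :: "nat list" and x assume "\<forall>i<length t. t ! i \<le> b i" "x \<in> set t"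
      then obtain i where "i < length t" "x \<le> b i" by (auto simp: in_set_conv_nth)
      then show "x \<le> Max (b ` {..<length t})" by (meson Max_ge finite_imageI finite_lessThan image_eqI lessThan_iff order_trans)
    qed
    show "finite {t. set t \<subseteq> {..Max (b ` {..<n})} \<and> length t = n}" by (rule finite_lists_length_eq) simp
  qed
  let ?T = "\<lambda>k. {t. length t = length s + k \<and> take (length s) t = s \<and> (\<forall>i<length t. t ! i \<le> b i)}"
  have finT: "finite (?T k)" for k by (rule finite_subset[OF _ fin[of "length s + k"]]) auto
  have "{y \<in> space M. extendible A b s y} = {y \<in> space M. \<forall>k. \<exists>t\<in>?T k. \<forall>j\<in>{..length t}. y \<in> A (take j t)}"
    unfolding extendible_def good_lists_def by blast
  also have "\<dots> \<in> sets M"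
    using A finT
    by (intro sets.sets_Collect_countable_All sets.sets_Collect_finite_Ex sets.sets_Collect_finite_All')
      (auto simp: sets.Int_space_eq1 Collect_conj_eq)
  finally show ?thesis .
qed

lemma measurable_leftmost:
  assumes A: "\<And>s. A s \<in> sets M"
  shows "leftmost A b k \<in> M \<rightarrow>\<^sub>M count_space UNIV"
proof (induction k)
  case (Suc k)
  have L: "(\<lambda>y. LEAST n. extendible A b (s @ [n]) y) \<in> M \<rightarrow>\<^sub>M count_space UNIV" for s
    by (rule measurable_Least) (use measurable_extendible[OF A] in \<open>simp add: pred_def\<close>)
  have "(\<lambda>y. s @ [LEAST n. extendible A b (s @ [n]) y]) \<in> M \<rightarrow>\<^sub>M count_space UNIV" for s
    using measurable_compose[OF L[of s], of "\<lambda>n. s @ [n]" "count_space UNIV"] by simp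
  then show ?case
    using measurable_compose_countable'[where f="\<lambda>s y. s @ [LEAST n. extendible A b (s @ [n]) y]", OF _ Suc]
    by simp
qed simp

text \<open>Projections of Souslin sets are measurable up to small measure: the outer measure of the projection
  is almost attained on branches below some bound \<open>b\<close>.\<close>

lemma souslin_bound:
  fixes A :: "nat list \<Rightarrow> 'y set"
  assumes M: "finite_measure M" and A: "\<And>s. A s \<in> sets M"
    and ex: "\<And>y. y \<in> space M \<Longrightarrow> \<exists>z. \<forall>k. y \<in> A (initial z k)"
    and c: "c < emeasure M (space M)"
  shows "\<exists>b. c \<le> emeasure M {y \<in> space M. extendible A b [] y}"
proof -
  interpret finite_measure M by fact
  \<comment> \<open>A projection, possibly not measurable; therefore its outer measure is used,
    which is still continuous along increasing sequences.\<close>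
  define P where "P s = {y \<in> space M. \<exists>z. (\<forall>i<length s. z i \<le> s ! i) \<and> (\<forall>k. y \<in> A (initial z k))}" for s
  have step: "\<exists>n. c < outer_measure_of M (P (s @ [n]))" if s: "c < outer_measure_of M (P s)" for s
  proof -
    have inc: "incseq (\<lambda>n. P (s @ [n]))"
    proof (intro incseq_SucI subsetI)
      fix n y assume "y \<in> P (s @ [n])"
      then obtain z where z: "y \<in> space M" "\<forall>i<Suc (length s). z i \<le> (s @ [n]) ! i" "\<forall>k. y \<in> A (initial z k)"
        by (auto simp: P_def)
      then have "\<forall>i<Suc (length s). z i \<le> (s @ [Suc n]) ! i"
        by (auto simp: nth_append less_Suc_eq)
      then show "y \<in> P (s @ [Suc n])" using z by (auto simp: P_def)
    qed
    have "P s = (\<Union>n. P (s @ [n]))"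
    proof (intro equalityI subsetI)
      fix y assume "y \<in> P s"
      then obtain z where z: "y \<in> space M" "\<forall>i<length s. z i \<le> s ! i" "\<forall>k. y \<in> A (initial z k)"
        by (auto simp: P_def)
      then have "y \<in> P (s @ [z (length s)])" by (auto simp: P_def nth_append less_Suc_eq)
      then show "y \<in> (\<Union>n. P (s @ [n]))" by auto
    next
      fix y assume "y \<in> (\<Union>n. P (s @ [n]))"
      then obtain n z where z: "y \<in> space M" "\<forall>i<Suc (length s). z i \<le> (s @ [n]) ! i" "\<forall>k. y \<in> A (initial z k)"
        by (auto simp: P_def)
      have "z i \<le> s ! i" if "i < length s" for i using z(2)[rule_format, of i] that by (simp add: nth_append)
      then show "y \<in> P s" using z by (auto simp: P_def)
    qed
    moreover have "(SUP n. outer_measure_of M (P (s @ [n]))) = outer_measure_of M (\<Union>n. P (s @ [n]))"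
      by (rule SUP_outer_measure_of_incseq[OF _ inc]) (auto simp: P_def)
    ultimately have "c < (SUP n. outer_measure_of M (P (s @ [n])))" using s by metis
    then show ?thesis by (simp only: less_SUP_iff) auto
  qed
  \<comment> \<open>The bound is found entry by entry: each new entry is large enough to keep the
    outer measure above \<open>c\<close>.\<close>
  define B where "B = rec_nat [] (\<lambda>_ s. s @ [SOME n. c < outer_measure_of M (P (s @ [n]))])"
  have B0: "B 0 = []" and BS: "B (Suc k) = B k @ [SOME n. c < outer_measure_of M (P (B k @ [n]))]" for k
    by (simp_all add: B_def)
  have B: "c < outer_measure_of M (P (B k))" for k
  proof (induction k)
    case 0
    have "P [] = space M" using ex by (auto simp: P_def)
    then show ?case using c by (simp add: B0)
  next
    case (Suc k) then show ?case unfolding BS by (rule someI_ex[OF step])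
  qed
  have Bl: "length (B k) = k" for k by (induction k) (auto simp: B0 BS)
  define b where "b i = B (Suc i) ! i" for i
  have Bb: "i < k \<Longrightarrow> B k ! i = b i" for i k
  proof (induction k)
    case (Suc k)
    then show ?case by (cases "i = k") (auto simp: b_def BS nth_append Bl)
  qed simp
  \<comment> \<open>A measurable set that contains \<open>P (B k)\<close>. These sets decrease, so
    continuity of the measure transfers the lower bound \<open>c\<close> to their intersection, the
    set of extendible points.\<close>
  define Q where "Q k = {y \<in> space M. good_lists A b [] k y \<noteq> {}}" for k
  have Qm: "Q k \<in> sets M" for k
  proof -
    have "Q k = {y \<in> space M. \<exists>t\<in>{t. length t = k \<and> (\<forall>i<k. t ! i \<le> b i)}. \<forall>j\<in>{..length t}. y \<in> A (take j t)}"
      by (auto simp: Q_def good_lists_def)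
    also have "\<dots> \<in> sets M"
      using A by (intro sets.sets_Collect_countable_Ex' sets.sets_Collect_finite_All')
       (auto simp: Collect_conj_eq)
    finally show ?thesis .
  qed
  have PQ: "P (B k) \<subseteq> Q k" for k
  proof
    fix y assume "y \<in> P (B k)"
    then obtain z where "y \<in> space M" "\<forall>i<k. z i \<le> b i" "\<forall>k. y \<in> A (initial z k)" by (auto simp: P_def Bl Bb)
    then have "initial z k \<in> good_lists A b [] k y" "y \<in> space M" by (auto simp: good_lists_def take_initial)
    then show "y \<in> Q k" by (auto simp: Q_def)
  qed
  have dec: "decseq Q"
  proof (rule decseq_SucI, rule subsetI)
    fix k y assume "y \<in> Q (Suc k)"
    then show "y \<in> Q k" using good_lists_shorten[of _ A b "[]" "Suc k" y k] by (auto simp: Q_def)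
  qed
  have "c \<le> emeasure M (Q k)" for k
    using B[of k] outer_measure_of_mono[OF PQ[of k], of M] Qm[of k] by simp
  then have "c \<le> (INF k. emeasure M (Q k))" by (rule INF_greatest)
  also have "\<dots> = emeasure M (\<Inter>k. Q k)" by (rule INF_emeasure_decseq) (use Qm dec in auto)
  also have "(\<Inter>k. Q k) = {y \<in> space M. extendible A b [] y}" by (auto simp: Q_def extendible_def)
  finally show ?thesis by blast
qed

text \<open>Bounds whose extendible points miss at most \<open>1 / Suc n\<close> of the measure
  together exhaust the space up to a null set. A measurable choice \<open>m\<close> of the bound is
  followed by the leftmost branch below it.\<close>

lemma souslin_selection:
  fixes A :: "nat list \<Rightarrow> 'y set"
  assumes M: "finite_measure M" and A: "\<And>s. A s \<in> sets M"
    and ex: "\<And>y. y \<in> space M \<Longrightarrow> \<exists>z. \<forall>k. y \<in> A (initial z k)"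
  obtains Z where "\<And>i. Z i \<in> M \<rightarrow>\<^sub>M count_space UNIV" "AE y in M. \<forall>k. y \<in> A (initial (\<lambda>i. Z i y) k)"
proof -
  interpret finite_measure M by fact
  have "\<exists>b. emeasure M (space M) - ennreal (1 / Suc n) \<le> emeasure M {y \<in> space M. extendible A b [] y}" for n
  proof (cases "emeasure M (space M) = 0")
    case False
    then have lt: "emeasure M (space M) - ennreal (1 / Suc n) < emeasure M (space M)"
      by (intro ennreal_between) (auto simp: zero_less_iff_neq_zero less_top[symmetric])
    show ?thesis by (rule souslin_bound[OF M A ex lt])
  qed simp
  then obtain b where b: "\<And>n. emeasure M (space M) - ennreal (1 / Suc n) \<le> emeasure M {y \<in> space M. extendible A (b n) [] y}"
    by metis
  let ?E = "\<lambda>n. {y \<in> space M. extendible A (b n) [] y}"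
  have E: "?E n \<in> sets M" for n by (rule measurable_extendible[OF A])
  define N where "N = space M - (\<Union>n. ?E n)"
  have N: "N \<in> sets M" unfolding N_def using E by auto
  have "emeasure M N \<le> ennreal (1 / Suc n)" for n
  proof -
    have "emeasure M N \<le> emeasure M (space M - ?E n)" using E N by (intro emeasure_mono) (auto simp: N_def)
    also have "\<dots> = emeasure M (space M) - emeasure M (?E n)" using E by (intro emeasure_compl) (auto simp: emeasure_finite)
    also have "\<dots> \<le> ennreal (1 / Suc n)" using b[of n] by (simp add: ennreal_minus_le_iff ennreal_diff_le_mono_left add.commute)
    finally show ?thesis .
  qed
  then have le: "measure M N \<le> 1 / Suc n" for n by (simp add: emeasure_eq_measure)
  have "measure M N = 0"
  proof (rule ccontr)
    assume "measure M N \<noteq> 0"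
    then have "0 < measure M N" by (simp add: zero_less_measure_iff)
    from reals_Archimedean[OF this] obtain n where "inverse (real (Suc n)) < measure M N" by blast
    then show False using le[of n] by (simp add: inverse_eq_divide)
  qed
  then have "emeasure M N = 0" by (simp add: emeasure_eq_measure)
  then have "N \<in> null_sets M" using N by auto
  from AE_not_in[OF this] have "AE y in M. \<exists>n\<in>UNIV. extendible A (b n) [] y"
    using AE_space by eventually_elim (auto simp: N_def)
  then obtain m where m: "m \<in> M \<rightarrow>\<^sub>M count_space (UNIV::nat set)" "AE y in M. extendible A (b (m y)) [] y"
    using measurable_countable_choice[of UNIV M "\<lambda>n y. extendible A (b n) [] y"] E by blast
  define Z where "Z i y = leftmost A (b (m y)) (Suc i) y ! i" for i y
  show ?thesis
  proof
    show "Z i \<in> M \<rightarrow>\<^sub>M count_space UNIV" for i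
    proof -
      have "(\<lambda>y. leftmost A (b n) (Suc i) y ! i) \<in> M \<rightarrow>\<^sub>M count_space UNIV" for n
        by (rule measurable_compose[OF measurable_leftmost[OF A]]) simp
      then show ?thesis unfolding Z_def by (rule measurable_compose_countable'[OF _ m(1)]) auto
    qed
    show "AE y in M. \<forall>k. y \<in> A (initial (\<lambda>i. Z i y) k)"
      using m(2)
    proof eventually_elim
      case (elim y)
      show ?case
      proof
        fix k
        have "y \<in> A (leftmost A (b (m y)) k y)" by (rule extendible_in[OF extendible_leftmost[OF elim]])
        then show "y \<in> A (initial (\<lambda>i. Z i y) k)" unfolding Z_def leftmost_initial[symmetric] .
      qed
    qed
  qed
qed

lemma count_space_eq_sets:
  assumes "f \<in> M \<rightarrow>\<^sub>M count_space C" "g \<in> M \<rightarrow>\<^sub>M count_space C" "countable C"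
  shows "{x \<in> space M. f x = g x} \<in> sets M"
proof -
  have "{x \<in> space M. f x = g x} = (\<Union>c\<in>C. (f -` {c} \<inter> space M) \<inter> (g -` {c} \<inter> space M))"
    using measurable_space[OF assms(1)] measurable_space[OF assms(2)] by auto
  also have "\<dots> \<in> sets M"
    using assms by (intro sets.countable_UN' sets.Int measurable_sets) auto
  finally show ?thesis .
qed

lemma measurable_count_space_binop:
  assumes "f \<in> M \<rightarrow>\<^sub>M count_space C" "g \<in> M \<rightarrow>\<^sub>M count_space D" "countable C" "countable D"
    and "\<And>c d. c \<in> C \<Longrightarrow> d \<in> D \<Longrightarrow> h c d \<in> H"
  shows "(\<lambda>x. h (f x) (g x)) \<in> M \<rightarrow>\<^sub>M count_space H"
proof (rule measurable_compose_countable'[OF _ assms(1,3)])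
  fix c assume c: "c \<in> C"
  show "(\<lambda>x. h c (g x)) \<in> M \<rightarrow>\<^sub>M count_space H"
    by (rule measurable_compose[OF assms(2)]) (use assms c in auto)
qed

section \<open>A countable dense family of measurable functions\<close>

text \<open>Terms for the algebra generated by a sequence of sets. Countability of the datatype
  gives countability of the algebra.\<close>

datatype set_term = Gen nat | Neg set_term | Or set_term set_term

instance set_term :: countable by countable_datatype

primrec set_value :: "'x set \<Rightarrow> (nat \<Rightarrow> 'x set) \<Rightarrow> set_term \<Rightarrow> 'x set" where
  "set_value X E (Gen n) = E n"
| "set_value X E (Neg s) = X - set_value X E s"
| "set_value X E (Or s t) = set_value X E s \<union> set_value X E t"

lemma (in finite_measure) measure_sym_diff_triangle:
  assumes "A \<in> sets M" "B \<in> sets M" "C \<in> sets M"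
  shows "measure M (sym_diff A C) \<le> measure M (sym_diff A B) + measure M (sym_diff B C)"
proof -
  have "measure M (sym_diff A C) \<le> measure M (sym_diff A B \<union> sym_diff B C)"
    using assms by (intro finite_measure_mono) auto
  also have "\<dots> \<le> measure M (sym_diff A B) + measure M (sym_diff B C)"
    using assms by (intro measure_Un_le) auto
  finally show ?thesis .
qed

text \<open>The sets that can be approximated by values of terms form a sigma-algebra that contains
  the generators. For countable unions, continuity of the measure reduces to a finite union.\<close>

lemma dense_sets:
  assumes M: "finite_measure M" and E: "\<And>n::nat. E n \<in> sets M" "sets M = sigma_sets (space M) (range E)"
  shows "set_value (space M) E s \<in> sets M"
    and "A \<in> sets M \<Longrightarrow> 0 < e \<Longrightarrow> \<exists>s. measure M (sym_diff A (set_value (space M) E s)) < e"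
proof -
  interpret finite_measure M by fact
  let ?v = "set_value (space M) E"
  show v: "?v s \<in> sets M" for s by (induction s) (use E(1) in auto)
  assume A: "A \<in> sets M" and e: "0 < e"
  from A have "A \<in> sigma_sets (space M) (range E)" using E(2) by simp
  then have "\<forall>e>0. \<exists>s. measure M (sym_diff A (?v s)) < e"
  proof induction
    case (Basic a)
    then obtain n where "a = E n" by auto
    then show ?case by (intro allI impI exI[of _ "Gen n"]) simp
  next
    case Empty
    \<comment> \<open>A term for the empty set: the complement of the union of \<open>E 0\<close>
      and its complement.\<close>
    have "sym_diff {} (?v (Neg (Or (Gen 0) (Neg (Gen 0))))) = {}" using sets.sets_into_space[OF E(1)[of 0]] by auto
    then show ?case by (metis measure_empty)
  next
    case (Compl a)
    have a: "a \<in> sets M" using Compl.hyps E(2) by simp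
    show ?case
    proof (intro allI impI)
      fix e :: real assume "0 < e"
      then obtain s where s: "measure M (sym_diff a (?v s)) < e" using Compl.IH by blast
      have "sym_diff (space M - a) (?v (Neg s)) = sym_diff a (?v s)"
        using sets.sets_into_space[OF a] sets.sets_into_space[OF v[of s]] by auto
      then show "\<exists>s. measure M (sym_diff (space M - a) (?v s)) < e" using s by metis
    qed
  next
    case (Union a)
    have a: "a i \<in> sets M" for i using Union.hyps E(2) by simp
    have fin: "\<forall>e>0. \<exists>s. measure M (sym_diff (\<Union>i<Suc n. a i) (?v s)) < e" for n
    proof (induction n)
      case 0 then show ?case using Union.IH[of 0] by (simp add: lessThan_Suc)
    next
      case (Suc n)
      show ?case
      proof (intro allI impI)
        fix e :: real assume "0 < e"
        then have e2: "0 < e / 2" by simp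
        obtain s where s: "measure M (sym_diff (\<Union>i<Suc n. a i) (?v s)) < e / 2" using Suc e2 by blast
        obtain t where t: "measure M (sym_diff (a (Suc n)) (?v t)) < e / 2" using Union.IH e2 by blast
        have "measure M (sym_diff (\<Union>i<Suc (Suc n). a i) (?v (Or s t)))
          \<le> measure M (sym_diff (\<Union>i<Suc n. a i) (?v s) \<union> sym_diff (a (Suc n)) (?v t))"
          using a v by (intro finite_measure_mono) (auto simp: lessThan_Suc)
        also have "\<dots> \<le> measure M (sym_diff (\<Union>i<Suc n. a i) (?v s)) + measure M (sym_diff (a (Suc n)) (?v t))"
          using a v by (intro measure_Un_le) auto
        also have "\<dots> < e" using s t by simp
        finally show "\<exists>s. measure M (sym_diff (\<Union>i<Suc (Suc n). a i) (?v s)) < e" by blast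
      qed
    qed
    show ?case
    proof (intro allI impI)
      fix e :: real assume "0 < e"
      then have e2: "0 < e / 2" by simp
      let ?U = "\<Union>i. a i" and ?F = "\<lambda>n. \<Union>i<Suc n. a i"
      have "(\<lambda>n. measure M (?F n)) \<longlonglongrightarrow> measure M (\<Union>n. ?F n)"
        by (rule finite_Lim_measure_incseq) (use a in \<open>auto intro!: incseq_SucI simp: lessThan_Suc\<close>)
      moreover have "(\<Union>n. ?F n) = ?U" by auto
      ultimately have "(\<lambda>n. measure M (?F n)) \<longlonglongrightarrow> measure M ?U" by simp
      from LIMSEQ_D[OF this e2] obtain n where d1: "norm (measure M (?F n) - measure M ?U) < e / 2" by blast
      have d2: "measure M (?U - ?F n) = measure M ?U - measure M (?F n)"
        using a by (intro finite_measure_Diff) auto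
      have d3: "sym_diff ?U (?F n) = ?U - ?F n" by auto
      have n: "measure M (sym_diff ?U (?F n)) < e / 2"
        using d1 unfolding d3 d2 real_norm_def by linarith
      obtain s where s: "measure M (sym_diff (?F n) (?v s)) < e / 2" using fin e2 by blast
      have "measure M (sym_diff ?U (?v s)) \<le> measure M (sym_diff ?U (?F n)) + measure M (sym_diff (?F n) (?v s))"
        using a v by (intro measure_sym_diff_triangle) auto
      then show "\<exists>s. measure M (sym_diff ?U (?v s)) < e" using n s by (intro exI[of _ s]) linarith
    qed
  qed
  then show "\<exists>s. measure M (sym_diff A (?v s)) < e" using e by blast
qed

text \<open>Up to small measure, a function to a countable set takes only the first \<open>n\<close>
  values of an enumeration, and its finitely many level sets are approximated by members of a
  countable dense family. Finite lists of indices code the resulting functions.\<close>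

lemma dense_functions:
  fixes M :: "'x measure" and C :: "'c set"
  assumes M: "prob_space M" "standard_measure M" and C: "countable C" "C \<noteq> {}"
  obtains f :: "nat \<Rightarrow> 'x \<Rightarrow> 'c" where "\<And>n. f n \<in> M \<rightarrow>\<^sub>M count_space C"
    "\<And>\<phi> e. \<phi> \<in> M \<rightarrow>\<^sub>M count_space C \<Longrightarrow> 0 < e \<Longrightarrow> \<exists>n. measure M {x \<in> space M. f n x \<noteq> \<phi> x} < e"
proof -
  interpret prob_space M by fact
  obtain E :: "nat \<Rightarrow> 'x set" where E: "\<And>n. E n \<in> sets M" "sets M = sigma_sets (space M) (range E)"
    using standard_measure_separating[OF M(2)] by metis
  define B :: "nat \<Rightarrow> 'x set" where "B n = set_value (space M) E (from_nat n)" for n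
  have B: "B n \<in> sets M" for n unfolding B_def by (rule dense_sets(1)[OF finite_measure_axioms E])
  have dense: "\<exists>n. measure M (sym_diff A (B n)) < e" if A: "A \<in> sets M" "0 < e" for A e
    using dense_sets(2)[OF finite_measure_axioms E that] unfolding B_def by (metis from_nat_to_nat)
  define c where "c = from_nat_into C"
  have c: "range c = C" unfolding c_def by (rule range_from_nat_into[OF C(2,1)])
  \<comment> \<open>The code \<open>l\<close> assigns the value \<open>c j\<close> for the first
    \<open>j\<close> with \<open>x\<close> in the set number \<open>l ! j\<close>. The search stops
    at \<open>length l\<close> at the latest, so every list codes a total function.\<close>
  define g where "g l x = c (LEAST j. length l \<le> j \<or> x \<in> B (l ! j))" for l :: "nat list" and x
  have g: "g l \<in> M \<rightarrow>\<^sub>M count_space C" for l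
  proof -
    have "(\<lambda>x. LEAST j. length l \<le> j \<or> x \<in> B (l ! j)) \<in> M \<rightarrow>\<^sub>M count_space UNIV"
    proof (rule measurable_Least)
      fix j
      have "{x \<in> space M. length l \<le> j \<or> x \<in> B (l ! j)} = (if length l \<le> j then space M else B (l ! j))"
        using sets.sets_into_space[OF B[of "l ! j"]] by auto
      then show "(\<lambda>x. length l \<le> j \<or> x \<in> B (l ! j)) \<in> M \<rightarrow>\<^sub>M count_space UNIV"
        using B by (simp add: pred_def)
    qed
    from measurable_compose[OF this, of c "count_space C"] show ?thesis unfolding g_def using c by auto
  qed
  have approx: "\<exists>l. measure M {x \<in> space M. g l x \<noteq> \<phi> x} < e"
    if \<phi>: "\<phi> \<in> M \<rightarrow>\<^sub>M count_space C" and e: "0 < e" for \<phi> e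
  proof -
    define i where "i x = (LEAST j. c j = \<phi> x)" for x
    have ci: "c (i x) = \<phi> x" if "x \<in> space M" for x
    proof -
      have "\<phi> x \<in> range c" using measurable_space[OF \<phi> that] c by simp
      then show ?thesis unfolding i_def by (metis (mono_tags, lifting) LeastI rangeE)
    qed
    have im[measurable]: "i \<in> M \<rightarrow>\<^sub>M count_space UNIV"
    proof -
      have "{x \<in> space M. c j = \<phi> x} \<in> sets M" for j
        using count_space_eq_sets[OF _ \<phi> C(1), of "\<lambda>_. c j"] c by auto
      then show ?thesis unfolding i_def by (intro measurable_Least) (simp add: pred_def)
    qed
    have "(\<lambda>n. measure M {x \<in> space M. i x < n}) \<longlonglongrightarrow> measure M (\<Union>n. {x \<in> space M. i x < n})"
      by (rule finite_Lim_measure_incseq) (auto simp: incseq_def)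
    moreover have "(\<Union>n. {x \<in> space M. i x < n}) = space M" by auto
    ultimately have "(\<lambda>n. measure M {x \<in> space M. i x < n}) \<longlonglongrightarrow> 1" by (simp add: prob_space)
    from LIMSEQ_D[OF this, of "e/2"] e obtain n where "norm (measure M {x \<in> space M. i x < n} - 1) < e/2" by auto
    moreover have "measure M {x \<in> space M. \<not> i x < n} = 1 - measure M {x \<in> space M. i x < n}"
      by (rule prob_neg) measurable
    ultimately have n: "measure M {x \<in> space M. \<not> i x < n} < e / 2" by simp
    \<comment> \<open>Chosen so that \<open>n\<close> errors of size \<open>d\<close> add up to at
      most \<open>e / 2\<close>; the extra 1 covers \<open>n = 0\<close>.\<close>
    define d where "d = e / (2 * (real n + 1))"
    have d: "0 < d" using e by (simp add: d_def)
    have "\<exists>k. measure M (sym_diff {x \<in> space M. i x = j} (B k)) < d" for j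
      by (rule dense[OF _ d]) measurable
    then obtain k where k: "\<And>j. measure M (sym_diff {x \<in> space M. i x = j} (B (k j))) < d" by metis
    let ?l = "map k [0..<n]"
    let ?bad = "\<Union>j<n. sym_diff {x \<in> space M. i x = j} (B (k j))"
    have good: "g ?l x = \<phi> x" if x: "x \<in> space M" "i x < n" "x \<notin> ?bad" for x
    proof -
      have j: "x \<in> B (k j) \<longleftrightarrow> i x = j" if "j < n" for j
      proof -
        have "x \<notin> sym_diff {x \<in> space M. i x = j} (B (k j))" using x(3) that by blast
        then show ?thesis using x(1) by blast
      qed
      have "(LEAST j. length ?l \<le> j \<or> x \<in> B (?l ! j)) = i x"
      proof (rule Least_equality)
        show "length ?l \<le> i x \<or> x \<in> B (?l ! i x)" using j[of "i x"] x(2) by simp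
        fix y assume y: "length ?l \<le> y \<or> x \<in> B (?l ! y)"
        show "i x \<le> y"
        proof (cases "y < n")
          case True then show ?thesis using y j[of y] by simp
        next
          case False then show ?thesis using x(2) by simp
        qed
      qed
      then show ?thesis unfolding g_def using ci[OF x(1)] by simp
    qed
    have badm: "?bad \<in> sets M" using B im by (intro sets.finite_UN) auto
    have "measure M {x \<in> space M. g ?l x \<noteq> \<phi> x} \<le> measure M ({x \<in> space M. \<not> i x < n} \<union> ?bad)"
      using good badm by (intro finite_measure_mono) auto
    also have "\<dots> \<le> measure M {x \<in> space M. \<not> i x < n} + measure M ?bad"
      using badm by (intro measure_Un_le) auto
    also have "measure M ?bad \<le> (\<Sum>j<n. measure M (sym_diff {x \<in> space M. i x = j} (B (k j))))"
      using B by (intro finite_measure_subadditive_finite) auto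
    also have "\<dots> \<le> (\<Sum>j<n. d)" using k by (intro sum_mono less_imp_le) auto
    also have "\<dots> = real n * d" by simp
    also have "\<dots> \<le> e / 2"
    proof -
      have "real n * d \<le> (real n + 1) * d" using d by (intro mult_right_mono) auto
      also have "\<dots> = e / 2" unfolding d_def by (simp add: field_simps)
      finally show ?thesis .
    qed
    finally have "measure M {x \<in> space M. g ?l x \<noteq> \<phi> x} < e" using n by linarith
    then show ?thesis by blast
  qed
  show ?thesis
  proof (rule that[of "\<lambda>n. g (from_nat n)"])
    show "g (from_nat n) \<in> M \<rightarrow>\<^sub>M count_space C" for n by (rule g)
    fix \<phi> and e :: real assume "\<phi> \<in> M \<rightarrow>\<^sub>M count_space C" "0 < e"
    from approx[OF this] show "\<exists>n. measure M {x \<in> space M. g (from_nat n) x \<noteq> \<phi> x} < e" by (metis from_nat_to_nat)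
  qed
qed

section \<open>Choosing the untwisting measurably in the parameter\<close>

lemma (in sigma_finite_measure) equivalent_finite_measure:
  obtains M' where "finite_measure M'" "sets M' = sets M" "\<And>P. (AE x in M'. P x) \<longleftrightarrow> (AE x in M. P x)"
proof -
  obtain h where h: "h \<in> borel_measurable M" "integral\<^sup>N M h \<noteq> \<infinity>" "\<And>x. x \<in> space M \<Longrightarrow> 0 < h x"
    using Ex_finite_integrable_function by blast
  show ?thesis
  proof (rule that[of "density M h"])
    show "finite_measure (density M h)"
    proof
      have "emeasure (density M h) (space M) = integral\<^sup>N M h"
        by (subst emeasure_density) (use h in \<open>auto intro!: nn_integral_cong\<close>)
      then show "emeasure (density M h) (space (density M h)) \<noteq> \<infinity>" using h by simp
    qed
    show "(AE x in density M h. P x) \<longleftrightarrow> (AE x in M. P x)" for P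
      unfolding AE_density[OF h(1)] by (rule AE_cong) (use h(3) in auto)
  qed simp
qed

text \<open>A pair \<open>(\<phi>, \<delta>)\<close> is coded by a branch of naturals whose entries
  encode pairs: \<open>u\<close> of entry \<open>i\<close> is the index of a function from the dense
  family, required to converge fast in measure, and \<open>v\<close> of entry \<open>j\<close> is
  the index of the value of \<open>\<delta>\<close> at the group element \<open>e j\<close>. The
  conditions on initial segments are inequalities between measures of sections, hence measurable in
  \<open>y\<close>. Along a selected branch Borel-Cantelli produces the limit function and the exact
  untwisting identity.\<close>

lemma measurable_untwisting:
  fixes X :: "'x measure" and Y :: "'y measure" and P :: "'p monoid"
  assumes K: "countable_action K X \<alpha>" and X: "prob_space X" "standard_measure X" and Y: "sigma_finite_measure Y"
    and P: "group P" "countable (carrier P)"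
    and \<omega>: "\<And>k. k \<in> carrier K \<Longrightarrow> \<omega> k \<in> X \<Otimes>\<^sub>M Y \<rightarrow>\<^sub>M count_space (carrier P)"
    and ex: "AE y in Y. \<exists>\<phi> \<delta>. \<phi> \<in> X \<rightarrow>\<^sub>M count_space (carrier P) \<and> (\<forall>k\<in>carrier K. \<delta> k \<in> carrier P \<and>
        (AE x in X. \<phi> (\<alpha> k x) \<otimes>\<^bsub>P\<^esub> \<omega> k (x, y) = \<delta> k \<otimes>\<^bsub>P\<^esub> \<phi> x))"
  obtains \<Phi> D where "\<Phi> \<in> X \<Otimes>\<^sub>M Y \<rightarrow>\<^sub>M count_space (carrier P)"
    "\<And>k. k \<in> carrier K \<Longrightarrow> D k \<in> Y \<rightarrow>\<^sub>M count_space (carrier P)"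
    "AE y in Y. \<forall>k\<in>carrier K. AE x in X. \<Phi> (\<alpha> k x, y) \<otimes>\<^bsub>P\<^esub> \<omega> k (x, y) = D k y \<otimes>\<^bsub>P\<^esub> \<Phi> (x, y)"
proof -
  interpret K: countable_action K X \<alpha> by fact
  interpret X: prob_space X by fact
  interpret Y: sigma_finite_measure Y by fact
  interpret P: group P by fact
  \<comment> \<open>The selection theorem is stated for finite measures; a positive integrable
    density replaces \<open>Y\<close> by one without changing the null sets.\<close>
  obtain Y' where Y': "finite_measure Y'" "sets Y' = sets Y" "\<And>P. (AE x in Y'. P x) \<longleftrightarrow> (AE x in Y. P x)"
    by (rule Y.equivalent_finite_measure) (rule that)
  have sp: "space Y' = space Y" using sets_eq_imp_space_eq[OF Y'(2)] .
  obtain f :: "nat \<Rightarrow> 'x \<Rightarrow> 'p" where f: "\<And>n. f n \<in> X \<rightarrow>\<^sub>M count_space (carrier P)"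
    and dense: "\<And>\<phi> e. \<phi> \<in> X \<rightarrow>\<^sub>M count_space (carrier P) \<Longrightarrow> 0 < e \<Longrightarrow> \<exists>n. measure X {x \<in> space X. f n x \<noteq> \<phi> x} < e"
    using dense_functions[OF X P(2)] P.one_closed by blast
  define e where "e = from_nat_into (carrier K)"
  have e: "range e = carrier K" unfolding e_def by (rule range_from_nat_into) (use K.cnt K.one_closed in auto)
  have eK: "e j \<in> carrier K" for j using e by blast
  define c where "c = from_nat_into (carrier P)"
  have c: "range c = carrier P" unfolding c_def by (rule range_from_nat_into) (use P P.one_closed in auto)
  have cP: "c j \<in> carrier P" for j using c by blast
  define B1 where "B1 n m = {x \<in> space X. f n x \<noteq> f m x}" for n m
  define W where "W n j m = {z \<in> space (Y \<Otimes>\<^sub>M X). f n (\<alpha> (e j) (snd z)) \<otimes>\<^bsub>P\<^esub> \<omega> (e j) (snd z, fst z) \<noteq> c m \<otimes>\<^bsub>P\<^esub> f n (snd z)}" for n j m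
  define B2 where "B2 n j m y = {x \<in> space X. f n (\<alpha> (e j) x) \<otimes>\<^bsub>P\<^esub> \<omega> (e j) (x, y) \<noteq> c m \<otimes>\<^bsub>P\<^esub> f n x}" for n j m y
  have neq: "{x \<in> space L. p x \<noteq> q x} \<in> sets L" if "p \<in> L \<rightarrow>\<^sub>M count_space (carrier P)" "q \<in> L \<rightarrow>\<^sub>M count_space (carrier P)" for L :: "'l measure" and p q
    using sets.sets_Collect_neg[OF count_space_eq_sets[OF that P(2)]] .
  have B1m: "B1 n m \<in> sets X" for n m unfolding B1_def by (rule neq[OF f f])
  have prodm: "(\<lambda>x. p x \<otimes>\<^bsub>P\<^esub> q x) \<in> L \<rightarrow>\<^sub>M count_space (carrier P)"
    if "p \<in> L \<rightarrow>\<^sub>M count_space (carrier P)" "q \<in> L \<rightarrow>\<^sub>M count_space (carrier P)" for L :: "'l measure" and p q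
    using measurable_count_space_binop[OF that P(2,2), of "\<lambda>a b. a \<otimes>\<^bsub>P\<^esub> b"] by simp
  have Wm: "W n j m \<in> sets (Y \<Otimes>\<^sub>M X)" for n j m
  proof -
    have a: "(\<lambda>z. \<alpha> (e j) (snd z)) \<in> Y \<Otimes>\<^sub>M X \<rightarrow>\<^sub>M X"
      by (rule measurable_compose[OF measurable_snd K.act_measurable[OF eK]])
    have b: "(\<lambda>z. \<omega> (e j) (snd z, fst z)) \<in> Y \<Otimes>\<^sub>M X \<rightarrow>\<^sub>M count_space (carrier P)"
      by (rule measurable_compose[OF _ \<omega>[OF eK]]) measurable
    show ?thesis unfolding W_def
      by (intro neq prodm measurable_compose[OF a f] b measurable_compose[OF measurable_snd f])
        (use cP in auto)
  qed
  have WB: "Pair y -` W n j m = B2 n j m y" if "y \<in> space Y" for y n j m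
    using that by (auto simp: W_def B2_def space_pair_measure)
  have B2m: "B2 n j m y \<in> sets X" if "y \<in> space Y" for y n j m
    unfolding WB[OF that, symmetric] by (rule sets_Pair1[OF Wm])
  obtain N where N: "N \<in> null_sets Y" "{y \<in> space Y. \<not> (\<exists>\<phi> \<delta>. \<phi> \<in> X \<rightarrow>\<^sub>M count_space (carrier P) \<and> (\<forall>k\<in>carrier K. \<delta> k \<in> carrier P \<and>
        (AE x in X. \<phi> (\<alpha> k x) \<otimes>\<^bsub>P\<^esub> \<omega> k (x, y) = \<delta> k \<otimes>\<^bsub>P\<^esub> \<phi> x)))} \<subseteq> N"
    using ex unfolding eventually_ae_filter by blast
  define u where "u n = fst (prod_decode n)" for n
  define v where "v n = snd (prod_decode n)" for n
  define cond1 where "cond1 s = (\<forall>i. Suc i < length s \<longrightarrow> measure X (B1 (u (s ! i)) (u (s ! Suc i))) \<le> (1/2) ^ i)" for s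
  \<comment> \<open>The exceptional null set \<open>N\<close> is put into every \<open>A s\<close>,
    because the selection theorem asks for a branch at every point.\<close>
  define A where "A s = N \<union> {y \<in> space Y. cond1 s \<and>
     (\<forall>i\<in>{..<length s}. \<forall>j\<in>{..<length s}. measure X (B2 (u (s ! i)) j (v (s ! j)) y) \<le> (1/2) ^ i)}" for s
  have Am: "A s \<in> sets Y" for s
  proof -
    have m: "(\<lambda>y. measure X (Pair y -` W n j m)) \<in> borel_measurable Y" for n j m
      unfolding measure_def by (intro borel_measurable_enn2real X.measurable_emeasure_Pair Wm)
    have "{y \<in> space Y. measure X (B2 n j m y) \<le> r} \<in> sets Y" for n j m r
    proof -
      have "{y \<in> space Y. measure X (B2 n j m y) \<le> r} = {y \<in> space Y. measure X (Pair y -` W n j m) \<le> r}"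
        using WB by auto
      also have "\<dots> \<in> sets Y" using m[of n j m] by measurable
      finally show ?thesis .
    qed
    then have "{y \<in> space Y. \<forall>i\<in>{..<length s}. \<forall>j\<in>{..<length s}. measure X (B2 (u (s ! i)) j (v (s ! j)) y) \<le> (1/2) ^ i} \<in> sets Y"
      by (intro sets.sets_Collect_finite_All) auto
    then show ?thesis unfolding A_def using N(1) by (intro sets.Un) auto
  qed
  have branch: "\<exists>z. \<forall>k. y \<in> A (initial z k)" if y: "y \<in> space Y" for y
  proof (cases "y \<in> N")
    case True then show ?thesis by (auto simp: A_def)
  next
    case False
    then obtain \<phi> \<delta> where \<phi>: "\<phi> \<in> X \<rightarrow>\<^sub>M count_space (carrier P)"
      and \<delta>: "\<And>k. k \<in> carrier K \<Longrightarrow> \<delta> k \<in> carrier P"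
      and eq: "\<And>k. k \<in> carrier K \<Longrightarrow> AE x in X. \<phi> (\<alpha> k x) \<otimes>\<^bsub>P\<^esub> \<omega> k (x, y) = \<delta> k \<otimes>\<^bsub>P\<^esub> \<phi> x"
      using N(2) y by blast
    define C where "C n = {x \<in> space X. f n x \<noteq> \<phi> x}" for n
    have C: "C n \<in> sets X" for n unfolding C_def by (rule neq[OF f \<phi>])
    have "\<exists>n. measure X (C n) < (1/2) ^ i / 2" for i :: nat unfolding C_def by (rule dense[OF \<phi>]) simp
    then obtain n where n: "\<And>i. measure X (C (n i)) < (1/2) ^ i / 2" by metis
    have "\<exists>m. c m = \<delta> (e j)" for j using \<delta>[OF eK] c by (metis imageE)
    then obtain m where m: "\<And>j. c (m j) = \<delta> (e j)" by metis
    define z where "z i = prod_encode (n i, m i)" for i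
    have uv: "u (z i) = n i" "v (z i) = m i" for i by (simp_all add: z_def u_def v_def)
    have c1: "measure X (B1 (n i) (n (Suc i))) \<le> (1/2) ^ i" for i
    proof -
      have "measure X (B1 (n i) (n (Suc i))) \<le> measure X (C (n i) \<union> C (n (Suc i)))"
        using C by (intro X.finite_measure_mono) (auto simp: B1_def C_def)
      also have "\<dots> \<le> measure X (C (n i)) + measure X (C (n (Suc i)))" using C by (intro measure_Un_le) auto
      also have "\<dots> \<le> (1/2) ^ i / 2 + (1/2) ^ Suc i / 2" using n by (intro add_mono less_imp_le)
      also have "\<dots> \<le> (1/2) ^ i" by simp
      finally show ?thesis .
    qed
    have c2: "measure X (B2 (n i) j (m j) y) \<le> (1/2) ^ i" for i j
    proof -
      let ?C' = "\<alpha> (e j) -` C (n i) \<inter> space X"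
      have C': "?C' \<in> sets X" by (rule measurable_sets[OF K.act_measurable[OF eK] C])
      have "measure X (B2 (n i) j (m j) y) \<le> measure X (?C' \<union> C (n i))"
      proof (rule X.finite_measure_mono_AE)
        show "AE x in X. x \<in> B2 (n i) j (m j) y \<longrightarrow> x \<in> ?C' \<union> C (n i)"
          using eq[OF eK[of j]] AE_space
        proof eventually_elim
          case (elim x)
          then have "\<alpha> (e j) x \<in> space X" using eK by auto
          then show ?case using elim by (auto simp: B2_def C_def m)
        qed
      qed (use C C' in auto)
      also have "\<dots> \<le> measure X ?C' + measure X (C (n i))" using C C' by (intro measure_Un_le) auto
      also have "measure X ?C' = measure X (C (n i))"
        unfolding measure_def K.act_emeasure[OF eK C] ..
      also have "measure X (C (n i)) + measure X (C (n i)) \<le> (1/2) ^ i" using n[of i] by simp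
      finally show ?thesis .
    qed
    show ?thesis
      by (intro exI[of _ z]) (use y c1 c2 in \<open>auto simp: A_def cond1_def uv\<close>)
  qed
  obtain Z where Z: "\<And>i. Z i \<in> Y \<rightarrow>\<^sub>M count_space UNIV" and ZA: "AE y in Y. \<forall>k. y \<in> A (initial (\<lambda>i. Z i y) k)"
  proof (rule souslin_selection[OF Y'(1), of A])
    show "A s \<in> sets Y'" for s using Am Y'(2) by simp
    show "y \<in> space Y' \<Longrightarrow> \<exists>z. \<forall>k. y \<in> A (initial z k)" for y using branch sp by simp
    fix Z assume "\<And>i::nat. Z i \<in> Y' \<rightarrow>\<^sub>M count_space (UNIV :: nat set)" "AE y in Y'. \<forall>k. y \<in> A (initial (\<lambda>i. Z i y) k)"
    then show thesis using that[of Z] measurable_cong_sets[OF Y'(2) refl] Y'(3) by blast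
  qed
  define F where "F i z = f (u (Z i (snd z))) (fst z)" for i z
  have F: "F i \<in> X \<Otimes>\<^sub>M Y \<rightarrow>\<^sub>M count_space (carrier P)" for i
    unfolding F_def
  proof (rule measurable_compose_countable'[where I=UNIV and f="\<lambda>n z. f n (fst z)"])
    show "(\<lambda>z. u (Z i (snd z))) \<in> X \<Otimes>\<^sub>M Y \<rightarrow>\<^sub>M count_space UNIV"
      by (rule measurable_compose[OF measurable_compose[OF measurable_snd Z]]) simp
  qed (auto intro: measurable_compose[OF measurable_fst f])
  \<comment> \<open>The value at which the sequence \<open>F i z\<close> becomes stationary. It does
    so almost everywhere by Borel-Cantelli; at other points the definition still gives a measurable
    default.\<close>
  define \<Phi> where "\<Phi> z = F (LEAST n. \<forall>i. n \<le> i \<longrightarrow> F i z = F n z) z" for z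
  have Pm: "\<Phi> \<in> X \<Otimes>\<^sub>M Y \<rightarrow>\<^sub>M count_space (carrier P)"
    unfolding \<Phi>_def
  proof (rule measurable_compose_countable'[OF F])
    have "{z \<in> space (X \<Otimes>\<^sub>M Y). \<forall>i. n \<le> i \<longrightarrow> F i z = F n z} \<in> sets (X \<Otimes>\<^sub>M Y)" for n
    proof (rule sets.sets_Collect_countable_All)
      fix i show "{z \<in> space (X \<Otimes>\<^sub>M Y). n \<le> i \<longrightarrow> F i z = F n z} \<in> sets (X \<Otimes>\<^sub>M Y)"
        using count_space_eq_sets[OF F F P(2), of i n] by (cases "n \<le> i") auto
    qed
    then have "(\<lambda>z. \<forall>i. n \<le> i \<longrightarrow> F i z = F n z) \<in> X \<Otimes>\<^sub>M Y \<rightarrow>\<^sub>M count_space UNIV" for n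
      unfolding pred_def .
    then show "(\<lambda>z. LEAST n. \<forall>i. n \<le> i \<longrightarrow> F i z = F n z) \<in> X \<Otimes>\<^sub>M Y \<rightarrow>\<^sub>M count_space UNIV"
      by (rule measurable_Least)
  qed auto
  \<comment> \<open>The enumeration \<open>e\<close> may repeat elements; the least index of
    \<open>k\<close> decides which entry of the branch is read.\<close>
  define D where "D k y = c (v (Z (LEAST j. e j = k) y))" for k y
  have Dm: "D k \<in> Y \<rightarrow>\<^sub>M count_space (carrier P)" for k
    unfolding D_def by (rule measurable_compose[OF Z]) (use cP in auto)
  have "summable (\<lambda>i. (1/2) ^ i :: real)" by (rule summable_geometric) simp
  then have summ: "summable (\<lambda>i. measure X (C i))" if "\<And>i. measure X (C i) \<le> (1/2) ^ i" for C
    by (rule summable_comparison_test'[where N=0]) (use that in simp)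
  have "AE y in Y. \<forall>k\<in>carrier K. AE x in X. \<Phi> (\<alpha> k x, y) \<otimes>\<^bsub>P\<^esub> \<omega> k (x, y) = D k y \<otimes>\<^bsub>P\<^esub> \<Phi> (x, y)"
    using ZA AE_not_in[OF N(1)] AE_space
  proof eventually_elim
    case (elim y)
    have y: "y \<in> space Y" by fact
    have A: "y \<in> A (initial (\<lambda>i. Z i y) k)" for k using elim(1) by blast
    have yN: "y \<notin> N" by fact
    have c1: "measure X (B1 (u (Z i y)) (u (Z (Suc i) y))) \<le> (1/2) ^ i" for i
      using A[of "Suc (Suc i)"] yN by (auto simp: A_def cond1_def)
    \<comment> \<open>The inequality involves the entries \<open>i\<close> and \<open>j\<close>, so
      the initial segment must be long enough to contain both.\<close>
    have c2: "measure X (B2 (u (Z i y)) j (v (Z j y)) y) \<le> (1/2) ^ i" for i j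
      using A[of "Suc (max i j)"] yN by (auto simp: A_def)
    have "AE x in X. eventually (\<lambda>i. x \<in> space X - B1 (u (Z i y)) (u (Z (Suc i) y))) sequentially"
      by (rule borel_cantelli_AE1) (use B1m c1 in \<open>auto intro: summ simp: X.emeasure_finite less_top[symmetric]\<close>)
    then have lim: "AE x in X. \<forall>\<^sub>F i in sequentially. F i (x, y) = \<Phi> (x, y)"
    proof eventually_elim
      case (elim x)
      then obtain n where n: "\<And>i. n \<le> i \<Longrightarrow> F i (x, y) = F (Suc i) (x, y)"
        by (auto simp: eventually_sequentially B1_def F_def)
      have "\<forall>i. n \<le> i \<longrightarrow> F i (x, y) = F n (x, y)"
      proof (intro allI impI)
        fix i assume "n \<le> i"
        then show "F i (x, y) = F n (x, y)"
        proof (induction rule: dec_induct)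
          case (step m) then show ?case using n[of m] by simp
        qed simp
      qed
      then have "\<forall>i. (LEAST n. \<forall>i. n \<le> i \<longrightarrow> F i (x, y) = F n (x, y)) \<le> i \<longrightarrow> F i (x, y) = \<Phi> (x, y)"
        unfolding \<Phi>_def by (rule LeastI)
      then show ?case unfolding eventually_sequentially by blast
    qed
    show ?case
    proof
      fix k assume k: "k \<in> carrier K"
      define j where "j = (LEAST j. e j = k)"
      have j: "e j = k" unfolding j_def using k e by (metis (mono_tags, lifting) LeastI imageE)
      have "AE x in X. eventually (\<lambda>i. x \<in> space X - B2 (u (Z i y)) j (v (Z j y)) y) sequentially"
        by (rule borel_cantelli_AE1) (use B2m[OF y] c2 in \<open>auto intro: summ simp: X.emeasure_finite less_top[symmetric]\<close>)
      then show "AE x in X. \<Phi> (\<alpha> k x, y) \<otimes>\<^bsub>P\<^esub> \<omega> k (x, y) = D k y \<otimes>\<^bsub>P\<^esub> \<Phi> (x, y)"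
        using lim K.act_AE[OF lim k] AE_space
      proof eventually_elim
        case (elim x)
        from elim(1-3) have "\<forall>\<^sub>F i in sequentially. \<Phi> (\<alpha> k x, y) \<otimes>\<^bsub>P\<^esub> \<omega> k (x, y) = D k y \<otimes>\<^bsub>P\<^esub> \<Phi> (x, y)"
        proof eventually_elim
          case (elim i)
          then show ?case by (auto simp: B2_def F_def j D_def j_def[symmetric])
        qed
        then show ?case by simp
      qed
    qed
  qed
  with Pm Dm show ?thesis by (rule that)
qed

section \<open>Extensions of superrigid actions\<close>

locale superrigid_extension =
  fixes \<Gamma> :: "'a monoid" and \<Lambda> :: "'l monoid" and \<pi> :: "'a \<Rightarrow> 'l"
    and X :: "'x measure" and \<alpha> :: "'a \<Rightarrow> 'x \<Rightarrow> 'x"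
    and Y :: "'y measure" and \<beta> :: "'l \<Rightarrow> 'y \<Rightarrow> 'y"
  assumes \<Gamma>: "group \<Gamma>" "countable (carrier \<Gamma>)" and \<Lambda>: "group \<Lambda>" "countable (carrier \<Lambda>)"
    and \<pi>: "\<pi> \<in> epi \<Gamma> \<Lambda>"
    and Y: "standard_measure Y" "emeasure Y (space Y) = \<infinity>"
    and \<beta>: "mp_action \<Lambda> Y \<beta>" "ergodic_action \<Lambda> Y \<beta>"
    and X: "standard_measure X" "prob_space X"
    and \<alpha>: "mp_action \<Gamma> X \<alpha>" "free_action \<Gamma> X \<alpha>"
    and superrigid: "U_fin_cocycle_superrigid (kernel_group \<Gamma> \<Lambda> \<pi>) X \<alpha>"
    and weakly_mixing: "weakly_mixing_action (kernel_group \<Gamma> \<Lambda> \<pi>) X \<alpha>"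
    and no_hom: "\<And>\<theta> k. \<theta> \<in> hom (kernel_group \<Gamma> \<Lambda> \<pi>) \<Lambda> \<Longrightarrow> k \<in> kernel \<Gamma> \<Lambda> \<pi> \<Longrightarrow> \<theta> k = \<one>\<^bsub>\<Lambda>\<^esub>"
    and conjugations: "\<And>\<Delta>. is_conjugation (kernel_group \<Gamma> \<Lambda> \<pi>) X \<alpha> \<Delta> \<Longrightarrow>
               \<exists>g\<in>carrier \<Gamma>. AE x in X. \<Delta> x = \<alpha> g x"
begin

abbreviation N where "N \<equiv> kernel_group \<Gamma> \<Lambda> \<pi>"
abbreviation Z where "Z \<equiv> X \<Otimes>\<^sub>M Y"
abbreviation \<sigma> where "\<sigma> \<equiv> product_action X Y \<alpha> (\<lambda>g. \<beta> (\<pi> g))"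
abbreviation mul (infixl "\<cdot>" 70) where "g \<cdot> h \<equiv> g \<otimes>\<^bsub>\<Gamma>\<^esub> h"
abbreviation iv where "iv g \<equiv> inv\<^bsub>\<Gamma>\<^esub> g"

sublocale G: group \<Gamma> by (rule \<Gamma>)
sublocale L: group \<Lambda> by (rule \<Lambda>)
sublocale hom: group_hom \<Gamma> \<Lambda> \<pi>
  using \<pi> by unfold_locales (auto simp: epi_def)

lemma surj_\<pi>: "\<pi> ` carrier \<Gamma> = carrier \<Lambda>"
  using \<pi> by (simp add: epi_def)

sublocale X: prob_space X by (rule X)
sublocale Y: sigma_finite_measure Y by (rule standard_sigma_finite[OF Y(1)])
sublocale XY: pair_sigma_finite X Y ..
sublocale YX: pair_sigma_finite Y X ..
sublocale XA: countable_action \<Gamma> X \<alpha>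
  using \<Gamma> \<alpha> by unfold_locales auto
sublocale LA: countable_action \<Lambda> Y \<beta>
  using \<Lambda> \<beta> by unfold_locales auto

lemma mp_Y: "mp_action \<Gamma> Y (\<lambda>g. \<beta> (\<pi> g))"
  unfolding mp_action_def
proof (intro conjI ballI)
  show "group_action \<Gamma> (space Y) (\<lambda>g. \<beta> (\<pi> g))"
  proof (rule group_actionI[OF \<Gamma>(1)])
    fix g assume "g \<in> carrier \<Gamma>"
    then show "\<beta> (\<pi> g) \<in> extensional (space Y)" using LA.bij_prop0[of "\<pi> g"] by (simp add: Bij_def)
  qed (auto simp: LA.act_mult)
qed (auto simp: LA.act_distr)

sublocale YA: countable_action \<Gamma> Y "\<lambda>g. \<beta> (\<pi> g)"
  using \<Gamma> mp_Y by unfold_locales auto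

sublocale ZA: countable_action \<Gamma> Z \<sigma>
  using \<Gamma> mp_action_product[OF \<Gamma>(1) \<alpha>(1) _ mp_Y] X.sigma_finite_measure_axioms Y.sigma_finite_measure_axioms
  by unfold_locales auto

lemma standard_Z: "standard_measure Z"
  by (rule standard_measure_pair[OF X(1) Y(1)])

lemma carrier_N: "carrier N = kernel \<Gamma> \<Lambda> \<pi>"
  and N_mult [simp]: "x \<otimes>\<^bsub>N\<^esub> y = x \<cdot> y" and N_one [simp]: "\<one>\<^bsub>N\<^esub> = \<one>\<^bsub>\<Gamma>\<^esub>"
  by (simp_all add: kernel_group_def)

lemma N_iff: "n \<in> carrier N \<longleftrightarrow> n \<in> carrier \<Gamma> \<and> \<pi> n = \<one>\<^bsub>\<Lambda>\<^esub>"
  by (simp add: carrier_N kernel_def)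

lemma N_in [simp]: "n \<in> carrier N \<Longrightarrow> n \<in> carrier \<Gamma>"
  by (simp add: N_iff)

lemma N_\<pi> [simp]: "n \<in> carrier N \<Longrightarrow> \<pi> n = \<one>\<^bsub>\<Lambda>\<^esub>"
  by (simp add: N_iff)

lemma N_conj: "n \<in> carrier N \<Longrightarrow> g \<in> carrier \<Gamma> \<Longrightarrow> g \<cdot> n \<cdot> iv g \<in> carrier N"
  unfolding N_iff[of "g \<cdot> n \<cdot> iv g"] by simp

lemma N_conj': "n \<in> carrier N \<Longrightarrow> g \<in> carrier \<Gamma> \<Longrightarrow> iv g \<cdot> n \<cdot> g \<in> carrier N"
  unfolding N_iff[of "iv g \<cdot> n \<cdot> g"] by simp

lemma group_N: "group N"
  unfolding kernel_group_def by (rule G.subgroup_imp_group[OF hom.subgroup_kernel])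

lemma countable_N: "countable (carrier N)"
  by (rule countable_subset[OF _ \<Gamma>(2)]) auto

lemma mp_N: "mp_action N X \<alpha>"
  unfolding mp_action_def
proof (intro conjI ballI)
  show "group_action N (space X) \<alpha>"
    by (rule group_actionI[OF group_N]) (use XA.bij_prop0 in \<open>auto simp: XA.act_mult Bij_def\<close>)
qed (auto simp: XA.act_distr)

sublocale NX: weakly_mixing_countable N X \<alpha>
  using group_N countable_N mp_N weakly_mixing
  by (auto simp: weakly_mixing_countable_def weakly_mixing_countable_axioms_def countable_action_def
      countable_action_axioms_def X(2))

lemma space_Z_pair [simp]: "(x, y) \<in> space Z \<longleftrightarrow> x \<in> space X \<and> y \<in> space Y"
  by (simp add: space_pair_measure)

lemma space_ZD [simp]: "z \<in> space Z \<Longrightarrow> fst z \<in> space X" "z \<in> space Z \<Longrightarrow> snd z \<in> space Y"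
  by (auto simp: space_pair_measure)

lemma fst_\<sigma> [simp]: "z \<in> space Z \<Longrightarrow> fst (\<sigma> g z) = \<alpha> g (fst z)"
  and snd_\<sigma> [simp]: "z \<in> space Z \<Longrightarrow> snd (\<sigma> g z) = \<beta> (\<pi> g) (snd z)"
  by (simp_all add: product_action_def space_pair_measure)

lemma \<sigma>_pair [simp]: "x \<in> space X \<Longrightarrow> y \<in> space Y \<Longrightarrow> \<sigma> g (x, y) = (\<alpha> g x, \<beta> (\<pi> g) y)"
  by (simp add: product_action_def)

lemma AE_sections: "AE z in Z. Q z \<Longrightarrow> AE y in Y. AE x in X. Q (x, y)"
  by (rule XY.AE_pair_swap)

lemma null_preserving_snd: "null_preserving Z Y snd"
proof (rule null_preservingI)
  fix A assume A: "A \<in> null_sets Y"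
  have [measurable]: "A \<in> sets Y" using A by auto
  have "{z \<in> space Z. snd z \<notin> A} \<in> sets Z" by measurable
  then show "AE z in Z. snd z \<notin> A"
    by (rule XY.AE_pair_measure_swap) (use AE_not_in[OF A] in simp)
qed simp

lemma null_preserving_fst: "null_preserving Z X fst"
proof (rule null_preservingI)
  fix A assume A: "A \<in> null_sets X"
  have [measurable]: "A \<in> sets X" using A by auto
  have "{z \<in> space Z. fst z \<notin> A} \<in> sets Z" by measurable
  then show "AE z in Z. fst z \<notin> A"
  proof (rule XY.AE_pair_measure)
    show "AE x in X. AE y in Y. fst (x, y) \<notin> A" using AE_not_in[OF A] by eventually_elim simp
  qed
qed simp

lemma AE_snd: "AE y in Y. Q y \<Longrightarrow> AE z in Z. Q (snd z)"
  by (rule null_preserving_AE[OF null_preserving_snd])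

lemma AE_sndD: "AE z in Z. Q (snd z) \<Longrightarrow> AE y in Y. Q y"
  using AE_sections[of "\<lambda>z. Q (snd z)"] by (simp add: X.AE_const)

lemma AE_N_sections:
  assumes "\<And>n. n \<in> carrier N \<Longrightarrow> AE z in Z. Q n z"
  shows "AE y in Y. \<forall>n\<in>carrier N. AE x in X. Q n (x, y)"
  using AE_sections[OF assms] by (subst AE_ball_countable[OF countable_N]) blast

lemma \<sigma>_measurable [measurable]: "g \<in> carrier \<Gamma> \<Longrightarrow> \<sigma> g \<in> Z \<rightarrow>\<^sub>M Z"
  by (rule ZA.act_measurable)

section \<open>Freeness and orbits\<close>

text \<open>Freeness is read off the point of \<open>X\<close>, where the action is free; the action
  on \<open>Y\<close> factors through \<open>\<pi>\<close>.\<close>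

definition free :: "'x \<times> 'y \<Rightarrow> bool" where
  "free z \<longleftrightarrow> (\<forall>g\<in>carrier \<Gamma>. \<forall>h\<in>carrier \<Gamma>. \<alpha> g (fst z) = \<alpha> h (fst z) \<longrightarrow> g = h)"

lemma AE_free: "AE z in Z. free z"
proof -
  have "AE x in X. \<forall>g\<in>carrier \<Gamma> - {\<one>\<^bsub>\<Gamma>\<^esub>}. \<alpha> g x \<noteq> x"
    using \<alpha>(2) \<Gamma>(2) by (subst AE_ball_countable) (auto simp: free_action_def)
  then have "AE x in X. \<forall>g\<in>carrier \<Gamma>. \<forall>h\<in>carrier \<Gamma>. \<alpha> g x = \<alpha> h x \<longrightarrow> g = h"
    using AE_space
  proof eventually_elim
    case (elim x)
    show ?case
    proof (intro ballI impI)
      fix g h assume gh: "g \<in> carrier \<Gamma>" "h \<in> carrier \<Gamma>" "\<alpha> g x = \<alpha> h x"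
      then have "\<alpha> (iv h \<cdot> g) x = x" using elim(2) by (simp add: XA.act_mult)
      then have "iv h \<cdot> g = \<one>\<^bsub>\<Gamma>\<^esub>" using elim(1) gh by (metis DiffI G.inv_closed G.m_closed singletonD)
      then show "g = h" using gh by (metis G.inv_closed G.inv_equality G.inv_inv)
    qed
  qed
  from null_preserving_AE[OF null_preserving_fst this] show ?thesis by (simp add: free_def)
qed

lemma freeD:
  assumes "free z" "z \<in> space Z" "\<sigma> g z = \<sigma> h z" "g \<in> carrier \<Gamma>" "h \<in> carrier \<Gamma>"
  shows "g = h"
  using assms fst_\<sigma>[of z g] fst_\<sigma>[of z h] unfolding free_def by metis

section \<open>Orbit equivalence of points and morphisms of the orbit relation\<close>

definition oeq :: "'x \<times> 'y \<Rightarrow> 'x \<times> 'y \<Rightarrow> bool" where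
  "oeq z w \<longleftrightarrow> (\<exists>g\<in>carrier \<Gamma>. z = \<sigma> g w)"

lemma oeq_refl: "z \<in> space Z \<Longrightarrow> oeq z z"
  unfolding oeq_def by (intro bexI[of _ "\<one>\<^bsub>\<Gamma>\<^esub>"]) (simp_all add: ZA.act_one)

lemma oeq_sym: "oeq z w \<Longrightarrow> w \<in> space Z \<Longrightarrow> oeq w z"
  unfolding oeq_def by (metis G.inv_closed ZA.act_inv(1))

lemma oeq_trans: "oeq z w \<Longrightarrow> oeq w v \<Longrightarrow> v \<in> space Z \<Longrightarrow> oeq z v"
  unfolding oeq_def by (metis G.m_closed ZA.act_mult)

lemma oeq_\<sigma>: "g \<in> carrier \<Gamma> \<Longrightarrow> oeq (\<sigma> g z) z"
  by (auto simp: oeq_def)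

lemma oeq_space: "oeq z w \<Longrightarrow> w \<in> space Z \<Longrightarrow> z \<in> space Z"
  unfolding oeq_def using ZA.act_space by blast

text \<open>Orbits go into orbits and null sets pull back to null sets; neither injectivity nor
  invertibility is included, so that extensions by return maps are covered. Inverses modulo orbits
  are carried as separate maps.\<close>

definition mor :: "('x \<times> 'y \<Rightarrow> 'x \<times> 'y) \<Rightarrow> bool" where
  "mor F \<longleftrightarrow> null_preserving Z Z F \<and> (\<forall>g\<in>carrier \<Gamma>. AE z in Z. oeq (F (\<sigma> g z)) (F z))"

lemma mor_np: "mor F \<Longrightarrow> null_preserving Z Z F"
  by (simp add: mor_def)

lemma mor_measurable: "mor F \<Longrightarrow> F \<in> Z \<rightarrow>\<^sub>M Z"
  by (simp add: mor_def null_preserving_def)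

lemma mor_space: "mor F \<Longrightarrow> z \<in> space Z \<Longrightarrow> F z \<in> space Z"
  by (rule measurable_space[OF mor_measurable])

lemma mor_AE: "mor F \<Longrightarrow> AE z in Z. P z \<Longrightarrow> AE z in Z. P (F z)"
  by (rule null_preserving_AE[OF mor_np])

lemma mor_AE_oeq:
  assumes F: "mor F"
  shows "AE z in Z. \<forall>w. oeq w z \<longrightarrow> oeq (F w) (F z)"
proof -
  have "AE z in Z. \<forall>g\<in>carrier \<Gamma>. oeq (F (\<sigma> g z)) (F z)"
    using F \<Gamma>(2) by (subst AE_ball_countable) (auto simp: mor_def)
  then show ?thesis
  proof eventually_elim
    case (elim z)
    show ?case
    proof (intro allI impI)
      fix w assume "oeq w z"
      then obtain g where "g \<in> carrier \<Gamma>" "w = \<sigma> g z" unfolding oeq_def by blast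
      then show "oeq (F w) (F z)" using elim by simp
    qed
  qed
qed

lemma choose_group_element:
  assumes F: "F \<in> Z \<rightarrow>\<^sub>M Z" and H: "H \<in> Z \<rightarrow>\<^sub>M Z" and FH: "AE z in Z. oeq (F z) (H z)"
  obtains k where "k \<in> Z \<rightarrow>\<^sub>M count_space (carrier \<Gamma>)" "AE z in Z. F z = \<sigma> (k z) (H z)"
proof (rule measurable_countable_choice[where C="carrier \<Gamma>" and M=Z and P="\<lambda>g z. F z = \<sigma> g (H z)"])
  show "{z \<in> space Z. F z = \<sigma> g (H z)} \<in> sets Z" if g: "g \<in> carrier \<Gamma>" for g
    by (rule standard_measure_eq_sets[OF standard_Z F measurable_compose[OF H \<sigma>_measurable[OF g]]])
  show "AE z in Z. \<exists>g\<in>carrier \<Gamma>. F z = \<sigma> g (H z)" using FH by (simp add: oeq_def)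
qed (use \<Gamma> G.one_closed that in auto)

lemma count_in: "k \<in> Z \<rightarrow>\<^sub>M count_space (carrier \<Gamma>) \<Longrightarrow> z \<in> space Z \<Longrightarrow> k z \<in> carrier \<Gamma>"
  using measurable_space[of k Z "count_space (carrier \<Gamma>)" z] by simp

lemma count_in_Y: "k \<in> Y \<rightarrow>\<^sub>M count_space (carrier \<Gamma>) \<Longrightarrow> y \<in> space Y \<Longrightarrow> k y \<in> carrier \<Gamma>"
  using measurable_space[of k Y "count_space (carrier \<Gamma>)" y] by simp

text \<open>On almost every fibre over \<open>y\<close> the values of \<open>k\<close> are permuted
  injectively by the kernel, so weak mixing makes \<open>k\<close> constant there;
  \<open>generic_section\<close> turns the fibrewise constants into a measurable function of
  \<open>y\<close>.\<close>

lemma depends_on_snd: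
  assumes k: "k \<in> Z \<rightarrow>\<^sub>M count_space (carrier \<Gamma>)"
    and eq: "\<And>n. n \<in> carrier N \<Longrightarrow> AE z in Z. k (\<sigma> n z) = \<tau> n (snd z) (k z)"
    and inj: "\<And>n. n \<in> carrier N \<Longrightarrow> AE y in Y. inj_on (\<tau> n y) (carrier \<Gamma>)"
  obtains \<kappa> where "\<kappa> \<in> Y \<rightarrow>\<^sub>M count_space (carrier \<Gamma>)" "AE z in Z. k z = \<kappa> (snd z)"
proof -
  have i: "AE y in Y. \<forall>n\<in>carrier N. inj_on (\<tau> n y) (carrier \<Gamma>)"
    using inj by (subst AE_ball_countable[OF countable_N]) blast
  have e: "AE y in Y. \<forall>n\<in>carrier N. AE x in X. k (\<sigma> n (x, y)) = \<tau> n y (k (x, y))"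
    using AE_N_sections[of "\<lambda>n z. k (\<sigma> n z) = \<tau> n (snd z) (k z)", OF eq] by simp
  have const: "AE y in Y. AE x in X. AE x' in X. k (x, y) = k (x', y)"
    using e i AE_space
  proof eventually_elim
    case (elim y)
    have "\<exists>c\<in>carrier \<Gamma>. AE x in X. k (x, y) = c"
    proof (rule NX.weakly_mixing_constant[OF _ \<Gamma>(2)])
      show "(\<lambda>x. k (x, y)) \<in> X \<rightarrow>\<^sub>M count_space (carrier \<Gamma>)"
        by (rule measurable_compose[OF _ k]) (use elim in measurable)
      fix n assume n: "n \<in> carrier N"
      have "AE x in X. k (\<sigma> n (x, y)) = \<tau> n y (k (x, y))" using elim(1) n by auto
      then have "AE x in X. k (\<alpha> n x, y) = \<tau> n y (k (x, y))"
        using AE_space by eventually_elim (use n elim(3) in \<open>simp add: product_action_def\<close>)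
      then show "\<exists>\<tau>. inj_on \<tau> (carrier \<Gamma>) \<and> (AE x in X. k (\<alpha> n x, y) = \<tau> (k (x, y)))"
        using elim(2) n by blast
    qed
    then obtain c where c: "AE x in X. k (x, y) = c" by blast
    then show ?case
    proof eventually_elim
      case (elim x)
      note x = this
      from c show ?case by eventually_elim (simp add: x)
    qed
  qed
  have eqs: "{z \<in> space (X \<Otimes>\<^sub>M Z). k (snd z) = k (fst z, snd (snd z))} \<in> sets (X \<Otimes>\<^sub>M Z)"
  proof (rule count_space_eq_sets[OF _ _ \<Gamma>(2)])
    show "(\<lambda>z. k (snd z)) \<in> X \<Otimes>\<^sub>M Z \<rightarrow>\<^sub>M count_space (carrier \<Gamma>)"
      by (rule measurable_compose[OF measurable_snd k])
    show "(\<lambda>z. k (fst z, snd (snd z))) \<in> X \<Otimes>\<^sub>M Z \<rightarrow>\<^sub>M count_space (carrier \<Gamma>)"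
      by (rule measurable_compose[OF _ k]) measurable
  qed
  obtain x0 where x0: "x0 \<in> space X" "AE z in Z. k z = k (x0, snd z)"
    by (rule generic_section[OF X(2) Y.sigma_finite_measure_axioms eqs const])
  show ?thesis
  proof
    show "(\<lambda>y. k (x0, y)) \<in> Y \<rightarrow>\<^sub>M count_space (carrier \<Gamma>)"
      by (rule measurable_compose[OF _ k]) (use x0 in measurable)
  qed (rule x0(2))
qed

text \<open>A morphism \<open>F\<close> of the orbit relation in normal form: \<open>F(x, y) = (F\<^sub>y(x), F\<^sub>0(y))\<close> with
  \<open>F\<^sub>y(n x) = D\<^sub>n(y) F\<^sub>y(x)\<close> for all \<open>n\<close> in the kernel.\<close>

definition normal_form :: "('x \<times> 'y \<Rightarrow> 'x \<times> 'y) \<Rightarrow> ('a \<Rightarrow> 'y \<Rightarrow> 'a) \<Rightarrow> ('y \<Rightarrow> 'y) \<Rightarrow> bool" where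
  "normal_form F D F0 \<longleftrightarrow> mor F \<and> F0 \<in> Y \<rightarrow>\<^sub>M Y \<and> (AE z in Z. snd (F z) = F0 (snd z)) \<and>
     (\<forall>n\<in>carrier N. D n \<in> Y \<rightarrow>\<^sub>M count_space (carrier \<Gamma>)) \<and>
     (AE y in Y. (\<lambda>n. D n y) \<in> hom N N) \<and>
     (\<forall>n\<in>carrier N. AE z in Z. F (\<sigma> n z) = \<sigma> (D n (snd z)) (F z))"

section \<open>Untwisting the Zimmer cocycle\<close>

lemma mult_measurable:
  assumes "f \<in> L \<rightarrow>\<^sub>M count_space (carrier \<Gamma>)" "g \<in> L \<rightarrow>\<^sub>M count_space (carrier \<Gamma>)"
  shows "(\<lambda>x. f x \<cdot> g x) \<in> L \<rightarrow>\<^sub>M count_space (carrier \<Gamma>)"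
  by (rule measurable_count_space_binop[OF assms \<Gamma>(2) \<Gamma>(2)]) (rule G.m_closed)

lemma mor_twist:
  assumes F: "mor F" and k: "k \<in> Z \<rightarrow>\<^sub>M count_space (carrier \<Gamma>)"
  shows "mor (\<lambda>z. \<sigma> (k z) (F z))"
  unfolding mor_def
proof (intro conjI ballI)
  show "null_preserving Z Z (\<lambda>z. \<sigma> (k z) (F z))"
    by (rule null_preserving_piecewise[OF k \<Gamma>(2), where f="\<lambda>c z. \<sigma> c (F z)"])
      (rule null_preserving_comp[OF mor_np[OF F] ZA.act_null_preserving])
  fix g assume g: "g \<in> carrier \<Gamma>"
  have "AE z in Z. oeq (F (\<sigma> g z)) (F z)" using F g by (simp add: mor_def)
  then show "AE z in Z. oeq (\<sigma> (k (\<sigma> g z)) (F (\<sigma> g z))) (\<sigma> (k z) (F z))"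
    using AE_space
  proof eventually_elim
    case (elim z)
    have s: "F z \<in> space Z" "F (\<sigma> g z) \<in> space Z" "\<sigma> g z \<in> space Z"
      using mor_space[OF F] elim g by auto
    have c: "k z \<in> carrier \<Gamma>" "k (\<sigma> g z) \<in> carrier \<Gamma>" using count_in[OF k] s elim by auto
    have "oeq (\<sigma> (k (\<sigma> g z)) (F (\<sigma> g z))) (F z)" using oeq_trans[OF oeq_\<sigma>[OF c(2)] elim(1) s(1)] .
    moreover have "oeq (F z) (\<sigma> (k z) (F z))" by (rule oeq_sym[OF oeq_\<sigma>[OF c(1)] s(1)])
    ultimately show ?case by (rule oeq_trans) (use c s in auto)
  qed
qed

text \<open>The element \<open>\<omega> n z\<close> moving \<open>\<Delta> z\<close> to
  \<open>\<Delta> (\<sigma> n z)\<close> is unique almost everywhere. As \<open>n\<close> fixes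
  \<open>y\<close>, the functions \<open>\<omega> n\<close> on the fibre over \<open>y\<close> form
  a cocycle of the kernel, to which superrigidity applies.\<close>

lemma cocycle_untwist:
  assumes D: "mor \<Delta>"
  obtains \<Phi> D where "\<Phi> \<in> Z \<rightarrow>\<^sub>M count_space (carrier \<Gamma>)"
    "\<And>n. n \<in> carrier N \<Longrightarrow> D n \<in> Y \<rightarrow>\<^sub>M count_space (carrier \<Gamma>)"
    "\<And>n. n \<in> carrier N \<Longrightarrow> AE z in Z. \<sigma> (\<Phi> (\<sigma> n z)) (\<Delta> (\<sigma> n z)) = \<sigma> (D n (snd z)) (\<sigma> (\<Phi> z) (\<Delta> z))"
proof -
  have "\<forall>n\<in>carrier N. \<exists>k. k \<in> Z \<rightarrow>\<^sub>M count_space (carrier \<Gamma>) \<and> (AE z in Z. \<Delta> (\<sigma> n z) = \<sigma> (k z) (\<Delta> z))"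
  proof
    fix n assume n: "n \<in> carrier N"
    have m: "(\<lambda>z. \<Delta> (\<sigma> n z)) \<in> Z \<rightarrow>\<^sub>M Z"
      by (rule measurable_compose[OF \<sigma>_measurable mor_measurable[OF D]]) (use n in simp)
    have "AE z in Z. oeq (\<Delta> (\<sigma> n z)) (\<Delta> z)" using D n by (simp add: mor_def)
    then obtain k where "k \<in> Z \<rightarrow>\<^sub>M count_space (carrier \<Gamma>)" "AE z in Z. \<Delta> (\<sigma> n z) = \<sigma> (k z) (\<Delta> z)"
      by (rule choose_group_element[OF m mor_measurable[OF D]])
    then show "\<exists>k. k \<in> Z \<rightarrow>\<^sub>M count_space (carrier \<Gamma>) \<and> (AE z in Z. \<Delta> (\<sigma> n z) = \<sigma> (k z) (\<Delta> z))" by blast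
  qed
  from bchoice[OF this] obtain \<omega> where w: "\<forall>n\<in>carrier N. \<omega> n \<in> Z \<rightarrow>\<^sub>M count_space (carrier \<Gamma>) \<and> (AE z in Z. \<Delta> (\<sigma> n z) = \<sigma> (\<omega> n z) (\<Delta> z))"
    by blast
  have \<omega>: "\<And>n. n \<in> carrier N \<Longrightarrow> \<omega> n \<in> Z \<rightarrow>\<^sub>M count_space (carrier \<Gamma>)"
    and eq: "\<And>n. n \<in> carrier N \<Longrightarrow> AE z in Z. \<Delta> (\<sigma> n z) = \<sigma> (\<omega> n z) (\<Delta> z)"
    using bspec[OF w] by simp_all
  have coc: "AE z in Z. \<omega> (n \<cdot> m) z = \<omega> n (\<sigma> m z) \<cdot> \<omega> m z" if nm: "n \<in> carrier N" "m \<in> carrier N" for n m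
  proof -
    have nmN: "n \<cdot> m \<in> carrier N" using nm group.is_monoid[OF group_N] monoid.m_closed[of N n m] by simp
    \<comment> \<open>Freeness is used at \<open>\<Delta> z\<close> rather than at \<open>z\<close>;
      it holds there almost everywhere because \<open>\<Delta>\<close> pulls null sets back to null
      sets.\<close>
    show ?thesis
      using eq[OF nmN] eq[OF nm(2)] ZA.act_AE[OF eq[OF nm(1)] N_in[OF nm(2)]] mor_AE[OF D AE_free] AE_space
    proof eventually_elim
      case (elim z)
      have s: "\<Delta> z \<in> space Z" "\<sigma> m z \<in> space Z" using mor_space[OF D] elim nm by auto
      have c: "\<omega> (n \<cdot> m) z \<in> carrier \<Gamma>" "\<omega> n (\<sigma> m z) \<in> carrier \<Gamma>" "\<omega> m z \<in> carrier \<Gamma>"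
        using count_in[OF \<omega>] nmN nm s elim by auto
      have "\<sigma> (\<omega> (n \<cdot> m) z) (\<Delta> z) = \<Delta> (\<sigma> n (\<sigma> m z))"
        using elim(1) elim(5) nm by (simp add: ZA.act_mult)
      also have "\<dots> = \<sigma> (\<omega> n (\<sigma> m z)) (\<sigma> (\<omega> m z) (\<Delta> z))" using elim nm by simp
      also have "\<dots> = \<sigma> (\<omega> n (\<sigma> m z) \<cdot> \<omega> m z) (\<Delta> z)" using c s by (simp add: ZA.act_mult)
      finally show ?case by (rule freeD[OF elim(4) s(1)]) (use c in auto)
    qed
  qed
  have "AE y in Y. \<forall>n\<in>carrier N. \<forall>m\<in>carrier N. AE x in X. \<omega> (n \<cdot> m) (x, y) = \<omega> n (\<sigma> m (x, y)) \<cdot> \<omega> m (x, y)"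
    using AE_sections[OF coc] by (simp add: AE_ball_countable[OF countable_N])
  then have ex: "AE y in Y. \<exists>\<phi> \<delta>. \<phi> \<in> X \<rightarrow>\<^sub>M count_space (carrier \<Gamma>) \<and> (\<forall>k\<in>carrier N. \<delta> k \<in> carrier \<Gamma> \<and>
        (AE x in X. \<phi> (\<alpha> k x) \<cdot> \<omega> k (x, y) = \<delta> k \<cdot> \<phi> x))"
    using AE_space
  proof eventually_elim
    case (elim y)
    have sec: "(\<lambda>x. \<omega> n (x, y)) \<in> X \<rightarrow>\<^sub>M count_space (carrier \<Gamma>)" if "n \<in> carrier N" for n
      by (rule measurable_compose[OF _ \<omega>[OF that]]) (use elim in measurable)
    have coc': "AE x in X. \<omega> (g \<otimes>\<^bsub>N\<^esub> h) (x, y) = \<omega> g (\<alpha> h x, y) \<cdot> \<omega> h (x, y)" if gh: "g \<in> carrier N" "h \<in> carrier N" for g h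
    proof -
      have "AE x in X. \<omega> (g \<cdot> h) (x, y) = \<omega> g (\<sigma> h (x, y)) \<cdot> \<omega> h (x, y)" using elim(1) gh by blast
      then show ?thesis using AE_space by eventually_elim (use gh elim in simp)
    qed
    have cl: "k \<otimes>\<^bsub>N\<^esub> h \<in> carrier N" if "k \<in> carrier N" "h \<in> carrier N" for k h
      using that group.is_monoid[OF group_N] monoid.m_closed[of N k h] by simp
    obtain \<phi> \<delta> where p: "\<phi> \<in> X \<rightarrow>\<^sub>M count_space (carrier \<Gamma>)" "\<delta> \<in> hom N \<Gamma>"
      "\<And>k. k \<in> carrier N \<Longrightarrow> AE x in X. \<delta> k = \<phi> (\<alpha> k x) \<cdot> \<omega> k (x, y) \<cdot> iv (\<phi> x)"
      by (rule superrigid_countable[where \<omega>="\<lambda>n x. \<omega> n (x, y)", OF superrigid \<Gamma> countable_N _ cl sec coc'])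
        (use NX.act_measurable in auto)
    have "\<delta> k \<in> carrier \<Gamma> \<and> (AE x in X. \<phi> (\<alpha> k x) \<cdot> \<omega> k (x, y) = \<delta> k \<cdot> \<phi> x)" if k: "k \<in> carrier N" for k
    proof
      show "\<delta> k \<in> carrier \<Gamma>" using p(2) k by (auto simp: hom_def)
      show "AE x in X. \<phi> (\<alpha> k x) \<cdot> \<omega> k (x, y) = \<delta> k \<cdot> \<phi> x"
        using p(3)[OF k] AE_space
      proof eventually_elim
        case (elim x)
        have "\<phi> (\<alpha> k x) \<in> carrier \<Gamma>" "\<phi> x \<in> carrier \<Gamma>" "\<omega> k (x, y) \<in> carrier \<Gamma>"
          using measurable_space[OF p(1)] measurable_space[OF sec[OF k]] elim(2) k by auto
        then show ?case by (simp add: elim(1) G.m_assoc)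
      qed
    qed
    then show ?case using p(1) by blast
  qed
  obtain \<Phi> D where \<Phi>: "\<Phi> \<in> Z \<rightarrow>\<^sub>M count_space (carrier \<Gamma>)"
    and Dm: "\<And>n. n \<in> carrier N \<Longrightarrow> D n \<in> Y \<rightarrow>\<^sub>M count_space (carrier \<Gamma>)"
    and PD: "AE y in Y. \<forall>n\<in>carrier N. AE x in X. \<Phi> (\<alpha> n x, y) \<cdot> \<omega> n (x, y) = D n y \<cdot> \<Phi> (x, y)"
    by (rule measurable_untwisting[OF NX.countable_action_axioms X(2,1) Y.sigma_finite_measure_axioms \<Gamma> \<omega> ex]) (assumption, rule that)
  have PD': "AE z in Z. \<Phi> (\<sigma> n z) \<cdot> \<omega> n z = D n (snd z) \<cdot> \<Phi> z" if n: "n \<in> carrier N" for n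
  proof (rule XY.AE_pair_measure_swap)
    have a: "(\<lambda>z. \<Phi> (\<sigma> n z)) \<in> Z \<rightarrow>\<^sub>M count_space (carrier \<Gamma>)"
      by (rule measurable_compose[OF \<sigma>_measurable \<Phi>]) (use n in simp)
    have b: "(\<lambda>z. D n (snd z)) \<in> Z \<rightarrow>\<^sub>M count_space (carrier \<Gamma>)"
      by (rule measurable_compose[OF measurable_snd Dm[OF n]])
    show "{z \<in> space Z. \<Phi> (\<sigma> n z) \<cdot> \<omega> n z = D n (snd z) \<cdot> \<Phi> z} \<in> sets Z"
      by (rule count_space_eq_sets[OF mult_measurable[OF a \<omega>[OF n]] mult_measurable[OF b \<Phi>] \<Gamma>(2)])
    show "AE y in Y. AE x in X. \<Phi> (\<sigma> n (x, y)) \<cdot> \<omega> n (x, y) = D n (snd (x, y)) \<cdot> \<Phi> (x, y)"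
      using PD AE_space
    proof eventually_elim
      case (elim y)
      have "AE x in X. \<Phi> (\<alpha> n x, y) \<cdot> \<omega> n (x, y) = D n y \<cdot> \<Phi> (x, y)" using elim(1) n by blast
      then show ?case using AE_space by eventually_elim (use n elim in simp)
    qed
  qed
  show ?thesis
  proof (rule that[OF \<Phi> Dm])
    fix n assume n: "n \<in> carrier N"
    show "AE z in Z. \<sigma> (\<Phi> (\<sigma> n z)) (\<Delta> (\<sigma> n z)) = \<sigma> (D n (snd z)) (\<sigma> (\<Phi> z) (\<Delta> z))"
      using PD'[OF n] eq[OF n] AE_space
    proof eventually_elim
      case (elim z)
      have s: "\<Delta> z \<in> space Z" "\<sigma> n z \<in> space Z" using mor_space[OF D] elim n by auto
      have c: "\<Phi> (\<sigma> n z) \<in> carrier \<Gamma>" "\<omega> n z \<in> carrier \<Gamma>" "\<Phi> z \<in> carrier \<Gamma>" "D n (snd z) \<in> carrier \<Gamma>"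
        using count_in[OF \<omega>[OF n]] count_in[OF \<Phi>] count_in_Y[OF Dm[OF n]] s elim by auto
      have "\<sigma> (\<Phi> (\<sigma> n z)) (\<Delta> (\<sigma> n z)) = \<sigma> (\<Phi> (\<sigma> n z) \<cdot> \<omega> n z) (\<Delta> z)"
        using elim(2) c s by (simp add: ZA.act_mult)
      also have "\<dots> = \<sigma> (D n (snd z)) (\<sigma> (\<Phi> z) (\<Delta> z))" using elim(1) c s by (simp add: ZA.act_mult)
      finally show ?case .
    qed
  qed
qed

lemma normal_form_exists:
  assumes D: "mor \<Delta>"
  obtains F D F0 where "normal_form F D F0" "AE z in Z. oeq (F z) (\<Delta> z)"
proof -
  obtain \<Phi> D where \<Phi>: "\<Phi> \<in> Z \<rightarrow>\<^sub>M count_space (carrier \<Gamma>)"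
    and Dm: "\<And>n. n \<in> carrier N \<Longrightarrow> D n \<in> Y \<rightarrow>\<^sub>M count_space (carrier \<Gamma>)"
    and eq: "\<And>n. n \<in> carrier N \<Longrightarrow> AE z in Z. \<sigma> (\<Phi> (\<sigma> n z)) (\<Delta> (\<sigma> n z)) = \<sigma> (D n (snd z)) (\<sigma> (\<Phi> z) (\<Delta> z))"
    by (rule cocycle_untwist[OF D]) blast
  define F where "F z = \<sigma> (\<Phi> z) (\<Delta> z)" for z
  have F: "mor F" unfolding F_def by (rule mor_twist[OF D \<Phi>])
  have eqF: "AE z in Z. F (\<sigma> n z) = \<sigma> (D n (snd z)) (F z)" if "n \<in> carrier N" for n
    unfolding F_def by (rule eq[OF that])
  have Dy: "D n y \<in> carrier \<Gamma>" if "n \<in> carrier N" "y \<in> space Y" for n y by (rule count_in_Y[OF Dm[OF that(1)] that(2)])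
  have cl: "n \<cdot> m \<in> carrier N" if "n \<in> carrier N" "m \<in> carrier N" for n m
    using that group.is_monoid[OF group_N] monoid.m_closed[of N n m] by simp
  \<comment> \<open>The selected \<open>D\<close> comes only with values in \<open>\<Gamma>\<close>;
    multiplicativity is recovered from the untwisted equation at points where \<open>F z\<close> is
    free.\<close>
  have "AE y in Y. D (n \<cdot> m) y = D n y \<cdot> D m y" if nm: "n \<in> carrier N" "m \<in> carrier N" for n m
  proof (rule AE_sndD)
    show "AE z in Z. D (n \<cdot> m) (snd z) = D n (snd z) \<cdot> D m (snd z)"
      using eqF[OF cl[OF nm]] eqF[OF nm(2)] ZA.act_AE[OF eqF[OF nm(1)] N_in[OF nm(2)]] mor_AE[OF F AE_free] AE_space
    proof eventually_elim
      case (elim z)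
      have s: "F z \<in> space Z" "\<sigma> m z \<in> space Z" using mor_space[OF F] elim nm by auto
      have c: "D (n \<cdot> m) (snd z) \<in> carrier \<Gamma>" "D n (snd z) \<in> carrier \<Gamma>" "D m (snd z) \<in> carrier \<Gamma>"
        using Dy cl nm elim(5) by auto
      have "\<sigma> (D (n \<cdot> m) (snd z)) (F z) = F (\<sigma> n (\<sigma> m z))" using elim(1,5) nm by (simp add: ZA.act_mult)
      also have "\<dots> = \<sigma> (D n (snd z)) (\<sigma> (D m (snd z)) (F z))" using elim(2,3,5) nm by simp
      also have "\<dots> = \<sigma> (D n (snd z) \<cdot> D m (snd z)) (F z)" using c s by (simp add: ZA.act_mult)
      finally show ?case by (rule freeD[OF elim(4) s(1)]) (use c in auto)
    qed
  qed
  then have "AE y in Y. \<forall>n\<in>carrier N. \<forall>m\<in>carrier N. D (n \<cdot> m) y = D n y \<cdot> D m y"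
    by (simp add: AE_ball_countable[OF countable_N])
  then have Dh: "AE y in Y. (\<lambda>n. D n y) \<in> hom N N"
    using AE_space
  proof eventually_elim
    case (elim y)
    have "(\<lambda>n. \<pi> (D n y)) \<in> hom N \<Lambda>" using elim Dy by (auto simp: hom_def)
    then have "\<pi> (D n y) = \<one>\<^bsub>\<Lambda>\<^esub>" if "n \<in> carrier N" for n using no_hom[of "\<lambda>n. \<pi> (D n y)" n] that carrier_N by simp
    then have "D n y \<in> carrier N" if "n \<in> carrier N" for n using Dy[OF that elim(2)] that N_iff by blast
    then show ?case using elim by (auto simp: hom_def)
  qed
  have sndm: "(\<lambda>z. snd (F z)) \<in> Z \<rightarrow>\<^sub>M Y" by (rule measurable_compose[OF mor_measurable[OF F] measurable_snd])
  \<comment> \<open>The values of \<open>D n\<close> lie in the kernel, which acts trivially on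
    \<open>Y\<close>.\<close>
  have sinv: "AE z in Z. snd (F (\<sigma> n z)) = snd (F z)" if n: "n \<in> carrier N" for n
    using eqF[OF n] AE_snd[OF Dh] AE_space
  proof eventually_elim
    case (elim z)
    have "D n (snd z) \<in> carrier N" using elim(2) n by (auto simp: hom_def)
    then show ?case using elim(1) mor_space[OF F elim(3)] by simp
  qed
  have sec: "AE y in Y. \<forall>n\<in>carrier N. AE x in X. snd (F (\<sigma> n (x, y))) = snd (F (x, y))"
    by (rule AE_N_sections[of "\<lambda>n z. snd (F (\<sigma> n z)) = snd (F z)"]) (rule sinv)
  have const: "AE y in Y. AE x in X. AE x' in X. snd (F (x, y)) = snd (F (x', y))"
    using sec AE_space
  proof eventually_elim
    case (elim y)
    show ?case
    proof (rule NX.ergodic_constant_standard[OF NX.ergodic _ Y(1)])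
      show "(\<lambda>x. snd (F (x, y))) \<in> X \<rightarrow>\<^sub>M Y"
        by (rule measurable_compose[OF _ sndm]) (use elim in measurable)
      fix n assume n: "n \<in> carrier N"
      have "AE x in X. snd (F (\<sigma> n (x, y))) = snd (F (x, y))" using elim(1) n by blast
      then show "AE x in X. snd (F (\<alpha> n x, y)) = snd (F (x, y))"
        using AE_space by eventually_elim (use n elim in simp)
    qed
  qed
  have eqs: "{z \<in> space (X \<Otimes>\<^sub>M Z). snd (F (snd z)) = snd (F (fst z, snd (snd z)))} \<in> sets (X \<Otimes>\<^sub>M Z)"
  proof (rule standard_measure_eq_sets[OF Y(1)])
    show "(\<lambda>z. snd (F (snd z))) \<in> X \<Otimes>\<^sub>M Z \<rightarrow>\<^sub>M Y" by (rule measurable_compose[OF measurable_snd sndm])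
    show "(\<lambda>z. snd (F (fst z, snd (snd z)))) \<in> X \<Otimes>\<^sub>M Z \<rightarrow>\<^sub>M Y"
      by (rule measurable_compose[OF _ sndm]) measurable
  qed
  obtain x0 where x0: "x0 \<in> space X" "AE z in Z. snd (F z) = snd (F (x0, snd z))"
    by (rule generic_section[of X Y "\<lambda>z. snd (F z)", OF X(2) Y.sigma_finite_measure_axioms eqs const])
  have "(\<lambda>y. snd (F (x0, y))) \<in> Y \<rightarrow>\<^sub>M Y"
    by (rule measurable_compose[OF _ sndm]) (use x0 in measurable)
  then have "normal_form F D (\<lambda>y. snd (F (x0, y)))"
    unfolding normal_form_def using F x0(2) Dm Dh eqF by blast
  moreover have "AE z in Z. oeq (F z) (\<Delta> z)"
    using AE_space by eventually_elim (use oeq_\<sigma> count_in[OF \<Phi>] in \<open>auto simp: F_def\<close>)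
  ultimately show ?thesis by (rule that)
qed

section \<open>Maps in normal form and their inverses modulo orbits\<close>

lemma normal_formD:
  assumes "normal_form F D F0"
  shows "mor F" "F0 \<in> Y \<rightarrow>\<^sub>M Y" "AE z in Z. snd (F z) = F0 (snd z)"
    "n \<in> carrier N \<Longrightarrow> D n \<in> Y \<rightarrow>\<^sub>M count_space (carrier \<Gamma>)"
    "AE y in Y. (\<lambda>n. D n y) \<in> hom N N"
    "AE z in Z. \<forall>n\<in>carrier N. F (\<sigma> n z) = \<sigma> (D n (snd z)) (F z)"
  using assms by (auto simp: normal_form_def AE_ball_countable[OF countable_N])

lemma normal_form_null_preserving:
  assumes F: "normal_form F D F0"
  shows "null_preserving Y Y F0"
proof (rule null_preservingI)
  fix A assume "A \<in> null_sets Y"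
  then have "AE z in Z. snd (F z) \<notin> A"
    by (intro mor_AE[OF normal_formD(1)[OF F]] AE_snd AE_not_in)
  then have "AE z in Z. F0 (snd z) \<notin> A" using normal_formD(3)[OF F] by eventually_elim simp
  then show "AE y in Y. F0 y \<notin> A" by (rule AE_sndD)
qed (rule normal_formD(2)[OF F])

lemma hom_ND:
  assumes "d \<in> hom N N" "n \<in> carrier N"
  shows "d n \<in> carrier N" "d n \<in> carrier \<Gamma>"
proof -
  show "d n \<in> carrier N" using assms by (auto simp: hom_def)
  then show "d n \<in> carrier \<Gamma>" by simp
qed

lemma inj_on_translate:
  "a \<in> carrier \<Gamma> \<Longrightarrow> b \<in> carrier \<Gamma> \<Longrightarrow> inj_on (\<lambda>c. a \<cdot> c \<cdot> iv b) (carrier \<Gamma>)"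
  by (auto intro!: inj_onI)

text \<open>If \<open>k z\<close> moves \<open>z\<close> to \<open>H (F z)\<close>, comparing the
  two ways to evaluate \<open>H (F (\<sigma> n z))\<close> gives
  \<open>k (\<sigma> n z) \<cdot> n = E (D n y) (F0 y) \<cdot> k z\<close> with
  \<open>y = snd z\<close>. This is an injective rule for the values of \<open>k\<close>, so
  \<open>k\<close> depends on \<open>y\<close> alone. The same equation then shows that the composed
  morphism is conjugation by \<open>\<kappa> y\<close>.\<close>

lemma normal_form_compose:
  assumes F: "normal_form F D F0" and H: "normal_form H E H0" and HF: "AE z in Z. oeq (H (F z)) z"
  obtains \<kappa> where "\<kappa> \<in> Y \<rightarrow>\<^sub>M count_space (carrier \<Gamma>)" "AE z in Z. H (F z) = \<sigma> (\<kappa> (snd z)) z"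
    "AE y in Y. \<forall>n\<in>carrier N. E (D n y) (F0 y) = \<kappa> y \<cdot> n \<cdot> iv (\<kappa> y)"
proof -
  note FD = normal_formD[OF F] and HD = normal_formD[OF H]
  have m: "(\<lambda>z. H (F z)) \<in> Z \<rightarrow>\<^sub>M Z" by (rule measurable_compose[OF mor_measurable[OF FD(1)] mor_measurable[OF HD(1)]])
  obtain k where k: "k \<in> Z \<rightarrow>\<^sub>M count_space (carrier \<Gamma>)" and eq: "AE z in Z. H (F z) = \<sigma> (k z) z"
    by (rule choose_group_element[OF m measurable_ident_sets[OF refl] HF])
  have hN: "AE y in Y. (\<lambda>n. E n (F0 y)) \<in> hom N N"
    by (rule null_preserving_AE[OF normal_form_null_preserving[OF F] HD(5)])
  have key: "AE z in Z. k (\<sigma> n z) \<cdot> n = E (D n (snd z)) (F0 (snd z)) \<cdot> k z" if n: "n \<in> carrier N" for n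
    using FD(6) mor_AE[OF FD(1) HD(6)] FD(3) eq ZA.act_AE[OF eq N_in[OF n]] AE_free AE_snd[OF FD(5)] AE_snd[OF hN] AE_space
  proof eventually_elim
    case (elim z)
    let ?y = "snd z"
    have Dn: "D n ?y \<in> carrier N" by (rule hom_ND(1)[OF elim(7) n])
    have En: "E (D n ?y) (F0 ?y) \<in> carrier \<Gamma>" by (rule hom_ND(2)[OF elim(8) Dn])
    have s: "\<sigma> n z \<in> space Z" using elim(9) n by simp
    have c: "k z \<in> carrier \<Gamma>" "k (\<sigma> n z) \<in> carrier \<Gamma>" using count_in[OF k] s elim(9) by auto
    have "\<sigma> (k (\<sigma> n z) \<cdot> n) z = \<sigma> (k (\<sigma> n z)) (\<sigma> n z)" using c n elim(9) by (simp add: ZA.act_mult)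
    also have "\<dots> = H (F (\<sigma> n z))" using elim(5) by simp
    also have "\<dots> = H (\<sigma> (D n ?y) (F z))" using elim(1) n by simp
    also have "\<dots> = \<sigma> (E (D n ?y) (F0 ?y)) (H (F z))" using elim(2) Dn elim(3) by simp
    also have "\<dots> = \<sigma> (E (D n ?y) (F0 ?y) \<cdot> k z) z" using elim(4) c En elim(9) by (simp add: ZA.act_mult)
    finally show ?case by (rule freeD[OF elim(6,9)]) (use c En n in auto)
  qed
  obtain \<kappa> where \<kappa>: "\<kappa> \<in> Y \<rightarrow>\<^sub>M count_space (carrier \<Gamma>)" "AE z in Z. k z = \<kappa> (snd z)"
  proof (rule depends_on_snd[OF k, where \<tau>="\<lambda>n y c. E (D n y) (F0 y) \<cdot> c \<cdot> iv n"])
    fix n assume n: "n \<in> carrier N"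
    show "AE z in Z. k (\<sigma> n z) = E (D n (snd z)) (F0 (snd z)) \<cdot> k z \<cdot> iv n"
      using key[OF n] AE_space
    proof eventually_elim
      case (elim z)
      have "k (\<sigma> n z) \<in> carrier \<Gamma>" using count_in[OF k] elim(2) n by simp
      then have "k (\<sigma> n z) = k (\<sigma> n z) \<cdot> n \<cdot> iv n" using n by (simp add: G.m_assoc)
      then show ?case using elim(1) by simp
    qed
    show "AE y in Y. inj_on (\<lambda>c. E (D n y) (F0 y) \<cdot> c \<cdot> iv n) (carrier \<Gamma>)"
      using FD(5) hN
    proof eventually_elim
      case (elim y)
      show ?case by (rule inj_on_translate) (use hom_ND[OF elim(2) hom_ND(1)[OF elim(1) n]] n in auto)
    qed
  qed (rule that)
  have "AE y in Y. E (D n y) (F0 y) = \<kappa> y \<cdot> n \<cdot> iv (\<kappa> y)" if n: "n \<in> carrier N" for n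
  proof (rule AE_sndD)
    show "AE z in Z. E (D n (snd z)) (F0 (snd z)) = \<kappa> (snd z) \<cdot> n \<cdot> iv (\<kappa> (snd z))"
      using key[OF n] \<kappa>(2) ZA.act_AE[OF \<kappa>(2) N_in[OF n]] AE_snd[OF FD(5)] AE_snd[OF hN] AE_space
    proof eventually_elim
      case (elim z)
      have En: "E (D n (snd z)) (F0 (snd z)) \<in> carrier \<Gamma>" by (rule hom_ND(2)[OF elim(5) hom_ND(1)[OF elim(4) n]])
      have K: "\<kappa> (snd z) \<in> carrier \<Gamma>" using count_in_Y[OF \<kappa>(1)] elim(6) by simp
      have "\<kappa> (snd z) \<cdot> n = E (D n (snd z)) (F0 (snd z)) \<cdot> \<kappa> (snd z)"
        using elim(1,2,3,6) n by simp
      then show ?case using En K by (simp add: G.m_assoc)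
    qed
  qed
  then have "AE y in Y. \<forall>n\<in>carrier N. E (D n y) (F0 y) = \<kappa> y \<cdot> n \<cdot> iv (\<kappa> y)"
    by (simp add: AE_ball_countable[OF countable_N])
  moreover have "AE z in Z. H (F z) = \<sigma> (\<kappa> (snd z)) z" using eq \<kappa>(2) by eventually_elim simp
  ultimately show ?thesis using \<kappa>(1) that by blast
qed

text \<open>Covariance of the morphisms \<open>D_y\<close> along \<Lambda>-orbits, up to conjugation
  by the element that moves \<open>F z\<close> to \<open>F (\<sigma> g z)\<close>. It serves to
  carry surjectivity of \<open>D_y\<close> from one point of an orbit to another.\<close>

lemma normal_form_translate:
  assumes F: "normal_form F D F0" and g: "g \<in> carrier \<Gamma>"
  obtains h where "h \<in> Y \<rightarrow>\<^sub>M count_space (carrier \<Gamma>)"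
    "AE y in Y. \<forall>n\<in>carrier N. D (g \<cdot> n \<cdot> iv g) (\<beta> (\<pi> g) y) \<cdot> h y = h y \<cdot> D n y"
proof -
  note FD = normal_formD[OF F]
  have m: "(\<lambda>z. F (\<sigma> g z)) \<in> Z \<rightarrow>\<^sub>M Z" by (rule measurable_compose[OF \<sigma>_measurable[OF g] mor_measurable[OF FD(1)]])
  have "AE z in Z. oeq (F (\<sigma> g z)) (F z)" using FD(1) g by (simp add: mor_def)
  then obtain k where k: "k \<in> Z \<rightarrow>\<^sub>M count_space (carrier \<Gamma>)" and eq: "AE z in Z. F (\<sigma> g z) = \<sigma> (k z) (F z)"
    by (rule choose_group_element[OF m mor_measurable[OF FD(1)]])
  have hg: "AE y in Y. (\<lambda>n. D n (\<beta> (\<pi> g) y)) \<in> hom N N" using YA.act_AE[OF FD(5) g] .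
  have key: "AE z in Z. k (\<sigma> n z) \<cdot> D n (snd z) = D (g \<cdot> n \<cdot> iv g) (\<beta> (\<pi> g) (snd z)) \<cdot> k z" if n: "n \<in> carrier N" for n
    using FD(6) ZA.act_AE[OF FD(6) g] eq ZA.act_AE[OF eq N_in[OF n]] mor_AE[OF FD(1) AE_free] AE_snd[OF FD(5)] AE_snd[OF hg] AE_space
  proof eventually_elim
    case (elim z)
    let ?n = "g \<cdot> n \<cdot> iv g" and ?y = "snd z"
    have nN: "?n \<in> carrier N" by (rule N_conj[OF n g])
    have Dn: "D n ?y \<in> carrier \<Gamma>" by (rule hom_ND(2)[OF elim(6) n])
    have En: "D ?n (\<beta> (\<pi> g) ?y) \<in> carrier \<Gamma>" by (rule hom_ND(2)[OF elim(7) nN])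
    have s: "\<sigma> n z \<in> space Z" "\<sigma> g z \<in> space Z" "F z \<in> space Z" using elim(8) n g mor_space[OF FD(1)] by auto
    have c: "k z \<in> carrier \<Gamma>" "k (\<sigma> n z) \<in> carrier \<Gamma>" using count_in[OF k] s elim(8) by auto
    have gn: "\<sigma> g (\<sigma> n z) = \<sigma> ?n (\<sigma> g z)"
      using n g elim(8) by (simp add: ZA.act_mult[symmetric] G.m_assoc)
    have "\<sigma> (k (\<sigma> n z) \<cdot> D n ?y) (F z) = \<sigma> (k (\<sigma> n z)) (F (\<sigma> n z))"
      using elim(1) n c Dn s by (simp add: ZA.act_mult)
    also have "\<dots> = F (\<sigma> ?n (\<sigma> g z))" using elim(4) by (simp add: gn)
    also have "\<dots> = \<sigma> (D ?n (\<beta> (\<pi> g) ?y)) (F (\<sigma> g z))" using elim(2) nN elim(8) by simp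
    also have "\<dots> = \<sigma> (D ?n (\<beta> (\<pi> g) ?y) \<cdot> k z) (F z)" using elim(3) En c s by (simp add: ZA.act_mult)
    finally show ?case by (rule freeD[OF elim(5) s(3)]) (use c En Dn in auto)
  qed
  obtain h where h: "h \<in> Y \<rightarrow>\<^sub>M count_space (carrier \<Gamma>)" "AE z in Z. k z = h (snd z)"
  proof (rule depends_on_snd[OF k, where \<tau>="\<lambda>n y c. D (g \<cdot> n \<cdot> iv g) (\<beta> (\<pi> g) y) \<cdot> c \<cdot> iv (D n y)"])
    fix n assume n: "n \<in> carrier N"
    show "AE z in Z. k (\<sigma> n z) = D (g \<cdot> n \<cdot> iv g) (\<beta> (\<pi> g) (snd z)) \<cdot> k z \<cdot> iv (D n (snd z))"
      using key[OF n] AE_snd[OF FD(5)] AE_space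
    proof eventually_elim
      case (elim z)
      have "k (\<sigma> n z) \<in> carrier \<Gamma>" "D n (snd z) \<in> carrier \<Gamma>" using count_in[OF k] elim(3) n hom_ND(2)[OF elim(2) n] by auto
      then have "k (\<sigma> n z) = k (\<sigma> n z) \<cdot> D n (snd z) \<cdot> iv (D n (snd z))" by (simp add: G.m_assoc)
      then show ?case using elim(1) by simp
    qed
    show "AE y in Y. inj_on (\<lambda>c. D (g \<cdot> n \<cdot> iv g) (\<beta> (\<pi> g) y) \<cdot> c \<cdot> iv (D n y)) (carrier \<Gamma>)"
      using FD(5) hg
    proof eventually_elim
      case (elim y)
      show ?case by (rule inj_on_translate) (use hom_ND(2)[OF elim(1) n] hom_ND(2)[OF elim(2) N_conj[OF n g]] in auto)
    qed
  qed (rule that)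
  have "AE y in Y. D (g \<cdot> n \<cdot> iv g) (\<beta> (\<pi> g) y) \<cdot> h y = h y \<cdot> D n y" if n: "n \<in> carrier N" for n
  proof (rule AE_sndD)
    show "AE z in Z. D (g \<cdot> n \<cdot> iv g) (\<beta> (\<pi> g) (snd z)) \<cdot> h (snd z) = h (snd z) \<cdot> D n (snd z)"
      using key[OF n] h(2) ZA.act_AE[OF h(2) N_in[OF n]] AE_space
    proof eventually_elim
      case (elim z)
      then show ?case using n by simp
    qed
  qed
  then have "AE y in Y. \<forall>n\<in>carrier N. D (g \<cdot> n \<cdot> iv g) (\<beta> (\<pi> g) y) \<cdot> h y = h y \<cdot> D n y"
    by (simp add: AE_ball_countable[OF countable_N])
  then show ?thesis using h(1) that by blast
qed

text \<open>Surjectivity of \<open>n \<mapsto> D\<^sub>n(y)\<close> is a \<open>\<Lambda>\<close>-invariant property of \<open>y\<close>, and it holds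
  at some point of almost every \<open>\<Lambda>\<close>-orbit because \<open>F\<close> has a right inverse.\<close>

lemma normal_form_iso:
  assumes F: "normal_form F D F0" and H: "normal_form H E H0"
    and HF: "AE z in Z. oeq (H (F z)) z" and FH: "AE z in Z. oeq (F (H z)) z"
  shows "AE y in Y. (\<lambda>n. D n y) \<in> iso N N"
proof -
  note FD = normal_formD[OF F] and HD = normal_formD[OF H]
  obtain \<kappa> where \<kappa>: "\<kappa> \<in> Y \<rightarrow>\<^sub>M count_space (carrier \<Gamma>)" "AE z in Z. H (F z) = \<sigma> (\<kappa> (snd z)) z"
    "AE y in Y. \<forall>n\<in>carrier N. E (D n y) (F0 y) = \<kappa> y \<cdot> n \<cdot> iv (\<kappa> y)"
    by (rule normal_form_compose[OF F H HF])
  obtain \<mu> where \<mu>: "\<mu> \<in> Y \<rightarrow>\<^sub>M count_space (carrier \<Gamma>)"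
    "AE y in Y. \<forall>n\<in>carrier N. D (E n y) (H0 y) = \<mu> y \<cdot> n \<cdot> iv (\<mu> y)"
    by (rule normal_form_compose[OF H F FH])
  define S where "S y \<longleftrightarrow> carrier N \<subseteq> (\<lambda>n. D n y) ` carrier N" for y
  have "AE y in Y. S (H0 y)"
    using \<mu>(2) HD(5) AE_space
  proof eventually_elim
    case (elim y)
    show ?case unfolding S_def
    proof
      fix m assume m: "m \<in> carrier N"
      have mu: "\<mu> y \<in> carrier \<Gamma>" by (rule count_in_Y[OF \<mu>(1) elim(3)])
      let ?n = "iv (\<mu> y) \<cdot> m \<cdot> \<mu> y"
      have n: "?n \<in> carrier N" by (rule N_conj'[OF m mu])
      have "\<mu> y \<cdot> ?n \<cdot> iv (\<mu> y) = m"
        using m mu N_in[OF m] by (simp add: G.m_assoc) (simp add: G.m_assoc[symmetric])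
      then have d: "m = D (E ?n y) (H0 y)" using elim(1) n by simp
      have "E ?n y \<in> carrier N" by (rule hom_ND(1)[OF elim(2) n])
      then show "m \<in> (\<lambda>n. D n (H0 y)) ` carrier N" by (rule rev_image_eqI) (rule d)
    qed
  qed
  then have "AE y in Y. S (H0 (F0 y))" by (rule null_preserving_AE[OF normal_form_null_preserving[OF F]])
  moreover have "AE y in Y. H0 (F0 y) = \<beta> (\<pi> (\<kappa> y)) y"
  proof (rule AE_sndD)
    show "AE z in Z. H0 (F0 (snd z)) = \<beta> (\<pi> (\<kappa> (snd z))) (snd z)"
      using \<kappa>(2) FD(3) mor_AE[OF FD(1) HD(3)] AE_space
    proof eventually_elim
      case (elim z)
      have "H0 (F0 (snd z)) = snd (H (F z))" using elim by simp
      then show ?case using elim by simp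
    qed
  qed
  ultimately have Sk: "AE y in Y. S (\<beta> (\<pi> (\<kappa> y)) y)" by eventually_elim simp
  have "AE y in Y. S (\<beta> (\<pi> g) y) \<longrightarrow> S y" if g: "g \<in> carrier \<Gamma>" for g
  proof -
    obtain h where h: "h \<in> Y \<rightarrow>\<^sub>M count_space (carrier \<Gamma>)"
      "AE y in Y. \<forall>n\<in>carrier N. D (g \<cdot> n \<cdot> iv g) (\<beta> (\<pi> g) y) \<cdot> h y = h y \<cdot> D n y"
      by (rule normal_form_translate[OF F g])
    show ?thesis
      using h(2) FD(5) AE_space
    proof eventually_elim
      case (elim y)
      show ?case
      proof
        assume S: "S (\<beta> (\<pi> g) y)"
        show "S y" unfolding S_def
        proof
          fix m assume m: "m \<in> carrier N"
          have hy: "h y \<in> carrier \<Gamma>" by (rule count_in_Y[OF h(1) elim(3)])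
          have "h y \<cdot> m \<cdot> iv (h y) \<in> (\<lambda>n. D n (\<beta> (\<pi> g) y)) ` carrier N"
            using S N_conj[OF m hy] unfolding S_def by blast
          then obtain n' where n'D: "h y \<cdot> m \<cdot> iv (h y) = D n' (\<beta> (\<pi> g) y)" and n'1: "n' \<in> carrier N"
            by (rule imageE)
          note n' = n'1 n'D[symmetric]
          let ?n = "iv g \<cdot> n' \<cdot> g"
          have n: "?n \<in> carrier N" by (rule N_conj'[OF n'(1) g])
          have "g \<cdot> ?n \<cdot> iv g = n'"
            using g N_in[OF n'(1)] by (simp add: G.m_assoc) (simp add: G.m_assoc[symmetric])
          then have "h y \<cdot> m \<cdot> iv (h y) \<cdot> h y = h y \<cdot> D ?n y" using elim(1) n n'(2) by metis
          then have "h y \<cdot> m = h y \<cdot> D ?n y" using hy m by (simp add: G.m_assoc)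
          then have "m = D ?n y" using hy N_in[OF m] hom_ND(2)[OF elim(2) n] by simp
          then show "m \<in> (\<lambda>n. D n y) ` carrier N" using n by blast
        qed
      qed
    qed
  qed
  then have "AE y in Y. \<forall>g\<in>carrier \<Gamma>. S (\<beta> (\<pi> g) y) \<longrightarrow> S y"
    by (subst AE_ball_countable[OF \<Gamma>(2)]) blast
  then have surj: "AE y in Y. S y" using Sk AE_space
    by eventually_elim (use count_in_Y[OF \<kappa>(1)] in blast)
  show ?thesis
    using surj \<kappa>(3) FD(5) AE_space
  proof eventually_elim
    case (elim y)
    \<comment> \<open>After \<open>E\<close> the morphism becomes conjugation by
      \<open>\<kappa> y\<close>, which is injective.\<close>
    have "inj_on (\<lambda>n. D n y) (carrier N)"
    proof (rule inj_onI)
      fix n m assume nm: "n \<in> carrier N" "m \<in> carrier N" "D n y = D m y"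
      then have "\<kappa> y \<cdot> n \<cdot> iv (\<kappa> y) = \<kappa> y \<cdot> m \<cdot> iv (\<kappa> y)" using elim(2) by metis
      then show "n = m" using nm count_in_Y[OF \<kappa>(1) elim(4)] by simp
    qed
    moreover have "(\<lambda>n. D n y) ` carrier N = carrier N"
      using elim(1) hom_ND(1)[OF elim(3)] by (auto simp: S_def)
    ultimately show ?case using elim(3) by (simp add: iso_def bij_betw_def)
  qed
qed

text \<open>The measures \<open>A \<mapsto> (\<mu> \<times> \<nu>){(x, y). y \<in> B, F\<^sub>y(x) \<in> A}\<close> are invariant under the kernel,
  hence multiples of \<open>\<mu>\<close>. So almost every \<open>F\<^sub>y\<close> preserves \<open>\<mu>\<close>.\<close>

lemma normal_form_measure_preserving:
  assumes F: "normal_form F D F0" and iso: "AE y in Y. (\<lambda>n. D n y) \<in> iso N N"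
  shows "AE y in Y. distr X X (\<lambda>x. fst (F (x, y))) = X"
proof -
  note FD = normal_formD[OF F]
  have f[measurable]: "(\<lambda>z. fst (F z)) \<in> Z \<rightarrow>\<^sub>M X" by (rule measurable_compose[OF mor_measurable[OF FD(1)] measurable_fst])
  define V where "V A = (\<lambda>z. fst (F z)) -` A \<inter> space Z" for A
  have V[measurable]: "A \<in> sets X \<Longrightarrow> V A \<in> sets Z" for A unfolding V_def by (rule measurable_sets[OF f])
  define m where "m A y = emeasure X ((\<lambda>x. (x, y)) -` V A)" for A y
  have mm: "m A \<in> borel_measurable Y" if "A \<in> sets X" for A
    unfolding m_def by (rule XY.measurable_emeasure_Pair2[OF V[OF that]])
  have sec: "(\<lambda>x. (x, y)) -` V A \<in> sets X" if "A \<in> sets X" for A y by (rule sets_Pair2[OF V[OF that]])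
  have minv: "AE y in Y. m (\<alpha> k -` A \<inter> space X) y = m A y" if k: "k \<in> carrier N" and A: "A \<in> sets X" for k A
    using iso AE_sections[OF FD(6)] AE_space
  proof eventually_elim
    case (elim y)
    \<comment> \<open>Surjectivity of \<open>D_y\<close> enters here: it turns invariance under the
      values of \<open>D_y\<close> into invariance under the whole kernel.\<close>
    have "k \<in> (\<lambda>n. D n y) ` carrier N" using elim(1) k by (simp add: iso_def bij_betw_def)
    then obtain n where n': "k = D n y" "n \<in> carrier N" by (rule imageE)
    note n = n'(2) n'(1)[symmetric]
    let ?A = "\<alpha> k -` A \<inter> space X" and ?S = "\<lambda>A. (\<lambda>x. (x, y)) -` V A"
    have A': "?A \<in> sets X" using k by (intro measurable_sets[OF XA.act_measurable A]) simp
    have "m ?A y = emeasure X (\<alpha> n -` ?S A \<inter> space X)"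
      unfolding m_def
    proof (rule emeasure_eq_AE)
      show "AE x in X. x \<in> ?S ?A \<longleftrightarrow> x \<in> \<alpha> n -` ?S A \<inter> space X"
        using elim(2) AE_space
      proof eventually_elim
        case (elim x)
        have s: "F (x, y) \<in> space Z" using mor_space[OF FD(1), of "(x, y)"] elim \<open>y \<in> space Y\<close> by simp
        have "F (\<sigma> n (x, y)) = \<sigma> (D n y) (F (x, y))" using elim(1) n(1) by simp
        then have "F (\<alpha> n x, y) = \<sigma> k (F (x, y))" using n elim(2) \<open>y \<in> space Y\<close> by simp
        then have "fst (F (\<alpha> n x, y)) = \<alpha> k (fst (F (x, y)))" using s by simp
        then show ?case using elim(2) \<open>y \<in> space Y\<close> s n(1) by (auto simp: V_def)
      qed
    qed (use sec A A' n(1) in \<open>auto intro: measurable_sets[OF XA.act_measurable]\<close>)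
    also have "\<dots> = m A y" unfolding m_def by (rule XA.act_emeasure) (use n(1) sec[OF A] in auto)
    finally show ?case .
  qed
  have integral: "(\<integral>\<^sup>+y. m A y * indicator B y \<partial>Y) = (\<integral>\<^sup>+y. emeasure X A * indicator B y \<partial>Y)"
    if A: "A \<in> sets X" and B[measurable]: "B \<in> sets Y" for A B
  proof -
    define S where "S = space X \<times> B"
    have S[measurable]: "S \<in> sets Z" unfolding S_def by auto
    define \<rho> where "\<rho> = distr (restrict_space Z S) X (\<lambda>z. fst (F z))"
    have rf: "(\<lambda>z. fst (F z)) \<in> restrict_space Z S \<rightarrow>\<^sub>M X" by (rule measurable_restrict_space1[OF f])
    have \<rho>1: "emeasure \<rho> A = emeasure Z (V A \<inter> S)" if A: "A \<in> sets X" for A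
    proof -
      have "emeasure \<rho> A = emeasure (restrict_space Z S) ((\<lambda>z. fst (F z)) -` A \<inter> space (restrict_space Z S))"
        unfolding \<rho>_def by (rule emeasure_distr[OF rf A])
      also have "(\<lambda>z. fst (F z)) -` A \<inter> space (restrict_space Z S) = V A \<inter> S"
        using sets.sets_into_space[OF S] by (auto simp: V_def space_restrict_space)
      also have "emeasure (restrict_space Z S) (V A \<inter> S) = emeasure Z (V A \<inter> S)"
        by (rule emeasure_restrict_space) (use S in auto)
      finally show ?thesis .
    qed
    have \<rho>2: "emeasure \<rho> A = (\<integral>\<^sup>+y. m A y * indicator B y \<partial>Y)" if A: "A \<in> sets X" for A
    proof -
      have "emeasure \<rho> A = (\<integral>\<^sup>+y. emeasure X ((\<lambda>x. (x, y)) -` (V A \<inter> S)) \<partial>Y)"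
        unfolding \<rho>1[OF A] by (rule XY.emeasure_pair_measure_alt2) (use A in auto)
      also have "\<dots> = (\<integral>\<^sup>+y. m A y * indicator B y \<partial>Y)"
      proof (rule nn_integral_cong)
        fix y assume "y \<in> space Y"
        show "emeasure X ((\<lambda>x. (x, y)) -` (V A \<inter> S)) = m A y * indicator B y"
        proof (cases "y \<in> B")
          case True
          then have "(\<lambda>x. (x, y)) -` (V A \<inter> S) = (\<lambda>x. (x, y)) -` V A" by (auto simp: S_def V_def space_pair_measure)
          then show ?thesis using True by (simp add: m_def)
        next
          case False
          then have "(\<lambda>x. (x, y)) -` (V A \<inter> S) = {}" by (auto simp: S_def)
          then show ?thesis using False by simp
        qed
      qed
      finally show ?thesis .
    qed
    obtain c where c: "\<And>A. A \<in> sets X \<Longrightarrow> emeasure \<rho> A = c * emeasure X A"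
    proof (rule NX.ergodic_measure_unique[OF NX.ergodic X.sigma_finite_measure_axioms, of \<rho>])
      show "sets \<rho> = sets X" by (simp add: \<rho>_def)
      show "absolutely_continuous X \<rho>"
        unfolding absolutely_continuous_def
      proof
        fix A assume A: "A \<in> null_sets X"
        have "null_preserving Z X (\<lambda>z. fst (F z))" by (rule null_preserving_comp[OF mor_np[OF FD(1)] null_preserving_fst])
        then have "V A \<in> null_sets Z" using A by (simp add: null_preserving_def V_def)
        then have "emeasure Z (V A \<inter> S) = 0" using S by (metis null_setsD1 null_set_Int2)
        then show "A \<in> null_sets \<rho>" using A \<rho>1[of A] by (auto simp: null_sets_def \<rho>_def)
      qed
      fix k A assume kA: "k \<in> carrier N" "A \<in> sets X"
      have A': "\<alpha> k -` A \<inter> space X \<in> sets X" using kA by (intro measurable_sets[OF XA.act_measurable]) auto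
      show "emeasure \<rho> (\<alpha> k -` A \<inter> space X) = emeasure \<rho> A"
        unfolding \<rho>2[OF A'] \<rho>2[OF kA(2)]
        by (rule nn_integral_cong_AE) (use minv[OF kA] in eventually_elim, simp)
    qed (use X.emeasure_space_1 that in auto)
    \<comment> \<open>Testing the whole space identifies the factor \<open>c\<close> as the measure
      of \<open>B\<close>, possibly infinite.\<close>
    have "m (space X) y = 1" if y: "y \<in> space Y" for y
    proof -
      have "(\<lambda>x. (x, y)) -` V (space X) = space X"
        using y mor_space[OF FD(1)] by (auto simp: V_def space_pair_measure)
      then show ?thesis by (simp add: m_def X.emeasure_space_1)
    qed
    then have "c = (\<integral>\<^sup>+y. indicator B y \<partial>Y)"
      using c[of "space X"] \<rho>2[of "space X"] by (simp add: X.emeasure_space_1 cong: nn_integral_cong)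
    then have "emeasure \<rho> A = (\<integral>\<^sup>+y. emeasure X A * indicator B y \<partial>Y)"
      unfolding nn_integral_cmult_indicator[OF B] using c[OF A] by (simp add: mult.commute)
    then show ?thesis using \<rho>2[OF A] by simp
  qed
  have eq: "AE y in Y. m A y = emeasure X A" if A: "A \<in> sets X" for A
  proof -
    have "density Y (m A) = density Y (\<lambda>_. emeasure X A)"
      by (rule measure_eqI) (use integral[OF A] mm[OF A] in \<open>auto simp: emeasure_density\<close>)
    then show ?thesis using Y.density_unique_iff[OF mm[OF A], of "\<lambda>_. emeasure X A"] by simp
  qed
  obtain G where G: "countable G" "Int_stable G" "G \<subseteq> sets X" "space X \<in> G" "sets X = sigma_sets (space X) G"
    by (rule standard_measure_generator[OF X(1)])
  have "AE y in Y. \<forall>A\<in>G. m A y = emeasure X A"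
    using eq G(3) by (subst AE_ball_countable[OF G(1)]) blast
  then show ?thesis
    using AE_space
  proof eventually_elim
    case (elim y)
    have fy: "(\<lambda>x. fst (F (x, y))) \<in> X \<rightarrow>\<^sub>M X"
      by (rule measurable_compose[OF _ f]) (use elim in measurable)
    have e: "emeasure (distr X X (\<lambda>x. fst (F (x, y)))) A = m A y" if A: "A \<in> sets X" for A
    proof -
      have "(\<lambda>x. fst (F (x, y))) -` A \<inter> space X = (\<lambda>x. (x, y)) -` V A"
        using elim(2) by (auto simp: V_def space_pair_measure)
      then show ?thesis by (simp add: emeasure_distr[OF fy A] m_def)
    qed
    show ?case
    proof (rule measure_eqI_generator_eq[OF G(2), where \<Omega>="space X" and A="\<lambda>_. space X"])
      show "G \<subseteq> Pow (space X)" using G(3) sets.sets_into_space by blast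
      show "emeasure (distr X X (\<lambda>x. fst (F (x, y)))) A = emeasure X A" if "A \<in> G" for A
        using e[of A] elim(1) G(3) that by auto
      show "emeasure (distr X X (\<lambda>x. fst (F (x, y)))) (space X) \<noteq> \<infinity>" for i :: nat
        using e[of "space X"] elim(1) G(4) by (simp add: X.emeasure_space_1)
    qed (use G in auto)
  qed
qed

text \<open>The inverse of \<open>F_y\<close> is the first coordinate of \<open>H\<close> on the
  fibre over \<open>F0 y\<close>, corrected by the inverse of the element \<open>\<kappa> y\<close>
  that moves \<open>z\<close> to \<open>H (F z)\<close>.\<close>

lemma normal_form_conjugation:
  assumes F: "normal_form F D F0" and H: "normal_form H E H0"
    and HF: "AE z in Z. oeq (H (F z)) z" and FH: "AE z in Z. oeq (F (H z)) z"
  shows "AE y in Y. is_conjugation N X \<alpha> (\<lambda>x. fst (F (x, y)))"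
proof -
  note FD = normal_formD[OF F] and HD = normal_formD[OF H]
  obtain \<kappa> where \<kappa>: "\<kappa> \<in> Y \<rightarrow>\<^sub>M count_space (carrier \<Gamma>)" "AE z in Z. H (F z) = \<sigma> (\<kappa> (snd z)) z"
    by (rule normal_form_compose[OF F H HF])
  note iso = normal_form_iso[OF F H HF FH]
  show ?thesis
    using iso normal_form_measure_preserving[OF F iso] AE_sections[OF \<kappa>(2)] AE_sections[OF FD(3)] AE_sections[OF FD(6)] AE_space
  proof eventually_elim
    case (elim y)
    have y: "y \<in> space Y" by fact
    have ky: "\<kappa> y \<in> carrier \<Gamma>" by (rule count_in_Y[OF \<kappa>(1) y])
    have F0y: "F0 y \<in> space Y" by (rule measurable_space[OF FD(2) y])
    define f where "f = (\<lambda>x. fst (F (x, y)))"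
    define j where "j = (\<lambda>x. \<alpha> (iv (\<kappa> y)) (fst (H (x, F0 y))))"
    have f: "f \<in> X \<rightarrow>\<^sub>M X" unfolding f_def
      by (rule measurable_compose[OF _ measurable_compose[OF mor_measurable[OF FD(1)] measurable_fst]]) (use y in measurable)
    have H1: "(\<lambda>x. fst (H (x, F0 y))) \<in> X \<rightarrow>\<^sub>M X"
      by (rule measurable_compose[OF _ measurable_compose[OF mor_measurable[OF HD(1)] measurable_fst]]) (use F0y in measurable)
    have j: "j \<in> X \<rightarrow>\<^sub>M X" unfolding j_def
      by (rule measurable_compose[OF H1 XA.act_measurable]) (use ky in simp)
    have mp: "distr X X f = X" using elim(2) by (simp add: f_def)
    have jf: "AE x in X. j (f x) = x"
      using elim(3,4) AE_space
    proof eventually_elim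
      case (elim x)
      have s: "F (x, y) \<in> space Z" using mor_space[OF FD(1), of "(x, y)"] elim y by simp
      have "F (x, y) = (f x, F0 y)" using elim(2) by (simp add: f_def prod_eq_iff)
      then have "j (f x) = \<alpha> (iv (\<kappa> y)) (fst (H (F (x, y))))" by (simp add: j_def)
      also have "\<dots> = \<alpha> (iv (\<kappa> y)) (\<alpha> (\<kappa> y) x)" using elim y by simp
      also have "\<dots> = x" using ky elim(3) by simp
      finally show ?case .
    qed
    have m: "{x \<in> space X. f (j x) = x} \<in> sets X"
      by (rule standard_measure_eq_sets[OF X(1) measurable_compose[OF j f] measurable_ident_sets[OF refl]])
    \<comment> \<open>A left inverse of a measure preserving map is also a right inverse almost
      everywhere: the identity holds at the points \<open>f x\<close>, and these carry the image
      measure, which is \<open>X\<close>.\<close>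
    have "AE x in distr X X f. f (j x) = x"
      by (subst AE_distr_iff[OF f m]) (use jf in eventually_elim, simp)
    then have fj: "AE x in X. f (j x) = x" unfolding mp .
    have "f \<in> ns_isos X X"
      unfolding ns_isos_def
    proof (intro CollectI conjI f bexI[of _ j] jf fj j ballI)
      fix A assume "A \<in> sets X"
      then show "(emeasure X (f -` A \<inter> space X) = 0) = (emeasure X A = 0)"
        by (metis emeasure_distr f mp)
    qed
    moreover have eq: "AE x in X. f (\<alpha> n x) = \<alpha> (D n y) (f x)" if n: "n \<in> carrier N" for n
      using elim(5) AE_space
    proof eventually_elim
      case (elim x)
      have s: "F (x, y) \<in> space Z" using mor_space[OF FD(1), of "(x, y)"] elim y by simp
      have "F (\<sigma> n (x, y)) = \<sigma> (D n y) (F (x, y))" using elim(1) n by simp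
      then have "F (\<alpha> n x, y) = \<sigma> (D n y) (F (x, y))" using n elim(2) y by simp
      then show ?case using s by (simp add: f_def)
    qed
    ultimately have "is_conjugation N X \<alpha> f"
      unfolding is_conjugation_def using mp elim(1) by (intro conjI bexI[of _ "\<lambda>n. D n y"] ballI eq) auto
    then show ?case by (simp add: f_def)
  qed
qed

section \<open>Maps that fix the first coordinate, and rigidity of morphisms\<close>

definition id_map :: "('y \<Rightarrow> 'y) \<Rightarrow> 'x \<times> 'y \<Rightarrow> 'x \<times> 'y" where
  "id_map f z = (fst z, f (snd z))"

lemma fst_id_map [simp]: "fst (id_map f z) = fst z" and snd_id_map [simp]: "snd (id_map f z) = f (snd z)"
  by (simp_all add: id_map_def)

lemma id_map_measurable: "f \<in> Y \<rightarrow>\<^sub>M Y \<Longrightarrow> id_map f \<in> Z \<rightarrow>\<^sub>M Z"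
  unfolding id_map_def by (intro measurable_Pair measurable_fst measurable_compose[OF measurable_snd])

lemma id_map_null_preserving:
  assumes f: "null_preserving Y Y f" shows "null_preserving Z Z (id_map f)"
proof (rule null_preservingI)
  show "id_map f \<in> Z \<rightarrow>\<^sub>M Z" using f by (intro id_map_measurable) (simp add: null_preserving_def)
  fix A assume A: "A \<in> null_sets Z"
  have m: "id_map f \<in> Z \<rightarrow>\<^sub>M Z" by fact
  show "AE z in Z. id_map f z \<notin> A"
  proof (rule XY.AE_pair_measure_swap)
    have "{z \<in> space Z. id_map f z \<notin> A} = space Z - (id_map f -` A \<inter> space Z)" by auto
    also have "\<dots> \<in> sets Z" using measurable_sets[OF m] A by blast
    finally show "{z \<in> space Z. id_map f z \<notin> A} \<in> sets Z" .
    have "AE y in Y. AE x in X. (x, y) \<notin> A" by (rule AE_sections[OF AE_not_in[OF A]])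
    from null_preserving_AE[OF f this] show "AE y in Y. AE x in X. id_map f (x, y) \<notin> A"
      by (simp add: id_map_def)
  qed
qed

text \<open>The group element relating the two points fixes the common first coordinate, so it is
  trivial by freeness.\<close>

lemma oeq_id_map_unique:
  assumes f: "f \<in> Y \<rightarrow>\<^sub>M Y" "g \<in> Y \<rightarrow>\<^sub>M Y" and z: "z \<in> space Z" "free z"
    and oeq: "oeq (id_map f z) (id_map g z)"
  shows "f (snd z) = g (snd z)"
proof -
  have s: "id_map g z \<in> space Z" by (rule measurable_space[OF id_map_measurable[OF f(2)] z(1)])
  obtain k where k: "k \<in> carrier \<Gamma>" "id_map f z = \<sigma> k (id_map g z)" using oeq by (auto simp: oeq_def)
  have "fst z = \<alpha> k (fst z)" using arg_cong[OF k(2), of fst] s by simp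
  then have "\<alpha> \<one>\<^bsub>\<Gamma>\<^esub> (fst z) = \<alpha> k (fst z)" using z(1) by simp
  then have "k = \<one>\<^bsub>\<Gamma>\<^esub>" using z(2) k(1) G.one_closed unfolding free_def by metis
  then show ?thesis using arg_cong[OF k(2), of snd] s by simp
qed

lemma commuting_mor:
  assumes f: "null_preserving Y Y f" and comm: "\<And>l. l \<in> carrier \<Lambda> \<Longrightarrow> AE y in Y. f (\<beta> l y) = \<beta> l (f y)"
    and g: "g \<in> carrier \<Gamma>"
  shows "AE z in Z. id_map f (\<sigma> g z) = \<sigma> g (id_map f z)"
proof -
  have "AE z in Z. f (\<beta> (\<pi> g) (snd z)) = \<beta> (\<pi> g) (f (snd z))" by (rule AE_snd[OF comm]) (use g in simp)
  then show ?thesis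
    using AE_space
  proof eventually_elim
    case (elim z)
    have s: "f (snd z) \<in> space Y" using f elim(2) measurable_space[of f Y Y] by (auto simp: null_preserving_def)
    show ?case using elim s g by (simp add: id_map_def prod_eq_iff)
  qed
qed

lemma mor_id_map:
  assumes f: "null_preserving Y Y f" and comm: "\<And>l. l \<in> carrier \<Lambda> \<Longrightarrow> AE y in Y. f (\<beta> l y) = \<beta> l (f y)"
  shows "mor (id_map f)"
  unfolding mor_def
proof (intro conjI ballI)
  fix g assume g: "g \<in> carrier \<Gamma>"
  have "AE z in Z. id_map f (\<sigma> g z) = \<sigma> g (id_map f z)" by (rule commuting_mor[OF f _ g]) (rule comm)
  then show "AE z in Z. oeq (id_map f (\<sigma> g z)) (id_map f z)"
    by eventually_elim (use g in \<open>auto simp: oeq_def\<close>)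
qed (rule id_map_null_preserving[OF f])

text \<open>Comparing first coordinates shows that the element moving \<open>id_map f z\<close> to
  \<open>id_map f (\<sigma> g z)\<close> is \<open>g\<close> itself; the second coordinate is then
  the commutation relation, and every \<open>l\<close> is some \<open>\<pi> g\<close>.\<close>

lemma mor_id_mapD:
  assumes f: "f \<in> Y \<rightarrow>\<^sub>M Y" and mor: "mor (id_map f)" and l: "l \<in> carrier \<Lambda>"
  shows "AE y in Y. f (\<beta> l y) = \<beta> l (f y)"
proof -
  have "l \<in> \<pi> ` carrier \<Gamma>" using l surj_\<pi> by simp
  then obtain g where g': "l = \<pi> g" "g \<in> carrier \<Gamma>" by (rule imageE)
  note g = g'(2) g'(1)[symmetric]
  have "AE z in Z. oeq (id_map f (\<sigma> g z)) (id_map f z)" using mor g by (simp add: mor_def)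
  then have "AE z in Z. f (\<beta> (\<pi> g) (snd z)) = \<beta> (\<pi> g) (f (snd z))"
    using AE_free AE_space
  proof eventually_elim
    case (elim z)
    have s: "id_map f z \<in> space Z" by (rule measurable_space[OF id_map_measurable[OF f] elim(3)])
    obtain h where h: "h \<in> carrier \<Gamma>" "id_map f (\<sigma> g z) = \<sigma> h (id_map f z)" using elim(1) by (auto simp: oeq_def)
    have "\<alpha> g (fst z) = \<alpha> h (fst z)" using arg_cong[OF h(2), of fst] s elim(3) by simp
    then have "g = h" using elim(2) g(1) h(1) unfolding free_def by metis
    then show ?case using arg_cong[OF h(2), of snd] s elim(3) by simp
  qed
  from AE_sndD[OF this] show ?thesis by (simp add: g)
qed

lemma mor_cong_oeq:
  assumes F: "mor F" and K: "K \<in> Z \<rightarrow>\<^sub>M Z" and eq: "AE z in Z. oeq (F z) (K z)"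
  shows "mor K"
proof -
  have "AE z in Z. oeq (K z) (F z)"
    using eq AE_space by eventually_elim (use oeq_sym measurable_space[OF K] in blast)
  then obtain k where k: "k \<in> Z \<rightarrow>\<^sub>M count_space (carrier \<Gamma>)" "AE z in Z. K z = \<sigma> (k z) (F z)"
    by (rule choose_group_element[OF K mor_measurable[OF F]])
  have T: "mor (\<lambda>z. \<sigma> (k z) (F z))" by (rule mor_twist[OF F k(1)])
  show ?thesis unfolding mor_def
  proof (intro conjI ballI)
    show "null_preserving Z Z K" by (rule null_preserving_cong[OF mor_np[OF T] K k(2)])
    fix g assume g: "g \<in> carrier \<Gamma>"
    have "AE z in Z. oeq (\<sigma> (k (\<sigma> g z)) (F (\<sigma> g z))) (\<sigma> (k z) (F z))" using T g by (simp add: mor_def)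
    then show "AE z in Z. oeq (K (\<sigma> g z)) (K z)"
      using k(2) ZA.act_AE[OF k(2) g] by eventually_elim simp
  qed
qed

lemma mor_quasi_inverse_cong:
  assumes D: "mor D" and T: "mor T" and F: "mor F" and H: "mor H"
    and FD: "AE z in Z. oeq (F z) (D z)" and HT: "AE z in Z. oeq (H z) (T z)"
    and TD: "AE z in Z. oeq (T (D z)) z"
  shows "AE z in Z. oeq (H (F z)) z"
  using mor_AE[OF D mor_AE_oeq[OF H]] FD mor_AE[OF D HT] TD AE_space
proof eventually_elim
  case (elim z)
  have s: "D z \<in> space Z" "T (D z) \<in> space Z" using mor_space[OF D] mor_space[OF T] elim(5) by auto
  have "oeq (H (F z)) (H (D z))" using elim(1,2) by blast
  then show ?case using oeq_trans[OF oeq_trans[OF _ elim(3) s(2)] elim(4,5)] by blast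
qed

text \<open>\<open>T\<close> is an inverse of \<open>D\<close> modulo orbits. Its normal form is
  what shows that the fibre maps of \<open>D\<close> are conjugations. The group elements
  implementing these are chosen measurably and absorbed into \<open>f\<close>.\<close>

lemma mor_rigid_aux:
  assumes D: "mor D" and T: "mor T"
    and TD: "AE z in Z. oeq (T (D z)) z" and DT: "AE z in Z. oeq (D (T z)) z"
  obtains f where "f \<in> Y \<rightarrow>\<^sub>M Y" "AE z in Z. oeq (D z) (id_map f z)"
proof -
  obtain F d F0 where F: "normal_form F d F0" and FD: "AE z in Z. oeq (F z) (D z)" by (rule normal_form_exists[OF D])
  obtain H e H0 where H: "normal_form H e H0" and HT: "AE z in Z. oeq (H z) (T z)" by (rule normal_form_exists[OF T])
  note Fm = normal_formD(1)[OF F] and Hm = normal_formD(1)[OF H]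
  have HF: "AE z in Z. oeq (H (F z)) z" by (rule mor_quasi_inverse_cong[OF D T Fm Hm FD HT TD])
  have FH: "AE z in Z. oeq (F (H z)) z" by (rule mor_quasi_inverse_cong[OF T D Hm Fm HT FD DT])
  have conj: "AE y in Y. \<exists>g\<in>carrier \<Gamma>. AE x in X. fst (F (x, y)) = \<alpha> g x"
    using normal_form_conjugation[OF F H HF FH] by eventually_elim (rule conjugations)
  have fF: "(\<lambda>z. fst (F z)) \<in> Z \<rightarrow>\<^sub>M X" by (rule measurable_compose[OF mor_measurable[OF Fm] measurable_fst])
  obtain \<gamma> where \<gamma>: "\<gamma> \<in> Y \<rightarrow>\<^sub>M count_space (carrier \<Gamma>)" "AE y in Y. AE x in X. fst (F (x, y)) = \<alpha> (\<gamma> y) x"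
  proof (rule measurable_countable_choice[OF \<Gamma>(2) _ _ conj])
    fix g assume g: "g \<in> carrier \<Gamma>"
    have "{z \<in> space (Y \<Otimes>\<^sub>M X). fst (F (snd z, fst z)) = \<alpha> g (snd z)} \<in> sets (Y \<Otimes>\<^sub>M X)"
    proof (rule standard_measure_eq_sets[OF X(1)])
      show "(\<lambda>z. fst (F (snd z, fst z))) \<in> Y \<Otimes>\<^sub>M X \<rightarrow>\<^sub>M X"
        by (rule measurable_compose[OF _ fF]) measurable
      show "(\<lambda>z. \<alpha> g (snd z)) \<in> Y \<Otimes>\<^sub>M X \<rightarrow>\<^sub>M X" by (rule measurable_compose[OF measurable_snd XA.act_measurable[OF g]])
    qed
    from X.sets_Collect_AE[OF this] show "{y \<in> space Y. AE x in X. fst (F (x, y)) = \<alpha> g x} \<in> sets Y" by simp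
  qed (use G.one_closed that in auto)
  define f where "f y = \<beta> (\<pi> (iv (\<gamma> y))) (F0 y)" for y
  have f: "f \<in> Y \<rightarrow>\<^sub>M Y" unfolding f_def
    by (rule measurable_compose_countable'[OF measurable_compose[OF normal_formD(2)[OF F]] \<gamma>(1) \<Gamma>(2)]) simp
  have "AE z in Z. fst (F z) = \<alpha> (\<gamma> (snd z)) (fst z)"
  proof (rule XY.AE_pair_measure_swap)
    have "(\<lambda>z. \<alpha> (\<gamma> (snd z)) (fst z)) \<in> Z \<rightarrow>\<^sub>M X"
      by (rule measurable_compose_countable'[OF measurable_compose[OF measurable_fst] measurable_compose[OF measurable_snd \<gamma>(1)] \<Gamma>(2)]) simp
    then show "{z \<in> space Z. fst (F z) = \<alpha> (\<gamma> (snd z)) (fst z)} \<in> sets Z"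
      by (rule standard_measure_eq_sets[OF X(1) fF])
  qed (use \<gamma>(2) in simp)
  then have "AE z in Z. oeq (D z) (id_map f z)"
    using normal_formD(3)[OF F] FD AE_space
  proof eventually_elim
    case (elim z)
    have g: "\<gamma> (snd z) \<in> carrier \<Gamma>" by (rule count_in_Y[OF \<gamma>(1)]) (use elim in simp)
    have s: "id_map f z \<in> space Z" by (rule measurable_space[OF id_map_measurable[OF f] elim(4)])
    have F0: "F0 (snd z) \<in> space Y" by (rule measurable_space[OF normal_formD(2)[OF F]]) (use elim in simp)
    have "F z = \<sigma> (\<gamma> (snd z)) (id_map f z)"
      using elim(1,2) s g YA.act_inv(2)[OF g F0] by (simp add: prod_eq_iff f_def)
    then have Fid: "oeq (F z) (id_map f z)" using g by (auto simp: oeq_def)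
    have "oeq (D z) (F z)" by (rule oeq_sym[OF elim(3) mor_space[OF D elim(4)]])
    then show ?case using Fid s by (rule oeq_trans)
  qed
  then show ?thesis using f that by blast
qed

text \<open>Both \<open>D\<close> and its inverse modulo orbits are equivalent to maps of the form
  \<open>id_map\<close>. By freeness these two maps are inverse to each other almost everywhere,
  which makes \<open>f\<close> an automorphism.\<close>

lemma mor_rigid:
  assumes D: "mor D" and T: "mor T"
    and TD: "AE z in Z. oeq (T (D z)) z" and DT: "AE z in Z. oeq (D (T z)) z"
  obtains f where "f \<in> ns_isos Y Y" "\<And>l. l \<in> carrier \<Lambda> \<Longrightarrow> AE y in Y. f (\<beta> l y) = \<beta> l (f y)"
    "AE z in Z. oeq (D z) (id_map f z)"
proof -
  obtain f where f: "f \<in> Y \<rightarrow>\<^sub>M Y" "AE z in Z. oeq (D z) (id_map f z)" by (rule mor_rigid_aux[OF D T TD DT])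
  obtain j where j: "j \<in> Y \<rightarrow>\<^sub>M Y" "AE z in Z. oeq (T z) (id_map j z)" by (rule mor_rigid_aux[OF T D DT TD])
  have mf: "mor (id_map f)" by (rule mor_cong_oeq[OF D id_map_measurable[OF f(1)] f(2)])
  have mj: "mor (id_map j)" by (rule mor_cong_oeq[OF T id_map_measurable[OF j(1)] j(2)])
  have np: "null_preserving Y Y f" if mf: "mor (id_map f)" and f: "f \<in> Y \<rightarrow>\<^sub>M Y" for f
  proof (rule null_preservingI[OF f])
    fix A assume "A \<in> null_sets Y"
    then have "AE z in Z. snd (id_map f z) \<notin> A" by (intro mor_AE[OF mf] AE_snd AE_not_in)
    then have "AE z in Z. f (snd z) \<notin> A" by simp
    then show "AE y in Y. f y \<notin> A" by (rule AE_sndD)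
  qed
  have inv: "AE y in Y. j (f y) = y"
    if f: "f \<in> Y \<rightarrow>\<^sub>M Y" "AE z in Z. oeq (D z) (id_map f z)" and j: "j \<in> Y \<rightarrow>\<^sub>M Y" "AE z in Z. oeq (T z) (id_map j z)"
      and m: "mor (id_map f)" "mor (id_map j)" "mor D" "mor T" and TD: "AE z in Z. oeq (T (D z)) z" for f j D T
  proof -
    have a: "AE z in Z. oeq (id_map f z) (D z)"
      using f(2) AE_space by eventually_elim (use oeq_sym measurable_space[OF id_map_measurable[OF f(1)]] in blast)
    have b: "AE z in Z. oeq (id_map j z) (T z)"
      using j(2) AE_space by eventually_elim (use oeq_sym measurable_space[OF id_map_measurable[OF j(1)]] in blast)
    have "AE z in Z. oeq (id_map j (id_map f z)) z" by (rule mor_quasi_inverse_cong[OF m(3,4,1,2) a b TD])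
    then have "AE z in Z. j (f (snd z)) = snd z"
      using AE_free AE_space
    proof eventually_elim
      case (elim z)
      have "oeq (id_map (\<lambda>y. j (f y)) z) (id_map (\<lambda>y. y) z)" using elim(1) by (simp add: id_map_def)
      from oeq_id_map_unique[OF measurable_compose[OF f(1) j(1)] measurable_ident_sets[OF refl] elim(3,2) this] show ?case .
    qed
    then show ?thesis by (rule AE_sndD)
  qed
  have jf: "AE y in Y. j (f y) = y" by (rule inv[OF f j mf mj D T TD])
  have fj: "AE y in Y. f (j y) = y" by (rule inv[OF j f mj mf T D DT])
  have "f \<in> ns_isos Y Y"
    unfolding ns_isos_def
  proof (intro CollectI conjI f(1) bexI[of _ j] jf fj j(1) ballI)
    fix A assume A: "A \<in> sets Y"
    show "(emeasure Y (f -` A \<inter> space Y) = 0) = (emeasure Y A = 0)"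
    proof
      assume "emeasure Y A = 0"
      then show "emeasure Y (f -` A \<inter> space Y) = 0" using np[OF mf f(1)] A by (auto simp: null_preserving_def null_sets_def)
    next
      assume "emeasure Y (f -` A \<inter> space Y) = 0"
      then have "f -` A \<inter> space Y \<in> null_sets Y" using measurable_sets[OF f(1) A] by (simp add: null_sets_def)
      then have "AE y in Y. j y \<notin> f -` A \<inter> space Y" by (intro null_preserving_AE[OF np[OF mj j(1)]] AE_not_in)
      then have "AE y in Y. y \<notin> A" using fj AE_space
        by eventually_elim (use measurable_space[OF j(1)] in auto)
      then show "emeasure Y A = 0" using A AE_iff_null_sets null_setsD1 by blast
    qed
  qed
  then show ?thesis using mor_id_mapD[OF f(1) mf] f(2) that by blast
qed

end

section \<open>Automorphisms modulo null sets and outer automorphisms\<close>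

lemma ns_isos_null_preserving: "f \<in> ns_isos M N \<Longrightarrow> null_preserving M N f"
  unfolding ns_isos_def null_preserving_def by (auto simp: null_sets_def)

lemma null_preserving_measurable: "null_preserving M N f \<Longrightarrow> f \<in> M \<rightarrow>\<^sub>M N"
  by (simp add: null_preserving_def)

lemma null_preservingD_measurable_vimage:
  "null_preserving M N f \<Longrightarrow> A \<in> null_sets N \<Longrightarrow> f -` A \<inter> space M \<in> null_sets M"
  by (simp add: null_preserving_def)

lemma ns_isosI:
  assumes f: "null_preserving M N f" and g: "null_preserving N M g"
    and gf: "AE x in M. g (f x) = x" and fg: "AE y in N. f (g y) = y"
  shows "f \<in> ns_isos M N"
  unfolding ns_isos_def
proof (intro CollectI conjI bexI[of _ g] ballI gf fg null_preserving_measurable f g)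
  fix A assume A: "A \<in> sets N"
  show "(emeasure M (f -` A \<inter> space M) = 0) = (emeasure N A = 0)"
  proof
    assume "emeasure N A = 0"
    then show "emeasure M (f -` A \<inter> space M) = 0"
      using null_preservingD_measurable_vimage[OF f, of A] A by (auto simp: null_sets_def)
  next
    assume "emeasure M (f -` A \<inter> space M) = 0"
    then have "f -` A \<inter> space M \<in> null_sets M"
      using measurable_sets[OF null_preserving_measurable[OF f] A] by (simp add: null_sets_def)
    then have "AE y in N. g y \<notin> f -` A \<inter> space M" by (intro null_preserving_AE[OF g] AE_not_in)
    then have "AE y in N. y \<notin> A" using fg AE_space
      by eventually_elim (use measurable_space[OF null_preserving_measurable[OF g]] in auto)
    then show "emeasure N A = 0" using A AE_iff_null_sets null_setsD1 by blast
  qed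
qed

text \<open>The inverse in the definition is only measurable. It pulls null sets back to null sets
  because \<open>f\<close> detects them.\<close>

lemma ns_isosE:
  assumes f: "f \<in> ns_isos M N"
  obtains g where "g \<in> ns_isos N M" "AE x in M. g (f x) = x" "AE y in N. f (g y) = y"
proof -
  obtain g where g: "g \<in> N \<rightarrow>\<^sub>M M" "AE x in M. g (f x) = x" "AE y in N. f (g y) = y"
    using f unfolding ns_isos_def by blast
  have ns: "\<forall>A\<in>sets N. (emeasure M (f -` A \<inter> space M) = 0) = (emeasure N A = 0)"
    using f unfolding ns_isos_def by blast
  have fm: "f \<in> M \<rightarrow>\<^sub>M N" using f by (simp add: ns_isos_def)
  have "null_preserving N M g"
  proof (rule null_preservingI[OF g(1)])
    fix A assume A: "A \<in> null_sets M"
    let ?B = "g -` A \<inter> space N"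
    have B: "?B \<in> sets N" using A g(1) by (intro measurable_sets) auto
    have "AE x in M. x \<notin> f -` ?B \<inter> space M"
      using g(2) AE_not_in[OF A] by eventually_elim auto
    moreover have "f -` ?B \<inter> space M \<in> sets M" by (rule measurable_sets[OF fm B])
    ultimately have "f -` ?B \<inter> space M \<in> null_sets M" by (simp add: AE_iff_null_sets)
    then have "emeasure N ?B = 0" using bspec[OF ns B] null_setsD1 by blast
    then have "?B \<in> null_sets N" using B by (simp add: null_sets_def)
    from AE_not_in[OF this] show "AE y in N. g y \<notin> A" using AE_space by eventually_elim auto
  qed
  then have "g \<in> ns_isos N M" by (rule ns_isosI[OF _ ns_isos_null_preserving[OF f] g(3,2)])
  then show ?thesis using g(2,3) that by blast
qed

lemma ns_isos_AE: "f \<in> ns_isos M N \<Longrightarrow> AE y in N. P y \<Longrightarrow> AE x in M. P (f x)"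
  by (rule null_preserving_AE[OF ns_isos_null_preserving])

lemma ns_isos_measurable: "f \<in> ns_isos M N \<Longrightarrow> f \<in> M \<rightarrow>\<^sub>M N"
  by (simp add: ns_isos_def)

lemma ns_isos_space: "f \<in> ns_isos M N \<Longrightarrow> x \<in> space M \<Longrightarrow> f x \<in> space N"
  by (rule measurable_space[OF ns_isos_measurable])

lemma ns_isos_comp:
  assumes f: "f \<in> ns_isos N K" and g: "g \<in> ns_isos M N"
  shows "(\<lambda>x. f (g x)) \<in> ns_isos M K"
proof -
  obtain f' where f': "f' \<in> ns_isos K N" "AE x in N. f' (f x) = x" "AE y in K. f (f' y) = y" by (rule ns_isosE[OF f])
  obtain g' where g': "g' \<in> ns_isos N M" "AE x in M. g' (g x) = x" "AE y in N. g (g' y) = y" by (rule ns_isosE[OF g])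
  note np = ns_isos_null_preserving
  show ?thesis
  proof (rule ns_isosI[OF null_preserving_comp[OF np[OF g] np[OF f]] null_preserving_comp[OF np[OF f'(1)] np[OF g'(1)]]])
    show "AE x in M. g' (f' (f (g x))) = x" using ns_isos_AE[OF g f'(2)] g'(2) by eventually_elim simp
    show "AE y in K. f (g (g' (f' y))) = y" using ns_isos_AE[OF f'(1) g'(3)] f'(3) by eventually_elim simp
  qed
qed

lemma ns_isos_id: "(\<lambda>x. x) \<in> ns_isos M M"
  by (rule ns_isosI[where g="\<lambda>x. x"]) (auto simp: null_preserving_def null_sets_def Int_absorb2[OF sets.sets_into_space])

lemma ae_class_self: "f \<in> ns_isos M M \<Longrightarrow> f \<in> ae_class M f"
  by (simp add: ae_class_def)

lemma ae_classD: "g \<in> ae_class M f \<Longrightarrow> g \<in> ns_isos M M" "g \<in> ae_class M f \<Longrightarrow> AE x in M. g x = f x"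
  by (auto simp: ae_class_def)

lemma ae_class_eqI:
  assumes "AE x in M. f x = g x" shows "ae_class M f = ae_class M g"
proof -
  have "(AE x in M. h x = f x) \<longleftrightarrow> (AE x in M. h x = g x)" for h
  proof
    assume "AE x in M. h x = f x" then show "AE x in M. h x = g x" using assms by eventually_elim simp
  next
    assume "AE x in M. h x = g x" then show "AE x in M. h x = f x" using assms by eventually_elim simp
  qed
  then show ?thesis by (simp add: ae_class_def)
qed

lemma ae_class_eqD:
  "f \<in> ns_isos M M \<Longrightarrow> ae_class M f = ae_class M g \<Longrightarrow> AE x in M. f x = g x"
  using ae_class_self ae_classD(2) by blast

lemma carrier_Aut_ns: "carrier (Aut_ns M) = ae_class M ` ns_isos M M"
  by (simp add: Aut_ns_def)

lemma mult_Aut_ns: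
  assumes f: "f \<in> ns_isos M M" and g: "g \<in> ns_isos M M"
  shows "ae_class M f \<otimes>\<^bsub>Aut_ns M\<^esub> ae_class M g = ae_class M (\<lambda>x. f (g x))"
proof (intro equalityI subsetI)
  fix h assume "h \<in> ae_class M f \<otimes>\<^bsub>Aut_ns M\<^esub> ae_class M g"
  then obtain f' g' where *: "h \<in> ns_isos M M" "f' \<in> ae_class M f" "g' \<in> ae_class M g" "AE x in M. h x = f' (g' x)"
    by (auto simp: Aut_ns_def)
  have "AE x in M. h x = f (g x)"
    using *(4) ae_classD(2)[OF *(3)] ns_isos_AE[OF g ae_classD(2)[OF *(2)]] by eventually_elim simp
  then show "h \<in> ae_class M (\<lambda>x. f (g x))" using *(1) by (simp add: ae_class_def)
next
  fix h assume "h \<in> ae_class M (\<lambda>x. f (g x))"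
  then show "h \<in> ae_class M f \<otimes>\<^bsub>Aut_ns M\<^esub> ae_class M g"
    using ae_class_self[OF f] ae_class_self[OF g] by (auto simp: Aut_ns_def ae_class_def)
qed

lemma respects_rel_cong:
  assumes f: "respects_rel M R S f" and eq: "AE x in M. g x = f x"
  shows "respects_rel M R S g"
proof -
  obtain A where A: "A \<in> null_sets M" "\<forall>x\<in>space M - A. \<forall>y\<in>space M - A. (x, y) \<in> R \<longleftrightarrow> (f x, f y) \<in> S"
    using f by (auto simp: respects_rel_def)
  obtain B where B: "B \<in> null_sets M" "{x \<in> space M. g x \<noteq> f x} \<subseteq> B" using eq by (auto simp: eventually_ae_filter)
  show ?thesis unfolding respects_rel_def
  proof (rule bexI[of _ "A \<union> B"])
    show "\<forall>x\<in>space M - (A \<union> B). \<forall>y\<in>space M - (A \<union> B). (x, y) \<in> R \<longleftrightarrow> (g x, g y) \<in> S"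
    proof (intro ballI)
      fix x y assume "x \<in> space M - (A \<union> B)" "y \<in> space M - (A \<union> B)"
      moreover from this have "g x = f x" "g y = f y" using B(2) by auto
      ultimately show "(x, y) \<in> R \<longleftrightarrow> (g x, g y) \<in> S" using A(2) by auto
    qed
  qed (use A B in auto)
qed

lemma respects_rel_comp:
  assumes f: "respects_rel N S T f" and g: "respects_rel M R S g" and np: "null_preserving M N g"
  shows "respects_rel M R T (\<lambda>x. f (g x))"
proof -
  obtain A where A: "A \<in> null_sets N" "\<forall>x\<in>space N - A. \<forall>y\<in>space N - A. (x, y) \<in> S \<longleftrightarrow> (f x, f y) \<in> T"
    using f by (auto simp: respects_rel_def)
  obtain B where B: "B \<in> null_sets M" "\<forall>x\<in>space M - B. \<forall>y\<in>space M - B. (x, y) \<in> R \<longleftrightarrow> (g x, g y) \<in> S"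
    using g by (auto simp: respects_rel_def)
  let ?C = "g -` A \<inter> space M"
  show ?thesis unfolding respects_rel_def
  proof (rule bexI[of _ "?C \<union> B"])
    show "?C \<union> B \<in> null_sets M" using null_preservingD_measurable_vimage[OF np A(1)] B(1) by auto
    show "\<forall>x\<in>space M - (?C \<union> B). \<forall>y\<in>space M - (?C \<union> B). (x, y) \<in> R \<longleftrightarrow> (f (g x), f (g y)) \<in> T"
    proof (intro ballI)
      fix x y assume "x \<in> space M - (?C \<union> B)" "y \<in> space M - (?C \<union> B)"
      moreover from this have "g x \<in> space N - A" "g y \<in> space N - A"
        using measurable_space[OF null_preserving_measurable[OF np]] by auto
      ultimately show "(x, y) \<in> R \<longleftrightarrow> (f (g x), f (g y)) \<in> T" using A(2) B(2) by auto
    qed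
  qed
qed

lemma respects_rel_inverse:
  assumes f: "respects_rel M R S f" and g: "null_preserving N M g" and fg: "AE y in N. f (g y) = y"
  shows "respects_rel N S R g"
proof -
  obtain A where A: "A \<in> null_sets M" "\<forall>x\<in>space M - A. \<forall>y\<in>space M - A. (x, y) \<in> R \<longleftrightarrow> (f x, f y) \<in> S"
    using f by (auto simp: respects_rel_def)
  obtain B where B: "B \<in> null_sets N" "{y \<in> space N. f (g y) \<noteq> y} \<subseteq> B" using fg by (auto simp: eventually_ae_filter)
  let ?C = "g -` A \<inter> space N"
  show ?thesis unfolding respects_rel_def
  proof (rule bexI[of _ "?C \<union> B"])
    show "?C \<union> B \<in> null_sets N" using null_preservingD_measurable_vimage[OF g A(1)] B(1) by auto
    show "\<forall>x\<in>space N - (?C \<union> B). \<forall>y\<in>space N - (?C \<union> B). (x, y) \<in> S \<longleftrightarrow> (g x, g y) \<in> R"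
    proof (intro ballI)
      fix x y assume *: "x \<in> space N - (?C \<union> B)" "y \<in> space N - (?C \<union> B)"
      then have "g x \<in> space M - A" "g y \<in> space M - A"
        using measurable_space[OF null_preserving_measurable[OF g]] by auto
      moreover have "f (g x) = x" "f (g y) = y" using * B(2) by auto
      ultimately show "(x, y) \<in> S \<longleftrightarrow> (g x, g y) \<in> R" using A(2) by auto
    qed
  qed
qed

section \<open>Automorphisms of an equivalence relation and their cosets\<close>

lemma carrier_Aut_rel:
  "carrier (Aut_rel M S) = ae_class M ` {h \<in> ns_isos M M. respects_rel M S S h}"
proof (intro equalityI subsetI)
  fix C assume "C \<in> carrier (Aut_rel M S)"
  then obtain h where h: "h \<in> ns_isos M M" "C = ae_class M h" and "\<forall>f\<in>C. respects_rel M S S f"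
    by (auto simp: Aut_rel_def carrier_Aut_ns)
  then have "respects_rel M S S h" using ae_class_self by blast
  then show "C \<in> ae_class M ` {h \<in> ns_isos M M. respects_rel M S S h}" using h by blast
next
  fix C assume "C \<in> ae_class M ` {h \<in> ns_isos M M. respects_rel M S S h}"
  then obtain h where h: "h \<in> ns_isos M M" "C = ae_class M h" "respects_rel M S S h" by blast
  then have "\<forall>f\<in>C. respects_rel M S S f" by (auto intro: respects_rel_cong[OF h(3) ae_classD(2)])
  then show "C \<in> carrier (Aut_rel M S)" using h by (auto simp: Aut_rel_def carrier_Aut_ns)
qed

lemma mult_Aut_rel: "mult (Aut_rel M S) = mult (Aut_ns M)"
  by (simp add: Aut_rel_def)

text \<open>The one consequence of countable classes that the group theory below uses: almost every
  point has no equivalent point in a given null set. Orbit relations and their restrictions are thus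
  treated together.\<close>

locale null_equiv =
  fixes K :: "'z measure" and S :: "('z \<times> 'z) set"
  assumes equiv: "equiv (space K) S"
    and saturation: "\<And>A. A \<in> null_sets K \<Longrightarrow> AE x in K. \<forall>y. (y, x) \<in> S \<longrightarrow> y \<notin> A"
begin

lemma S_refl: "x \<in> space K \<Longrightarrow> (x, x) \<in> S"
  using equiv by (auto simp: equiv_def refl_on_def)

lemma S_sym: "(x, y) \<in> S \<Longrightarrow> (y, x) \<in> S"
  using equiv by (auto simp: equiv_def sym_def)

lemma S_trans: "(x, y) \<in> S \<Longrightarrow> (y, z) \<in> S \<Longrightarrow> (x, z) \<in> S"
  using equiv by (auto simp: equiv_def trans_def)

lemma S_space: "(x, y) \<in> S \<Longrightarrow> x \<in> space K \<and> y \<in> space K"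
  using equiv by (auto simp: equiv_def refl_on_def)

text \<open>\<open>respects_rel\<close> discards a null set for both points of a pair; saturation
  lets the second point range over the full class of the first.\<close>

lemma respects_AE:
  assumes "respects_rel K S T f"
  shows "AE x in K. \<forall>y. (y, x) \<in> S \<longrightarrow> (f y, f x) \<in> T"
proof -
  obtain A where A: "A \<in> null_sets K" "\<forall>x\<in>space K - A. \<forall>y\<in>space K - A. (x, y) \<in> S \<longleftrightarrow> (f x, f y) \<in> T"
    using assms by (auto simp: respects_rel_def)
  show ?thesis
    using saturation[OF A(1)] AE_not_in[OF A(1)]
  proof eventually_elim
    case (elim x)
    show ?case
    proof (intro allI impI)
      fix y assume y: "(y, x) \<in> S"
      then have "y \<in> space K - A" "x \<in> space K - A" using elim S_space by auto
      then show "(f y, f x) \<in> T" using A(2) y by blast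
    qed
  qed
qed

definition aut :: "('z \<Rightarrow> 'z) set" where
  "aut = {h \<in> ns_isos K K. respects_rel K S S h}"

lemma aut_ns: "h \<in> aut \<Longrightarrow> h \<in> ns_isos K K"
  by (simp add: aut_def)

lemma aut_AE: "h \<in> aut \<Longrightarrow> AE x in K. P x \<Longrightarrow> AE x in K. P (h x)"
  by (rule ns_isos_AE[OF aut_ns])

lemma aut_comp: "f \<in> aut \<Longrightarrow> g \<in> aut \<Longrightarrow> (\<lambda>x. f (g x)) \<in> aut"
proof -
  assume "f \<in> aut" "g \<in> aut"
  then have f: "f \<in> ns_isos K K" "respects_rel K S S f" and g: "g \<in> ns_isos K K" "respects_rel K S S g"
    by (simp_all add: aut_def)
  have "respects_rel K S S (\<lambda>x. f (g x))"
    by (rule respects_rel_comp[OF f(2) g(2) ns_isos_null_preserving[OF g(1)]])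
  then show ?thesis using ns_isos_comp[OF f(1) g(1)] by (simp add: aut_def)
qed

lemma aut_inverse:
  assumes "f \<in> aut"
  obtains g where "g \<in> aut" "AE x in K. g (f x) = x" "AE y in K. f (g y) = y"
proof -
  obtain g where g: "g \<in> ns_isos K K" "AE x in K. g (f x) = x" "AE y in K. f (g y) = y"
    by (rule ns_isosE[OF aut_ns[OF assms]])
  have "respects_rel K S S f" using assms by (simp add: aut_def)
  then have "respects_rel K S S g" by (rule respects_rel_inverse[OF _ ns_isos_null_preserving[OF g(1)] g(3)])
  then show ?thesis using g that by (auto simp: aut_def)
qed

lemma carrier_aut: "carrier (Aut_rel K S) = ae_class K ` aut"
  by (simp add: carrier_Aut_rel aut_def)

lemma aut_full:
  assumes e: "e \<in> ns_isos K K" and r: "AE x in K. (e x, x) \<in> S"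
  shows "e \<in> aut"
proof -
  obtain A where A: "A \<in> null_sets K" "{x \<in> space K. (e x, x) \<notin> S} \<subseteq> A" using r by (auto simp: eventually_ae_filter)
  have "respects_rel K S S e" unfolding respects_rel_def
  proof (rule bexI[OF _ A(1)], intro ballI)
    fix x y assume "x \<in> space K - A" "y \<in> space K - A"
    then have "(e x, x) \<in> S" "(e y, y) \<in> S" using A(2) by auto
    then show "(x, y) \<in> S \<longleftrightarrow> (e x, e y) \<in> S" using S_sym S_trans by metis
  qed
  then show ?thesis using e by (simp add: aut_def)
qed

lemma full_group_iff:
  "C \<in> full_group K S \<longleftrightarrow> (\<exists>e\<in>ns_isos K K. C = ae_class K e \<and> (AE x in K. (e x, x) \<in> S))"
proof
  assume "C \<in> full_group K S"
  then show "\<exists>e\<in>ns_isos K K. C = ae_class K e \<and> (AE x in K. (e x, x) \<in> S)"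
    unfolding full_group_def carrier_aut using ae_class_self aut_ns by fastforce
next
  assume "\<exists>e\<in>ns_isos K K. C = ae_class K e \<and> (AE x in K. (e x, x) \<in> S)"
  then obtain e where e: "e \<in> ns_isos K K" "C = ae_class K e" "AE x in K. (e x, x) \<in> S" by blast
  have "AE x in K. (f x, x) \<in> S" if "f \<in> C" for f
    using ae_classD(2)[of f K e] e(3) that e(2) by (auto elim!: eventually_elim2)
  then show "C \<in> full_group K S"
    using aut_full[OF e(1,3)] e(2) by (auto simp: full_group_def carrier_aut)
qed

text \<open>The coset of \<open>h\<close> in a form without products: classes of automorphisms that
  agree with \<open>h\<close> up to equivalence. An automorphism of a restriction can be compared in
  this way with a map that leaves the set.\<close>

definition out_coset :: "('z \<Rightarrow> 'z) \<Rightarrow> ('z \<Rightarrow> 'z) set set" where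
  "out_coset h = {ae_class K h' | h'. h' \<in> aut \<and> (AE x in K. (h' x, h x) \<in> S)}"

text \<open>For \<open>h'\<close> equivalent to \<open>h\<close>, the required element of the full
  group is \<open>h'\<close> composed with the inverse of \<open>h\<close>.\<close>

lemma coset_eq:
  assumes h: "h \<in> aut"
  shows "full_group K S #>\<^bsub>Aut_rel K S\<^esub> ae_class K h = out_coset h"
proof (intro equalityI subsetI)
  fix D assume "D \<in> full_group K S #>\<^bsub>Aut_rel K S\<^esub> ae_class K h"
  then obtain C where C: "C \<in> full_group K S" "D = C \<otimes>\<^bsub>Aut_ns K\<^esub> ae_class K h"
    by (auto simp: r_coset_def mult_Aut_rel)
  then obtain e where e: "e \<in> ns_isos K K" "C = ae_class K e" "AE x in K. (e x, x) \<in> S" by (auto simp: full_group_iff)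
  have "D = ae_class K (\<lambda>x. e (h x))" unfolding C(2) e(2) by (rule mult_Aut_ns[OF e(1) aut_ns[OF h]])
  moreover have "(\<lambda>x. e (h x)) \<in> aut" by (rule aut_comp[OF aut_full[OF e(1,3)] h])
  moreover have "AE x in K. (e (h x), h x) \<in> S" by (rule aut_AE[OF h e(3)])
  ultimately show "D \<in> out_coset h" unfolding out_coset_def by blast
next
  fix D assume "D \<in> out_coset h"
  then obtain h' where h': "h' \<in> aut" "D = ae_class K h'" "AE x in K. (h' x, h x) \<in> S" by (auto simp: out_coset_def)
  obtain g where g: "g \<in> aut" "AE x in K. g (h x) = x" "AE y in K. h (g y) = y" by (rule aut_inverse[OF h])
  let ?e = "\<lambda>x. h' (g x)"
  have e: "?e \<in> ns_isos K K" by (rule aut_ns[OF aut_comp[OF h'(1) g(1)]])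
  have "AE x in K. (?e x, x) \<in> S" using aut_AE[OF g(1) h'(3)] g(3) by eventually_elim simp
  then have "ae_class K ?e \<in> full_group K S" using e by (auto simp: full_group_iff)
  moreover have "D = ae_class K ?e \<otimes>\<^bsub>Aut_ns K\<^esub> ae_class K h"
    unfolding mult_Aut_ns[OF e aut_ns[OF h]] h'(2)
    by (rule ae_class_eqI) (use g(2) in eventually_elim, simp)
  ultimately show "D \<in> full_group K S #>\<^bsub>Aut_rel K S\<^esub> ae_class K h"
    by (auto simp: r_coset_def mult_Aut_rel)
qed

text \<open>Since \<open>h\<close> respects the relation, replacing \<open>k\<close> by an
  equivalent map changes \<open>h (k x)\<close> only within its class. Conversely, a member
  \<open>q\<close> of the right-hand coset is factored through the inverse of
  \<open>k\<close>.\<close>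

lemma out_coset_mult:
  assumes h: "h \<in> aut" and k: "k \<in> aut"
  shows "out_coset h <#>\<^bsub>Aut_rel K S\<^esub> out_coset k = out_coset (\<lambda>x. h (k x))"
proof (intro equalityI subsetI)
  fix D assume "D \<in> out_coset h <#>\<^bsub>Aut_rel K S\<^esub> out_coset k"
  then obtain h' k' where *: "h' \<in> aut" "AE x in K. (h' x, h x) \<in> S" "k' \<in> aut" "AE x in K. (k' x, k x) \<in> S"
    and D: "D = ae_class K h' \<otimes>\<^bsub>Aut_ns K\<^esub> ae_class K k'"
    by (auto simp: set_mult_def out_coset_def mult_Aut_rel)
  have hr: "AE x in K. \<forall>y. (y, x) \<in> S \<longrightarrow> (h y, h x) \<in> S" by (rule respects_AE) (use h in \<open>simp add: aut_def\<close>)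
  have "D = ae_class K (\<lambda>x. h' (k' x))" unfolding D by (rule mult_Aut_ns[OF aut_ns[OF *(1)] aut_ns[OF *(3)]])
  moreover have "AE x in K. (h' (k' x), h (k x)) \<in> S"
    using aut_AE[OF *(3,2)] *(4) aut_AE[OF k hr]
  proof eventually_elim
    case (elim x)
    then have "(h (k' x), h (k x)) \<in> S" by blast
    then show ?case using elim(1) S_trans by blast
  qed
  ultimately show "D \<in> out_coset (\<lambda>x. h (k x))"
    using aut_comp[OF *(1,3)] unfolding out_coset_def by blast
next
  fix D assume "D \<in> out_coset (\<lambda>x. h (k x))"
  then obtain q where q: "q \<in> aut" "D = ae_class K q" "AE x in K. (q x, h (k x)) \<in> S" by (auto simp: out_coset_def)
  obtain g where g: "g \<in> aut" "AE x in K. g (k x) = x" "AE y in K. k (g y) = y" by (rule aut_inverse[OF k])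
  let ?h = "\<lambda>x. q (g x)"
  have hq: "?h \<in> aut" by (rule aut_comp[OF q(1) g(1)])
  have "AE x in K. (?h x, h x) \<in> S" using aut_AE[OF g(1) q(3)] g(3) by eventually_elim simp
  then have "ae_class K ?h \<in> out_coset h" using hq unfolding out_coset_def by blast
  moreover have "ae_class K k \<in> out_coset k"
    unfolding out_coset_def using k S_refl ns_isos_space[OF aut_ns[OF k]] by auto
  moreover have "D = ae_class K ?h \<otimes>\<^bsub>Aut_ns K\<^esub> ae_class K k"
    unfolding mult_Aut_ns[OF aut_ns[OF hq] aut_ns[OF k]] q(2)
    by (rule ae_class_eqI) (use g(2) in eventually_elim, simp)
  ultimately show "D \<in> out_coset h <#>\<^bsub>Aut_rel K S\<^esub> out_coset k"
    by (auto simp: set_mult_def mult_Aut_rel)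
qed

lemma out_coset_eqD:
  assumes h: "h \<in> aut" and eq: "out_coset h = out_coset k"
  shows "AE x in K. (h x, k x) \<in> S"
proof -
  have "ae_class K h \<in> out_coset h"
    unfolding out_coset_def using h S_refl ns_isos_space[OF aut_ns[OF h]] by auto
  then obtain q where q: "q \<in> aut" "ae_class K h = ae_class K q" "AE x in K. (q x, k x) \<in> S"
    unfolding eq by (auto simp: out_coset_def)
  show ?thesis using ae_class_eqD[OF aut_ns[OF h] q(2)] q(3) by eventually_elim simp
qed

lemma carrier_Out_rel: "carrier (Out_rel K S) = out_coset ` aut"
proof -
  have "carrier (Out_rel K S) = (\<lambda>a. full_group K S #>\<^bsub>Aut_rel K S\<^esub> a) ` carrier (Aut_rel K S)"
    by (auto simp: Out_rel_def FactGroup_def RCOSETS_def)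
  also have "\<dots> = out_coset ` aut"
    unfolding carrier_aut image_image by (rule image_cong[OF refl coset_eq])
  finally show ?thesis .
qed

text \<open>\<open>r C h\<close> says that \<open>h\<close> represents \<open>C\<close>. A relation
  is used instead of a function because on a restriction there is no canonical automorphism for a
  given \<open>C\<close>, only one up to the full group.\<close>

lemma Out_rel_isoI:
  assumes ex: "\<And>C. C \<in> carrier G \<Longrightarrow> \<exists>h\<in>aut. r C h"
    and coset: "\<And>C h. C \<in> carrier G \<Longrightarrow> h \<in> aut \<Longrightarrow> r C h \<Longrightarrow> E C = out_coset h"
    and mult: "\<And>C D h k. C \<in> carrier G \<Longrightarrow> D \<in> carrier G \<Longrightarrow> h \<in> aut \<Longrightarrow> k \<in> aut \<Longrightarrow> r C h \<Longrightarrow> r D k \<Longrightarrow>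
      C \<otimes>\<^bsub>G\<^esub> D \<in> carrier G \<and> r (C \<otimes>\<^bsub>G\<^esub> D) (\<lambda>x. h (k x))"
    and inj: "\<And>C D h k. C \<in> carrier G \<Longrightarrow> D \<in> carrier G \<Longrightarrow> h \<in> aut \<Longrightarrow> k \<in> aut \<Longrightarrow> r C h \<Longrightarrow> r D k \<Longrightarrow>
      AE x in K. (h x, k x) \<in> S \<Longrightarrow> C = D"
    and surj: "\<And>h. h \<in> aut \<Longrightarrow> \<exists>C\<in>carrier G. r C h"
  shows "E \<in> iso G (Out_rel K S)"
proof -
  have hom: "E (C \<otimes>\<^bsub>G\<^esub> D) = E C \<otimes>\<^bsub>Out_rel K S\<^esub> E D" if CD: "C \<in> carrier G" "D \<in> carrier G" for C D
  proof -
    obtain h where h: "h \<in> aut" "r C h" using ex[OF CD(1)] by blast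
    obtain k where k: "k \<in> aut" "r D k" using ex[OF CD(2)] by blast
    have "E (C \<otimes>\<^bsub>G\<^esub> D) = out_coset (\<lambda>x. h (k x))"
      using mult[OF CD h(1) k(1) h(2) k(2)] coset aut_comp[OF h(1) k(1)] by blast
    then show ?thesis
      using coset[OF CD(1) h] coset[OF CD(2) k] out_coset_mult[OF h(1) k(1)]
      by (simp add: Out_rel_def FactGroup_def)
  qed
  have closed: "E C \<in> carrier (Out_rel K S)" if "C \<in> carrier G" for C
    using ex[OF that] coset[OF that] by (auto simp: carrier_Out_rel)
  have "inj_on E (carrier G)"
  proof (rule inj_onI)
    fix C D assume CD: "C \<in> carrier G" "D \<in> carrier G" "E C = E D"
    obtain h where h: "h \<in> aut" "r C h" using ex[OF CD(1)] by blast
    obtain k where k: "k \<in> aut" "r D k" using ex[OF CD(2)] by blast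
    have "out_coset h = out_coset k" using coset[OF CD(1) h] coset[OF CD(2) k] CD(3) by simp
    from out_coset_eqD[OF h(1) this] show "C = D" by (rule inj[OF CD(1,2) h(1) k(1) h(2) k(2)])
  qed
  moreover have "carrier (Out_rel K S) \<subseteq> E ` carrier G"
  proof
    fix Q assume "Q \<in> carrier (Out_rel K S)"
    then obtain h where h: "h \<in> aut" "Q = out_coset h" by (auto simp: carrier_Out_rel)
    obtain C where "C \<in> carrier G" "r C h" using surj[OF h(1)] by blast
    then show "Q \<in> E ` carrier G" using coset h by blast
  qed
  ultimately show ?thesis using hom closed by (auto simp: iso_def hom_def bij_betw_def)
qed

end

context superrigid_extension
begin

section \<open>Restrictions of the orbit relation\<close>

abbreviation R where "R \<equiv> orbit_rel \<Gamma> Z \<sigma>"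

lemma R_iff: "(z, w) \<in> R \<longleftrightarrow> w \<in> space Z \<and> oeq z w"
  by (auto simp: orbit_rel_def orbit_def oeq_def)

lemma R_space: "(z, w) \<in> R \<Longrightarrow> z \<in> space Z \<and> w \<in> space Z"
  using R_iff oeq_space by blast

lemma equiv_R: "equiv (space Z) R"
proof (rule equivI)
  show "R \<subseteq> space Z \<times> space Z" using R_space by auto
  show "refl_on (space Z) R" using oeq_refl by (auto simp: refl_on_def R_iff)
  show "sym R"
  proof (rule symI)
    fix z w assume "(z, w) \<in> R"
    then have *: "w \<in> space Z" "oeq z w" by (simp_all add: R_iff)
    show "(w, z) \<in> R" unfolding R_iff using oeq_sym[OF *(2,1)] oeq_space[OF *(2,1)] by (rule conjI[rotated])
  qed
  show "trans R"
  proof (rule transI)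
    fix z w v assume "(z, w) \<in> R" "(w, v) \<in> R"
    then have "oeq z w" "oeq w v" "v \<in> space Z" by (simp_all add: R_iff)
    then show "(z, v) \<in> R" using oeq_trans by (simp add: R_iff)
  qed
qed

text \<open>Only the sigma-algebra and the null sets are recorded, while sizes are always measured
  in \<open>Z\<close>. This covers \<open>Z\<close> itself, unnormalized and normalized
  restrictions, and iterated ones.\<close>

definition restr :: "('x \<times> 'y) measure \<Rightarrow> ('x \<times> 'y) set \<Rightarrow> bool" where
  "restr K V \<longleftrightarrow> V \<in> sets Z \<and> space K = V \<and> sets K = sets (restrict_space Z V) \<and>
     (\<forall>A\<in>sets K. emeasure K A = 0 \<longleftrightarrow> emeasure Z A = 0)"

lemma restrD:
  assumes "restr K V"
  shows "V \<in> sets Z" "space K = V" "V \<subseteq> space Z" "A \<in> sets K \<longleftrightarrow> A \<in> sets Z \<and> A \<subseteq> V"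
    "A \<in> null_sets K \<longleftrightarrow> A \<in> null_sets Z \<and> A \<subseteq> V"
proof -
  show V: "V \<in> sets Z" "space K = V" using assms by (simp_all add: restr_def)
  show VZ: "V \<subseteq> space Z" by (rule sets.sets_into_space[OF V(1)])
  have VV: "V \<inter> space Z = V" using VZ by auto
  show s: "A \<in> sets K \<longleftrightarrow> A \<in> sets Z \<and> A \<subseteq> V" for A
    using assms V(1) by (simp add: restr_def sets_restrict_space_iff VV conj_commute)
  show "A \<in> null_sets K \<longleftrightarrow> A \<in> null_sets Z \<and> A \<subseteq> V"
    using s[of A] assms unfolding restr_def null_sets_def by auto
qed

lemma restr_AE:
  assumes K: "restr K V"
  shows "(AE z in K. P z) \<longleftrightarrow> (AE z in Z. z \<in> V \<longrightarrow> P z)"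
proof
  assume "AE z in K. P z"
  then obtain A where A: "A \<in> null_sets K" "{z \<in> space K. \<not> P z} \<subseteq> A" by (auto simp: eventually_ae_filter)
  have "A \<in> null_sets Z" using A(1) restrD(5)[OF K] by simp
  moreover have "{z \<in> space Z. \<not> (z \<in> V \<longrightarrow> P z)} \<subseteq> A" using A(2) restrD(2)[OF K] by auto
  ultimately show "AE z in Z. z \<in> V \<longrightarrow> P z" unfolding eventually_ae_filter by blast
next
  assume "AE z in Z. z \<in> V \<longrightarrow> P z"
  then obtain A where A: "A \<in> null_sets Z" "{z \<in> space Z. \<not> (z \<in> V \<longrightarrow> P z)} \<subseteq> A" by (auto simp: eventually_ae_filter)
  have "A \<inter> V \<in> null_sets K" using A(1) restrD(5)[OF K] null_set_Int2[OF A(1) restrD(1)[OF K]] by simp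
  moreover have "{z \<in> space K. \<not> P z} \<subseteq> A \<inter> V" using A(2) restrD(2,3)[OF K] by auto
  ultimately show "AE z in K. P z" unfolding eventually_ae_filter by blast
qed

lemma restr_Z: "restr Z (space Z)"
  by (simp add: restr_def sets_restrict_space_iff set_eq_iff) (metis sets.sets_into_space subsetD sets_restrict_space_iff sets.top Int_absorb subset_iff)

lemma restr_measurable_into:
  assumes K: "restr K V"
  shows "f \<in> L \<rightarrow>\<^sub>M K \<longleftrightarrow> f \<in> L \<rightarrow>\<^sub>M Z \<and> (\<forall>x\<in>space L. f x \<in> V)"
proof -
  have "f \<in> L \<rightarrow>\<^sub>M K \<longleftrightarrow> f \<in> L \<rightarrow>\<^sub>M restrict_space Z V"
    using K by (intro arg_cong2[where f="(\<in>)"] refl measurable_cong_sets) (simp_all add: restr_def)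
  also have "\<dots> \<longleftrightarrow> f \<in> L \<rightarrow>\<^sub>M Z \<and> (\<forall>x\<in>space L. f x \<in> V)"
    using restrD(3)[OF K] by (auto simp: measurable_restrict_space2_iff space_restrict_space)
  finally show ?thesis .
qed

lemma restr_incl: "restr K V \<Longrightarrow> null_preserving K Z (\<lambda>z. z)"
proof (rule null_preservingI)
  assume K: "restr K V"
  show "(\<lambda>z. z) \<in> K \<rightarrow>\<^sub>M Z"
    using restr_measurable_into[OF K, of "\<lambda>z. z" K] measurable_ident_sets[OF refl, of K] by simp
  fix A assume "A \<in> null_sets Z"
  from AE_not_in[OF this] show "AE z in K. z \<notin> A" unfolding restr_AE[OF K] by eventually_elim simp
qed

lemma restr_null_preserving_into:
  assumes K: "restr K V" and f: "null_preserving L Z f" and V: "\<And>x. x \<in> space L \<Longrightarrow> f x \<in> V"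
  shows "null_preserving L K f"
proof (rule null_preservingI)
  show "f \<in> L \<rightarrow>\<^sub>M K" using restr_measurable_into[OF K] null_preserving_measurable[OF f] V by blast
  fix A assume "A \<in> null_sets K"
  then have "A \<in> null_sets Z" using restrD(5)[OF K] by simp
  then show "AE x in L. f x \<notin> A" by (intro null_preserving_AE[OF f] AE_not_in)
qed

lemma AE_saturation: "AE z in Z. P z \<Longrightarrow> AE z in Z. \<forall>w. oeq w z \<longrightarrow> P w"
  using ZA.act_AE_all[of P] by (rule eventually_mono) (auto simp: oeq_def)

lemma restr_null_equiv:
  assumes K: "restr K V"
  shows "null_equiv K (restrict_rel R V)"
proof
  show "equiv (space K) (restrict_rel R V)"
    unfolding restrD(2)[OF K]
  proof (rule equivI)
    show "restrict_rel R V \<subseteq> V \<times> V" by (auto simp: restrict_rel_def)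
    show "refl_on V (restrict_rel R V)"
      using restrD(3)[OF K] oeq_refl by (auto simp: refl_on_def restrict_rel_def R_iff)
    show "sym (restrict_rel R V)" using equiv_R by (auto simp: equiv_def sym_def restrict_rel_def)
    show "trans (restrict_rel R V)" using equiv_R unfolding equiv_def trans_def restrict_rel_def by blast
  qed
  fix A assume "A \<in> null_sets K"
  then have "A \<in> null_sets Z" using restrD(5)[OF K] by simp
  from AE_saturation[OF AE_not_in[OF this]] show "AE x in K. \<forall>y. (y, x) \<in> restrict_rel R V \<longrightarrow> y \<notin> A"
    unfolding restr_AE[OF K] by (rule eventually_mono) (auto simp: restrict_rel_def R_iff)
qed

lemma restrict_rel_iff: "V \<subseteq> space Z \<Longrightarrow> (z, w) \<in> restrict_rel R V \<longleftrightarrow> z \<in> V \<and> w \<in> V \<and> oeq z w"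
  by (auto simp: restrict_rel_def R_iff)

section \<open>Ergodicity of the product action\<close>

text \<open>Two layers: ergodicity of the kernel on \<open>X\<close> makes almost every fibre
  trivial for \<open>P\<close>, and ergodicity of \<open>\<Lambda>\<close> applies to the set of
  those \<open>y\<close> whose fibre is full.\<close>

lemma ergodic_Z_AE:
  assumes P: "{z \<in> space Z. P z} \<in> sets Z" and inv: "\<And>g. g \<in> carrier \<Gamma> \<Longrightarrow> AE z in Z. P (\<sigma> g z) \<longleftrightarrow> P z"
  shows "(AE z in Z. P z) \<or> (AE z in Z. \<not> P z)"
proof -
  have Py: "{x \<in> space X. P (x, y)} \<in> sets X" if y: "y \<in> space Y" for y
  proof -
    have "(\<lambda>x. (x, y)) \<in> X \<rightarrow>\<^sub>M Z" using y by measurable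
    from measurable_sets[OF this P]
    have "(\<lambda>x. (x, y)) -` {z \<in> space Z. P z} \<inter> space X \<in> sets X" .
    moreover have "(\<lambda>x. (x, y)) -` {z \<in> space Z. P z} \<inter> space X = {x \<in> space X. P (x, y)}" using y by auto
    ultimately show ?thesis by simp
  qed
  have Pn: "{z \<in> space Z. \<not> P z} \<in> sets Z" by (rule sets.sets_Collect_neg[OF P])
  have tri: "AE y in Y. (AE x in X. P (x, y)) \<or> (AE x in X. \<not> P (x, y))"
  proof -
    have i: "AE z in Z. P (\<sigma> n z) = P z" if "n \<in> carrier N" for n by (rule inv) (use that in simp)
    have "AE y in Y. \<forall>n\<in>carrier N. AE x in X. P (\<sigma> n (x, y)) = P (x, y)"
      by (rule AE_N_sections[of "\<lambda>n z. P (\<sigma> n z) = P z"]) (rule i)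
    then show ?thesis using AE_space
    proof eventually_elim
      case (elim y)
      show ?case
      proof (rule NX.ergodic_AE[OF NX.ergodic Py[OF elim(2)]])
        fix n assume n: "n \<in> carrier N"
        have "AE x in X. P (\<sigma> n (x, y)) = P (x, y)" using elim(1) n by blast
        then show "AE x in X. P (\<alpha> n x, y) = P (x, y)" using AE_space
          by eventually_elim (use n elim(2) in simp)
      qed
    qed
  qed
  have Bm: "{y \<in> space Y. AE x in X. P (x, y)} \<in> sets Y"
  proof -
    have "(\<lambda>z. (snd z, fst z)) \<in> Y \<Otimes>\<^sub>M X \<rightarrow>\<^sub>M Z" by measurable
    from measurable_sets[OF this P] have "{z \<in> space (Y \<Otimes>\<^sub>M X). P (snd z, fst z)} \<in> sets (Y \<Otimes>\<^sub>M X)"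
      by (rule rev_iffD1[OF _ arg_cong[where f="\<lambda>A. A \<in> sets _"]]) (auto simp: space_pair_measure)
    from X.sets_Collect_AE[OF this] show ?thesis by simp
  qed
  have "(AE y in Y. AE x in X. P (x, y)) \<or> (AE y in Y. \<not> (AE x in X. P (x, y)))"
  proof (rule LA.ergodic_AE[OF \<beta>(2) Bm])
    fix l assume "l \<in> carrier \<Lambda>"
    then have "l \<in> \<pi> ` carrier \<Gamma>" using surj_\<pi> by simp
    then obtain g where g: "l = \<pi> g" "g \<in> carrier \<Gamma>" by (rule imageE)
    show "AE y in Y. (AE x in X. P (x, \<beta> l y)) = (AE x in X. P (x, y))"
      using AE_sections[OF inv[OF g(2)]] AE_space
    proof eventually_elim
      case (elim y)
      have e: "AE x in X. P (\<alpha> g x, \<beta> l y) = P (x, y)"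
        using elim(1) AE_space by eventually_elim (use g elim(2) in simp)
      show ?case
      proof
        assume "AE x in X. P (x, \<beta> l y)"
        from XA.act_AE[OF this g(2)] e show "AE x in X. P (x, y)" by eventually_elim simp
      next
        assume "AE x in X. P (x, y)"
        with e have "AE x in X. P (\<alpha> g x, \<beta> l y)" by eventually_elim simp
        from XA.act_AE[OF this G.inv_closed[OF g(2)]] AE_space
        show "AE x in X. P (x, \<beta> l y)" by eventually_elim (use g in simp)
      qed
    qed
  qed
  then show ?thesis
  proof
    assume "AE y in Y. AE x in X. P (x, y)"
    then have "AE z in Z. P z" by (rule XY.AE_pair_measure_swap[OF P])
    then show ?thesis ..
  next
    assume "AE y in Y. \<not> (AE x in X. P (x, y))"
    then have "AE y in Y. AE x in X. \<not> P (x, y)" using tri by eventually_elim blast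
    then have "AE z in Z. \<not> P z" by (rule XY.AE_pair_measure_swap[OF Pn])
    then show ?thesis ..
  qed
qed

text \<open>The saturation of \<open>V\<close> is invariant and is not null, since it contains
  \<open>V\<close>.\<close>

lemma orbit_meets:
  assumes V: "V \<in> sets Z" "emeasure Z V \<noteq> 0"
  shows "AE z in Z. \<exists>g\<in>carrier \<Gamma>. \<sigma> g z \<in> V"
proof -
  have m: "{z \<in> space Z. \<exists>g\<in>carrier \<Gamma>. \<sigma> g z \<in> V} \<in> sets Z"
  proof -
    have "{z \<in> space Z. \<exists>g\<in>carrier \<Gamma>. \<sigma> g z \<in> V} = (\<Union>g\<in>carrier \<Gamma>. \<sigma> g -` V \<inter> space Z)" by auto
    also have "\<dots> \<in> sets Z" by (intro sets.countable_UN' \<Gamma>(2)) (auto intro: measurable_sets[OF \<sigma>_measurable V(1)])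
    finally show ?thesis .
  qed
  have "(AE z in Z. \<exists>g\<in>carrier \<Gamma>. \<sigma> g z \<in> V) \<or> (AE z in Z. \<not> (\<exists>g\<in>carrier \<Gamma>. \<sigma> g z \<in> V))"
  proof (rule ergodic_Z_AE[OF m])
    fix g assume g: "g \<in> carrier \<Gamma>"
    show "AE z in Z. (\<exists>h\<in>carrier \<Gamma>. \<sigma> h (\<sigma> g z) \<in> V) = (\<exists>h\<in>carrier \<Gamma>. \<sigma> h z \<in> V)"
      using AE_space
    proof eventually_elim
      case (elim z)
      show ?case
      proof
        assume "\<exists>h\<in>carrier \<Gamma>. \<sigma> h (\<sigma> g z) \<in> V"
        then obtain h where "h \<in> carrier \<Gamma>" "\<sigma> h (\<sigma> g z) \<in> V" by blast
        then show "\<exists>h\<in>carrier \<Gamma>. \<sigma> h z \<in> V" using g elim by (intro bexI[of _ "h \<cdot> g"]) (simp_all add: ZA.act_mult)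
      next
        assume "\<exists>h\<in>carrier \<Gamma>. \<sigma> h z \<in> V"
        then obtain h where "h \<in> carrier \<Gamma>" "\<sigma> h z \<in> V" by blast
        then show "\<exists>h\<in>carrier \<Gamma>. \<sigma> h (\<sigma> g z) \<in> V" using g elim
          by (intro bexI[of _ "h \<cdot> iv g"]) (simp_all add: ZA.act_mult)
      qed
    qed
  qed
  moreover have "\<not> (AE z in Z. \<not> (\<exists>g\<in>carrier \<Gamma>. \<sigma> g z \<in> V))"
  proof
    assume "AE z in Z. \<not> (\<exists>g\<in>carrier \<Gamma>. \<sigma> g z \<in> V)"
    then have "AE z in Z. z \<notin> V" using AE_space by eventually_elim (metis G.one_closed ZA.act_one)
    then show False using V AE_iff_null_sets null_setsD1 by blast
  qed
  ultimately show ?thesis by blast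
qed

lemma return_map:
  assumes K: "restr K V" and V: "emeasure Z V \<noteq> 0"
  obtains \<rho> where "null_preserving Z K \<rho>" "AE z in Z. oeq (\<rho> z) z" "\<And>z. z \<in> V \<Longrightarrow> \<rho> z = z"
proof -
  have Vs: "V \<in> sets Z" by (rule restrD(1)[OF K])
  have "V \<noteq> {}" using V by auto
  then obtain v0 where v0: "v0 \<in> V" by blast
  obtain k where k: "k \<in> Z \<rightarrow>\<^sub>M count_space (carrier \<Gamma>)" "AE z in Z. \<sigma> (k z) z \<in> V"
  proof (rule measurable_countable_choice[OF \<Gamma>(2) _ _ orbit_meets[OF Vs V]])
    fix g assume "g \<in> carrier \<Gamma>"
    from measurable_sets[OF \<sigma>_measurable[OF this] Vs]
    show "{z \<in> space Z. \<sigma> g z \<in> V} \<in> sets Z" by (simp add: vimage_def Int_def conj_commute)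
  qed (use G.one_closed that in auto)
  let ?p = "\<lambda>z. \<sigma> (k z) z"
  have p: "null_preserving Z Z ?p"
    by (rule null_preserving_piecewise[OF k(1) \<Gamma>(2), where f="\<lambda>g z. \<sigma> g z"]) (rule ZA.act_null_preserving)
  have pm: "?p \<in> Z \<rightarrow>\<^sub>M Z" by (rule null_preserving_measurable[OF p])
  \<comment> \<open>The default \<open>v0\<close> makes the map total into \<open>V\<close>; it is
    taken on a null set only.\<close>
  define \<rho> where "\<rho> z = (if z \<in> V then z else if ?p z \<in> V then ?p z else v0)" for z
  have v0Z: "v0 \<in> space Z" using v0 restrD(3)[OF K] by blast
  have m: "\<rho> \<in> Z \<rightarrow>\<^sub>M Z"
    unfolding \<rho>_def
  proof (intro measurable_If)
    show "(\<lambda>z. z) \<in> Z \<rightarrow>\<^sub>M Z" "?p \<in> Z \<rightarrow>\<^sub>M Z" "(\<lambda>z. v0) \<in> Z \<rightarrow>\<^sub>M Z" using pm v0Z by auto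
    show "{z \<in> space Z. z \<in> V} \<in> sets Z" using Vs by simp
    show "{z \<in> space Z. ?p z \<in> V} \<in> sets Z"
      using measurable_sets[OF pm Vs] by (simp add: vimage_def Int_def conj_commute)
  qed
  have in_V: "\<rho> z \<in> V" for z using v0 by (simp add: \<rho>_def)
  have "null_preserving Z Z \<rho>"
  proof (rule null_preservingI[OF m])
    fix A assume A: "A \<in> null_sets Z"
    from AE_not_in[OF A] null_preserving_AE[OF p AE_not_in[OF A]] k(2)
    show "AE z in Z. \<rho> z \<notin> A" by eventually_elim (simp add: \<rho>_def)
  qed
  then have "null_preserving Z K \<rho>" by (rule restr_null_preserving_into[OF K]) (rule in_V)
  moreover have "AE z in Z. oeq (\<rho> z) z"
    using k(2) AE_space
    by eventually_elim (use oeq_refl oeq_\<sigma> count_in[OF k(1)] in \<open>auto simp: \<rho>_def\<close>)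
  moreover have "\<rho> z = z" if "z \<in> V" for z using that by (simp add: \<rho>_def)
  ultimately show ?thesis by (rule that)
qed

section \<open>The centralizer in terms of representatives, and rigidity of partial
  isomorphisms\<close>

definition cent :: "('y \<Rightarrow> 'y) \<Rightarrow> bool" where
  "cent j \<longleftrightarrow> j \<in> ns_isos Y Y \<and> (\<forall>l\<in>carrier \<Lambda>. AE y in Y. j (\<beta> l y) = \<beta> l (j y))"

lemma cent_ns: "cent j \<Longrightarrow> j \<in> ns_isos Y Y"
  by (simp add: cent_def)

lemma cent_mor: "cent j \<Longrightarrow> mor (id_map j)"
  by (rule mor_id_map[OF ns_isos_null_preserving[OF cent_ns]]) (auto simp: cent_def)

lemma cent_inverse:
  assumes j: "cent j"
  obtains i where "cent i" "AE y in Y. i (j y) = y" "AE y in Y. j (i y) = y"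
proof -
  obtain i where i: "i \<in> ns_isos Y Y" "AE y in Y. i (j y) = y" "AE y in Y. j (i y) = y"
    by (rule ns_isosE[OF cent_ns[OF j]])
  have "AE y in Y. i (\<beta> l y) = \<beta> l (i y)" if l: "l \<in> carrier \<Lambda>" for l
  proof -
    have "AE y in Y. j (\<beta> l y) = \<beta> l (j y)" using j l by (simp add: cent_def)
    from ns_isos_AE[OF i(1) this] i(3) ns_isos_AE[OF i(1) LA.act_AE[OF i(2) l]]
    show ?thesis by eventually_elim simp
  qed
  then show ?thesis using i that by (auto simp: cent_def)
qed

lemma cent_comp:
  assumes i: "cent i" and j: "cent j" shows "cent (\<lambda>y. i (j y))"
  unfolding cent_def
proof (intro conjI ballI)
  show "(\<lambda>y. i (j y)) \<in> ns_isos Y Y" by (rule ns_isos_comp[OF cent_ns[OF i] cent_ns[OF j]])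
  fix l assume l: "l \<in> carrier \<Lambda>"
  have "AE y in Y. j (\<beta> l y) = \<beta> l (j y)" "AE y in Y. i (\<beta> l y) = \<beta> l (i y)" using i j l by (simp_all add: cent_def)
  from this(1) ns_isos_AE[OF cent_ns[OF j] this(2)] show "AE y in Y. i (j (\<beta> l y)) = \<beta> l (i (j y))"
    by eventually_elim simp
qed

lemma AE_id_map: "AE y in Y. i (j y) = y \<Longrightarrow> AE z in Z. id_map i (id_map j z) = z"
  using AE_snd[of "\<lambda>y. i (j y) = y"] by (auto simp: id_map_def elim: eventually_mono)

text \<open>Composing a partial isomorphism with return maps gives a morphism of the whole orbit relation,
  to which rigidity applies.\<close>

lemma restr_iso_rigid:
  assumes K: "restr K V" "emeasure Z V \<noteq> 0" and L: "restr L W" "emeasure Z W \<noteq> 0"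
    and f: "f \<in> ns_isos K L" "respects_rel K (restrict_rel R V) (restrict_rel R W) f"
  obtains j where "cent j" "AE z in K. oeq (f z) (id_map j z)"
proof -
  obtain g where g: "g \<in> ns_isos L K" "AE z in K. g (f z) = z" "AE w in L. f (g w) = w" by (rule ns_isosE[OF f(1)])
  have gr: "respects_rel L (restrict_rel R W) (restrict_rel R V) g"
    by (rule respects_rel_inverse[OF f(2) ns_isos_null_preserving[OF g(1)] g(3)])
  obtain \<rho> where \<rho>: "null_preserving Z K \<rho>" "AE z in Z. oeq (\<rho> z) z" "\<And>z. z \<in> V \<Longrightarrow> \<rho> z = z" by (rule return_map[OF K]) (rule that)
  obtain \<tau> where \<tau>: "null_preserving Z L \<tau>" "AE z in Z. oeq (\<tau> z) z" "\<And>z. z \<in> W \<Longrightarrow> \<tau> z = z" by (rule return_map[OF L]) (rule that)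
  \<comment> \<open>Stated for arbitrary data, since it is used for \<open>f\<close> and for its
    inverse \<open>g\<close> with the two restrictions exchanged.\<close>
  have ext_mor: "mor (\<lambda>z. f (\<rho> z))"
    if K: "restr K V" and L: "restr L W" and f: "f \<in> ns_isos K L" "respects_rel K (restrict_rel R V) (restrict_rel R W) f"
      and \<rho>: "null_preserving Z K \<rho>" "AE z in Z. oeq (\<rho> z) z" for K V L W f \<rho>
    unfolding mor_def
  proof (intro conjI ballI)
    interpret K': null_equiv K "restrict_rel R V" by (rule restr_null_equiv[OF K])
    show "null_preserving Z Z (\<lambda>z. f (\<rho> z))"
      by (rule null_preserving_comp[OF null_preserving_comp[OF \<rho>(1) ns_isos_null_preserving[OF f(1)]] restr_incl[OF L]])
    fix c assume c: "c \<in> carrier \<Gamma>"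
    show "AE z in Z. oeq (f (\<rho> (\<sigma> c z))) (f (\<rho> z))"
      using null_preserving_AE[OF \<rho>(1) K'.respects_AE[OF f(2)]] \<rho>(2) ZA.act_AE[OF \<rho>(2) c] AE_space
    proof eventually_elim
      case (elim z)
      have s: "\<rho> z \<in> V" "\<rho> (\<sigma> c z) \<in> V"
        using measurable_space[OF null_preserving_measurable[OF \<rho>(1)]] restrD(2)[OF K] elim(4) c by auto
      have "oeq (\<rho> (\<sigma> c z)) z" by (rule oeq_trans[OF elim(3) oeq_\<sigma>[OF c] elim(4)])
      then have "oeq (\<rho> (\<sigma> c z)) (\<rho> z)" by (rule oeq_trans[OF _ oeq_sym[OF elim(2,4)]]) (use s restrD(3)[OF K] in auto)
      then have "(\<rho> (\<sigma> c z), \<rho> z) \<in> restrict_rel R V" using s restrD(3)[OF K] by (simp add: restrict_rel_iff)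
      then have "(f (\<rho> (\<sigma> c z)), f (\<rho> z)) \<in> restrict_rel R W" using elim(1) by blast
      then show ?case using restrD(3)[OF L] by (simp add: restrict_rel_iff)
    qed
  qed
  have inv: "AE z in Z. oeq (g (\<tau> (f (\<rho> z)))) z"
    if K: "restr K V" and L: "restr L W" and f: "f \<in> ns_isos K L"
      and g: "g \<in> ns_isos L K" "respects_rel L (restrict_rel R W) (restrict_rel R V) g" "AE z in K. g (f z) = z"
      and \<rho>: "null_preserving Z K \<rho>" "AE z in Z. oeq (\<rho> z) z"
      and \<tau>: "null_preserving Z L \<tau>" "AE z in Z. oeq (\<tau> z) z" for K V L W f g \<rho> \<tau>
  proof -
    interpret L': null_equiv L "restrict_rel R W" by (rule restr_null_equiv[OF L])
    have fr: "null_preserving Z L (\<lambda>z. f (\<rho> z))" by (rule null_preserving_comp[OF \<rho>(1) ns_isos_null_preserving[OF f]])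
    have fr': "null_preserving Z Z (\<lambda>z. f (\<rho> z))" by (rule null_preserving_comp[OF fr restr_incl[OF L]])
    show ?thesis
      using null_preserving_AE[OF fr L'.respects_AE[OF g(2)]] null_preserving_AE[OF fr' \<tau>(2)]
        null_preserving_AE[OF \<rho>(1) g(3)] \<rho>(2) AE_space
    proof eventually_elim
      case (elim z)
      let ?w = "f (\<rho> z)"
      have w: "?w \<in> W" using measurable_space[OF null_preserving_measurable[OF fr]] restrD(2)[OF L] elim(5) by auto
      have wZ: "?w \<in> space Z" using w restrD(3)[OF L] by blast
      have tw: "\<tau> ?w \<in> W" using measurable_space[OF null_preserving_measurable[OF \<tau>(1)] wZ] restrD(2)[OF L] by simp
      have "(\<tau> ?w, ?w) \<in> restrict_rel R W" using w tw elim(2) restrD(3)[OF L] by (simp add: restrict_rel_iff)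
      then have "(g (\<tau> ?w), g ?w) \<in> restrict_rel R V" using elim(1) by blast
      then have "oeq (g (\<tau> ?w)) (\<rho> z)" using elim(3) restrD(3)[OF K] by (simp add: restrict_rel_iff)
      then show ?case using elim(4,5) by (rule oeq_trans)
    qed
  qed
  obtain j where j: "j \<in> ns_isos Y Y" "\<And>l. l \<in> carrier \<Lambda> \<Longrightarrow> AE y in Y. j (\<beta> l y) = \<beta> l (j y)"
    "AE z in Z. oeq (f (\<rho> z)) (id_map j z)"
    by (rule mor_rigid[OF ext_mor[OF K(1) L(1) f \<rho>(1,2)] ext_mor[OF L(1) K(1) g(1) gr \<tau>(1,2)]
          inv[OF K(1) L(1) f(1) g(1) gr g(2) \<rho>(1,2) \<tau>(1,2)] inv[OF L(1) K(1) g(1) f(1,2) g(3) \<tau>(1,2) \<rho>(1,2)]]) blast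
  have "AE z in K. oeq (f z) (id_map j z)"
    unfolding restr_AE[OF K(1)] using j(3) by eventually_elim (use \<rho>(3) in auto)
  moreover have "cent j" using j by (simp add: cent_def)
  ultimately show ?thesis by (intro that)
qed

text \<open>\<open>id_map j\<close> preserves orbits, and so does its inverse, which gives the
  converse direction. All exceptional points are collected in one null set because
  \<open>respects_rel\<close> quantifies over pairs of points.\<close>

lemma restr_respects:
  assumes K: "restr K V" and L: "restr L W" and f: "f \<in> K \<rightarrow>\<^sub>M L" and j: "cent j"
    and eq: "AE z in K. oeq (f z) (id_map j z)"
  shows "respects_rel K (restrict_rel R V) (restrict_rel R W) f"
proof -
  obtain i where i: "cent i" "AE y in Y. i (j y) = y" by (rule cent_inverse[OF j])
  have "AE z in Z. (\<forall>w. oeq w z \<longrightarrow> oeq (id_map j w) (id_map j z)) \<and> (\<forall>w. oeq w (id_map j z) \<longrightarrow> oeq (id_map i w) (id_map i (id_map j z)))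
      \<and> id_map i (id_map j z) = z \<and> (z \<in> V \<longrightarrow> oeq (f z) (id_map j z))"
    using mor_AE_oeq[OF cent_mor[OF j]] mor_AE[OF cent_mor[OF j] mor_AE_oeq[OF cent_mor[OF i(1)]]] AE_id_map[where i=i and j=j, OF i(2)] eq[unfolded restr_AE[OF K]]
    by eventually_elim simp
  then obtain A where A: "A \<in> null_sets Z" and good: "\<And>z. z \<in> space Z - A \<Longrightarrow>
      (\<forall>w. oeq w z \<longrightarrow> oeq (id_map j w) (id_map j z)) \<and> (\<forall>w. oeq w (id_map j z) \<longrightarrow> oeq (id_map i w) (id_map i (id_map j z)))
      \<and> id_map i (id_map j z) = z \<and> (z \<in> V \<longrightarrow> oeq (f z) (id_map j z))"
    unfolding eventually_ae_filter by blast
  have AV: "A \<inter> V \<in> null_sets K" using A restrD(5)[OF K] null_set_Int2[OF A restrD(1)[OF K]] by simp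
  show ?thesis unfolding respects_rel_def
  proof (rule bexI[OF _ AV], intro ballI)
    fix z w assume "z \<in> space K - A \<inter> V" "w \<in> space K - A \<inter> V"
    then have zw: "z \<in> V" "w \<in> V" "z \<in> space Z - A" "w \<in> space Z - A" using restrD(2,3)[OF K] by auto
    have fW: "f z \<in> W" "f w \<in> W" using measurable_space[OF f] zw restrD(2)[OF K] restrD(2)[OF L] by auto
    have js: "id_map j z \<in> space Z" "id_map j w \<in> space Z" using mor_space[OF cent_mor[OF j]] zw by auto
    have fs: "f z \<in> space Z" "f w \<in> space Z" using fW restrD(3)[OF L] by auto
    note gz = good[OF zw(3)] and gw = good[OF zw(4)]
    have "oeq z w \<longleftrightarrow> oeq (f z) (f w)"
    proof
      assume "oeq z w"
      then have a: "oeq (id_map j z) (id_map j w)" using gw by blast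
      have b: "oeq (f z) (id_map j z)" "oeq (f w) (id_map j w)" using gz gw zw by auto
      show "oeq (f z) (f w)"
        by (rule oeq_trans[OF oeq_trans[OF b(1) a js(2)] oeq_sym[OF b(2) js(2)] fs(2)])
    next
      assume a: "oeq (f z) (f w)"
      have b: "oeq (f z) (id_map j z)" "oeq (f w) (id_map j w)" using gz gw zw by auto
      have "oeq (id_map j z) (id_map j w)"
        by (rule oeq_trans[OF oeq_trans[OF oeq_sym[OF b(1) js(1)] a fs(2)] b(2) js(2)])
      then have "oeq (id_map i (id_map j z)) (id_map i (id_map j w))" using gw by blast
      then show "oeq z w" using gz gw by simp
    qed
    then show "(z, w) \<in> restrict_rel R V \<longleftrightarrow> (f z, f w) \<in> restrict_rel R W"
      using zw fW restrD(3)[OF K] restrD(3)[OF L] by (simp add: restrict_rel_iff)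
  qed
qed

section \<open>Scaling of the measure\<close>

text \<open>The condition behind \<open>mod_ns\<close> for a single representative. It is written
  with preimages, since \<open>j\<close> is invertible only almost everywhere.\<close>

definition scaling :: "('y \<Rightarrow> 'y) \<Rightarrow> real \<Rightarrow> bool" where
  "scaling j c \<longleftrightarrow> 0 < c \<and> (\<forall>A\<in>sets Y. emeasure Y A = ennreal c * emeasure Y (j -` A \<inter> space Y))"

lemma scalingD:
  "scaling j c \<Longrightarrow> A \<in> sets Y \<Longrightarrow> emeasure Y A = ennreal c * emeasure Y (j -` A \<inter> space Y)"
  unfolding scaling_def by blast

lemma scaling_pos: "scaling j c \<Longrightarrow> 0 < c"
  by (simp add: scaling_def)

lemma Y_finite_positive:
  obtains A where "A \<in> sets Y" "0 < emeasure Y A" "emeasure Y A < \<infinity>"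
  using Y.approx_PInf_emeasure_with_finite[of "space Y" 0] Y(2) by (metis ennreal_0 sets.top)

text \<open>The image measure under \<open>j\<close> is \<Lambda>-invariant, because
  \<open>j\<close> commutes with \<open>\<Lambda>\<close>, and absolutely continuous.\<close>

lemma cent_pushforward:
  assumes j: "cent j"
  obtains d where "\<And>A. A \<in> sets Y \<Longrightarrow> emeasure Y (j -` A \<inter> space Y) = d * emeasure Y A"
proof -
  note jm = ns_isos_measurable[OF cent_ns[OF j]]
  have e: "emeasure (distr Y Y j) A = emeasure Y (j -` A \<inter> space Y)" if "A \<in> sets Y" for A
    by (rule emeasure_distr[OF jm that])
  obtain d where d: "\<And>A. A \<in> sets Y \<Longrightarrow> emeasure (distr Y Y j) A = d * emeasure Y A"
  proof (rule LA.ergodic_measure_unique[OF \<beta>(2) Y.sigma_finite_measure_axioms, of "distr Y Y j"])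
    show "absolutely_continuous Y (distr Y Y j)"
      unfolding absolutely_continuous_def
    proof
      fix A assume A: "A \<in> null_sets Y"
      then have "j -` A \<inter> space Y \<in> null_sets Y"
        by (rule null_preservingD_measurable_vimage[OF ns_isos_null_preserving[OF cent_ns[OF j]]])
      then show "A \<in> null_sets (distr Y Y j)" using A e[of A] by (auto simp: null_sets_def)
    qed
    fix l A assume l: "l \<in> carrier \<Lambda>" and A: "A \<in> sets Y"
    have A': "\<beta> l -` A \<inter> space Y \<in> sets Y" by (rule measurable_sets[OF LA.act_measurable[OF l] A])
    have jA: "j -` A \<inter> space Y \<in> sets Y" by (rule measurable_sets[OF jm A])
    have "emeasure Y (j -` (\<beta> l -` A \<inter> space Y) \<inter> space Y) = emeasure Y (\<beta> l -` (j -` A \<inter> space Y) \<inter> space Y)"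
    proof (rule emeasure_eq_AE)
      have "AE y in Y. j (\<beta> l y) = \<beta> l (j y)" using j l by (simp add: cent_def)
      then show "AE y in Y. y \<in> j -` (\<beta> l -` A \<inter> space Y) \<inter> space Y \<longleftrightarrow> y \<in> \<beta> l -` (j -` A \<inter> space Y) \<inter> space Y"
        using AE_space by eventually_elim (use l measurable_space[OF jm] in auto)
    qed (use measurable_sets[OF jm A'] measurable_sets[OF LA.act_measurable[OF l] jA] in auto)
    also have "\<dots> = emeasure Y (j -` A \<inter> space Y)" by (rule LA.act_emeasure[OF l jA])
    finally show "emeasure (distr Y Y j) (\<beta> l -` A \<inter> space Y) = emeasure (distr Y Y j) A"
      by (simp add: e[OF A] e[OF A'])
  qed (use Y(2) in auto)
  then show ?thesis using e that by metis
qed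

text \<open>The factor \<open>d\<close> of the image measure could a priori be 0 or infinite.
  Composing with the inverse and testing a set of finite positive measure gives
  \<open>d * d' = 1\<close>. The constant is \<open>d'\<close>, since \<open>scaling\<close> has the
  preimage on the right-hand side.\<close>

lemma cent_scaling:
  assumes j: "cent j"
  obtains c where "scaling j c"
proof -
  obtain i where i: "cent i" "AE y in Y. i (j y) = y" by (rule cent_inverse[OF j])
  obtain d where d: "\<And>A. A \<in> sets Y \<Longrightarrow> emeasure Y (j -` A \<inter> space Y) = d * emeasure Y A" by (rule cent_pushforward[OF j]) blast
  obtain d' where d': "\<And>A. A \<in> sets Y \<Longrightarrow> emeasure Y (i -` A \<inter> space Y) = d' * emeasure Y A" by (rule cent_pushforward[OF i(1)]) blast
  note jm = ns_isos_measurable[OF cent_ns[OF j]] and im = ns_isos_measurable[OF cent_ns[OF i(1)]]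
  have dd: "emeasure Y A = d * (d' * emeasure Y A)" if A: "A \<in> sets Y" for A
  proof -
    have iA: "i -` A \<inter> space Y \<in> sets Y" by (rule measurable_sets[OF im A])
    have "emeasure Y A = emeasure Y (j -` (i -` A \<inter> space Y) \<inter> space Y)"
    proof (rule emeasure_eq_AE)
      show "AE y in Y. y \<in> A \<longleftrightarrow> y \<in> j -` (i -` A \<inter> space Y) \<inter> space Y"
        using i(2) AE_space by eventually_elim (use measurable_space[OF jm] in auto)
    qed (use A measurable_sets[OF jm iA] in auto)
    then show ?thesis using d[OF iA] d'[OF A] by simp
  qed
  obtain A where A: "A \<in> sets Y" "0 < emeasure Y A" "emeasure Y A < \<infinity>" by (rule Y_finite_positive)
  define a where "a = emeasure Y A"
  have a: "0 < a" "a < \<infinity>" using A by (simp_all add: a_def)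
  have ad: "a = d * d' * a" using dd[OF A(1)] by (simp add: a_def mult.assoc)
  then have prod: "d * d' = 1"
  proof -
    have "1 * a = (d * d') * a" using ad by simp
    then show ?thesis using a by (metis ennreal_mult_right_cong mult.commute ennreal_mult_cancel_left infinity_ennreal_def less_irrefl)
  qed
  have d'0: "d' \<noteq> 0" using prod by auto
  have d'inf: "d' \<noteq> \<infinity>"
  proof
    assume "d' = \<infinity>"
    then have "d * \<infinity> = 1" using prod by simp
    then show False by (cases "d = 0") (auto simp: ennreal_mult_top)
  qed
  define c where "c = enn2real d'"
  have c: "ennreal c = d'" "0 < c"
    using d'0 d'inf by (auto simp: c_def less_top enn2real_positive_iff zero_less_iff_neq_zero)
  have "emeasure Y B = ennreal c * emeasure Y (j -` B \<inter> space Y)" if B: "B \<in> sets Y" for B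
    using d[OF B] prod c(1) by (metis mult.assoc mult.commute mult_1)
  then show ?thesis using c(2) that by (auto simp: scaling_def)
qed

lemma scaling_inverse:
  assumes j: "cent j" and i: "cent i" and ij: "AE y in Y. i (j y) = y" and c: "scaling j c"
  shows "scaling i (1 / c)"
proof -
  note jm = ns_isos_measurable[OF cent_ns[OF j]] and im = ns_isos_measurable[OF cent_ns[OF i]]
  have c0: "0 < c" by (rule scaling_pos[OF c])
  have "emeasure Y A = ennreal (1 / c) * emeasure Y (i -` A \<inter> space Y)" if A: "A \<in> sets Y" for A
  proof -
    have iA: "i -` A \<inter> space Y \<in> sets Y" by (rule measurable_sets[OF im A])
    have "emeasure Y (i -` A \<inter> space Y) = ennreal c * emeasure Y (j -` (i -` A \<inter> space Y) \<inter> space Y)"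
      by (rule scalingD[OF c iA])
    also have "emeasure Y (j -` (i -` A \<inter> space Y) \<inter> space Y) = emeasure Y A"
    proof (rule emeasure_eq_AE)
      show "AE y in Y. y \<in> j -` (i -` A \<inter> space Y) \<inter> space Y \<longleftrightarrow> y \<in> A"
        using ij AE_space by eventually_elim (use measurable_space[OF jm] in auto)
    qed (use A measurable_sets[OF jm iA] in auto)
    finally have "ennreal (1 / c) * emeasure Y (i -` A \<inter> space Y) = ennreal (1 / c) * ennreal c * emeasure Y A"
      by (simp add: mult.assoc)
    also have "ennreal (1 / c) * ennreal c = 1" using c0 by (simp flip: ennreal_mult)
    finally show ?thesis by simp
  qed
  then show ?thesis using c0 by (simp add: scaling_def)
qed

lemma scaling_unique: "scaling j c \<Longrightarrow> scaling j d \<Longrightarrow> c = d"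
proof -
  assume c: "scaling j c" and d: "scaling j d"
  obtain A where A: "A \<in> sets Y" "0 < emeasure Y A" "emeasure Y A < \<infinity>" by (rule Y_finite_positive)
  let ?m = "emeasure Y (j -` A \<inter> space Y)"
  have e: "emeasure Y A = ennreal c * ?m" "emeasure Y A = ennreal d * ?m" and pos: "0 < c" "0 < d"
    using scalingD[OF c A(1)] scalingD[OF d A(1)] scaling_pos[OF c] scaling_pos[OF d] by auto
  have m0: "?m \<noteq> 0" using e A(2) by auto
  have minf: "?m \<noteq> \<infinity>"
  proof
    assume "?m = \<infinity>"
    then have "emeasure Y A = \<infinity>" using e(1) pos by (simp add: ennreal_mult_top)
    then show False using A(3) by simp
  qed
  obtain r where r: "?m = ennreal r" "0 < r"
    using m0 minf by (metis ennreal_cases ennreal_0 infinity_ennreal_def less_eq_real_def)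
  have "ennreal (c * r) = ennreal (d * r)" using e r pos by (simp add: ennreal_mult)
  then show "c = d" using r pos by simp
qed

lemma mod_ns_eq:
  assumes j: "cent j" and c: "scaling j c"
  shows "mod_ns Y (ae_class Y j) = c"
  unfolding mod_ns_def
proof (rule the_equality)
  have "emeasure Y (f -` A \<inter> space Y) = emeasure Y (j -` A \<inter> space Y)" if f: "f \<in> ae_class Y j" and A: "A \<in> sets Y" for f A
  proof (rule emeasure_eq_AE)
    show "AE y in Y. y \<in> f -` A \<inter> space Y \<longleftrightarrow> y \<in> j -` A \<inter> space Y"
      using ae_classD(2)[OF f] by eventually_elim auto
  qed (use measurable_sets[OF ns_isos_measurable[OF ae_classD(1)[OF f]] A] measurable_sets[OF ns_isos_measurable[OF cent_ns[OF j]] A] in auto)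
  then show "0 < c \<and> (\<forall>f\<in>ae_class Y j. \<forall>A\<in>sets Y. emeasure Y A = ennreal c * emeasure Y (f -` A \<inter> space Y))"
    using scalingD[OF c] scaling_pos[OF c] by simp
  fix d assume "0 < d \<and> (\<forall>f\<in>ae_class Y j. \<forall>A\<in>sets Y. emeasure Y A = ennreal d * emeasure Y (f -` A \<inter> space Y))"
  then have "scaling j d" using ae_class_self[OF cent_ns[OF j]] by (auto simp: scaling_def)
  then show "d = c" by (rule scaling_unique[OF _ c])
qed

lemma scaling_one_iff:
  assumes j: "j \<in> Y \<rightarrow>\<^sub>M Y" shows "scaling j 1 \<longleftrightarrow> distr Y Y j = Y"
proof
  assume s: "scaling j 1"
  show "distr Y Y j = Y"
  proof (rule measure_eqI)
    fix A assume "A \<in> sets (distr Y Y j)"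
    then have A: "A \<in> sets Y" by simp
    show "emeasure (distr Y Y j) A = emeasure Y A"
      unfolding emeasure_distr[OF j A] scalingD[OF s A] by simp
  qed simp
next
  assume d: "distr Y Y j = Y"
  show "scaling j 1" unfolding scaling_def
    using emeasure_distr[OF j] d by (metis ennreal_1 mult_1 zero_less_one)
qed

lemma scaling_Z:
  assumes j: "j \<in> Y \<rightarrow>\<^sub>M Y" and c: "scaling j c" and A: "A \<in> sets Z"
  shows "emeasure Z A = ennreal c * emeasure Z (id_map j -` A \<inter> space Z)"
proof -
  let ?B = "id_map j -` A \<inter> space Z"
  have B: "?B \<in> sets Z" by (rule measurable_sets[OF id_map_measurable[OF j] A])
  have "emeasure Z A = (\<integral>\<^sup>+x. emeasure Y (Pair x -` A) \<partial>X)" by (rule Y.emeasure_pair_measure_alt[OF A])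
  also have "\<dots> = (\<integral>\<^sup>+x. ennreal c * emeasure Y (Pair x -` ?B) \<partial>X)"
  proof (rule nn_integral_cong)
    fix x assume x: "x \<in> space X"
    have "Pair x -` A \<in> sets Y" by (rule sets_Pair1[OF A])
    then have "emeasure Y (Pair x -` A) = ennreal c * emeasure Y (j -` (Pair x -` A) \<inter> space Y)"
      by (rule scalingD[OF c])
    also have "j -` (Pair x -` A) \<inter> space Y = Pair x -` ?B" using x by (auto simp: id_map_def)
    finally show "emeasure Y (Pair x -` A) = ennreal c * emeasure Y (Pair x -` ?B)" .
  qed
  also have "\<dots> = ennreal c * (\<integral>\<^sup>+x. emeasure Y (Pair x -` ?B) \<partial>X)"
    by (rule nn_integral_cmult[OF Y.measurable_emeasure_Pair[OF B]])
  also have "(\<integral>\<^sup>+x. emeasure Y (Pair x -` ?B) \<partial>X) = emeasure Z ?B" by (rule Y.emeasure_pair_measure_alt[OF B, symmetric])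
  finally show ?thesis .
qed

text \<open>Cut \<open>V\<close> according to the group element \<open>a\<close> with
  \<open>h z = \<sigma> a (id_map j z)\<close>. On each piece \<open>id_map j\<close> scales by
  \<open>c\<close> and \<open>a\<close> preserves the measure, and the images lie in disjoint pieces
  of \<open>W\<close>.\<close>

lemma restr_scaling_le:
  assumes K: "restr K V" and L: "restr L W" and h: "h \<in> ns_isos K L" and j: "cent j" and c: "scaling j c"
    and eq: "AE z in K. oeq (h z) (id_map j z)"
  shows "ennreal c * emeasure Z V \<le> emeasure Z W"
proof -
  obtain g where g: "g \<in> ns_isos L K" "AE z in K. g (h z) = z" by (rule ns_isosE[OF h])
  note jm = ns_isos_measurable[OF cent_ns[OF j]]
  have incl: "(\<lambda>z. z) \<in> K \<rightarrow>\<^sub>M Z" "(\<lambda>z. z) \<in> L \<rightarrow>\<^sub>M Z"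
    using null_preserving_measurable[OF restr_incl[OF K]] null_preserving_measurable[OF restr_incl[OF L]] .
  have hZ: "h \<in> K \<rightarrow>\<^sub>M Z" using measurable_compose[OF ns_isos_measurable[OF h] incl(2)] by simp
  have tm: "(\<lambda>z. \<sigma> a (id_map j z)) \<in> Z \<rightarrow>\<^sub>M Z" if "a \<in> carrier \<Gamma>" for a
    by (rule measurable_compose[OF id_map_measurable[OF jm] \<sigma>_measurable[OF that]])
  obtain k where k: "k \<in> K \<rightarrow>\<^sub>M count_space (carrier \<Gamma>)" "AE z in K. h z = \<sigma> (k z) (id_map j z)"
  proof (rule measurable_countable_choice[where C="carrier \<Gamma>" and M=K and P="\<lambda>a z. h z = \<sigma> a (id_map j z)"])
    show "{z \<in> space K. h z = \<sigma> a (id_map j z)} \<in> sets K" if a: "a \<in> carrier \<Gamma>" for a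
      by (rule standard_measure_eq_sets[OF standard_Z hZ measurable_compose[OF incl(1) tm[OF a]]])
    show "AE z in K. \<exists>a\<in>carrier \<Gamma>. h z = \<sigma> a (id_map j z)" using eq by (simp add: oeq_def)
  qed (use \<Gamma> G.one_closed that in auto)
  define P where "P a = {z \<in> V. k z = a}" for a
  \<comment> \<open>The piece that receives \<open>P a\<close>, described through the inverse
    \<open>g\<close> so that measurability and disjointness are immediate.\<close>
  define Q where "Q a = {w \<in> W. k (g w) = a}" for a
  have kg: "(\<lambda>w. k (g w)) \<in> L \<rightarrow>\<^sub>M count_space (carrier \<Gamma>)" by (rule measurable_compose[OF ns_isos_measurable[OF g(1)] k(1)])
  have Pm: "P a \<in> sets Z" if "a \<in> carrier \<Gamma>" for a
  proof -
    have "k -` {a} \<inter> space K \<in> sets K" by (rule measurable_sets[OF k(1)]) (use that in simp)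
    moreover have "k -` {a} \<inter> space K = P a" using restrD(2)[OF K] by (auto simp: P_def)
    ultimately show ?thesis using restrD(4)[OF K] by simp
  qed
  have Qm: "Q a \<in> sets Z" if "a \<in> carrier \<Gamma>" for a
  proof -
    have "(\<lambda>w. k (g w)) -` {a} \<inter> space L \<in> sets L" by (rule measurable_sets[OF kg]) (use that in simp)
    moreover have "(\<lambda>w. k (g w)) -` {a} \<inter> space L = Q a" using restrD(2)[OF L] by (auto simp: Q_def)
    ultimately show ?thesis using restrD(4)[OF L] by simp
  qed
  have VP: "V = (\<Union>a\<in>carrier \<Gamma>. P a)" using measurable_space[OF k(1)] restrD(2)[OF K] by (auto simp: P_def)
  have QW: "(\<Union>a\<in>carrier \<Gamma>. Q a) \<subseteq> W" by (auto simp: Q_def)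
  have disj: "disjoint_family_on P (carrier \<Gamma>)" "disjoint_family_on Q (carrier \<Gamma>)"
    by (auto simp: disjoint_family_on_def P_def Q_def)
  have le: "ennreal c * emeasure Z (P a) \<le> emeasure Z (Q a)" if a: "a \<in> carrier \<Gamma>" for a
  proof -
    let ?Q = "\<sigma> a -` Q a \<inter> space Z"
    have Q': "?Q \<in> sets Z" by (rule measurable_sets[OF \<sigma>_measurable[OF a] Qm[OF a]])
    have Q'': "id_map j -` ?Q \<inter> space Z \<in> sets Z" by (rule measurable_sets[OF id_map_measurable[OF jm] Q'])
    have "emeasure Z (P a) \<le> emeasure Z (id_map j -` ?Q \<inter> space Z)"
    proof (rule emeasure_mono_AE[OF _ Q''])
      show "AE z in Z. z \<in> P a \<longrightarrow> z \<in> id_map j -` ?Q \<inter> space Z"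
        using k(2)[unfolded restr_AE[OF K]] g(2)[unfolded restr_AE[OF K]] AE_space
      proof eventually_elim
        case (elim z)
        show ?case
        proof
          assume z: "z \<in> P a"
          then have zV: "z \<in> V" "k z = a" by (auto simp: P_def)
          have "h z \<in> W" using ns_isos_space[OF h] zV(1) restrD(2)[OF K] restrD(2)[OF L] by simp
          then have "h z \<in> Q a" using elim(2) zV by (simp add: Q_def)
          then have "\<sigma> a (id_map j z) \<in> Q a" using elim(1) zV by simp
          then show "z \<in> id_map j -` ?Q \<inter> space Z"
            using elim(3) measurable_space[OF id_map_measurable[OF jm] elim(3)] by simp
        qed
      qed
    qed
    then have "ennreal c * emeasure Z (P a) \<le> ennreal c * emeasure Z (id_map j -` ?Q \<inter> space Z)" by (rule mult_left_mono) simp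
    also have "\<dots> = emeasure Z ?Q" by (rule scaling_Z[OF jm c Q', symmetric])
    also have "\<dots> = emeasure Z (Q a)" by (rule ZA.act_emeasure[OF a Qm[OF a]])
    finally show ?thesis .
  qed
  have "ennreal c * emeasure Z V = ennreal c * (\<integral>\<^sup>+a. emeasure Z (P a) \<partial>count_space (carrier \<Gamma>))"
    unfolding VP by (subst emeasure_UN_countable[OF Pm \<Gamma>(2) disj(1)]) auto
  also have "\<dots> = (\<integral>\<^sup>+a. ennreal c * emeasure Z (P a) \<partial>count_space (carrier \<Gamma>))"
    by (rule nn_integral_cmult[symmetric]) simp
  also have "\<dots> \<le> (\<integral>\<^sup>+a. emeasure Z (Q a) \<partial>count_space (carrier \<Gamma>))"
    by (rule nn_integral_mono) (use le in simp)
  also have "\<dots> = emeasure Z (\<Union>a\<in>carrier \<Gamma>. Q a)"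
    by (rule emeasure_UN_countable[OF Qm \<Gamma>(2) disj(2), symmetric])
  also have "\<dots> \<le> emeasure Z W" by (rule emeasure_mono[OF QW restrD(1)[OF L]])
  finally show ?thesis .
qed

text \<open>The reverse inequality comes from the inverse isomorphism, which agrees up to orbits
  with \<open>id_map i\<close> for the inverse \<open>i\<close> of \<open>j\<close> and has the
  constant \<open>1 / c\<close>.\<close>

lemma restr_scaling:
  assumes K: "restr K V" and L: "restr L W" and h: "h \<in> ns_isos K L" and j: "cent j" and c: "scaling j c"
    and eq: "AE z in K. oeq (h z) (id_map j z)"
  shows "emeasure Z W = ennreal c * emeasure Z V"
proof (rule antisym)
  show "ennreal c * emeasure Z V \<le> emeasure Z W" by (rule restr_scaling_le[OF assms])
  obtain g where g: "g \<in> ns_isos L K" "AE z in K. g (h z) = z" "AE w in L. h (g w) = w" by (rule ns_isosE[OF h])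
  obtain i where i: "cent i" "AE y in Y. i (j y) = y" by (rule cent_inverse[OF j])
  have c0: "0 < c" by (rule scaling_pos[OF c])
  have gZ: "null_preserving L Z g" using null_preserving_comp[OF ns_isos_null_preserving[OF g(1)] restr_incl[OF K]] by simp
  have "AE w in L. oeq (g w) (id_map i w)"
    using ns_isos_AE[OF g(1) eq] g(3) null_preserving_AE[OF gZ mor_AE[OF cent_mor[OF j] mor_AE_oeq[OF cent_mor[OF i(1)]]]]
      null_preserving_AE[OF gZ AE_id_map[where i=i and j=j, OF i(2)]] AE_space
  proof eventually_elim
    case (elim w)
    have s: "w \<in> space Z" using elim(5) restrD(2,3)[OF L] by auto
    have "oeq w (id_map j (g w))" using elim(1,2) by simp
    then have "oeq (id_map i w) (id_map i (id_map j (g w)))" using elim(3) by blast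
    then have "oeq (id_map i w) (g w)" unfolding elim(4) .
    then show ?case
      using oeq_sym ns_isos_space[OF g(1) elim(5)] restrD(2,3)[OF K] by blast
  qed
  from restr_scaling_le[OF L K g(1) i(1) scaling_inverse[OF j i c] this]
  have "ennreal c * (ennreal (1 / c) * emeasure Z W) \<le> ennreal c * emeasure Z V" by (rule mult_left_mono) simp
  moreover have "ennreal c * (ennreal (1 / c) * emeasure Z W) = emeasure Z W"
    using c0 by (simp add: mult.assoc[symmetric] flip: ennreal_mult)
  ultimately show "emeasure Z W \<le> ennreal c * emeasure Z V" by simp
qed

lemma cent_id: "cent (\<lambda>y. y)"
  by (simp add: cent_def ns_isos_id)

lemma scaling_id: "scaling (\<lambda>y. y) 1"
  by (simp add: scaling_def Int_absorb2[OF sets.sets_into_space])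

section \<open>Exhaustion\<close>

text \<open>One pass through the group suffices to match \<open>U\<close> with its image under a measure preserving
  \<open>T = id \<times> j\<close>: at step \<open>n\<close> the part of what is left that \<open>g\<^sub>n T\<close> maps into what is left is matched.
  By ergodicity the remainders are null sets, as they have the same finite measure.\<close>

lemma restr_iso_exists:
  assumes K: "restr K U" and fin: "emeasure Z U < \<infinity>" and j: "cent j" and c: "scaling j 1"
  obtains h where "h \<in> ns_isos K K" "AE z in K. oeq (h z) (id_map j z)"
proof -
  obtain i where i: "cent i" "AE y in Y. i (j y) = y" "AE y in Y. j (i y) = y" by (rule cent_inverse[OF j])
  note jm = ns_isos_measurable[OF cent_ns[OF j]]
  note npj = mor_np[OF cent_mor[OF j]] and npi = mor_np[OF cent_mor[OF i(1)]]
  define e where "e = from_nat_into (carrier \<Gamma>)"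
  have e: "range e = carrier \<Gamma>" unfolding e_def by (rule range_from_nat_into) (use \<Gamma> G.one_closed in auto)
  have eG: "e n \<in> carrier \<Gamma>" for n using e by blast
  define T where "T n z = \<sigma> (e n) (id_map j z)" for n z
  define S where "S n z = id_map i (\<sigma> (iv (e n)) z)" for n z
  have npT: "null_preserving Z Z (T n)" for n
    unfolding T_def by (rule null_preserving_comp[OF npj ZA.act_null_preserving[OF eG]])
  have npS: "null_preserving Z Z (S n)" for n
    unfolding S_def by (rule null_preserving_comp[OF ZA.act_null_preserving npi]) (use eG in simp)
  note Tm = null_preserving_measurable[OF npT] and Sm = null_preserving_measurable[OF npS]
  have ST: "AE z in Z. S n (T n z) = z" for n
    using AE_id_map[where i=i and j=j, OF i(2)] AE_space
    by eventually_elim (use eG mor_space[OF cent_mor[OF j]] in \<open>simp add: S_def T_def\<close>)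
  have TS: "AE z in Z. T n (S n z) = z" for n
    using ZA.act_AE[OF AE_id_map[where i=j and j=i, OF i(3)], of "iv (e n)"] AE_space eG[of n]
    by (auto simp: S_def T_def elim!: eventually_elim2)
  have T_measure: "emeasure Z (T n -` A \<inter> space Z) = emeasure Z A" if A: "A \<in> sets Z" for n A
  proof -
    have A': "\<sigma> (e n) -` A \<inter> space Z \<in> sets Z" by (rule measurable_sets[OF \<sigma>_measurable[OF eG] A])
    have "T n -` A \<inter> space Z = id_map j -` (\<sigma> (e n) -` A \<inter> space Z) \<inter> space Z"
      unfolding T_def using mor_space[OF cent_mor[OF j]] by blast
    then show ?thesis
      using scaling_Z[OF jm c A'] ZA.act_emeasure[OF eG A] by simp
  qed
  \<comment> \<open>\<open>A n\<close> and \<open>B n\<close> are what is left of \<open>U\<close>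
    on the source and on the target side. Both are updated from the same old pair.\<close>
  define AB where "AB = rec_nat (U, U) (\<lambda>n (A, B). (A - T n -` B, B - S n -` A))"
  define A where "A n = fst (AB n)" for n
  define B where "B n = snd (AB n)" for n
  have A0: "A 0 = U" "B 0 = U" by (simp_all add: A_def B_def AB_def)
  have AS: "A (Suc n) = A n - T n -` B n" "B (Suc n) = B n - S n -` A n" for n
    by (simp_all add: A_def B_def AB_def split: prod.split)
  define C where "C n = A n \<inter> T n -` B n" for n
  define D where "D n = B n \<inter> S n -` A n" for n
  have Us: "U \<in> sets Z" by (rule restrD(1)[OF K])
  have UZ: "U \<subseteq> space Z" by (rule restrD(3)[OF K])
  have sub: "A n \<subseteq> U" "B n \<subseteq> U" for n by (induction n) (auto simp: A0 AS)
  have ABm: "A n \<in> sets Z \<and> B n \<in> sets Z" for n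
  proof (induction n)
    case (Suc n)
    have "A n - T n -` B n = A n - (T n -` B n \<inter> space Z)" "B n - S n -` A n = B n - (S n -` A n \<inter> space Z)"
      using sub[of n] UZ by blast+
    then show ?case using Suc measurable_sets[OF Tm] measurable_sets[OF Sm] by (simp add: AS sets.Diff)
  qed (simp add: A0 Us)
  have CDe: "C n = A n \<inter> (T n -` B n \<inter> space Z)" "D n = B n \<inter> (S n -` A n \<inter> space Z)" for n
    using sub[of n] UZ unfolding C_def D_def by blast+
  have Cm: "C n \<in> sets Z" and Dm: "D n \<in> sets Z" for n
    unfolding CDe using ABm measurable_sets[OF Tm] measurable_sets[OF Sm] by (simp_all add: sets.Int)
  have decA: "A m \<subseteq> A n" and decB: "B m \<subseteq> B n" if "n \<le> m" for n m
    using that by (induction rule: dec_induct) (auto simp: AS)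
  have CA: "C n \<inter> A m = {}" and DB: "D n \<inter> B m = {}" if "n < m" for n m
    using decA[of "Suc n" m] decB[of "Suc n" m] that by (auto simp: C_def D_def AS)
  have disjC: "n = m" if "z \<in> C n" "z \<in> C m" for z n m
    using CA[of n m] CA[of m n] that by (cases n m rule: linorder_cases) (auto simp: C_def)
  have disjD: "n = m" if "z \<in> D n" "z \<in> D m" for z n m
    using DB[of n m] DB[of m n] that by (cases n m rule: linorder_cases) (auto simp: D_def)
  have measCD: "emeasure Z (C n) = emeasure Z (D n)" for n
  proof -
    have "emeasure Z (C n) = emeasure Z (T n -` D n \<inter> space Z)"
    proof (rule emeasure_eq_AE[OF _ Cm measurable_sets[OF Tm Dm]])
      show "AE z in Z. z \<in> C n \<longleftrightarrow> z \<in> T n -` D n \<inter> space Z"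
        using ST[of n] AE_space by eventually_elim (auto simp: C_def D_def)
    qed
    then show ?thesis using T_measure[OF Dm] by simp
  qed
  define C' where "C' = (\<Union>n. C n)"
  define D' where "D' = (\<Union>n. D n)"
  have CD'm: "C' \<in> sets Z" "D' \<in> sets Z" using Cm Dm by (auto simp: C'_def D'_def)
  have CD'sub: "C' \<subseteq> U" "D' \<subseteq> U" using sub by (auto simp: C'_def D'_def C_def D_def)
  have "emeasure Z C' = (\<Sum>n. emeasure Z (C n))"
    unfolding C'_def by (rule suminf_emeasure[symmetric]) (use Cm disjC in \<open>auto simp: disjoint_family_on_def\<close>)
  also have "\<dots> = (\<Sum>n. emeasure Z (D n))" by (simp add: measCD)
  also have "\<dots> = emeasure Z D'"
    unfolding D'_def by (rule suminf_emeasure) (use Dm disjD in \<open>auto simp: disjoint_family_on_def\<close>)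
  finally have measCD': "emeasure Z C' = emeasure Z D'" .
  have finC: "emeasure Z C' \<noteq> \<infinity>"
    using emeasure_mono[OF CD'sub(1) Us] fin by (auto simp: top_unique)
  \<comment> \<open>Equality passes to the complements by subtraction, which uses that the matched
    parts have finite measure.\<close>
  have rest: "emeasure Z (U - C') = emeasure Z (U - D')"
    using emeasure_Diff[OF _ Us CD'm(1) CD'sub(1)] emeasure_Diff[OF _ Us CD'm(2) CD'sub(2)] finC measCD' by simp
  have null: "emeasure Z (U - C') = 0"
  proof (rule ccontr)
    assume n0: "emeasure Z (U - C') \<noteq> 0"
    have Dr: "U - D' \<in> sets Z" using Us CD'm by auto
    have "AE z in Z. \<exists>g\<in>carrier \<Gamma>. \<sigma> g z \<in> U - D'" by (rule orbit_meets[OF Dr]) (use rest n0 in simp)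
    from null_preserving_AE[OF npj this] have "AE z in Z. z \<notin> U - C'"
    proof eventually_elim
      case (elim z)
      then obtain g where g: "g \<in> carrier \<Gamma>" "\<sigma> g (id_map j z) \<in> U - D'" by blast
      then have "g \<in> range e" using e by simp
      then obtain n where n: "g = e n" by blast
      then have Tz: "T n z \<in> U - D'" using g by (simp add: T_def)
      show ?case
      proof
        assume z: "z \<in> U - C'"
        \<comment> \<open>An unmatched point stays in every \<open>A m\<close>, and an unmatched
          image in every \<open>B m\<close>; such a pair would have been matched at step
          \<open>n\<close>.\<close>
        have "z \<in> A m" for m
        proof (induction m)
          case (Suc m)
          moreover have "z \<notin> C m" using z by (auto simp: C'_def)
          ultimately show ?case by (auto simp: AS C_def)
        qed (use z in \<open>simp add: A0\<close>)
        moreover have "T n z \<in> B m" for m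
        proof (induction m)
          case (Suc m)
          moreover have "T n z \<notin> D m" using Tz by (auto simp: D'_def)
          ultimately show ?case by (auto simp: AS D_def)
        qed (use Tz in \<open>simp add: A0\<close>)
        ultimately have "z \<in> C n" by (simp add: C_def)
        then show False using z by (auto simp: C'_def)
      qed
    qed
    moreover have "U - C' \<in> sets Z" using Us CD'm by auto
    ultimately have "U - C' \<in> null_sets Z" by (simp add: AE_iff_null_sets)
    then show False using n0 by auto
  qed
  have fullC: "AE z in K. z \<in> C'" and fullD: "AE z in K. z \<in> D'"
  proof -
    have "U - C' \<in> null_sets Z" "U - D' \<in> null_sets Z" using null rest Us CD'm by (auto simp: null_sets_def)
    from AE_not_in[OF this(1)] AE_not_in[OF this(2)]
    show "AE z in K. z \<in> C'" "AE z in K. z \<in> D'" unfolding restr_AE[OF K] by (auto elim: eventually_mono)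
  qed
  \<comment> \<open>The index 0 means unmatched, where \<open>h\<close> is the identity;
    \<open>Suc n\<close> means matched at step \<open>n\<close>.\<close>
  define p where "p z = (if z \<in> C' then Suc (LEAST n. z \<in> C n) else 0)" for z
  define q where "q z = (if z \<in> D' then Suc (LEAST n. z \<in> D n) else 0)" for z
  have pC: "p z = Suc n" if "z \<in> C n" for z n
    using that disjC[OF LeastI[of "\<lambda>n. z \<in> C n"]] by (auto simp: p_def C'_def)
  have qD: "q z = Suc n" if "z \<in> D n" for z n
    using that disjD[OF LeastI[of "\<lambda>n. z \<in> D n"]] by (auto simp: q_def D'_def)
  define h where "h z = (case p z of 0 \<Rightarrow> z | Suc n \<Rightarrow> T n z)" for z
  define g where "g z = (case q z of 0 \<Rightarrow> z | Suc n \<Rightarrow> S n z)" for z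
  have pm: "p \<in> Z \<rightarrow>\<^sub>M count_space UNIV" and qm: "q \<in> Z \<rightarrow>\<^sub>M count_space UNIV"
  proof -
    have "(\<lambda>z. Suc (LEAST n. z \<in> C n)) \<in> Z \<rightarrow>\<^sub>M count_space UNIV" "(\<lambda>z. Suc (LEAST n. z \<in> D n)) \<in> Z \<rightarrow>\<^sub>M count_space UNIV"
      by (rule measurable_compose[OF measurable_Least], use Cm Dm in \<open>auto simp: pred_def Int_def[symmetric]\<close>)+
    then show "p \<in> Z \<rightarrow>\<^sub>M count_space UNIV" "q \<in> Z \<rightarrow>\<^sub>M count_space UNIV"
      unfolding p_def q_def using CD'm by (auto intro!: measurable_If)
  qed
  have nph: "null_preserving Z Z h" unfolding h_def
  proof (rule null_preserving_piecewise[OF pm, where f="\<lambda>m z. case m of 0 \<Rightarrow> z | Suc n \<Rightarrow> T n z"])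
    show "null_preserving Z Z (\<lambda>z. case m of 0 \<Rightarrow> z | Suc n \<Rightarrow> T n z)" for m
      by (cases m) (use npT ns_isos_null_preserving[OF ns_isos_id] in auto)
  qed simp
  have npg: "null_preserving Z Z g" unfolding g_def
  proof (rule null_preserving_piecewise[OF qm, where f="\<lambda>m z. case m of 0 \<Rightarrow> z | Suc n \<Rightarrow> S n z"])
    show "null_preserving Z Z (\<lambda>z. case m of 0 \<Rightarrow> z | Suc n \<Rightarrow> S n z)" for m
      by (cases m) (use npS ns_isos_null_preserving[OF ns_isos_id] in auto)
  qed simp
  have hC: "h z = T n z" if "z \<in> C n" for z n using pC[OF that] by (simp add: h_def)
  have gD: "g z = S n z" if "z \<in> D n" for z n using qD[OF that] by (simp add: g_def)
  have hU: "h z \<in> U" if "z \<in> U" for z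
  proof (cases "z \<in> C'")
    case True
    then obtain n where n: "z \<in> C n" by (auto simp: C'_def)
    then show ?thesis using hC[OF n] sub(2) by (auto simp: C_def)
  qed (use that in \<open>simp add: h_def p_def\<close>)
  have gU: "g z \<in> U" if "z \<in> U" for z
  proof (cases "z \<in> D'")
    case True
    then obtain n where n: "z \<in> D n" by (auto simp: D'_def)
    then show ?thesis using gD[OF n] sub(1) by (auto simp: D_def)
  qed (use that in \<open>simp add: g_def q_def\<close>)
  have hK: "null_preserving K K h"
    by (rule restr_null_preserving_into[OF K null_preserving_comp[OF restr_incl[OF K] nph, simplified]])
      (use hU restrD(2)[OF K] in simp)
  have gK: "null_preserving K K g"
    by (rule restr_null_preserving_into[OF K null_preserving_comp[OF restr_incl[OF K] npg, simplified]])
      (use gU restrD(2)[OF K] in simp)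
  have "AE z in Z. \<forall>n. S n (T n z) = z" using ST by (simp add: AE_all_countable)
  then have STall: "AE z in K. \<forall>n. S n (T n z) = z" unfolding restr_AE[OF K] by eventually_elim blast
  have "AE z in Z. \<forall>n. T n (S n z) = z" using TS by (simp add: AE_all_countable)
  then have TSall: "AE z in K. \<forall>n. T n (S n z) = z" unfolding restr_AE[OF K] by eventually_elim blast
  have "h \<in> ns_isos K K"
  proof (rule ns_isosI[OF hK gK])
    show "AE z in K. g (h z) = z"
      using fullC STall
    proof eventually_elim
      case (elim z)
      then obtain n where n: "z \<in> C n" by (auto simp: C'_def)
      have "T n z \<in> D n" using n elim(2) by (auto simp: C_def D_def)
      then show ?case using hC[OF n] gD elim(2) by simp
    qed
    show "AE z in K. h (g z) = z"
      using fullD TSall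
    proof eventually_elim
      case (elim z)
      then obtain n where n: "z \<in> D n" by (auto simp: D'_def)
      have "S n z \<in> C n" using n elim(2) by (auto simp: C_def D_def)
      then show ?case using gD[OF n] hC elim(2) by simp
    qed
  qed
  moreover have "AE z in K. oeq (h z) (id_map j z)"
    using fullC
  proof eventually_elim
    case (elim z)
    then obtain n where n: "z \<in> C n" by (auto simp: C'_def)
    show ?case unfolding hC[OF n] T_def by (rule oeq_\<sigma>[OF eG])
  qed
  ultimately show ?thesis by (rule that)
qed

section \<open>Outer automorphisms of restrictions\<close>

text \<open>By freeness \<open>i\<close> and \<open>j\<close> agree at the second coordinates of
  almost all points of \<open>V\<close>. The set where they agree is \<Lambda>-invariant up to null
  sets, and it is not null because \<open>V\<close> is not.\<close>

lemma restr_cent_unique: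
  assumes K: "restr K V" "emeasure Z V \<noteq> 0" and i: "cent i" and j: "cent j"
    and eq: "AE z in K. oeq (id_map i z) (id_map j z)"
  shows "AE y in Y. i y = j y"
proof -
  note im = ns_isos_measurable[OF cent_ns[OF i]] and jm = ns_isos_measurable[OF cent_ns[OF j]]
  have m: "{y \<in> space Y. i y = j y} \<in> sets Y" by (rule standard_measure_eq_sets[OF Y(1) im jm])
  have "(AE y in Y. i y = j y) \<or> (AE y in Y. \<not> i y = j y)"
  proof (rule LA.ergodic_AE[OF \<beta>(2) m])
    fix l assume l: "l \<in> carrier \<Lambda>"
    have "AE y in Y. i (\<beta> l y) = \<beta> l (i y)" "AE y in Y. j (\<beta> l y) = \<beta> l (j y)" using i j l by (simp_all add: cent_def)
    then show "AE y in Y. (i (\<beta> l y) = j (\<beta> l y)) = (i y = j y)"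
      using AE_space
    proof eventually_elim
      case (elim y)
      have "i y \<in> space Y" "j y \<in> space Y" using measurable_space[OF im] measurable_space[OF jm] elim(3) by auto
      then have "\<beta> l (i y) = \<beta> l (j y) \<longleftrightarrow> i y = j y" using LA.inj_prop[OF l] by (auto dest: inj_onD)
      then show ?case using elim(1,2) by simp
    qed
  qed
  moreover have "\<not> (AE y in Y. \<not> i y = j y)"
  proof
    assume "AE y in Y. \<not> i y = j y"
    from AE_snd[OF this] eq[unfolded restr_AE[OF K(1)]] AE_free AE_space
    have "AE z in Z. z \<notin> V"
      by eventually_elim (use oeq_id_map_unique[OF im jm] in blast)
    then have "V \<in> null_sets Z" using restrD(1)[OF K(1)] by (simp add: AE_iff_null_sets)
    then show False using K(2) by auto
  qed
  ultimately show ?thesis by blast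
qed

text \<open>The common core of both computations of the outer automorphism group: \<open>P\<close>
  is trivial for the whole space and is preservation of the measure for a set of finite measure. The
  remaining inputs are existence of a representative for every \<open>j\<close> with
  \<open>P j\<close>, and necessity of \<open>P\<close>.\<close>

lemma Out_restr_iso:
  assumes K: "restr K V" "emeasure Z V \<noteq> 0"
    and carrier: "carrier G = ae_class Y ` {j. cent j \<and> P j}" and mult: "mult G = mult (Aut_ns Y)"
    and P_comp: "\<And>i j. cent i \<Longrightarrow> P i \<Longrightarrow> cent j \<Longrightarrow> P j \<Longrightarrow> P (\<lambda>y. i (j y))"
    and ex: "\<And>j. cent j \<Longrightarrow> P j \<Longrightarrow> \<exists>h\<in>ns_isos K K. AE z in K. oeq (h z) (id_map j z)"
    and surj: "\<And>h j. h \<in> ns_isos K K \<Longrightarrow> cent j \<Longrightarrow> AE z in K. oeq (h z) (id_map j z) \<Longrightarrow> P j"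
    and E: "\<And>C. C \<in> carrier G \<Longrightarrow> E C = {D \<in> carrier (Aut_rel K (restrict_rel R V)). \<forall>h\<in>D. \<forall>f\<in>C. AE z in K. oeq (h z) (id_map f z)}"
  shows "E \<in> iso G (Out_rel K (restrict_rel R V))"
proof -
  let ?S = "restrict_rel R V"
  interpret null_equiv K ?S by (rule restr_null_equiv[OF K(1)])
  note VZ = restrD(3)[OF K(1)] and KV = restrD(2)[OF K(1)]
  define r where "r C h \<longleftrightarrow> (\<exists>j. cent j \<and> P j \<and> C = ae_class Y j \<and> (AE z in K. oeq (h z) (id_map j z)))" for C h
  have idK: "AE z in K. id_map j z \<in> space Z" if "cent j" for j
    unfolding restr_AE[OF K(1)] using AE_space by eventually_elim (use mor_space[OF cent_mor[OF that]] in blast)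
  have S_iff: "(z, w) \<in> ?S \<longleftrightarrow> z \<in> V \<and> w \<in> V \<and> oeq z w" for z w by (rule restrict_rel_iff[OF VZ])
  show ?thesis
  proof (rule Out_rel_isoI[where r=r])
    show "\<exists>h\<in>aut. r C h" if "C \<in> carrier G" for C
    proof -
      obtain j where j: "cent j" "P j" "C = ae_class Y j" using \<open>C \<in> carrier G\<close> carrier by auto
      obtain h where h: "h \<in> ns_isos K K" "AE z in K. oeq (h z) (id_map j z)" using ex[OF j(1,2)] by blast
      have "respects_rel K ?S ?S h" by (rule restr_respects[OF K(1) K(1) ns_isos_measurable[OF h(1)] j(1) h(2)])
      then have "h \<in> aut" using h(1) by (simp add: aut_def)
      moreover have "r C h" using j h(2) by (auto simp: r_def)
      ultimately show ?thesis by blast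
    qed
    show "E C = out_coset h" if C: "C \<in> carrier G" and h: "h \<in> aut" and "r C h" for C h
    proof -
      obtain j where j: "cent j" "P j" "C = ae_class Y j" "AE z in K. oeq (h z) (id_map j z)"
        using \<open>r C h\<close> by (auto simp: r_def)
      have eqv: "(\<forall>k'\<in>ae_class K k. \<forall>f\<in>C. AE z in K. oeq (k' z) (id_map f z)) \<longleftrightarrow> (AE z in K. (k z, h z) \<in> ?S)"
        if k: "k \<in> aut" for k
      proof
        assume "\<forall>k'\<in>ae_class K k. \<forall>f\<in>C. AE z in K. oeq (k' z) (id_map f z)"
        then have "AE z in K. oeq (k z) (id_map j z)"
          using ae_class_self[OF aut_ns[OF k]] ae_class_self[OF cent_ns[OF j(1)]] j(3) by blast
        then show "AE z in K. (k z, h z) \<in> ?S"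
          using j(4) idK[OF j(1)] AE_space
        proof eventually_elim
          case (elim z)
          have s: "k z \<in> V" "h z \<in> V" using ns_isos_space[OF aut_ns[OF k]] ns_isos_space[OF aut_ns[OF h]] elim(4) KV by auto
          have "oeq (k z) (h z)" using oeq_trans[OF elim(1) oeq_sym[OF elim(2,3)]] s VZ by blast
          then show ?case using s by (simp add: S_iff)
        qed
      next
        assume kh: "AE z in K. (k z, h z) \<in> ?S"
        show "\<forall>k'\<in>ae_class K k. \<forall>f\<in>C. AE z in K. oeq (k' z) (id_map f z)"
        proof (intro ballI)
          fix k' f assume k': "k' \<in> ae_class K k" and f: "f \<in> C"
          have "AE z in Z. f (snd z) = j (snd z)" by (rule AE_snd[OF ae_classD(2)]) (use f j(3) in simp)
          then have fj: "AE z in K. id_map f z = id_map j z"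
            unfolding restr_AE[OF K(1)] by eventually_elim (simp add: id_map_def)
          show "AE z in K. oeq (k' z) (id_map f z)"
            using ae_classD(2)[OF k'] fj kh j(4) idK[OF j(1)]
          proof eventually_elim
            case (elim z)
            have "oeq (k z) (h z)" using elim(3) by (simp add: S_iff)
            then show ?case using oeq_trans[OF _ elim(4,5)] elim(1,2) by simp
          qed
        qed
      qed
      show ?thesis unfolding E[OF C] carrier_aut out_coset_def
      proof (intro equalityI subsetI)
        fix D assume "D \<in> {D \<in> ae_class K ` aut. \<forall>h\<in>D. \<forall>f\<in>C. AE z in K. oeq (h z) (id_map f z)}"
        then obtain k where "k \<in> aut" "D = ae_class K k" "\<forall>h\<in>ae_class K k. \<forall>f\<in>C. AE z in K. oeq (h z) (id_map f z)" by blast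
        then show "D \<in> {ae_class K h' | h'. h' \<in> aut \<and> (AE x in K. (h' x, h x) \<in> ?S)}" using eqv[of k] by blast
      next
        fix D assume "D \<in> {ae_class K h' | h'. h' \<in> aut \<and> (AE x in K. (h' x, h x) \<in> ?S)}"
        then obtain k where "k \<in> aut" "D = ae_class K k" "AE x in K. (k x, h x) \<in> ?S" by blast
        then show "D \<in> {D \<in> ae_class K ` aut. \<forall>h\<in>D. \<forall>f\<in>C. AE z in K. oeq (h z) (id_map f z)}" using eqv[of k] by blast
      qed
    qed
    show "C \<otimes>\<^bsub>G\<^esub> D \<in> carrier G \<and> r (C \<otimes>\<^bsub>G\<^esub> D) (\<lambda>x. h (k x))"
      if h: "h \<in> aut" and k: "k \<in> aut" and rr: "r C h" "r D k" for C D h k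
    proof -
      obtain i where i: "cent i" "P i" "C = ae_class Y i" "AE z in K. oeq (h z) (id_map i z)"
        using rr(1) by (auto simp: r_def)
      obtain j where j: "cent j" "P j" "D = ae_class Y j" "AE z in K. oeq (k z) (id_map j z)"
        using rr(2) by (auto simp: r_def)
      have CD: "C \<otimes>\<^bsub>G\<^esub> D = ae_class Y (\<lambda>y. i (j y))"
        unfolding mult i(3) j(3) by (rule mult_Aut_ns[OF cent_ns[OF i(1)] cent_ns[OF j(1)]])
      have c: "cent (\<lambda>y. i (j y))" "P (\<lambda>y. i (j y))"
        using cent_comp[OF i(1) j(1)] P_comp[OF i(1,2) j(1,2)] by auto
      have "AE z in Z. \<forall>w. oeq w (id_map j z) \<longrightarrow> oeq (id_map i w) (id_map i (id_map j z))"
        by (rule mor_AE[OF cent_mor[OF j(1)] mor_AE_oeq[OF cent_mor[OF i(1)]]])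
      then have ii: "AE z in K. \<forall>w. oeq w (id_map j z) \<longrightarrow> oeq (id_map i w) (id_map i (id_map j z))"
        unfolding restr_AE[OF K(1)] by eventually_elim blast
      have "AE z in K. oeq (h (k z)) (id_map (\<lambda>y. i (j y)) z)"
        using aut_AE[OF k i(4)] ii j(4) idK[OF c(1)]
      proof eventually_elim
        case (elim z)
        have e: "id_map i (id_map j z) = id_map (\<lambda>y. i (j y)) z" by (simp add: id_map_def)
        have "oeq (id_map i (k z)) (id_map i (id_map j z))" using elim(2,3) by blast
        then have "oeq (id_map i (k z)) (id_map (\<lambda>y. i (j y)) z)" unfolding e .
        then show ?case using oeq_trans[OF elim(1) _ elim(4)] by blast
      qed
      then show ?thesis using c CD carrier by (auto simp: r_def)
    qed
    show "C = D" if h: "h \<in> aut" and k: "k \<in> aut" and rr: "r C h" "r D k" and hk: "AE x in K. (h x, k x) \<in> ?S" for C D h k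
    proof -
      obtain i where i: "cent i" "P i" "C = ae_class Y i" "AE z in K. oeq (h z) (id_map i z)"
        using rr(1) by (auto simp: r_def)
      obtain j where j: "cent j" "P j" "D = ae_class Y j" "AE z in K. oeq (k z) (id_map j z)"
        using rr(2) by (auto simp: r_def)
      have "AE z in K. oeq (id_map i z) (id_map j z)"
        using hk i(4) j(4) idK[OF i(1)] idK[OF j(1)]
      proof eventually_elim
        case (elim z)
        have "oeq (h z) (k z)" "k z \<in> space Z" using elim(1) VZ by (auto simp: S_iff)
        then show ?case using oeq_trans[OF oeq_trans[OF oeq_sym[OF elim(2,4)]] elim(3,5)] by blast
      qed
      from restr_cent_unique[OF K i(1) j(1) this] show ?thesis unfolding i(3) j(3) by (rule ae_class_eqI)
    qed
    show "\<exists>C\<in>carrier G. r C h" if h: "h \<in> aut" for h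
    proof -
      have hr: "h \<in> ns_isos K K" "respects_rel K ?S ?S h" using h by (simp_all add: aut_def)
      obtain j where j: "cent j" "AE z in K. oeq (h z) (id_map j z)" by (rule restr_iso_rigid[OF K K hr])
      have "P j" by (rule surj[OF hr(1) j])
      then show ?thesis using j carrier by (auto simp: r_def)
    qed
  qed
qed

section \<open>The centralizer\<close>

lemma \<beta>_ns: "l \<in> carrier \<Lambda> \<Longrightarrow> \<beta> l \<in> ns_isos Y Y"
proof (rule ns_isosI)
  assume l: "l \<in> carrier \<Lambda>"
  show "null_preserving Y Y (\<beta> l)" "null_preserving Y Y (\<beta> (inv\<^bsub>\<Lambda>\<^esub> l))"
    using l LA.act_null_preserving by auto
  show "AE y in Y. \<beta> (inv\<^bsub>\<Lambda>\<^esub> l) (\<beta> l y) = y" "AE y in Y. \<beta> l (\<beta> (inv\<^bsub>\<Lambda>\<^esub> l) y) = y"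
    using l by (auto intro: AE_I2)
qed

lemma commute_iff:
  assumes j: "j \<in> ns_isos Y Y" and l: "l \<in> carrier \<Lambda>"
  shows "ae_class Y j \<otimes>\<^bsub>Aut_ns Y\<^esub> ae_class Y (\<beta> l) = ae_class Y (\<beta> l) \<otimes>\<^bsub>Aut_ns Y\<^esub> ae_class Y j \<longleftrightarrow>
    (AE y in Y. j (\<beta> l y) = \<beta> l (j y))"
  unfolding mult_Aut_ns[OF j \<beta>_ns[OF l]] mult_Aut_ns[OF \<beta>_ns[OF l] j]
proof
  assume "ae_class Y (\<lambda>y. j (\<beta> l y)) = ae_class Y (\<lambda>y. \<beta> l (j y))"
  then show "AE y in Y. j (\<beta> l y) = \<beta> l (j y)" by (rule ae_class_eqD[OF ns_isos_comp[OF j \<beta>_ns[OF l]]])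
qed (rule ae_class_eqI)

lemma carrier_Centr_ns: "carrier (Centr (Aut_ns Y) Y \<Lambda> \<beta>) = ae_class Y ` {j. cent j \<and> True}"
  unfolding Centr_def cent_def using commute_iff by (auto simp: carrier_Aut_ns)

lemma carrier_Centr_mp: "carrier (Centr (Aut_mp Y) Y \<Lambda> \<beta>) = ae_class Y ` {j. cent j \<and> distr Y Y j = Y}"
proof -
  have d: "(\<forall>f\<in>ae_class Y j. distr Y Y f = Y) \<longleftrightarrow> distr Y Y j = Y" if j: "j \<in> ns_isos Y Y" for j
  proof
    assume "\<forall>f\<in>ae_class Y j. distr Y Y f = Y" then show "distr Y Y j = Y" using ae_class_self[OF j] by blast
  next
    assume dj: "distr Y Y j = Y"
    show "\<forall>f\<in>ae_class Y j. distr Y Y f = Y"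
    proof
      fix f assume f: "f \<in> ae_class Y j"
      have "distr Y Y f = distr Y Y j"
        by (rule distr_cong_AE[OF refl refl ae_classD(2)[OF f] ns_isos_measurable[OF ae_classD(1)[OF f]] ns_isos_measurable[OF j]])
      then show "distr Y Y f = Y" using dj by simp
    qed
  qed
  have "C \<in> carrier (Centr (Aut_mp Y) Y \<Lambda> \<beta>) \<longleftrightarrow> (\<exists>j. C = ae_class Y j \<and> cent j \<and> distr Y Y j = Y)" for C
  proof
    assume C: "C \<in> carrier (Centr (Aut_mp Y) Y \<Lambda> \<beta>)"
    then obtain j where j: "j \<in> ns_isos Y Y" "C = ae_class Y j" by (auto simp: Centr_def Aut_mp_def carrier_Aut_ns)
    have "distr Y Y j = Y" using C d[OF j(1)] j(2) by (simp add: Centr_def Aut_mp_def)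
    moreover have "cent j" unfolding cent_def
    proof (intro conjI j(1) ballI)
      fix l assume l: "l \<in> carrier \<Lambda>"
      then have "C \<otimes>\<^bsub>Aut_ns Y\<^esub> ae_class Y (\<beta> l) = ae_class Y (\<beta> l) \<otimes>\<^bsub>Aut_ns Y\<^esub> C"
        using C by (simp add: Centr_def Aut_mp_def)
      then show "AE y in Y. j (\<beta> l y) = \<beta> l (j y)" unfolding j(2) commute_iff[OF j(1) l] .
    qed
    ultimately show "\<exists>j. C = ae_class Y j \<and> cent j \<and> distr Y Y j = Y" using j(2) by blast
  next
    assume "\<exists>j. C = ae_class Y j \<and> cent j \<and> distr Y Y j = Y"
    then obtain j where j: "C = ae_class Y j" "cent j" "distr Y Y j = Y" by blast
    note jn = cent_ns[OF j(2)]
    have "\<forall>l\<in>carrier \<Lambda>. C \<otimes>\<^bsub>Aut_ns Y\<^esub> ae_class Y (\<beta> l) = ae_class Y (\<beta> l) \<otimes>\<^bsub>Aut_ns Y\<^esub> C"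
      using j(2) commute_iff[OF jn] by (simp add: j(1) cent_def)
    moreover have "C \<in> carrier (Aut_ns Y)" using jn j(1) by (auto simp: carrier_Aut_ns)
    moreover have "\<forall>f\<in>C. distr Y Y f = Y" using d[OF jn] j by simp
    ultimately show "C \<in> carrier (Centr (Aut_mp Y) Y \<Lambda> \<beta>)" by (simp add: Centr_def Aut_mp_def)
  qed
  then show ?thesis by blast
qed

lemma mult_Centr: "mult (Centr (Aut_ns Y) Y \<Lambda> \<beta>) = mult (Aut_ns Y)" "mult (Centr (Aut_mp Y) Y \<Lambda> \<beta>) = mult (Aut_ns Y)"
  by (simp_all add: Centr_def Aut_mp_def)

section \<open>The outer automorphism group of the orbit relation\<close>

lemma restrict_rel_space: "restrict_rel R (space Z) = R"
  using R_space by (auto simp: restrict_rel_def)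

lemma id_map_aut:
  assumes j: "cent j"
  shows "id_map j \<in> ns_isos Z Z" "respects_rel Z R R (id_map j)"
proof -
  obtain i where i: "cent i" "AE y in Y. i (j y) = y" "AE y in Y. j (i y) = y" by (rule cent_inverse[OF j])
  show ns: "id_map j \<in> ns_isos Z Z"
    by (rule ns_isosI[OF mor_np[OF cent_mor[OF j]] mor_np[OF cent_mor[OF i(1)]]
          AE_id_map[where i=i and j=j, OF i(2)] AE_id_map[where i=j and j=i, OF i(3)]])
  have "AE z in Z. oeq (id_map j z) (id_map j z)"
    using AE_space by eventually_elim (use oeq_refl mor_space[OF cent_mor[OF j]] in blast)
  from restr_respects[OF restr_Z restr_Z ns_isos_measurable[OF ns] j this]
  show "respects_rel Z R R (id_map j)" by (simp add: restrict_rel_space)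
qed

lemma id_times_eq:
  assumes j: "cent j" shows "id_times X Y (ae_class Y j) = ae_class Z (id_map j)"
proof (intro equalityI subsetI)
  fix h assume "h \<in> id_times X Y (ae_class Y j)"
  then obtain f where h: "h \<in> ns_isos Z Z" and f: "f \<in> ae_class Y j" "AE z in Z. h z = (fst z, f (snd z))"
    by (auto simp: id_times_def)
  have "AE z in Z. h z = id_map j z"
    using f(2) AE_snd[OF ae_classD(2)[OF f(1)]] by eventually_elim (simp add: id_map_def)
  then show "h \<in> ae_class Z (id_map j)" using h by (simp add: ae_class_def)
next
  fix h assume "h \<in> ae_class Z (id_map j)"
  then show "h \<in> id_times X Y (ae_class Y j)"
    using ae_class_self[OF cent_ns[OF j]] by (auto simp: id_times_def ae_class_def id_map_def)
qed

lemma emeasure_Z: "emeasure Z (space Z) = \<infinity>"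
  using Y.emeasure_pair_measure_Times[of "space X" X "space Y"] Y(2) X.emeasure_space_1 by (simp add: space_pair_measure)

text \<open>\<open>out_class\<close> is given as a coset of the full group; it is rewritten into the
  intrinsic description required by \<open>Out_restr_iso\<close>, with the whole space as
  \<open>V\<close>.\<close>

lemma out_class_iso: "out_class X Y R \<in> iso (Centr (Aut_ns Y) Y \<Lambda> \<beta>) (Out_rel Z R)"
proof -
  interpret null_equiv Z R using restr_null_equiv[OF restr_Z] by (simp add: restrict_rel_space)
  have "out_class X Y R \<in> iso (Centr (Aut_ns Y) Y \<Lambda> \<beta>) (Out_rel Z (restrict_rel R (space Z)))"
  proof (rule Out_restr_iso[OF restr_Z _ carrier_Centr_ns mult_Centr(1)])
    show "emeasure Z (space Z) \<noteq> 0" using emeasure_Z by simp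
    show "\<exists>h\<in>ns_isos Z Z. AE z in Z. oeq (h z) (id_map j z)" if j: "cent j" for j
    proof (rule bexI[OF _ id_map_aut(1)[OF j]])
      show "AE z in Z. oeq (id_map j z) (id_map j z)"
        using AE_space by eventually_elim (use oeq_refl mor_space[OF cent_mor[OF j]] in blast)
    qed
    fix C assume "C \<in> carrier (Centr (Aut_ns Y) Y \<Lambda> \<beta>)"
    then obtain j where j: "cent j" "C = ae_class Y j" by (auto simp: carrier_Centr_ns)
    have a: "id_map j \<in> aut" using id_map_aut[OF j(1)] by (simp add: aut_def)
    have eq: "out_class X Y R C = out_coset (id_map j)"
      unfolding out_class_def j(2) id_times_eq[OF j(1)] by (rule coset_eq[OF a])
    have eqv: "(\<forall>k'\<in>ae_class Z k. \<forall>f\<in>C. AE z in Z. oeq (k' z) (id_map f z)) \<longleftrightarrow> (AE z in Z. (k z, id_map j z) \<in> R)"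
      if k: "k \<in> aut" for k
    proof
      assume "\<forall>k'\<in>ae_class Z k. \<forall>f\<in>C. AE z in Z. oeq (k' z) (id_map f z)"
      then have "AE z in Z. oeq (k z) (id_map j z)"
        using ae_class_self[OF aut_ns[OF k]] ae_class_self[OF cent_ns[OF j(1)]] j(2) by blast
      then show "AE z in Z. (k z, id_map j z) \<in> R" using AE_space
        by eventually_elim (use mor_space[OF cent_mor[OF j(1)]] in \<open>simp add: R_iff\<close>)
    next
      assume kj: "AE z in Z. (k z, id_map j z) \<in> R"
      show "\<forall>k'\<in>ae_class Z k. \<forall>f\<in>C. AE z in Z. oeq (k' z) (id_map f z)"
      proof (intro ballI)
        fix k' f assume k': "k' \<in> ae_class Z k" and f: "f \<in> C"
        have "AE z in Z. f (snd z) = j (snd z)" by (rule AE_snd[OF ae_classD(2)]) (use f j(2) in simp)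
        then show "AE z in Z. oeq (k' z) (id_map f z)"
          using ae_classD(2)[OF k'] kj by eventually_elim (simp add: R_iff id_map_def)
      qed
    qed
    show "out_class X Y R C = {D \<in> carrier (Aut_rel Z (restrict_rel R (space Z))). \<forall>h\<in>D. \<forall>f\<in>C. AE z in Z. oeq (h z) (id_map f z)}"
      unfolding eq restrict_rel_space carrier_aut out_coset_def
    proof (intro equalityI subsetI)
      fix D assume "D \<in> {ae_class Z h' |h'. h' \<in> aut \<and> (AE x in Z. (h' x, id_map j x) \<in> R)}"
      then obtain k where "k \<in> aut" "D = ae_class Z k" "AE x in Z. (k x, id_map j x) \<in> R" by blast
      then show "D \<in> {D \<in> ae_class Z ` aut. \<forall>h\<in>D. \<forall>f\<in>C. AE z in Z. oeq (h z) (id_map f z)}" using eqv[of k] by blast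
    next
      fix D assume "D \<in> {D \<in> ae_class Z ` aut. \<forall>h\<in>D. \<forall>f\<in>C. AE z in Z. oeq (h z) (id_map f z)}"
      then obtain k where "k \<in> aut" "D = ae_class Z k" "\<forall>h\<in>ae_class Z k. \<forall>f\<in>C. AE z in Z. oeq (h z) (id_map f z)" by blast
      then show "D \<in> {ae_class Z h' |h'. h' \<in> aut \<and> (AE x in Z. (h' x, id_map j x) \<in> R)}" using eqv[of k] by blast
    qed
  qed simp_all
  then show ?thesis by (simp add: restrict_rel_space)
qed

section \<open>Finite measure restrictions\<close>

text \<open>Formulated over an arbitrary \<open>restr K U\<close> because it is applied twice: to
  \<open>U\<close> inside \<open>Z\<close>, and to subsets of \<open>U\<close> inside the normalized
  restriction.\<close>

lemma restr_normalized:
  assumes K: "restr K U" and V: "V \<in> sets K" "emeasure K V \<noteq> 0" "emeasure K V \<noteq> \<infinity>"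
  shows "restr (normalized_restrict K V) V"
    and "A \<in> sets K \<Longrightarrow> A \<subseteq> V \<Longrightarrow> emeasure (normalized_restrict K V) A = inverse (emeasure K V) * emeasure K A"
proof -
  have VZ: "V \<in> sets Z" "V \<subseteq> U" using V(1) restrD(4)[OF K] by auto
  have VK: "V \<inter> space K = V" using VZ restrD(2)[OF K] by auto
  have s: "A \<in> sets (normalized_restrict K V) \<longleftrightarrow> A \<in> sets K \<and> A \<subseteq> V" for A
    using V(1) by (simp add: normalized_restrict_def sets_restrict_space_iff VK conj_commute)
  show e: "emeasure (normalized_restrict K V) A = inverse (emeasure K V) * emeasure K A"
    if A: "A \<in> sets K" "A \<subseteq> V" for A
    using A V(1) by (simp add: normalized_restrict_def emeasure_restrict_space VK)
  have VZs: "V \<inter> space Z = V" using sets.sets_into_space[OF VZ(1)] by auto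
  have s': "A \<in> sets (restrict_space Z V) \<longleftrightarrow> A \<in> sets K \<and> A \<subseteq> V" for A
    using VZ restrD(4)[OF K] by (auto simp: sets_restrict_space_iff VZs)
  have z: "emeasure (normalized_restrict K V) A = 0 \<longleftrightarrow> emeasure Z A = 0" if A: "A \<in> sets K" "A \<subseteq> V" for A
  proof -
    have "inverse (emeasure K V) \<noteq> 0" using V(3) by simp
    then have "emeasure (normalized_restrict K V) A = 0 \<longleftrightarrow> emeasure K A = 0" using e[OF A] by simp
    then show ?thesis using K A(1) by (simp add: restr_def)
  qed
  have "space (normalized_restrict K V) = V"
  proof -
    have "space (normalized_restrict K V) = space (restrict_space K V)"
      by (rule sets_eq_imp_space_eq) (simp add: normalized_restrict_def)
    then show ?thesis by (simp add: space_restrict_space VK)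
  qed
  moreover have "sets (normalized_restrict K V) = sets (restrict_space Z V)"
    by (rule Set.set_eqI) (simp only: s s')
  ultimately show "restr (normalized_restrict K V) V"
    unfolding restr_def using VZ(1) by (intro conjI ballI z) (simp_all add: s')
qed

lemma restrict_rel_twice: "V \<subseteq> U \<Longrightarrow> restrict_rel (restrict_rel S U) V = restrict_rel S V"
  by (auto simp: restrict_rel_def)

context
  fixes U assumes U: "U \<in> sets Z" "0 < emeasure Z U" "emeasure Z U < \<infinity>"
begin

abbreviation ZU where "ZU \<equiv> normalized_restrict Z U"

lemma restr_K: "restr ZU U"
  by (rule restr_normalized(1)[OF restr_Z U(1)]) (use U in auto)

lemma emeasure_K: "A \<in> sets Z \<Longrightarrow> A \<subseteq> U \<Longrightarrow> emeasure ZU A = inverse (emeasure Z U) * emeasure Z A"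
  by (rule restr_normalized(2)[OF restr_Z U(1)]) (use U in auto)

lemma finite_sub: "A \<subseteq> U \<Longrightarrow> emeasure Z A \<noteq> \<infinity>"
  using emeasure_mono[OF _ U(1), of A] U(3) by (auto simp: top_unique)

lemma measure_U: "emeasure Z U = ennreal (measure Z U)" "0 < measure Z U"
proof -
  show u: "emeasure Z U = ennreal (measure Z U)" by (rule emeasure_eq_ennreal_measure) (use U(3) in simp)
  show "0 < measure Z U" using U(2) unfolding u by simp
qed

lemma measure_K:
  assumes "A \<in> sets Z" "A \<subseteq> U" shows "measure ZU A = measure Z A / measure Z U" "emeasure ZU A \<noteq> \<infinity>"
proof -
  note u = measure_U
  have a: "emeasure Z A = ennreal (measure Z A)" using finite_sub[OF assms(2)] by (simp add: emeasure_eq_ennreal_measure)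
  have "emeasure ZU A = ennreal (measure Z A / measure Z U)"
    unfolding emeasure_K[OF assms] a using u by (simp add: inverse_ennreal ennreal_mult[symmetric] divide_inverse mult.commute)
  then show "measure ZU A = measure Z A / measure Z U" "emeasure ZU A \<noteq> \<infinity>" by (simp_all add: measure_def)
qed

text \<open>An automorphism of the restriction carries \<open>U\<close> to \<open>U\<close>, whose
  measure is finite and positive, so the scaling constant is 1. Conversely, exhaustion realizes
  every measure preserving element of the centralizer on \<open>U\<close>.\<close>

lemma out_class_restrict_iso:
  "out_class_restrict X Y R U \<in> iso (Centr (Aut_mp Y) Y \<Lambda> \<beta>) (Out_rel ZU (restrict_rel R U))"
proof (rule Out_restr_iso[OF restr_K _ carrier_Centr_mp mult_Centr(2)])
  show "emeasure Z U \<noteq> 0" using U by simp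
  show "distr Y Y (\<lambda>y. i (j y)) = Y" if i: "cent i" "distr Y Y i = Y" and j: "cent j" "distr Y Y j = Y" for i j
    using distr_distr[OF ns_isos_measurable[OF cent_ns[OF i(1)]] ns_isos_measurable[OF cent_ns[OF j(1)]]] i j
    by (simp add: comp_def)
  show "\<exists>h\<in>ns_isos ZU ZU. AE z in ZU. oeq (h z) (id_map j z)" if j: "cent j" "distr Y Y j = Y" for j
  proof -
    have "scaling j 1" using scaling_one_iff[OF ns_isos_measurable[OF cent_ns[OF j(1)]]] j(2) by simp
    then obtain h where "h \<in> ns_isos ZU ZU" "AE z in ZU. oeq (h z) (id_map j z)"
      by (rule restr_iso_exists[OF restr_K U(3) j(1)])
    then show ?thesis by blast
  qed
  show "distr Y Y j = Y" if h: "h \<in> ns_isos ZU ZU" and j: "cent j" and eq: "AE z in ZU. oeq (h z) (id_map j z)" for h j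
  proof -
    obtain c where c: "scaling j c" by (rule cent_scaling[OF j])
    note u = measure_U
    have "emeasure Z U = ennreal c * emeasure Z U" by (rule restr_scaling[OF restr_K restr_K h j c eq])
    then have "ennreal (measure Z U) = ennreal (c * measure Z U)"
      using u scaling_pos[OF c] by (simp add: ennreal_mult)
    then have "c = 1" using u(2) scaling_pos[OF c] by simp
    then show ?thesis using c scaling_one_iff[OF ns_isos_measurable[OF cent_ns[OF j]]] by simp
  qed
  fix C assume "C \<in> carrier (Centr (Aut_mp Y) Y \<Lambda> \<beta>)"
  then obtain j where j: "cent j" "C = ae_class Y j" by (auto simp: carrier_Centr_mp)
  have "(AE z in ZU. (h z, (fst z, f (snd z))) \<in> R) \<longleftrightarrow> (AE z in ZU. oeq (h z) (id_map f z))" if f: "f \<in> C" for h f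
  proof -
    have fm: "f \<in> Y \<rightarrow>\<^sub>M Y" using f j(2) by (simp add: ae_class_def ns_isos_def)
    have "AE z in ZU. (h z, (fst z, f (snd z))) \<in> R \<longleftrightarrow> oeq (h z) (id_map f z)"
      unfolding restr_AE[OF restr_K]
      using AE_space by eventually_elim (use measurable_space[OF id_map_measurable[OF fm]] in \<open>simp add: R_iff id_map_def\<close>)
    then show ?thesis by (rule AE_iff_cong)
  qed
  then show "out_class_restrict X Y R U C = {D \<in> carrier (Aut_rel ZU (restrict_rel R U)). \<forall>h\<in>D. \<forall>f\<in>C. AE z in ZU. oeq (h z) (id_map f z)}"
    unfolding out_class_restrict_def by blast
qed

text \<open>An isomorphism between the restrictions to \<open>V\<close> and \<open>W\<close> scales
  the measure by the ratio of \<open>W\<close> to \<open>V\<close>, whereas the fundamental group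
  records the ratio of \<open>V\<close> to \<open>W\<close>; this is why inverses of centralizer
  elements occur in both directions.\<close>

lemma fundamental_group:
  "fundamental_group_rel ZU (restrict_rel R U) = mod_ns Y ` carrier (Centr (Aut_ns Y) Y \<Lambda> \<beta>)"
proof (intro equalityI subsetI)
  fix t assume "t \<in> fundamental_group_rel ZU (restrict_rel R U)"
  then obtain V W where t: "t = measure ZU V / measure ZU W" and VW: "V \<in> sets ZU" "W \<in> sets ZU" "0 < measure ZU V" "0 < measure ZU W"
    and iso: "rel_isomorphic (normalized_restrict ZU V) (restrict_rel (restrict_rel R U) V) (normalized_restrict ZU W) (restrict_rel (restrict_rel R U) W)"
    by (auto simp: fundamental_group_rel_def)
  have VZ: "V \<in> sets Z" "V \<subseteq> U" "W \<in> sets Z" "W \<subseteq> U" using VW(1,2) restrD(4)[OF restr_K] by auto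
  have n0: "emeasure ZU V \<noteq> 0" "emeasure ZU W \<noteq> 0" using VW(3,4) by (auto simp: measure_def)
  have n0Z: "emeasure Z V \<noteq> 0" "emeasure Z W \<noteq> 0" using n0 emeasure_K VZ by auto
  note KV = restr_normalized(1)[OF restr_K VW(1) n0(1) measure_K(2)[OF VZ(1,2)]]
  note KW = restr_normalized(1)[OF restr_K VW(2) n0(2) measure_K(2)[OF VZ(3,4)]]
  obtain f where f: "f \<in> ns_isos (normalized_restrict ZU V) (normalized_restrict ZU W)"
    "respects_rel (normalized_restrict ZU V) (restrict_rel R V) (restrict_rel R W) f"
    using iso VZ by (auto simp: rel_isomorphic_def restrict_rel_twice)
  obtain j where j: "cent j" "AE z in normalized_restrict ZU V. oeq (f z) (id_map j z)"
    by (rule restr_iso_rigid[OF KV n0Z(1) KW n0Z(2) f])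
  obtain c where c: "scaling j c" by (rule cent_scaling[OF j(1)])
  obtain i where i: "cent i" "AE y in Y. i (j y) = y" by (rule cent_inverse[OF j(1)])
  have "emeasure Z W = ennreal c * emeasure Z V" by (rule restr_scaling[OF KV KW f(1) j(1) c j(2)])
  then have m: "measure Z W = c * measure Z V"
    using scaling_pos[OF c] by (simp add: measure_def enn2real_mult)
  have pos: "measure Z U \<noteq> 0" "measure Z V \<noteq> 0"
    using VW(3) measure_K(1)[OF VZ(1,2)] by auto
  have "t = 1 / c" unfolding t measure_K(1)[OF VZ(1,2)] measure_K(1)[OF VZ(3,4)] m using pos by simp
  also have "\<dots> = mod_ns Y (ae_class Y i)" by (rule mod_ns_eq[OF i(1) scaling_inverse[OF j(1) i(1,2) c], symmetric])
  finally show "t \<in> mod_ns Y ` carrier (Centr (Aut_ns Y) Y \<Lambda> \<beta>)" using i(1) by (auto simp: carrier_Centr_ns)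
next
  fix t assume "t \<in> mod_ns Y ` carrier (Centr (Aut_ns Y) Y \<Lambda> \<beta>)"
  then obtain i where i: "cent i" and ti: "t = mod_ns Y (ae_class Y i)" by (auto simp: carrier_Centr_ns)
  obtain c where c: "scaling i c" by (rule cent_scaling[OF i])
  have tc: "t = c" unfolding ti by (rule mod_ns_eq[OF i c])
  \<comment> \<open>The inverse has constant \<open>1 / c\<close>, so that source over target
    becomes \<open>c\<close>.\<close>
  obtain j where j: "cent j" "AE y in Y. j (i y) = y" "AE y in Y. i (j y) = y" by (rule cent_inverse[OF i])
  note cj = scaling_inverse[OF i j(1,2) c]
  note npj = mor_np[OF cent_mor[OF j(1)]] and npi = mor_np[OF cent_mor[OF i]]
  have ex: "AE z in Z. \<exists>g\<in>carrier \<Gamma>. \<sigma> g (id_map j z) \<in> U"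
    by (rule null_preserving_AE[OF npj orbit_meets[OF U(1)]]) (use U in simp)
  \<comment> \<open>Almost every orbit meets \<open>U\<close>; as the group is countable, a single
    element returns \<open>id_map j z\<close> to \<open>U\<close> for a non-null set of points
    \<open>z\<close> of \<open>U\<close>.\<close>
  have "\<exists>g\<in>carrier \<Gamma>. \<not> (AE z in Z. z \<in> U \<longrightarrow> \<sigma> g (id_map j z) \<notin> U)"
  proof (rule ccontr)
    assume "\<not> ?thesis"
    then have "AE z in Z. \<forall>g\<in>carrier \<Gamma>. z \<in> U \<longrightarrow> \<sigma> g (id_map j z) \<notin> U" by (subst AE_ball_countable[OF \<Gamma>(2)]) blast
    with ex have "AE z in Z. z \<notin> U" by eventually_elim blast
    then have "U \<in> null_sets Z" using U(1) by (simp add: AE_iff_null_sets)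
    then show False using U by auto
  qed
  then obtain g where g: "g \<in> carrier \<Gamma>" "\<not> (AE z in Z. z \<in> U \<longrightarrow> \<sigma> g (id_map j z) \<notin> U)" by blast
  define T where "T z = \<sigma> g (id_map j z)" for z
  define S where "S z = id_map i (\<sigma> (iv g) z)" for z
  have npT: "null_preserving Z Z T" unfolding T_def by (rule null_preserving_comp[OF npj ZA.act_null_preserving[OF g(1)]])
  have npS: "null_preserving Z Z S" unfolding S_def by (rule null_preserving_comp[OF ZA.act_null_preserving npi]) (use g in simp)
  note Tm = null_preserving_measurable[OF npT] and Sm = null_preserving_measurable[OF npS]
  have ST: "AE z in Z. S (T z) = z"
    using AE_id_map[where i=i and j=j, OF j(3)] AE_space
    by eventually_elim (use g(1) mor_space[OF cent_mor[OF j(1)]] in \<open>simp add: S_def T_def\<close>)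
  \<comment> \<open>Imposing the inverse identities pointwise makes \<open>T\<close> and
    \<open>S\<close> exact bijections between \<open>V\<close> and \<open>W\<close>; in
    \<open>V\<close> this discards only a null set.\<close>
  define V where "V = {z \<in> space Z. z \<in> U \<and> T z \<in> U \<and> S (T z) = z}"
  define W where "W = {z \<in> space Z. z \<in> U \<and> S z \<in> U \<and> T (S z) = z}"
  have idm: "(\<lambda>z. z) \<in> Z \<rightarrow>\<^sub>M Z" by simp
  have V: "V \<in> sets Z"
  proof -
    have "V = U \<inter> (T -` U \<inter> space Z) \<inter> {z \<in> space Z. S (T z) = z}" unfolding V_def by blast
    then show ?thesis
      using U(1) measurable_sets[OF Tm U(1)] standard_measure_eq_sets[OF standard_Z measurable_compose[OF Tm Sm] idm] by auto
  qed
  have W: "W \<in> sets Z"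
  proof -
    have "W = U \<inter> (S -` U \<inter> space Z) \<inter> {z \<in> space Z. T (S z) = z}" unfolding W_def by blast
    then show ?thesis
      using U(1) measurable_sets[OF Sm U(1)] standard_measure_eq_sets[OF standard_Z measurable_compose[OF Sm Tm] idm] by auto
  qed
  have VU: "V \<subseteq> U" and WU: "W \<subseteq> U" by (auto simp: V_def W_def)
  have VK: "V \<in> sets ZU" "W \<in> sets ZU" using V W VU WU restrD(4)[OF restr_K] by auto
  have TVW: "T z \<in> W" if "z \<in> V" for z
    using that measurable_space[OF Tm] by (auto simp: V_def W_def)
  have SWV: "S z \<in> V" if "z \<in> W" for z
    using that measurable_space[OF Sm] by (auto simp: V_def W_def)
  have V0: "emeasure Z V \<noteq> 0"
  proof
    assume "emeasure Z V = 0"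
    then have "V \<in> null_sets Z" using V by (simp add: null_sets_def)
    from AE_not_in[OF this] ST AE_space have "AE z in Z. z \<in> U \<longrightarrow> \<sigma> g (id_map j z) \<notin> U"
      by eventually_elim (auto simp: V_def T_def)
    then show False using g(2) by simp
  qed
  have KV0: "emeasure ZU V \<noteq> 0" using V0 restr_K VK(1) by (simp add: restr_def)
  note KV = restr_normalized(1)[OF restr_K VK(1) KV0 measure_K(2)[OF V VU]]
  have W0: "emeasure Z W \<noteq> 0"
  proof
    assume "emeasure Z W = 0"
    then have "W \<in> null_sets Z" using W by (simp add: null_sets_def)
    from null_preserving_AE[OF npT AE_not_in[OF this]] have "AE z in Z. z \<notin> V" by eventually_elim (use TVW in blast)
    then have "V \<in> null_sets Z" using V by (simp add: AE_iff_null_sets)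
    then show False using V0 by auto
  qed
  have KW0: "emeasure ZU W \<noteq> 0" using W0 restr_K VK(2) by (simp add: restr_def)
  note KW = restr_normalized(1)[OF restr_K VK(2) KW0 measure_K(2)[OF W WU]]
  have TK: "null_preserving (normalized_restrict ZU V) (normalized_restrict ZU W) T"
    by (rule restr_null_preserving_into[OF KW null_preserving_comp[OF restr_incl[OF KV] npT, simplified]])
      (use TVW restrD(2)[OF KV] in simp)
  have SK: "null_preserving (normalized_restrict ZU W) (normalized_restrict ZU V) S"
    by (rule restr_null_preserving_into[OF KV null_preserving_comp[OF restr_incl[OF KW] npS, simplified]])
      (use SWV restrD(2)[OF KW] in simp)
  have Tiso: "T \<in> ns_isos (normalized_restrict ZU V) (normalized_restrict ZU W)"
  proof (rule ns_isosI[OF TK SK])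
    show "AE z in normalized_restrict ZU V. S (T z) = z" unfolding restr_AE[OF KV] by (rule AE_I2) (simp add: V_def)
    show "AE z in normalized_restrict ZU W. T (S z) = z" unfolding restr_AE[OF KW] by (rule AE_I2) (simp add: W_def)
  qed
  have Teq: "AE z in normalized_restrict ZU V. oeq (T z) (id_map j z)"
    by (rule AE_I2) (simp add: T_def oeq_\<sigma>[OF g(1)])
  have iso: "rel_isomorphic (normalized_restrict ZU V) (restrict_rel (restrict_rel R U) V) (normalized_restrict ZU W) (restrict_rel (restrict_rel R U) W)"
    unfolding rel_isomorphic_def restrict_rel_twice[OF VU] restrict_rel_twice[OF WU]
    by (rule bexI[where x=T]) (rule restr_respects[OF KV KW ns_isos_measurable[OF Tiso] j(1) Teq], rule Tiso)
  have "emeasure Z W = ennreal (1 / c) * emeasure Z V" by (rule restr_scaling[OF KV KW Tiso j(1) cj Teq])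
  then have m: "measure Z W = (1 / c) * measure Z V"
    using scaling_pos[OF c] by (simp add: measure_def enn2real_mult)
  have pos: "0 < measure Z U" "0 < measure Z V" "0 < measure Z W"
    using measure_U(2) V0 W0 finite_sub[OF VU] finite_sub[OF WU]
    by (simp_all add: zero_less_measure_iff emeasure_eq_ennreal_measure)
  have "t = measure ZU V / measure ZU W"
    unfolding tc measure_K(1)[OF V VU] measure_K(1)[OF W WU] m using pos by simp
  moreover have "0 < measure ZU V" "0 < measure ZU W"
    unfolding measure_K(1)[OF V VU] measure_K(1)[OF W WU] using pos by simp_all
  ultimately show "t \<in> fundamental_group_rel ZU (restrict_rel R U)"
    unfolding fundamental_group_rel_def using VK iso by blast
qed

end

section \<open>The orbit relation is of type \<open>II\<^sub>\<infinity>\<close>\<close>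

text \<open>If the group were trivial, every set would be invariant, and a set of finite positive
  measure in the infinite space \<open>Y\<close> would contradict ergodicity.\<close>

lemma group_nontrivial: "carrier \<Gamma> \<noteq> {\<one>\<^bsub>\<Gamma>\<^esub>}"
proof
  assume triv: "carrier \<Gamma> = {\<one>\<^bsub>\<Gamma>\<^esub>}"
  have l1: "l = \<one>\<^bsub>\<Lambda>\<^esub>" if "l \<in> carrier \<Lambda>" for l
  proof -
    have "l \<in> \<pi> ` carrier \<Gamma>" using that surj_\<pi> by simp
    then show ?thesis unfolding triv by simp
  qed
  obtain A where A: "A \<in> sets Y" "0 < emeasure Y A" "emeasure Y A < \<infinity>" by (rule Y_finite_positive)
  have "\<beta> l -` A \<inter> space Y = A" if "l \<in> carrier \<Lambda>" for l
    unfolding l1[OF that] using sets.sets_into_space[OF A(1)] LA.act_one by force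
  then have "A \<in> null_sets Y \<or> space Y - A \<in> null_sets Y" using \<beta>(2) A(1) by (simp add: ergodic_action_def)
  then have "emeasure Y (space Y - A) = 0" using A(2) by (auto simp: null_sets_def)
  moreover have "emeasure Y (space Y) \<le> emeasure Y A + emeasure Y (space Y - A)"
    using emeasure_subadditive[of A Y "space Y - A"] A(1) sets.sets_into_space[OF A(1)] by (simp add: Un_absorb1)
  ultimately show False using A(3) Y(2) by simp
qed

text \<open>The diagonal of \<open>X \<times> X\<close> is invariant, hence null or conull. If
  conull, \<open>X\<close> would be concentrated at one point, which every group element would have
  to fix, against freeness. If null, no point has positive measure.\<close>

lemma AE_neq_point: "AE x in X. x \<noteq> x0"
proof -
  interpret XX: pair_sigma_finite X X ..
  interpret S: countable_action N "X \<Otimes>\<^sub>M X" "product_action X X \<alpha> \<alpha>" by (rule NX.square_action)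
  have D: "{z \<in> space (X \<Otimes>\<^sub>M X). fst z = snd z} \<in> sets (X \<Otimes>\<^sub>M X)"
    by (rule standard_measure_eq_sets[OF X(1) measurable_fst measurable_snd])
  have "(AE z in X \<Otimes>\<^sub>M X. fst z = snd z) \<or> (AE z in X \<Otimes>\<^sub>M X. \<not> fst z = snd z)"
  proof (rule S.ergodic_AE[OF _ D])
    show "ergodic_action N (X \<Otimes>\<^sub>M X) (product_action X X \<alpha> \<alpha>)" using weakly_mixing by (simp add: weakly_mixing_action_def)
    fix n assume n: "n \<in> carrier N"
    show "AE z in X \<Otimes>\<^sub>M X. (fst (product_action X X \<alpha> \<alpha> n z) = snd (product_action X X \<alpha> \<alpha> n z)) = (fst z = snd z)"
      using AE_space
    proof eventually_elim
      case (elim z)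
      then have "fst z \<in> space X" "snd z \<in> space X" by (auto simp: space_pair_measure)
      then show ?case using XA.inj_prop[OF N_in[OF n]] elim
        by (auto simp: product_action_def space_pair_measure dest: inj_onD)
    qed
  qed
  then show ?thesis
  proof
    assume "AE z in X \<Otimes>\<^sub>M X. fst z = snd z"
    from XX.AE_pair[OF this] have "AE x in X. AE x' in X. x = x'" by simp
    then obtain x1 where x1: "AE x in X. x1 = x" using eventually_happens'[OF X.ae_filter_bot] by blast
    have "g = \<one>\<^bsub>\<Gamma>\<^esub>" if g: "g \<in> carrier \<Gamma>" for g
    proof (rule ccontr)
      assume "g \<noteq> \<one>\<^bsub>\<Gamma>\<^esub>"
      then have "AE x in X. \<alpha> g x \<noteq> x" using \<alpha>(2) g by (simp add: free_action_def)
      then have "AE x in X. False" using x1 XA.act_AE[OF x1 g] by eventually_elim simp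
      then show False by (simp add: X.AE_False)
    qed
    then show ?thesis using group_nontrivial G.one_closed by blast
  next
    assume "AE z in X \<Otimes>\<^sub>M X. \<not> fst z = snd z"
    from XX.AE_pair[OF this] have a: "AE x in X. AE x' in X. x \<noteq> x'" by simp
    show ?thesis
    proof (cases "AE x' in X. x0 \<noteq> x'")
      case True then show ?thesis by eventually_elim simp
    next
      case False
      from a show ?thesis by eventually_elim (use False in blast)
    qed
  qed
qed

text \<open>On an atom every test \<open>fst z \<in> E n\<close> would be constant almost
  everywhere, so the atom would lie over a single point of \<open>X\<close>, and points of
  \<open>X\<close> are null.\<close>

lemma nonatomic_Z: "nonatomic Z"
  unfolding nonatomic_def
proof (intro ballI impI)
  fix A assume A: "A \<in> sets Z" "0 < emeasure Z A"
  obtain E :: "nat \<Rightarrow> 'x set" where E: "\<And>n. E n \<in> sets X"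
    "\<And>x y. x \<in> space X \<Longrightarrow> y \<in> space X \<Longrightarrow> (\<And>n. x \<in> E n \<longleftrightarrow> y \<in> E n) \<Longrightarrow> x = y"
    using standard_measure_separating[OF X(1)] by metis
  show "\<exists>B\<in>sets Z. B \<subseteq> A \<and> 0 < emeasure Z B \<and> 0 < emeasure Z (A - B)"
  proof (rule ccontr)
    assume atom: "\<not> ?thesis"
    have "\<exists>b. AE z in Z. z \<in> A \<longrightarrow> (fst z \<in> E n \<longleftrightarrow> b)" for n
    proof -
      define B where "B = A \<inter> (fst -` E n \<inter> space Z)"
      have B: "B \<in> sets Z" unfolding B_def using A(1) measurable_sets[OF measurable_fst E(1)] by (rule sets.Int)
      have "emeasure Z B = 0 \<or> emeasure Z (A - B) = 0"
        using atom B by (auto simp: B_def zero_less_iff_neq_zero)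
      then show ?thesis
      proof
        assume "emeasure Z B = 0"
        then have "B \<in> null_sets Z" using B by (simp add: null_sets_def)
        from AE_not_in[OF this] AE_space have "AE z in Z. z \<in> A \<longrightarrow> (fst z \<in> E n \<longleftrightarrow> False)"
          by eventually_elim (simp add: B_def)
        then show ?thesis by blast
      next
        assume "emeasure Z (A - B) = 0"
        then have "A - B \<in> null_sets Z" using A(1) B by (auto simp: null_sets_def)
        from AE_not_in[OF this] have "AE z in Z. z \<in> A \<longrightarrow> (fst z \<in> E n \<longleftrightarrow> True)"
          by eventually_elim (simp add: B_def)
        then show ?thesis by blast
      qed
    qed
    then obtain b where "\<And>n. AE z in Z. z \<in> A \<longrightarrow> (fst z \<in> E n \<longleftrightarrow> b n)" by metis
    then have "AE z in Z. \<forall>n. z \<in> A \<longrightarrow> (fst z \<in> E n \<longleftrightarrow> b n)" unfolding AE_all_countable by blast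
    then have b: "AE z in Z. z \<in> A \<longrightarrow> (\<forall>n. fst z \<in> E n \<longleftrightarrow> b n)" by eventually_elim blast
    have nA: "\<not> (AE z in Z. z \<notin> A)" using A AE_iff_null_sets[OF A(1)] by auto
    have "\<exists>z0. z0 \<in> A \<and> (\<forall>n. fst z0 \<in> E n \<longleftrightarrow> b n)"
    proof (rule ccontr)
      assume *: "\<not> ?thesis"
      from b have "AE z in Z. z \<notin> A" by eventually_elim (use * in blast)
      then show False using nA by simp
    qed
    then obtain z0 where z0: "z0 \<in> A" "\<And>n. fst z0 \<in> E n \<longleftrightarrow> b n" by blast
    have z0X: "fst z0 \<in> space X" using z0(1) sets.sets_into_space[OF A(1)] by auto
    have "AE z in Z. z \<notin> A"
      using b null_preserving_AE[OF null_preserving_fst AE_neq_point[of "fst z0"]] AE_space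
    proof eventually_elim
      case (elim z)
      show ?case
      proof
        assume "z \<in> A"
        then have "fst z = fst z0" using elim(1,3) z0(2) by (intro E(2) z0X) auto
        then show False using elim(2) by simp
      qed
    qed
    then show False using nA by simp
  qed
qed

lemma restr_restrict_space: "A \<in> sets Z \<Longrightarrow> restr (restrict_space Z A) A"
  using sets.sets_into_space[of A Z]
  by (auto simp: restr_def space_restrict_space emeasure_restrict_space sets_restrict_space_iff Int_absorb2)

lemma restr_oeq_null_preserving:
  assumes K: "restr K V" and L: "restr L W" and f: "f \<in> K \<rightarrow>\<^sub>M L" and eq: "AE z in K. oeq (f z) z"
  shows "null_preserving K L f"
proof -
  have incl: "(\<lambda>z. z) \<in> K \<rightarrow>\<^sub>M Z" by (rule null_preserving_measurable[OF restr_incl[OF K]])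
  note f' = iffD1[OF restr_measurable_into[OF L] f]
  note fZ = conjunct1[OF f'] and fW = bspec[OF conjunct2[OF f']]
  obtain k where k: "k \<in> K \<rightarrow>\<^sub>M count_space (carrier \<Gamma>)" "AE z in K. f z = \<sigma> (k z) z"
  proof (rule measurable_countable_choice[where C="carrier \<Gamma>" and M=K and P="\<lambda>a z. f z = \<sigma> a z"])
    show "{z \<in> space K. f z = \<sigma> a z} \<in> sets K" if a: "a \<in> carrier \<Gamma>" for a
      by (rule standard_measure_eq_sets[OF standard_Z fZ measurable_compose[OF incl \<sigma>_measurable[OF a]]])
    show "AE z in K. \<exists>a\<in>carrier \<Gamma>. f z = \<sigma> a z" using eq by (simp add: oeq_def)
  qed (use \<Gamma> G.one_closed that in auto)
  have "null_preserving K Z (\<lambda>z. \<sigma> (k z) z)"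
    by (rule null_preserving_piecewise[OF k(1) \<Gamma>(2), where f="\<lambda>a z. \<sigma> a z"])
      (rule null_preserving_comp[OF restr_incl[OF K] ZA.act_null_preserving])
  from null_preserving_cong[OF this fZ k(2)] show ?thesis
    by (rule restr_null_preserving_into[OF L]) (rule fW)
qed

text \<open>A partial isomorphism with graph in the relation agrees up to orbits with the identity,
  whose scaling constant is 1.\<close>

lemma mp_rel_R: "mp_rel Z R"
  unfolding mp_rel_def
proof (intro ballI allI impI)
  fix A B f
  assume A: "A \<in> sets Z" and B: "B \<in> sets Z" and bij: "bij_betw f A B"
    and f: "f \<in> restrict_space Z A \<rightarrow>\<^sub>M restrict_space Z B"
    and g: "the_inv_into A f \<in> restrict_space Z B \<rightarrow>\<^sub>M restrict_space Z A"
    and r: "\<forall>x\<in>A. (f x, x) \<in> R"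
  let ?g = "the_inv_into A f"
  note K = restr_restrict_space[OF A] and L = restr_restrict_space[OF B]
  have gf: "?g (f x) = x" if "x \<in> A" for x by (rule the_inv_into_f_f[OF bij_betw_imp_inj_on[OF bij] that])
  have fg: "f (?g y) = y" if "y \<in> B" for y by (rule f_the_inv_into_f_bij_betw[OF bij]) (use that in simp)
  have gA: "?g y \<in> A" if "y \<in> B" for y using bij_betwE[OF bij_betw_the_inv_into[OF bij]] that by blast
  have eqf: "AE z in restrict_space Z A. oeq (f z) z"
    by (rule AE_I2) (use r restrD(2)[OF K] in \<open>auto simp: R_iff\<close>)
  have eqg: "AE z in restrict_space Z B. oeq (?g z) z"
  proof (rule AE_I2)
    fix z assume "z \<in> space (restrict_space Z B)"
    then have z: "z \<in> B" using restrD(2)[OF L] by simp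
    have "(f (?g z), ?g z) \<in> R" using r gA[OF z] by blast
    then have "oeq z (?g z)" "?g z \<in> space Z" using fg[OF z] by (simp_all add: R_iff)
    then show "oeq (?g z) z" by (rule oeq_sym)
  qed
  have "f \<in> ns_isos (restrict_space Z A) (restrict_space Z B)"
  proof (rule ns_isosI[OF restr_oeq_null_preserving[OF K L f eqf] restr_oeq_null_preserving[OF L K g eqg]])
    show "AE x in restrict_space Z A. ?g (f x) = x" by (rule AE_I2) (use gf restrD(2)[OF K] in auto)
    show "AE y in restrict_space Z B. f (?g y) = y" by (rule AE_I2) (use fg restrD(2)[OF L] in auto)
  qed
  from restr_scaling[OF K L this cent_id scaling_id] eqf
  show "emeasure Z A = emeasure Z B" by (simp add: id_map_def)
qed

lemma type_II_inf: "type_II_inf_rel Z R"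
  unfolding type_II_inf_rel_def
proof (intro conjI ballI impI)
  show "R \<in> sets (Z \<Otimes>\<^sub>M Z)"
  proof -
    have "R = (\<Union>g\<in>carrier \<Gamma>. {p \<in> space (Z \<Otimes>\<^sub>M Z). fst p = \<sigma> g (snd p)})"
    proof (intro equalityI subsetI)
      fix p assume p: "p \<in> R"
      then obtain z w where zw: "p = (z, w)" "(z, w) \<in> R" by (cases p) auto
      then obtain g where "g \<in> carrier \<Gamma>" "z = \<sigma> g w" by (auto simp: R_iff oeq_def)
      then show "p \<in> (\<Union>g\<in>carrier \<Gamma>. {p \<in> space (Z \<Otimes>\<^sub>M Z). fst p = \<sigma> g (snd p)})"
        using R_space[OF zw(2)] zw(1) by (intro UN_I[of g]) (simp_all add: space_pair_measure[of Z Z])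
    next
      fix p assume "p \<in> (\<Union>g\<in>carrier \<Gamma>. {p \<in> space (Z \<Otimes>\<^sub>M Z). fst p = \<sigma> g (snd p)})"
      then obtain g where g: "g \<in> carrier \<Gamma>" "p \<in> space (Z \<Otimes>\<^sub>M Z)" "fst p = \<sigma> g (snd p)" by blast
      then have "(fst p, snd p) \<in> R" unfolding R_iff oeq_def by (auto simp: space_pair_measure[of Z Z])
      then show "p \<in> R" by simp
    qed
    also have "\<dots> \<in> sets (Z \<Otimes>\<^sub>M Z)"
      by (intro sets.countable_UN' \<Gamma>(2) image_subsetI
          standard_measure_eq_sets[OF standard_Z measurable_fst measurable_compose[OF measurable_snd \<sigma>_measurable]])
    finally show ?thesis .
  qed
  show "countable (R `` {z})" if z: "z \<in> space Z" for z
  proof (rule countable_subset)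
    show "R `` {z} \<subseteq> (\<lambda>g. \<sigma> g z) ` carrier \<Gamma>"
    proof
      fix w assume "w \<in> R `` {z}"
      then have "(z, w) \<in> R" by simp
      then have "oeq w z" using oeq_sym by (simp add: R_iff)
      then show "w \<in> (\<lambda>g. \<sigma> g z) ` carrier \<Gamma>" by (auto simp: oeq_def)
    qed
  qed (use \<Gamma>(2) in simp)
  fix A assume A: "A \<in> sets Z" and inv: "\<forall>(x, y)\<in>R. (x \<in> A) = (y \<in> A)"
  have "(AE z in Z. z \<in> A) \<or> (AE z in Z. z \<notin> A)"
  proof (rule ergodic_Z_AE)
    show "{z \<in> space Z. z \<in> A} \<in> sets Z" using A by simp
    fix g assume g: "g \<in> carrier \<Gamma>"
    show "AE z in Z. (\<sigma> g z \<in> A) = (z \<in> A)"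
      using AE_space by eventually_elim (use inv oeq_\<sigma>[OF g] R_iff in blast)
  qed
  then show "A \<in> null_sets Z \<or> space Z - A \<in> null_sets Z"
  proof
    assume "AE z in Z. z \<in> A"
    then have "AE z in Z. z \<notin> space Z - A" by eventually_elim simp
    then have "space Z - A \<in> null_sets Z" using A by (subst AE_iff_null_sets) auto
    then show ?thesis ..
  next
    assume "AE z in Z. z \<notin> A"
    then show ?thesis using A by (simp add: AE_iff_null_sets)
  qed
qed (use standard_Z nonatomic_Z emeasure_Z equiv_R mp_rel_R in auto)

end

theorem theoremA:
  fixes \<Gamma> :: "'a monoid" and \<Lambda> :: "'l monoid" and \<pi> :: "'a \<Rightarrow> 'l"
    and X :: "'x measure" and \<alpha> :: "'a \<Rightarrow> 'x \<Rightarrow> 'x"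
    and Y :: "'y measure" and \<beta> :: "'l \<Rightarrow> 'y \<Rightarrow> 'y"
    and R :: "(('x \<times> 'y) \<times> ('x \<times> 'y)) set"
  assumes "group \<Gamma>" and "countable (carrier \<Gamma>)"
    and "group \<Lambda>" and "countable (carrier \<Lambda>)"
    and "\<pi> \<in> epi \<Gamma> \<Lambda>"
    and "standard_measure Y" and "emeasure Y (space Y) = \<infinity>"
    and "mp_action \<Lambda> Y \<beta>" and "ergodic_action \<Lambda> Y \<beta>"
    and "standard_measure X" and "prob_space X"
    and "mp_action \<Gamma> X \<alpha>" and "ergodic_action \<Gamma> X \<alpha>" and "free_action \<Gamma> X \<alpha>"
    and "U_fin_cocycle_superrigid (kernel_group \<Gamma> \<Lambda> \<pi>) X \<alpha>"
    and "weakly_mixing_action (kernel_group \<Gamma> \<Lambda> \<pi>) X \<alpha>"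
    and "\<forall>\<theta>\<in>hom (kernel_group \<Gamma> \<Lambda> \<pi>) \<Lambda>. \<forall>k\<in>kernel \<Gamma> \<Lambda> \<pi>. \<theta> k = \<one>\<^bsub>\<Lambda>\<^esub>"
    and "\<forall>\<Delta>. is_conjugation (kernel_group \<Gamma> \<Lambda> \<pi>) X \<alpha> \<Delta> \<longrightarrow>
               (\<exists>g\<in>carrier \<Gamma>. AE x in X. \<Delta> x = \<alpha> g x)"
    and "R = orbit_rel \<Gamma> (X \<Otimes>\<^sub>M Y) (product_action X Y \<alpha> (\<lambda>g. \<beta> (\<pi> g)))"
  shows "type_II_inf_rel (X \<Otimes>\<^sub>M Y) R \<and>
    out_class X Y R \<in> iso (Centr (Aut_ns Y) Y \<Lambda> \<beta>) (Out_rel (X \<Otimes>\<^sub>M Y) R) \<and>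
    (\<forall>U\<in>sets (X \<Otimes>\<^sub>M Y). 0 < emeasure (X \<Otimes>\<^sub>M Y) U \<and> emeasure (X \<Otimes>\<^sub>M Y) U < \<infinity> \<longrightarrow>
       fundamental_group_rel (normalized_restrict (X \<Otimes>\<^sub>M Y) U) (restrict_rel R U)
         = mod_ns Y ` carrier (Centr (Aut_ns Y) Y \<Lambda> \<beta>) \<and>
       out_class_restrict X Y R U
         \<in> iso (Centr (Aut_mp Y) Y \<Lambda> \<beta>)
                (Out_rel (normalized_restrict (X \<Otimes>\<^sub>M Y) U) (restrict_rel R U)))"
proof -
  interpret superrigid_extension \<Gamma> \<Lambda> \<pi> X \<alpha> Y \<beta>
    by (rule superrigid_extension.intro[OF assms(1-12) assms(14-16)]) (use assms(17,18) in blast)+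
  show ?thesis
    unfolding assms(19)
    by (intro conjI ballI impI type_II_inf out_class_iso fundamental_group out_class_restrict_iso) simp_all
qed

end
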